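(* Assume: (A'') there is a function $w_f$ with $\lim_{h\to0}w_f(h)=0$ such that $\int_U|f(t,x,u,a,p)-f(s,x,u,b,q)|\nu(du)\le w_f(|t-s|+dist(a,b)+|p-q|)$ for all $t,s,x,a,b,p,q$, and a constant $K_1$ such that $\int_U|f(t,x,u,a,p)-f(t,y,u,b,q)|\nu(du)\le K_1(|x-y|+|p-q|+dist(a,b))$ for all $t,x,y,a,b,p,q$; and (B'') $c$ and $\psi$ are continuous (and bounded) and there is a constant $K_2$ such that $|c(t,x,a,p)-c(t,y,b,q)|+|\psi(x,p)-\psi(y,q)|\le K_2(|x-y|+dist(a,b)+|p-q|)$ for all $t,x,y,a,b,p,q$. Then there is a constant $C=C(T,d,\nu(U),K_1,K_2)$, not depending on $N$, such that the following holds for every $N\in\mathbb N$. Let $(((\Omega,\mathcal F,P;\mathbb F),\widehat\gamma,\xi,\mathcal N),m,X_{\widehat\gamma,m})$ be a relaxed feedback solution of the mean field game, and let $((\Omega,\mathcal F,P;\mathbb F),\gamma,\xi,\mathcal N)\in\mathbb A$ be a feedback control with $$E\Big[\sup_{t\in[0,T]}|X_{\gamma,m}(t)-X_{\widehat\gamma,m}(t)|\Big]\le\frac1{\sqrt N},\qquad |J(\gamma,m)-J(\widehat\gamma,m)|\le\frac1{\sqrt N}.$$ Let $\gamma^N=(\gamma^N_1,\dots,\gamma^N_N)$ be the feedback strategy vector given by $\gamma^N_i(t,x^N)=\gamma(t,x^N_i)$ for $t\in[0,T]$, $x^N=(x^N_1,\dots,x^N_N)\in\Sigma^N$, $i=1,\dots,N$,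 together with $\xi^N,\mathcal N^N$ such that $(\xi^N_i,\mathcal N^N_i)$, $i=1,\dots,N$, are i.i.d. copies of $(\xi,\mathcal N)$. Then $\gamma^N$ is a feedback $\epsilon_N$-Nash equilibrium for the $N$-player game with $\epsilon_N\le C/\sqrt N$.
   Context: Data (fixed throughout). $\Sigma=\{1,\dots,d\}$; $T>0$; $(A,dist)$ is a compact metric space; $U\subset\mathbb R^d$ is compact and $\nu$ is a Radon measure on $U$; $S=\{p\in\mathbb R^d:p_j\ge0,\ \sum_jp_j=1\}$ is the set of probability measures on $\Sigma$, with the Euclidean norm; $m_0\in S$ is fixed; $f:[0,T]\times\Sigma\times U\times A\times S\to\{-d,\dots,d\}$ is measurable with $f(t,x,u,a,p)\in\{1-x,\dots,d-x\}$; $c:[0,T]\times\Sigma\times A\times S\to\mathbb R$ and $\psi:\Sigma\times S\to\mathbb R$ are measurable. $\mathcal L=\{m:[0,T]\to S:\ |m(t)-m(s)|\le K|t-s|,\ m(0)=m_0\}$ with $K=2\nu(U)\sqrt d$. $N$-player game. A strategy vector is $((\Omega,\mathcal F,P;\mathbb F),\alpha^N,\xi^N,\mathcal N^N)$: $(\Omega,\mathcal F,P;\mathbb F)$ is a filtered probability space, $\xi^N_1,\dots,\xi^N_N$ are i.i.d. $\mathcal F_0$-measurable with law $m_0$, $\mathcal N^N_1,\dots,\mathcal N^N_N$ are i.i.d. stationary Poisson random measures on $[0,T]\times U$ with respect to $\mathbb F$ with intensity $\nu$, and $\alpha^N_i$ are $A$-valued $\mathbb F$-predictable processes. States: $X^N_i(t)=\xi^N_i+\int_0^t\int_Uf(s,X^N_i(s^-),u,\alpha^N_i(s),\mu^N(s^-))\mathcal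 N^N_i(ds,du)$ with $\mu^N(t)=\frac1N\sum_i\delta_{X^N_i(t)}$; costs: $J^N_i(\alpha^N)=E\big[\int_0^Tc(t,X^N_i(t),\alpha^N_i(t),\mu^N(t))dt+\psi(X^N_i(T),\mu^N(T))\big]$. A feedback strategy vector is $((\Omega,\mathcal F,P;\mathbb F),\gamma^N,\xi^N,\mathcal N^N)$ with $\gamma^N:[0,T]\times\Sigma^N\to A^N$ measurable; the states solve the same system with $\alpha^N_i(s)$ replaced by $\gamma^N_i(s,X^N(s^-))$, and $J^N_i(\gamma^N)$ is the cost of the resulting strategy vector. For an $A$-valued $\mathbb F$-predictable $\beta$, $[\gamma^{N,-i};\beta]$ denotes the strategy vector in which player $i$ uses the process $\beta$ and each player $j\ne i$ uses $\gamma^N_j(t,\widetilde X^N(t^-))$, where $\widetilde X^N$ is the solution of the resulting system. For $\epsilon>0$, $\gamma^N$ is a feedback $\epsilon$-Nash equilibrium if $J^N_i(\gamma^N)\le J^N_i([\gamma^{N,-i};\beta])+\epsilon$ for every $i$ and every such (open-loop) $\beta$. Mean field game, feedback controls. $\mathbb A$ is the set of tuples $((\Omega,\mathcal F,P;\mathbb F),\gamma,\xi,\mathcal N)$ with $\gamma:[0,T]\times\Sigma\to A$ measurable, $\xi$ $\mathcal F_0$-measurable with law $m_0$, $\mathcal N$ a stationary Poisson random measure on $[0,T]\times U$ with respect to $\mathbb F$ with intensity $\nu$. $X_{\gamma,m}$ solves $X(t)=\xi+\int_0^t\int_Uf(s,X(s^-),u,\gamma(s,X(s^-)),m(s))\mathcal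 N(ds,du)$, and $J(\gamma,m)=E\big[\int_0^Tc(s,X_{\gamma,m}(s),\gamma(s,X_{\gamma,m}(s^-)),m(s))ds+\psi(X_{\gamma,m}(T),m(T))\big]$. Relaxed controls. A deterministic relaxed control is a measure $\rho(dt,da)=\rho_t(da)dt$ on $[0,T]\times A$ with $\rho([0,t]\times A)=t$ for all $t$; $\mathcal D$ is the set of these with weak convergence. $\mathcal R$ is the set of tuples $((\Omega,\mathcal F,P;\mathbb F),\rho,\xi,\mathcal N)$ with $\rho$ a $\mathcal D$-valued random variable such that $\rho([0,\cdot]\times E)$ is $\mathbb F$-adapted for every Borel $E\subseteq A$, $\xi$ an $\mathcal F_0$-measurable random variable with law $m_0$, and $\mathcal N$ a stationary Poisson random measure on $[0,T]\times U$ with respect to $\mathbb F$ with intensity $\nu$. With $\rho$ is associated a relaxed Poisson measure $\mathcal N_\rho$: an integer valued random measure on $[0,T]\times U\times A$ with $\mathbb F$-compensator $\nu(du)\rho_t(da)dt$ (the space being enlarged, if necessary, to carry it); if $\rho_t=\delta_{\alpha(t)}$ with $\alpha$ predictable, $\mathcal N_\rho([0,t]\times U_0\times A_0)=\int_0^t\int_{U_0}\mathbf 1_{A_0}(\alpha(s))\mathcal N(ds,du)$. $X_{\rho,m}$ solves $X(t)=\xi+\int_0^t\int_U\int_Af(s,X(s^-),u,a,m(s))\mathcal N_\rho(ds,du,da)$ and $J(\rho,m)=E\big[\int_0^T\int_Ac(s,X_{\rho,m}(s),a,m(s))\rho_s(da)ds+\psi(X_{\rho,m}(T),m(T))\big]$.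 A relaxed feedback control is a tuple $((\Omega,\mathcal F,P;\mathbb F),\widehat\gamma,\xi,\mathcal N)$ with $\widehat\gamma:[0,T]\times\Sigma\to\mathcal P(A)$ measurable; $X_{\widehat\gamma,m}$ solves the relaxed equation with $\rho_t=\widehat\gamma(t,X(t^-))$ and $X$ the solution itself; $\rho^{\widehat\gamma}_t=\widehat\gamma(t,X_{\widehat\gamma,m}(t^-))$ and $J(\widehat\gamma,m)=J(\rho^{\widehat\gamma},m)$. A relaxed feedback solution of the mean field game is $(((\Omega,\mathcal F,P;\mathbb F),\widehat\gamma,\xi,\mathcal N),m,X)$ with $m\in\mathcal L$, $X=X_{\widehat\gamma,m}$, $J(\widehat\gamma,m)\le J(\sigma,m)$ for every $\sigma\in\mathcal R$ (on any filtered probability space), and $Law(X(t))=m(t)$ for all $t\in[0,T]$.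
   Formalization: The constant C may also depend on the fixed action space A (through its diameter), since a bound in T, d, ν(U), K₁, K₂ alone fails for A=[0,M] with M large; all probability spaces are taken over one common underlying type fixed before C. *)

theory Defs
  imports "HOL-Probability.Probability"
begin

section \<open>Data of the game\<close>

text \<open>The number of states is the cardinality of the index type \<open>'d\<close>, so the Euclidean space of
  that dimension is \<open>real^'d\<close>. States are the integers from 1 to \<open>CARD('d)\<close> (they enter the dynamics
  arithmetically); \<open>state_of\<close> is the enumeration of the coordinates by states.\<close>

record ('a, 'd) game =
  horizon :: real
  marks :: "(real^'d) set"
  intensity :: "(real^'d) measure"
  actions :: "'a set"
  init_law :: "real^'d"
  jump :: "real \<Rightarrow> int \<Rightarrow> real^'d \<Rightarrow> 'a \<Rightarrow> real^'d \<Rightarrow> int"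
  run_cost :: "real \<Rightarrow> int \<Rightarrow> 'a \<Rightarrow> real^'d \<Rightarrow> real"
  end_cost :: "int \<Rightarrow> real^'d \<Rightarrow> real"

definition states :: "('a, 'd::finite) game \<Rightarrow> int set" where
  "states G = {1..int CARD('d)}"

definition state_of :: "'d::finite \<Rightarrow> int" where
  "state_of j = int (to_nat_on (UNIV :: 'd set) j) + 1"

lemma bij_betw_state_of: "bij_betw (state_of :: 'd::finite \<Rightarrow> int) UNIV {1..int CARD('d)}"
proof -
  have 1: "bij_betw (to_nat_on (UNIV :: 'd set)) UNIV {..<CARD('d)}"
    by (rule to_nat_on_finite) simp
  have 2: "bij_betw (\<lambda>n. int n + 1) {..<CARD('d)} {1..int CARD('d)}"
    by (rule bij_betwI[where g = "\<lambda>k. nat (k - 1)"]) auto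
  show ?thesis
    using bij_betw_trans[OF 1 2] by (simp add: state_of_def comp_def cong: bij_betw_cong)
qed

definition prob_simplex :: "(real^'d::finite) set" where
  "prob_simplex = {p. (\<forall>j. 0 \<le> p $ j) \<and> (\<Sum>j\<in>UNIV. p $ j) = 1}"

abbreviation time_space :: "('a, 'd::finite) game \<Rightarrow> real measure" where
  "time_space G \<equiv> restrict_space lborel {0..horizon G}"

abbreviation action_space :: "('a::metric_space, 'd::finite) game \<Rightarrow> 'a measure" where
  "action_space G \<equiv> restrict_space borel (actions G)"

abbreviation simplex_space :: "(real^'d::finite) measure" where
  "simplex_space \<equiv> restrict_space borel prob_simplex"

text \<open>On a compact subset of Euclidean space a Radon measure is the same thing as a finite Borel
  measure.\<close>

definition game_data :: "('a::metric_space, 'd::finite) game \<Rightarrow> bool" where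
  "game_data G \<longleftrightarrow>
     0 < horizon G \<and> compact (actions G) \<and> compact (marks G) \<and>
     sets (intensity G) = sets (restrict_space borel (marks G)) \<and> finite_measure (intensity G) \<and>
     init_law G \<in> prob_simplex \<and>
     (\<lambda>(t, x, u, a, p). jump G t x u a p) \<in>
       time_space G \<Otimes>\<^sub>M count_space (states G) \<Otimes>\<^sub>M intensity G \<Otimes>\<^sub>M action_space G \<Otimes>\<^sub>M simplex_space
         \<rightarrow>\<^sub>M count_space UNIV \<and>
     (\<forall>t\<in>{0..horizon G}. \<forall>x\<in>states G. \<forall>u\<in>marks G. \<forall>a\<in>actions G. \<forall>p\<in>prob_simplex.
        jump G t x u a p \<in> {1 - x..int CARD('d) - x}) \<and>
     (\<lambda>(t, x, a, p). run_cost G t x a p) \<in>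
       borel_measurable (time_space G \<Otimes>\<^sub>M count_space (states G) \<Otimes>\<^sub>M action_space G \<Otimes>\<^sub>M simplex_space) \<and>
     (\<lambda>(x, p). end_cost G x p) \<in> borel_measurable (count_space (states G) \<Otimes>\<^sub>M simplex_space)"

definition flows :: "('a, 'd::finite) game \<Rightarrow> (real \<Rightarrow> real^'d) set" where
  "flows G = {m. m ` {0..horizon G} \<subseteq> prob_simplex \<and> m 0 = init_law G \<and>
     (2 * measure (intensity G) (marks G) * sqrt (real CARD('d)))-lipschitz_on {0..horizon G} m}"

text \<open>The regularity assumptions on the dynamics (with Lipschitz constant \<open>K\<^sub>1\<close>) and on the costs
  (with Lipschitz constant \<open>K\<^sub>2\<close>).\<close>

definition regular_dynamics :: "('a::metric_space, 'd::finite) game \<Rightarrow> real \<Rightarrow> bool" where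
  "regular_dynamics G K\<^sub>1 \<longleftrightarrow>
     (\<exists>w :: real \<Rightarrow> real. (w \<longlongrightarrow> 0) (at_right 0) \<and>
        (\<forall>t\<in>{0..horizon G}. \<forall>s\<in>{0..horizon G}. \<forall>x\<in>states G. \<forall>a\<in>actions G. \<forall>b\<in>actions G.
           \<forall>p\<in>prob_simplex. \<forall>q\<in>prob_simplex.
             (LINT u|intensity G. \<bar>real_of_int (jump G t x u a p) - real_of_int (jump G s x u b q)\<bar>)
               \<le> w (\<bar>t - s\<bar> + dist a b + norm (p - q)))) \<and>
     (\<forall>t\<in>{0..horizon G}. \<forall>x\<in>states G. \<forall>y\<in>states G. \<forall>a\<in>actions G. \<forall>b\<in>actions G.
        \<forall>p\<in>prob_simplex. \<forall>q\<in>prob_simplex.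
          (LINT u|intensity G. \<bar>real_of_int (jump G t x u a p) - real_of_int (jump G t y u b q)\<bar>)
            \<le> K\<^sub>1 * (\<bar>real_of_int (x - y)\<bar> + norm (p - q) + dist a b))"

definition regular_costs :: "('a::metric_space, 'd::finite) game \<Rightarrow> real \<Rightarrow> bool" where
  "regular_costs G K\<^sub>2 \<longleftrightarrow>
     continuous_on ({0..horizon G} \<times> states G \<times> actions G \<times> prob_simplex)
       (\<lambda>(t, x, a, p). run_cost G t x a p) \<and>
     bounded ((\<lambda>(t, x, a, p). run_cost G t x a p) ` ({0..horizon G} \<times> states G \<times> actions G \<times> prob_simplex)) \<and>
     continuous_on (states G \<times> prob_simplex) (\<lambda>(x, p). end_cost G x p) \<and>
     bounded ((\<lambda>(x, p). end_cost G x p) ` (states G \<times> prob_simplex)) \<and>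
     (\<forall>t\<in>{0..horizon G}. \<forall>x\<in>states G. \<forall>y\<in>states G. \<forall>a\<in>actions G. \<forall>b\<in>actions G.
        \<forall>p\<in>prob_simplex. \<forall>q\<in>prob_simplex.
          \<bar>run_cost G t x a p - run_cost G t y b q\<bar> + \<bar>end_cost G x p - end_cost G y q\<bar>
            \<le> K\<^sub>2 * (\<bar>real_of_int (x - y)\<bar> + dist a b + norm (p - q)))"


section \<open>Stochastic bases, predictability, random measures\<close>

definition filtered_prob_space ::
  "('a, 'd::finite) game \<Rightarrow> 'w measure \<Rightarrow> (real \<Rightarrow> 'w measure) \<Rightarrow> bool" where
  "filtered_prob_space G M F \<longleftrightarrow> prob_space M \<and>
     (\<forall>t\<in>{0..horizon G}. subalgebra M (F t)) \<and>
     (\<forall>s\<in>{0..horizon G}. \<forall>t\<in>{0..horizon G}. s \<le> t \<longrightarrow> subalgebra (F t) (F s))"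

definition predictable_algebra ::
  "('a, 'd::finite) game \<Rightarrow> 'w measure \<Rightarrow> (real \<Rightarrow> 'w measure) \<Rightarrow> (real \<times> 'w) measure" where
  "predictable_algebra G M F = sigma ({0..horizon G} \<times> space M)
     ({{0} \<times> B |B. B \<in> sets (F 0)} \<union>
      {{s<..t} \<times> B |s t B. 0 \<le> s \<and> s < t \<and> t \<le> horizon G \<and> B \<in> sets (F s)})"

definition predictable_control ::
  "('a::metric_space, 'd::finite) game \<Rightarrow> 'w measure \<Rightarrow> (real \<Rightarrow> 'w measure) \<Rightarrow> (real \<Rightarrow> 'w \<Rightarrow> 'a) \<Rightarrow> bool"
where
  "predictable_control G M F \<alpha> \<longleftrightarrow>
     (\<lambda>(t, \<omega>). \<alpha> t \<omega>) \<in> predictable_algebra G M F \<rightarrow>\<^sub>M action_space G"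

definition left_lim :: "(real \<Rightarrow> int) \<Rightarrow> real \<Rightarrow> int" where
  "left_lim x t = (if t \<le> 0 then x 0 else Lim (at_left t) x)"

text \<open>Adapted state-valued processes all of whose paths are right continuous with left limits.\<close>

definition state_process ::
  "('a, 'd::finite) game \<Rightarrow> 'w measure \<Rightarrow> (real \<Rightarrow> 'w measure) \<Rightarrow> (real \<Rightarrow> 'w \<Rightarrow> int) \<Rightarrow> bool" where
  "state_process G M F X \<longleftrightarrow>
     (\<forall>t\<in>{0..horizon G}. X t \<in> F t \<rightarrow>\<^sub>M count_space (states G)) \<and>
     (\<forall>\<omega>\<in>space M.
        (\<forall>t\<in>{0..<horizon G}. ((\<lambda>s. X s \<omega>) \<longlongrightarrow> X t \<omega>) (at_right t)) \<and>
        (\<forall>t\<in>{0<..horizon G}. \<exists>l. ((\<lambda>s. X s \<omega>) \<longlongrightarrow> l) (at_left t)))"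

definition adapted_random_measure ::
  "('a, 'd::finite) game \<Rightarrow> 'w measure \<Rightarrow> (real \<Rightarrow> 'w measure) \<Rightarrow> (real \<times> 'b) measure
     \<Rightarrow> ('w \<Rightarrow> (real \<times> 'b) measure) \<Rightarrow> bool" where
  "adapted_random_measure G M F E R \<longleftrightarrow>
     (\<forall>\<omega>\<in>space M. sets (R \<omega>) = sets E) \<and>
     (\<forall>B\<in>sets E. (\<lambda>\<omega>. emeasure (R \<omega>) B) \<in> borel_measurable M) \<and>
     (\<forall>t\<in>{0..horizon G}. \<forall>B\<in>sets E. B \<subseteq> {0..t} \<times> UNIV \<longrightarrow>
        (\<lambda>\<omega>. emeasure (R \<omega>) B) \<in> borel_measurable (F t))"

text \<open>Integer valued random measures (in the sense of semimartingale theory) charge each time section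
  with mass at most one; without this the compensator would not determine the jumps.\<close>

definition integer_random_measure ::
  "('a, 'd::finite) game \<Rightarrow> 'w measure \<Rightarrow> (real \<Rightarrow> 'w measure) \<Rightarrow> (real \<times> 'b) measure
     \<Rightarrow> ('w \<Rightarrow> (real \<times> 'b) measure) \<Rightarrow> bool" where
  "integer_random_measure G M F E R \<longleftrightarrow>
     adapted_random_measure G M F E R \<and>
     (AE \<omega> in M. (\<forall>B\<in>sets E. emeasure (R \<omega>) B \<in> range ennreal_of_enat) \<and>
                 (\<forall>t\<in>{0..horizon G}. emeasure (R \<omega>) (({t} \<times> UNIV) \<inter> space E) \<le> 1))"

abbreviation mark_space :: "('a, 'd::finite) game \<Rightarrow> (real \<times> (real^'d)) measure" where
  "mark_space G \<equiv> time_space G \<Otimes>\<^sub>M intensity G"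

text \<open>Stationary Poisson random measure on the time-mark space, relative to the filtration, with mean
  measure \<open>dt \<nu>(du)\<close>.\<close>

definition poisson_random_measure ::
  "('a, 'd::finite) game \<Rightarrow> 'w measure \<Rightarrow> (real \<Rightarrow> 'w measure) \<Rightarrow> ('w \<Rightarrow> (real \<times> (real^'d)) measure) \<Rightarrow> bool"
where
  "poisson_random_measure G M F \<N> \<longleftrightarrow>
     adapted_random_measure G M F (mark_space G) \<N> \<and>
     (\<forall>B\<in>sets (mark_space G). \<forall>k::nat.
        measure M {\<omega>\<in>space M. emeasure (\<N> \<omega>) B = of_nat k}
          = exp (- measure (mark_space G) B) * measure (mark_space G) B ^ k / fact k) \<and>
     (\<forall>(n::nat) B. (\<forall>i<n. B i \<in> sets (mark_space G)) \<and> disjoint_family_on B {..<n} \<longrightarrow>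
        prob_space.indep_vars M (\<lambda>_. borel) (\<lambda>i \<omega>. emeasure (\<N> \<omega>) (B i)) {..<n}) \<and>
     (\<forall>s\<in>{0..horizon G}. prob_space.indep_set M (sets (F s))
        (sigma_sets (space M)
          {(\<lambda>\<omega>. emeasure (\<N> \<omega>) B) -` E \<inter> space M |B E.
             B \<in> sets (mark_space G) \<and> B \<subseteq> {s<..} \<times> UNIV \<and> E \<in> sets borel}))"

definition initial_state ::
  "('a, 'd::finite) game \<Rightarrow> 'w measure \<Rightarrow> (real \<Rightarrow> 'w measure) \<Rightarrow> ('w \<Rightarrow> int) \<Rightarrow> bool" where
  "initial_state G M F \<xi> \<longleftrightarrow> \<xi> \<in> F 0 \<rightarrow>\<^sub>M count_space (states G) \<and>
     (\<forall>j. measure M {\<omega>\<in>space M. \<xi> \<omega> = state_of j} = init_law G $ j)"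


section \<open>The game with finitely many players\<close>

text \<open>Players are numbered \<open>1..N\<close>.\<close>

definition empirical :: "nat \<Rightarrow> (nat \<Rightarrow> int) \<Rightarrow> real^'d::finite" where
  "empirical N x = (\<chi> j. real (card {i\<in>{1..N}. x i = state_of j}) / real N)"

definition init_sigma :: "'w measure \<Rightarrow> ('w \<Rightarrow> int) \<Rightarrow> 'w set set" where
  "init_sigma M \<xi> = sigma_sets (space M) {\<xi> -` E \<inter> space M |E. True}"

definition noise_sigma ::
  "('a, 'd::finite) game \<Rightarrow> 'w measure \<Rightarrow> ('w \<Rightarrow> (real \<times> (real^'d)) measure) \<Rightarrow> 'w set set" where
  "noise_sigma G M \<N> = sigma_sets (space M)
     {(\<lambda>\<omega>. emeasure (\<N> \<omega>) B) -` E \<inter> space M |B E. B \<in> sets (mark_space G) \<and> E \<in> sets borel}"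

text \<open>The common part of strategy vectors: filtered space, initial states and driving noises. The
  variables are identically distributed because their laws are prescribed.\<close>

definition players_basis ::
  "('a, 'd::finite) game \<Rightarrow> nat \<Rightarrow> 'w measure \<Rightarrow> (real \<Rightarrow> 'w measure) \<Rightarrow> (nat \<Rightarrow> 'w \<Rightarrow> int)
     \<Rightarrow> (nat \<Rightarrow> 'w \<Rightarrow> (real \<times> (real^'d)) measure) \<Rightarrow> bool" where
  "players_basis G N M F \<xi> \<N> \<longleftrightarrow> filtered_prob_space G M F \<and>
     (\<forall>i\<in>{1..N}. initial_state G M F (\<xi> i) \<and> poisson_random_measure G M F (\<N> i)) \<and>
     prob_space.indep_sets M (\<lambda>i. init_sigma M (\<xi> i)) {1..N} \<and>
     prob_space.indep_sets M (\<lambda>i. noise_sigma G M (\<N> i)) {1..N}"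

text \<open>\<open>X\<close> is the vector of states when player \<open>i\<close> uses the process \<open>\<alpha> i\<close>. The left limit of the
  empirical measure is the empirical measure of the left limits, the state space being discrete.\<close>

definition players_state ::
  "('a, 'd::finite) game \<Rightarrow> nat \<Rightarrow> 'w measure \<Rightarrow> (real \<Rightarrow> 'w measure) \<Rightarrow> (nat \<Rightarrow> 'w \<Rightarrow> int)
     \<Rightarrow> (nat \<Rightarrow> 'w \<Rightarrow> (real \<times> (real^'d)) measure) \<Rightarrow> (nat \<Rightarrow> real \<Rightarrow> 'w \<Rightarrow> 'a)
     \<Rightarrow> (nat \<Rightarrow> real \<Rightarrow> 'w \<Rightarrow> int) \<Rightarrow> bool" where
  "players_state G N M F \<xi> \<N> \<alpha> X \<longleftrightarrow>
     (\<forall>i\<in>{1..N}. state_process G M F (X i)) \<and>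
     (AE \<omega> in M. \<forall>i\<in>{1..N}. \<forall>t\<in>{0..horizon G}.
        real_of_int (X i t \<omega>) = real_of_int (\<xi> i \<omega>) +
          (LINT z:{0<..t} \<times> marks G|\<N> i \<omega>. case z of (s, u) \<Rightarrow>
             real_of_int (jump G s (left_lim (\<lambda>r. X i r \<omega>) s) u (\<alpha> i s \<omega>)
               (empirical N (\<lambda>j. left_lim (\<lambda>r. X j r \<omega>) s)))))"

definition players_cost ::
  "('a, 'd::finite) game \<Rightarrow> nat \<Rightarrow> 'w measure \<Rightarrow> (nat \<Rightarrow> real \<Rightarrow> 'w \<Rightarrow> 'a)
     \<Rightarrow> (nat \<Rightarrow> real \<Rightarrow> 'w \<Rightarrow> int) \<Rightarrow> nat \<Rightarrow> real" where
  "players_cost G N M \<alpha> X i =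
     (LINT \<omega>|M. (LINT t:{0..horizon G}|lborel.
         run_cost G t (X i t \<omega>) (\<alpha> i t \<omega>) (empirical N (\<lambda>j. X j t \<omega>)))
       + end_cost G (X i (horizon G) \<omega>) (empirical N (\<lambda>j. X j (horizon G) \<omega>)))"

definition feedback_vector ::
  "('a::metric_space, 'd::finite) game \<Rightarrow> nat \<Rightarrow> (nat \<Rightarrow> real \<Rightarrow> (nat \<Rightarrow> int) \<Rightarrow> 'a) \<Rightarrow> bool" where
  "feedback_vector G N \<gamma> \<longleftrightarrow>
     (\<forall>i\<in>{1..N}. (\<lambda>(t, x). \<gamma> i t x) \<in>
        time_space G \<Otimes>\<^sub>M PiM {1..N} (\<lambda>_. count_space (states G)) \<rightarrow>\<^sub>M action_space G)"

definition feedback_process ::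
  "nat \<Rightarrow> (nat \<Rightarrow> real \<Rightarrow> (nat \<Rightarrow> int) \<Rightarrow> 'a) \<Rightarrow> (nat \<Rightarrow> real \<Rightarrow> 'w \<Rightarrow> int) \<Rightarrow> nat \<Rightarrow> real \<Rightarrow> 'w \<Rightarrow> 'a"
where
  "feedback_process N \<gamma> X i t \<omega> = \<gamma> i t (\<lambda>j\<in>{1..N}. left_lim (\<lambda>r. X j r \<omega>) t)"

text \<open>In the deviation of player \<open>i\<close>, the other players apply their feedback functions to the states
  \<open>Y\<close> of the system that results from the deviation. The costs are those along the solution of the
  respective system, which is unique up to indistinguishability.\<close>

definition feedback_nash ::
  "('a::metric_space, 'd::finite) game \<Rightarrow> nat \<Rightarrow> real \<Rightarrow> 'w measure \<Rightarrow> (real \<Rightarrow> 'w measure)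
     \<Rightarrow> (nat \<Rightarrow> real \<Rightarrow> (nat \<Rightarrow> int) \<Rightarrow> 'a) \<Rightarrow> (nat \<Rightarrow> 'w \<Rightarrow> int)
     \<Rightarrow> (nat \<Rightarrow> 'w \<Rightarrow> (real \<times> (real^'d)) measure) \<Rightarrow> bool" where
  "feedback_nash G N \<epsilon> M F \<gamma> \<xi> \<N> \<longleftrightarrow>
     players_basis G N M F \<xi> \<N> \<and> feedback_vector G N \<gamma> \<and>
     (\<forall>X. players_state G N M F \<xi> \<N> (feedback_process N \<gamma> X) X \<longrightarrow>
       (\<forall>i\<in>{1..N}. \<forall>\<beta> Y.
          predictable_control G M F \<beta> \<and>
          players_state G N M F \<xi> \<N> ((feedback_process N \<gamma> Y)(i := \<beta>)) Y \<longrightarrow>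
          players_cost G N M (feedback_process N \<gamma> X) X i
            \<le> players_cost G N M ((feedback_process N \<gamma> Y)(i := \<beta>)) Y i + \<epsilon>))"


section \<open>The mean field game\<close>

definition mfg_basis ::
  "('a, 'd::finite) game \<Rightarrow> 'w measure \<Rightarrow> (real \<Rightarrow> 'w measure) \<Rightarrow> ('w \<Rightarrow> int)
     \<Rightarrow> ('w \<Rightarrow> (real \<times> (real^'d)) measure) \<Rightarrow> bool" where
  "mfg_basis G M F \<xi> \<N> \<longleftrightarrow>
     filtered_prob_space G M F \<and> initial_state G M F \<xi> \<and> poisson_random_measure G M F \<N>"

definition feedback_control ::
  "('a::metric_space, 'd::finite) game \<Rightarrow> 'w measure \<Rightarrow> (real \<Rightarrow> 'w measure) \<Rightarrow> (real \<Rightarrow> int \<Rightarrow> 'a)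
     \<Rightarrow> ('w \<Rightarrow> int) \<Rightarrow> ('w \<Rightarrow> (real \<times> (real^'d)) measure) \<Rightarrow> bool" where
  "feedback_control G M F \<gamma> \<xi> \<N> \<longleftrightarrow> mfg_basis G M F \<xi> \<N> \<and>
     (\<lambda>(t, x). \<gamma> t x) \<in> time_space G \<Otimes>\<^sub>M count_space (states G) \<rightarrow>\<^sub>M action_space G"

definition feedback_state ::
  "('a, 'd::finite) game \<Rightarrow> 'w measure \<Rightarrow> (real \<Rightarrow> 'w measure) \<Rightarrow> (real \<Rightarrow> int \<Rightarrow> 'a) \<Rightarrow> ('w \<Rightarrow> int)
     \<Rightarrow> ('w \<Rightarrow> (real \<times> (real^'d)) measure) \<Rightarrow> (real \<Rightarrow> real^'d) \<Rightarrow> (real \<Rightarrow> 'w \<Rightarrow> int) \<Rightarrow> bool" where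
  "feedback_state G M F \<gamma> \<xi> \<N> m X \<longleftrightarrow>
     state_process G M F X \<and>
     (AE \<omega> in M. \<forall>t\<in>{0..horizon G}.
        real_of_int (X t \<omega>) = real_of_int (\<xi> \<omega>) +
          (LINT z:{0<..t} \<times> marks G|\<N> \<omega>. case z of (s, u) \<Rightarrow>
             let x = left_lim (\<lambda>r. X r \<omega>) s in real_of_int (jump G s x u (\<gamma> s x) (m s))))"

definition feedback_cost ::
  "('a, 'd::finite) game \<Rightarrow> 'w measure \<Rightarrow> (real \<Rightarrow> int \<Rightarrow> 'a) \<Rightarrow> (real \<Rightarrow> real^'d)
     \<Rightarrow> (real \<Rightarrow> 'w \<Rightarrow> int) \<Rightarrow> real" where
  "feedback_cost G M \<gamma> m X =
     (LINT \<omega>|M. (LINT s:{0..horizon G}|lborel.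
         run_cost G s (X s \<omega>) (\<gamma> s (left_lim (\<lambda>r. X r \<omega>) s)) (m s))
       + end_cost G (X (horizon G) \<omega>) (m (horizon G)))"

subsection \<open>Relaxed controls\<close>

abbreviation control_space :: "('a::metric_space, 'd::finite) game \<Rightarrow> (real \<times> 'a) measure" where
  "control_space G \<equiv> time_space G \<Otimes>\<^sub>M action_space G"

definition deterministic_relaxed :: "('a::metric_space, 'd::finite) game \<Rightarrow> (real \<times> 'a) measure set" where
  "deterministic_relaxed G = {r. sets r = sets (control_space G) \<and>
     (\<forall>t\<in>{0..horizon G}. emeasure r ({0..t} \<times> actions G) = ennreal t)}"

text \<open>\<open>r(dt, da) = \<kappa>\<^sub>t(da) dt\<close>\<close>

definition disintegrates ::
  "('a::metric_space, 'd::finite) game \<Rightarrow> (real \<times> 'a) measure \<Rightarrow> (real \<Rightarrow> 'a measure) \<Rightarrow> bool" where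
  "disintegrates G r \<kappa> \<longleftrightarrow> (\<forall>B\<in>sets (control_space G).
     emeasure r B = (\<integral>\<^sup>+ t. emeasure (\<kappa> t) (Pair t -` B) \<partial>time_space G))"

text \<open>The Borel sets of the weak topology on relaxed controls are generated by the evaluations on
  Borel sets, so measurability of a random relaxed control is measurability of its evaluations.\<close>

definition relaxed_control ::
  "('a::metric_space, 'd::finite) game \<Rightarrow> 'w measure \<Rightarrow> (real \<Rightarrow> 'w measure) \<Rightarrow> ('w \<Rightarrow> (real \<times> 'a) measure)
     \<Rightarrow> ('w \<Rightarrow> int) \<Rightarrow> ('w \<Rightarrow> (real \<times> (real^'d)) measure) \<Rightarrow> bool" where
  "relaxed_control G M F \<rho> \<xi> \<N> \<longleftrightarrow> mfg_basis G M F \<xi> \<N> \<and>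
     (\<forall>\<omega>\<in>space M. \<rho> \<omega> \<in> deterministic_relaxed G) \<and>
     (\<forall>B\<in>sets (control_space G). (\<lambda>\<omega>. emeasure (\<rho> \<omega>) B) \<in> borel_measurable M) \<and>
     (\<forall>t\<in>{0..horizon G}. \<forall>E\<in>sets (action_space G).
        (\<lambda>\<omega>. emeasure (\<rho> \<omega>) ({0..t} \<times> E)) \<in> borel_measurable (F t))"

abbreviation relaxed_mark_space ::
  "('a::metric_space, 'd::finite) game \<Rightarrow> (real \<times> (real^'d) \<times> 'a) measure" where
  "relaxed_mark_space G \<equiv> time_space G \<Otimes>\<^sub>M intensity G \<Otimes>\<^sub>M action_space G"

text \<open>The relaxed Poisson measure \<open>\<N>\<^sub>\<rho>\<close>. The third clause says that \<open>\<nu>(du) \<rho>(dt, da)\<close> is the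
  compensator: both measures integrate nonnegative predictable functions to the same expectation.
  Enlargements of the probability space are covered because \<open>\<N>\<^sub>\<rho>\<close> is a separate component of the
  tuples below, so that the space \<open>M\<close> may already be the enlarged one.\<close>

definition relaxed_poisson_measure ::
  "('a::metric_space, 'd::finite) game \<Rightarrow> 'w measure \<Rightarrow> (real \<Rightarrow> 'w measure) \<Rightarrow> ('w \<Rightarrow> (real \<times> 'a) measure)
     \<Rightarrow> ('w \<Rightarrow> (real \<times> (real^'d)) measure) \<Rightarrow> ('w \<Rightarrow> (real \<times> (real^'d) \<times> 'a) measure) \<Rightarrow> bool" where
  "relaxed_poisson_measure G M F \<rho> \<N> \<N>\<^sub>\<rho> \<longleftrightarrow>
     integer_random_measure G M F (relaxed_mark_space G) \<N>\<^sub>\<rho> \<and>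
     (\<forall>W :: (real \<times> 'w) \<times> (real^'d) \<times> 'a \<Rightarrow> ennreal.
        W \<in> borel_measurable (predictable_algebra G M F \<Otimes>\<^sub>M intensity G \<Otimes>\<^sub>M action_space G) \<longrightarrow>
        (\<integral>\<^sup>+ \<omega>. (\<integral>\<^sup>+ z. (case z of (s, u, a) \<Rightarrow> W ((s, \<omega>), u, a)) \<partial>\<N>\<^sub>\<rho> \<omega>) \<partial>M) =
        (\<integral>\<^sup>+ \<omega>. (\<integral>\<^sup>+ y. (case y of (s, a) \<Rightarrow> \<integral>\<^sup>+ u. W ((s, \<omega>), u, a) \<partial>intensity G) \<partial>\<rho> \<omega>) \<partial>M)) \<and>
     (\<forall>\<alpha>. predictable_control G M F \<alpha> \<and>
        (AE \<omega> in M. disintegrates G (\<rho> \<omega>) (\<lambda>t. return (action_space G) (\<alpha> t \<omega>))) \<longrightarrow>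
        (AE \<omega> in M. \<forall>t\<in>{0..horizon G}. \<forall>U\<^sub>0\<in>sets (intensity G). \<forall>A\<^sub>0\<in>sets (action_space G).
           emeasure (\<N>\<^sub>\<rho> \<omega>) ({0..t} \<times> U\<^sub>0 \<times> A\<^sub>0) =
             (\<integral>\<^sup>+ z. (case z of (s, u) \<Rightarrow> indicator ({0..t} \<times> U\<^sub>0) (s, u) * indicator A\<^sub>0 (\<alpha> s \<omega>)) \<partial>\<N> \<omega>)))"

definition relaxed_state ::
  "('a, 'd::finite) game \<Rightarrow> 'w measure \<Rightarrow> (real \<Rightarrow> 'w measure) \<Rightarrow> ('w \<Rightarrow> int)
     \<Rightarrow> ('w \<Rightarrow> (real \<times> (real^'d) \<times> 'a) measure) \<Rightarrow> (real \<Rightarrow> real^'d) \<Rightarrow> (real \<Rightarrow> 'w \<Rightarrow> int) \<Rightarrow> bool" where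
  "relaxed_state G M F \<xi> \<N>\<^sub>\<rho> m X \<longleftrightarrow>
     state_process G M F X \<and>
     (AE \<omega> in M. \<forall>t\<in>{0..horizon G}.
        real_of_int (X t \<omega>) = real_of_int (\<xi> \<omega>) +
          (LINT z:{0<..t} \<times> marks G \<times> actions G|\<N>\<^sub>\<rho> \<omega>. case z of (s, u, a) \<Rightarrow>
             real_of_int (jump G s (left_lim (\<lambda>r. X r \<omega>) s) u a (m s))))"

definition relaxed_cost ::
  "('a, 'd::finite) game \<Rightarrow> 'w measure \<Rightarrow> ('w \<Rightarrow> (real \<times> 'a) measure) \<Rightarrow> (real \<Rightarrow> real^'d)
     \<Rightarrow> (real \<Rightarrow> 'w \<Rightarrow> int) \<Rightarrow> real" where
  "relaxed_cost G M \<rho> m X =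
     (LINT \<omega>|M. (LINT y|\<rho> \<omega>. (case y of (s, a) \<Rightarrow> run_cost G s (X s \<omega>) a (m s)))
       + end_cost G (X (horizon G) \<omega>) (m (horizon G)))"

subsection \<open>Relaxed feedback solutions\<close>

definition relaxed_feedback ::
  "('a::metric_space, 'd::finite) game \<Rightarrow> (real \<Rightarrow> int \<Rightarrow> 'a measure) \<Rightarrow> bool" where
  "relaxed_feedback G \<gamma> \<longleftrightarrow>
     (\<lambda>(t, x). \<gamma> t x) \<in> time_space G \<Otimes>\<^sub>M count_space (states G) \<rightarrow>\<^sub>M prob_algebra (action_space G)"

text \<open>Optimality is required against every relaxed control on every filtered probability space over
  the type \<open>'w\<close>. Here \<open>\<rho>\<close> is the relaxed control induced by the relaxed feedback \<open>\<gamma>\<close> along its own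
  state process \<open>X\<close>, and \<open>\<N>\<^sub>\<rho>\<close> is the associated relaxed Poisson measure.\<close>

definition relaxed_feedback_solution ::
  "('a::metric_space, 'd::finite) game \<Rightarrow> 'w measure \<Rightarrow> (real \<Rightarrow> 'w measure) \<Rightarrow> (real \<Rightarrow> int \<Rightarrow> 'a measure)
     \<Rightarrow> ('w \<Rightarrow> int) \<Rightarrow> ('w \<Rightarrow> (real \<times> (real^'d)) measure)
     \<Rightarrow> ('w \<Rightarrow> (real \<times> 'a) measure) \<Rightarrow> ('w \<Rightarrow> (real \<times> (real^'d) \<times> 'a) measure)
     \<Rightarrow> (real \<Rightarrow> real^'d) \<Rightarrow> (real \<Rightarrow> 'w \<Rightarrow> int) \<Rightarrow> bool" where
  "relaxed_feedback_solution G M F \<gamma> \<xi> \<N> \<rho> \<N>\<^sub>\<rho> m X \<longleftrightarrow>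
     m \<in> flows G \<and> relaxed_feedback G \<gamma> \<and>
     relaxed_control G M F \<rho> \<xi> \<N> \<and>
     (AE \<omega> in M. disintegrates G (\<rho> \<omega>) (\<lambda>t. \<gamma> t (left_lim (\<lambda>r. X r \<omega>) t))) \<and>
     relaxed_poisson_measure G M F \<rho> \<N> \<N>\<^sub>\<rho> \<and>
     relaxed_state G M F \<xi> \<N>\<^sub>\<rho> m X \<and>
     (\<forall>(M' :: 'w measure) F' \<rho>' \<xi>' \<N>' \<N>\<^sub>\<rho>' X'.
        relaxed_control G M' F' \<rho>' \<xi>' \<N>' \<and> relaxed_poisson_measure G M' F' \<rho>' \<N>' \<N>\<^sub>\<rho>' \<and>
        relaxed_state G M' F' \<xi>' \<N>\<^sub>\<rho>' m X' \<longrightarrow>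
        relaxed_cost G M \<rho> m X \<le> relaxed_cost G M' \<rho>' m X') \<and>
     (\<forall>t\<in>{0..horizon G}. \<forall>j. measure M {\<omega>\<in>space M. X t \<omega> = state_of j} = m t $ j)"

text \<open>\<open>(\<xi>\<^sub>i, \<N>\<^sub>i)\<close>, \<open>1 \<le> i \<le> N\<close>, are independent copies of \<open>(\<xi>, \<N>)\<close>. Equality in law is equality of
  the finite dimensional distributions; the values of a Poisson random measure are almost surely
  finite, so it suffices to consider natural numbers.\<close>

definition same_law ::
  "('a, 'd::finite) game \<Rightarrow> 'w measure \<Rightarrow> ('w \<Rightarrow> int) \<Rightarrow> ('w \<Rightarrow> (real \<times> (real^'d)) measure)
     \<Rightarrow> 'v measure \<Rightarrow> ('v \<Rightarrow> int) \<Rightarrow> ('v \<Rightarrow> (real \<times> (real^'d)) measure) \<Rightarrow> bool" where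
  "same_law G M \<xi> \<N> M' \<xi>' \<N>' \<longleftrightarrow>
     (\<forall>x (n::nat) B (k :: nat \<Rightarrow> nat). (\<forall>j<n. B j \<in> sets (mark_space G)) \<longrightarrow>
        measure M {\<omega>\<in>space M. \<xi> \<omega> = x \<and> (\<forall>j<n. emeasure (\<N> \<omega>) (B j) = of_nat (k j))} =
        measure M' {\<omega>\<in>space M'. \<xi>' \<omega> = x \<and> (\<forall>j<n. emeasure (\<N>' \<omega>) (B j) = of_nat (k j))})"

definition iid_copies ::
  "('a, 'd::finite) game \<Rightarrow> nat \<Rightarrow> 'w measure \<Rightarrow> (nat \<Rightarrow> 'w \<Rightarrow> int)
     \<Rightarrow> (nat \<Rightarrow> 'w \<Rightarrow> (real \<times> (real^'d)) measure)
     \<Rightarrow> 'v measure \<Rightarrow> ('v \<Rightarrow> int) \<Rightarrow> ('v \<Rightarrow> (real \<times> (real^'d)) measure) \<Rightarrow> bool" where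
  "iid_copies G N M' \<xi>' \<N>' M \<xi> \<N> \<longleftrightarrow>
     prob_space.indep_sets M'
       (\<lambda>i. sigma_sets (space M') (init_sigma M' (\<xi>' i) \<union> noise_sigma G M' (\<N>' i))) {1..N} \<and>
     (\<forall>i\<in>{1..N}. same_law G M' (\<xi>' i) (\<N>' i) M \<xi> \<N>)"

end

theory Submission
  imports Defs
begin

text \<open>Suppose that all players but one use \<open>\<gamma>\<close>. Let \<open>law\<close> be the flow of laws of the limiting state under
  \<open>\<gamma>\<close> and \<open>m\<close>; it is within \<open>2 / sqrt N\<close> of \<open>m\<close> because the two limiting states differ with
  small probability. Dynkin's formula for the squared deviation of the number of players in each
  state from \<open>N * law\<close>, whose martingale part contributes only order \<open>N\<close>, and Gronwall's lemma
  show that the empirical measure is within order \<open>1 / sqrt N\<close> of \<open>m\<close> in mean. If the remaining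
  player uses \<open>\<gamma>\<close> too, then the law of its state and \<open>law\<close> solve linear Kolmogorov equations with
  close rates; comparing laws rather than paths is what makes regularity of \<open>\<gamma>\<close> unnecessary. If it
  deviates to \<open>\<beta>\<close>, then its state is close in mean to the solution driven by the same noise and
  the same \<open>\<beta>\<close> in the environment \<open>m\<close>. The cost of the latter is that of the relaxed control given
  by the point masses at \<open>\<beta>\<close>, hence at least the cost of the relaxed feedback solution.\<close>

section \<open>Integration and Gronwall's lemma\<close>

text \<open>The players interact through the empirical measure, so no law of large numbers for
  independent variables applies to them. Two facts replace it: no two players jump at the same time,
  so the predictable quadratic variation of a count is a sum over single players; and a feedback
  player reads only its own state, so in a fixed environment the drift of the counts is linear in
  the counts. The state equations hold only almost surely, and the filtration need not contain the
  null sets. All almost sure properties are therefore made sure by restricting the basis to an event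
  of probability one. There the equations are finite sums over atoms, and the sample space keeps its
  type, which is the type over which optimality of the relaxed solution is assumed. Integrands are
  evaluated at left limits, because these are predictable; at any fixed time they agree with the
  states almost surely. A measurable \<open>\<gamma>\<close> may send neighbouring states to distant
  actions. Hence the diameter of the action set enters the constant, through the oscillation of the
  running cost along \<open>\<gamma>\<close>.\<close>

lemmas LINT_cong = Bochner_Integration.integral_cong and LINT_sum = Bochner_Integration.integral_sum
  and LINT_add = Bochner_Integration.integral_add and LINT_diff = Bochner_Integration.integral_diff
  and set_LINT_def = set_lebesgue_integral_def
  and fst_compose = measurable_compose[OF measurable_fst] and snd_compose = measurable_compose[OF measurable_snd]

lemma (in finite_measure) integrable_if_bounded:
  fixes f :: "'a \<Rightarrow> real"
  assumes "f \<in> borel_measurable M" "\<And>x. x \<in> space M \<Longrightarrow> \<bar>f x\<bar> \<le> B"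
  shows "integrable M f"
  using assms by (intro integrable_const_bound[where B = B]) auto

lemma (in finite_measure) abs_integral_le_if_bounded:
  fixes f :: "'a \<Rightarrow> real"
  assumes f: "\<And>x. x \<in> space M \<Longrightarrow> \<bar>f x\<bar> \<le> B" and "0 \<le> B"
  shows "\<bar>integral\<^sup>L M f\<bar> \<le> B * measure M (space M)"
proof (cases "integrable M f")
  case True
  have "\<bar>integral\<^sup>L M f\<bar> \<le> (LINT x|M. \<bar>f x\<bar>)" by (rule integral_abs_bound)
  also have "\<dots> \<le> (LINT x|M. B)" using True f by (intro integral_mono) auto
  finally show ?thesis by (simp add: mult.commute)
qed (use assms in \<open>auto simp: not_integrable_integral_eq\<close>)

text \<open>In the supremum norm with weight \<open>exp (- 2 * b * t)\<close> the integral term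
  costs at most half of the norm, since the integral of \<open>exp (2 * b * s)\<close> up to
  \<open>t\<close> is at most \<open>exp (2 * b * t) / (2 * b)\<close>. The norm is finite because
  \<open>u\<close> is bounded, so this half can be absorbed; hence the doubled constants. Continuity
  of \<open>u\<close> does not enter: the functions treated later are expectations of which only
  measurability and bounds are at hand.\<close>

lemma gronwall_bounded:
  fixes u :: "real \<Rightarrow> real" and T
  defines "S \<equiv> restrict_space lborel {0..T}"
  assumes b: "0 < b" and a: "0 \<le> a"
    and meas: "u \<in> borel_measurable S"
    and bnd: "\<And>t. t \<in> {0..T} \<Longrightarrow> 0 \<le> u t \<and> u t \<le> B"
    and le: "\<And>t. t \<in> {0..T} \<Longrightarrow> u t \<le> a + b * (LINT s:{..t}|S. u s)"
    and t: "t \<in> {0..T}"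
  shows "u t \<le> 2 * a * exp (2 * b * t)"
proof -
  interpret S: finite_measure S
    by (rule finite_measureI) (simp add: S_def emeasure_restrict_space space_restrict_space emeasure_lborel_Icc_eq)
  define c where "c = (SUP t\<in>{0..T}. exp (- 2 * b * t) * u t)"
  have bdd: "bdd_above ((\<lambda>t. exp (- 2 * b * t) * u t) ` {0..T})"
  proof (rule bdd_aboveI2)
    fix t assume "t \<in> {0..T}"
    then have "exp (- 2 * b * t) * u t \<le> 1 * B"
      using bnd[of t] b by (intro mult_mono) auto
    then show "exp (- 2 * b * t) * u t \<le> B" by simp
  qed
  have up: "exp (- 2 * b * t) * u t \<le> c" if "t \<in> {0..T}" for t
    unfolding c_def using that bdd by (rule cSUP_upper)
  have uc: "u t \<le> c * exp (2 * b * t)" if "t \<in> {0..T}" for t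
    using up[OF that] by (simp add: exp_minus field_simps)
  have c0: "0 \<le> c" using up[OF t] bnd[OF t] by (meson exp_ge_zero mult_nonneg_nonneg order_trans)
  have sp: "space S = {0..T}" by (simp add: S_def space_restrict_space)
  have S_meas: "{..t} \<inter> space S \<in> sets S" for t
    by (auto simp: S_def sets_restrict_space)
  have ind[measurable]: "(\<lambda>s. indicator {..t} s :: real) \<in> borel_measurable S" for t
    using S_meas[of t] by (simp add: borel_measurable_indicator_iff)
  have main: "exp (- 2 * b * t) * u t \<le> a + c / 2" if t: "t \<in> {0..T}" for t
  proof -
    have "(LINT s:{..t}|S. u s) \<le> (LINT s:{..t}|S. c * exp (2 * b * s))"
      unfolding set_LINT_def
    proof (rule integral_mono)
      show "integrable S (\<lambda>s. indicat_real {..t} s *\<^sub>R u s)"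
      proof (rule S.integrable_if_bounded[where B = "\<bar>B\<bar>"])
        fix s assume "s \<in> space S"
        then have "0 \<le> u s \<and> u s \<le> B" using bnd sp by auto
        then show "\<bar>indicat_real {..t} s *\<^sub>R u s\<bar> \<le> \<bar>B\<bar>" by (auto split: split_indicator)
      qed (use meas in measurable)
      show "integrable S (\<lambda>s. indicat_real {..t} s *\<^sub>R (c * exp (2 * b * s)))"
      proof (rule S.integrable_if_bounded[where B = "c * exp (2 * b * t)"])
        have [measurable]: "(\<lambda>s. exp (2 * b * s)) \<in> borel_measurable S"
          unfolding S_def by (intro measurable_restrict_space1) measurable
        show "(\<lambda>s. indicat_real {..t} s *\<^sub>R (c * exp (2 * b * s))) \<in> borel_measurable S"
          by measurable
      qed (use c0 b t in \<open>auto intro!: mult_left_mono simp: abs_mult split: split_indicator\<close>)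
    qed (use uc in \<open>auto simp: sp indicator_def\<close>)
    also have "\<dots> = (LINT s|lborel. indicator {0..t} s *\<^sub>R (c * exp (2 * b * s)))"
      unfolding set_LINT_def S_def
      by (subst integral_restrict_space) (use t in \<open>auto intro!: LINT_cong simp: indicator_def\<close>)
    also have "\<dots> = c * exp (2 * b * t) / (2 * b) - c / (2 * b)"
      using t b by (subst integral_FTC_Icc[where F = "\<lambda>s. c * exp (2 * b * s) / (2 * b)"])
        (auto intro!: continuous_intros derivative_eq_intros simp: has_real_derivative_iff_has_vector_derivative[symmetric])
    finally have "b * (LINT s:{..t}|S. u s) \<le> c * exp (2 * b * t) / 2 - c / 2"
      using b by (simp add: field_simps)
    with le[OF t] c0 have "u t \<le> a + c * exp (2 * b * t) / 2" by linarith
    then have "exp (- 2 * b * t) * u t \<le> exp (- 2 * b * t) * (a + c * exp (2 * b * t) / 2)"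
      by (intro mult_left_mono) auto
    also have "\<dots> = exp (- 2 * b * t) * a + c / 2"
      by (simp add: distrib_left exp_minus)
    also have "\<dots> \<le> a + c / 2"
      using mult_right_mono[of "exp (- 2 * b * t)" 1 a] a b t by simp
    finally show ?thesis .
  qed
  have "c \<le> a + c / 2" unfolding c_def
    by (rule cSUP_least) (use t main in \<open>auto simp: c_def\<close>)
  then have "c \<le> 2 * a" by simp
  then have "c * exp (2 * b * t) \<le> 2 * a * exp (2 * b * t)" by (intro mult_right_mono) auto
  with uc[OF t] show ?thesis by linarith
qed

text \<open>Integration by parts from Fubini's theorem: the product of the two increments is an
  integral over a square, which is cut along the diagonal. One triangle yields \<open>g\<close>
  against the increment of \<open>F\<close>, the other \<open>f\<close> against the increment of
  \<open>G\<close>. Differentiability is avoided, as \<open>f\<close> and \<open>g\<close> are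
  merely measurable.\<close>

lemma indefinite_integral_mult:
  fixes f g :: "real \<Rightarrow> real"
  assumes fin: "finite_measure S" and sets_S: "\<And>t. {..t} \<inter> space S \<in> sets S" "\<And>t. {..<t} \<inter> space S \<in> sets S"
    and atomless: "\<And>s. AE r in S. r \<noteq> s"
    and [measurable]: "f \<in> borel_measurable S" "g \<in> borel_measurable S"
    and f: "\<And>s. s \<in> space S \<Longrightarrow> \<bar>f s\<bar> \<le> B" and g: "\<And>s. s \<in> space S \<Longrightarrow> \<bar>g s\<bar> \<le> B'"
    and F: "\<And>s. s \<in> space S \<Longrightarrow> F s = F0 + (LINT r:{..s}|S. f r)"
    and G: "\<And>s. s \<in> space S \<Longrightarrow> G s = G\<^sub>0 + (LINT r:{..s}|S. g r)"
    and [measurable]: "(\<lambda>(r, s). indicator {..s} r :: real) \<in> borel_measurable (S \<Otimes>\<^sub>M S)"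
    and t: "t \<in> space S"
  shows "F t * G t = F0 * G\<^sub>0 + (LINT s:{..t}|S. f s * G s + F s * g s)"
proof -
  interpret S: finite_measure S by fact
  interpret SS: pair_sigma_finite S S ..
  interpret PP: finite_measure "S \<Otimes>\<^sub>M S" by (rule finite_measure_pair_measure) unfold_locales
  have ind[measurable]: "(\<lambda>s. indicator {..t} s :: real) \<in> borel_measurable S" for t
    using sets_S(1)[of t] by (simp add: borel_measurable_indicator_iff)
  have ind'[measurable]: "(\<lambda>s. indicator {..<t} s :: real) \<in> borel_measurable S" for t
    using sets_S(2)[of t] by (simp add: borel_measurable_indicator_iff)
  define \<phi> where "\<phi> s = indicator {..t} s * f s" for s
  define \<gamma> where "\<gamma> s = indicator {..t} s * g s" for s
  have [measurable]: "\<phi> \<in> borel_measurable S" "\<gamma> \<in> borel_measurable S"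
    unfolding \<phi>_def \<gamma>_def by measurable
  have \<phi>: "\<bar>\<phi> s\<bar> \<le> \<bar>B\<bar>" and \<gamma>: "\<bar>\<gamma> s\<bar> \<le> \<bar>B'\<bar>" if "s \<in> space S" for s
    using f[OF that] g[OF that] by (auto simp: \<phi>_def \<gamma>_def indicator_def)
  have i\<phi>: "integrable S \<phi>"
    by (rule S.integrable_const_bound[where B = "\<bar>B\<bar>"]) (use \<phi> in auto)
  have i\<gamma>: "integrable S \<gamma>"
    by (rule S.integrable_const_bound[where B = "\<bar>B'\<bar>"]) (use \<gamma> in auto)
  have i2: "integrable (S \<Otimes>\<^sub>M S) (\<lambda>(r, s). \<phi> r * \<gamma> s * indicator {..s} r)"
    by (rule PP.integrable_if_bounded[where B = "\<bar>B\<bar> * \<bar>B'\<bar>"], measurable)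
      (auto intro!: mult_mono \<phi> \<gamma> simp: space_pair_measure abs_mult split: split_indicator)
  have i3: "integrable (S \<Otimes>\<^sub>M S) (\<lambda>(r, s). \<phi> r * \<gamma> s * (1 - indicator {..s} r))"
    by (rule PP.integrable_if_bounded[where B = "\<bar>B\<bar> * \<bar>B'\<bar>"], measurable)
      (auto intro!: mult_mono \<phi> \<gamma> simp: space_pair_measure abs_mult split: split_indicator)
  have Fs: "(LINT r|S. \<phi> r * indicator {..s} r) = F s - F0" if "s \<in> space S" "s \<le> t" for s
    using that F[of s] unfolding set_LINT_def
    by (auto simp: \<phi>_def intro!: LINT_cong split: split_indicator)
  have Gs: "(LINT s|S. \<gamma> s * (1 - indicator {..s} r)) = G r - G\<^sub>0" if r: "r \<in> space S" "r \<le> t" for r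
  proof -
    \<comment> \<open>The second triangle is the one with \<open>s < r\<close>, whereas
      \<open>G\<close> integrates over \<open>s \<le> r\<close>; the two ranges differ in a point,
      which is null.\<close>
    have "(LINT s|S. \<gamma> s * (1 - indicator {..s} r)) = (LINT s|S. indicator {..r} s * g s)"
    proof (rule integral_cong_AE)
      have "(\<lambda>s. \<gamma> s * (1 - indicator {..s} r)) = (\<lambda>s. \<gamma> s * indicator {..<r} s)"
        by (auto simp: indicator_def)
      then show "(\<lambda>s. \<gamma> s * (1 - indicator {..s} r)) \<in> borel_measurable S" by simp
      show "AE s in S. \<gamma> s * (1 - indicator {..s} r) = indicator {..r} s * g s"
        using atomless[of r] by eventually_elim (use r in \<open>auto simp: \<gamma>_def indicator_def\<close>)
    qed simp
    with G[OF r(1)] show ?thesis unfolding set_LINT_def by simp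
  qed
  have Ft: "integral\<^sup>L S \<phi> = F t - F0" and Gt: "integral\<^sup>L S \<gamma> = G t - G\<^sub>0"
    using F[OF t] G[OF t] unfolding set_LINT_def by (simp_all add: \<phi>_def[abs_def] \<gamma>_def[abs_def])
  have "(F t - F0) * (G t - G\<^sub>0) = (LINT r|S. \<phi> r * (LINT s|S. \<gamma> s))"
    unfolding Ft[symmetric] Gt[symmetric] by simp
  also have "\<dots> = (LINT r|S. (LINT s|S. \<phi> r * \<gamma> s * indicator {..s} r) + (LINT s|S. \<phi> r * \<gamma> s * (1 - indicator {..s} r)))"
  proof (rule LINT_cong[OF refl])
    fix r assume r: "r \<in> space S"
    have [measurable]: "(\<lambda>s. indicator {..s} r :: real) \<in> borel_measurable S"
      using measurable_compose[OF measurable_Pair1'[OF r, of S] assms(11)] by simp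
    have "integrable S (\<lambda>s. \<phi> r * \<gamma> s * indicator {..s} r)"
      by (rule S.integrable_if_bounded[where B = "\<bar>B\<bar> * \<bar>B'\<bar>"], measurable)
        (use r in \<open>auto intro!: mult_mono \<phi> \<gamma> simp: abs_mult split: split_indicator\<close>)
    moreover have "integrable S (\<lambda>s. \<phi> r * \<gamma> s * (1 - indicator {..s} r))"
      by (rule S.integrable_if_bounded[where B = "\<bar>B\<bar> * \<bar>B'\<bar>"], measurable)
        (use r in \<open>auto intro!: mult_mono \<phi> \<gamma> simp: abs_mult split: split_indicator\<close>)
    ultimately show "\<phi> r * (LINT s|S. \<gamma> s) = (LINT s|S. \<phi> r * \<gamma> s * indicator {..s} r) + (LINT s|S. \<phi> r * \<gamma> s * (1 - indicator {..s} r))"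
      by (subst LINT_add[symmetric]) (auto simp: algebra_simps)
  qed
  also have "\<dots> = (LINT r|S. LINT s|S. \<phi> r * \<gamma> s * indicator {..s} r) + (LINT r|S. LINT s|S. \<phi> r * \<gamma> s * (1 - indicator {..s} r))"
    using SS.integrable_fst[OF i2] SS.integrable_fst[OF i3] by (rule LINT_add)
  also have "(LINT r|S. LINT s|S. \<phi> r * \<gamma> s * indicator {..s} r) = (LINT s|S. \<gamma> s * (LINT r|S. \<phi> r * indicator {..s} r))"
    using SS.Fubini_integral[OF i2] by (simp add: algebra_simps flip: integral_mult_right_zero)
  also have "\<dots> = (LINT s|S. \<gamma> s * (F s - F0))"
    by (intro LINT_cong) (auto simp: \<gamma>_def Fs split: split_indicator)
  also have "(LINT r|S. LINT s|S. \<phi> r * \<gamma> s * (1 - indicator {..s} r)) = (LINT r|S. \<phi> r * (LINT s|S. \<gamma> s * (1 - indicator {..s} r)))"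
    by (simp add: mult.assoc)
  also have "\<dots> = (LINT r|S. \<phi> r * (G r - G\<^sub>0))"
    by (intro LINT_cong) (auto simp: \<phi>_def Gs split: split_indicator)
  finally have *: "(F t - F0) * (G t - G\<^sub>0) = (LINT s|S. \<gamma> s * (F s - F0)) + (LINT r|S. \<phi> r * (G r - G\<^sub>0))" .
  have bF: "\<bar>F s - F0\<bar> \<le> \<bar>B\<bar> * measure S (space S)" if "s \<in> space S" for s
  proof -
    have "\<bar>indicator {..s} r *\<^sub>R f r\<bar> \<le> \<bar>B\<bar>" if "r \<in> space S" for r
      using f[OF that] by (auto split: split_indicator)
    from S.abs_integral_le_if_bounded[OF this] show ?thesis
      unfolding F[OF that] set_LINT_def by simp
  qed
  have bG: "\<bar>G s - G\<^sub>0\<bar> \<le> \<bar>B'\<bar> * measure S (space S)" if "s \<in> space S" for s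
  proof -
    have "\<bar>indicator {..s} r *\<^sub>R g r\<bar> \<le> \<bar>B'\<bar>" if "r \<in> space S" for r
      using g[OF that] by (auto split: split_indicator)
    from S.abs_integral_le_if_bounded[OF this] show ?thesis
      unfolding G[OF that] set_LINT_def by simp
  qed
  have mF: "F \<in> borel_measurable S"
  proof -
    have "(\<lambda>s. F0 + (LINT r|S. indicator {..s} r * f r)) \<in> borel_measurable S"
      by (intro borel_measurable_add S.borel_measurable_lebesgue_integral) (simp_all, measurable)
    then show ?thesis
      by (rule measurable_cong[THEN iffD2, rotated]) (simp add: F set_LINT_def)
  qed
  have mG: "G \<in> borel_measurable S"
  proof -
    have "(\<lambda>s. G\<^sub>0 + (LINT r|S. indicator {..s} r * g r)) \<in> borel_measurable S"
      by (intro borel_measurable_add S.borel_measurable_lebesgue_integral) (simp_all, measurable)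
    then show ?thesis
      by (rule measurable_cong[THEN iffD2, rotated]) (simp add: G set_LINT_def)
  qed
  have i4: "integrable S (\<lambda>s. \<gamma> s * (F s - F0))"
    using mF by (intro S.integrable_const_bound[where B = "\<bar>B'\<bar> * (\<bar>B\<bar> * measure S (space S))"])
      (auto intro!: AE_I2 mult_mono bF \<gamma> simp: abs_mult)
  have i5: "integrable S (\<lambda>s. \<phi> s * (G s - G\<^sub>0))"
    using mG by (intro S.integrable_const_bound[where B = "\<bar>B\<bar> * (\<bar>B'\<bar> * measure S (space S))"])
      (auto intro!: AE_I2 mult_mono bG \<phi> simp: abs_mult)
  have "(LINT s:{..t}|S. f s * G s + F s * g s)
      = (LINT s|S. (\<gamma> s * (F s - F0) + \<phi> s * (G s - G\<^sub>0)) + (F0 * \<gamma> s + G\<^sub>0 * \<phi> s))"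
    unfolding set_LINT_def
    by (intro LINT_cong) (auto simp: \<gamma>_def \<phi>_def indicator_def algebra_simps)
  also have "\<dots> = (F t - F0) * (G t - G\<^sub>0) + (F0 * (G t - G\<^sub>0) + G\<^sub>0 * (F t - F0))"
    using i4 i5 i\<phi> i\<gamma> by (simp add: * Ft Gt)
  finally show ?thesis by (simp add: algebra_simps)
qed

section \<open>Integer valued measures and Poisson variables\<close>

definition atoms :: "'b measure \<Rightarrow> 'b set" where
  "atoms n = {z\<in>space n. emeasure n {z} \<noteq> 0}"

text \<open>Basic neighbourhoods shrinking to \<open>z\<close> have masses that converge to the mass
  of \<open>{z}\<close>. These are integers, so they reach their limit: the point mass is an
  integer, and some basic neighbourhood of \<open>z\<close> has no more mass than \<open>z\<close>
  itself. A point that is no atom thus lies in a basic null set, and there are countably many of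
  those. Integrality is asked on a countable basis only, since a random measure provides it almost
  surely for countably many sets at once.\<close>

lemma integer_valued_measure_atomic:
  fixes n :: "'b::{second_countable_topology, metric_space} measure"
  assumes op: "\<And>U. open U \<Longrightarrow> U \<inter> space n \<in> sets n"
    and fin: "finite_measure n"
    and basis: "countable \<B>" "topological_basis \<B>"
    and int: "\<And>B. B \<in> \<B> \<Longrightarrow> measure n (B \<inter> space n) \<in> \<int>"
  shows "finite (atoms n)" "\<And>z. z \<in> atoms n \<Longrightarrow> 1 \<le> measure n {z}" "emeasure n (space n - atoms n) = 0"
    "\<And>z. z \<in> space n \<Longrightarrow> {z} \<in> sets n"
proof -
  interpret finite_measure n by fact
  show sing: "{z} \<in> sets n" if "z \<in> space n" for z
  proof -
    have "space n - (- {z}) \<inter> space n \<in> sets n"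
      using op[of "- {z}"] by auto
    also have "space n - (- {z}) \<inter> space n = {z}" using that by auto
    finally show ?thesis .
  qed
  have pt: "measure n {z} \<in> \<int> \<and> (\<exists>B\<in>\<B>. z \<in> B \<and> measure n (B \<inter> space n) = measure n {z})"
    if z: "z \<in> space n" for z
  proof -
    define D where "D k = ball z (1 / real (Suc k)) \<inter> space n" for k
    have "\<exists>B\<in>\<B>. z \<in> B \<and> B \<subseteq> ball z (1 / real (Suc k))" for k
      using topological_basisE[OF basis(2), of "ball z (1 / real (Suc k))" z] by force
    then obtain B where B: "\<And>k. B k \<in> \<B>" "\<And>k. z \<in> B k" "\<And>k. B k \<subseteq> ball z (1 / real (Suc k))"
      by metis
    have "(\<Inter>k. D k) = {z}"
    proof
      show "(\<Inter>k. D k) \<subseteq> {z}"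
      proof
        fix y assume y: "y \<in> (\<Inter>k. D k)"
        have "dist z y < 1 / real (Suc k)" for k using y by (auto simp: D_def)
        then have "dist z y \<le> inverse (real (Suc k))" for k
          by (simp add: inverse_eq_divide less_imp_le)
        then have "dist z y \<le> 0"
          by (intro LIMSEQ_le_const[OF LIMSEQ_inverse_real_of_nat]) blast
        then show "y \<in> {z}" by simp
      qed
    qed (use z in \<open>auto simp: D_def\<close>)
    moreover have "decseq D" unfolding D_def decseq_def
      by (intro allI impI Int_mono subset_ball order_refl) (simp add: frac_le)
    moreover have "range D \<subseteq> sets n" using op by (auto simp: D_def)
    ultimately have lim: "(\<lambda>k. measure n (D k)) \<longlonglongrightarrow> measure n {z}"
      using finite_Lim_measure_decseq[of D] by simp
    have opB: "open (B k)" for k using B(1) basis(2) topological_basis_open by blast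
    have lim': "(\<lambda>k. measure n (B k \<inter> space n)) \<longlonglongrightarrow> measure n {z}"
    proof (rule tendsto_sandwich[OF _ _ tendsto_const lim])
      show "\<forall>\<^sub>F k in sequentially. measure n {z} \<le> measure n (B k \<inter> space n)"
        using B opB z op by (intro always_eventually allI finite_measure_mono) auto
      show "\<forall>\<^sub>F k in sequentially. measure n (B k \<inter> space n) \<le> measure n (D k)"
        using B opB z op by (intro always_eventually allI finite_measure_mono) (auto simp: D_def)
    qed
    have Z: "measure n {z} \<in> \<int>"
      using closed_sequentially[OF closed_Ints _ lim'] int[OF B(1)] by blast
    have "\<forall>\<^sub>F k in sequentially. dist (measure n (B k \<inter> space n)) (measure n {z}) < 1"
      by (rule tendstoD[OF lim']) simp
    then obtain k where "dist (measure n (B k \<inter> space n)) (measure n {z}) < 1"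
      by (auto simp: eventually_sequentially)
    then have "measure n (B k \<inter> space n) = measure n {z}"
      using Ints_eq_abs_less1[OF int[OF B(1)] Z, of k] by (auto simp: dist_real_def)
    with Z B show ?thesis by blast
  qed
  show one: "1 \<le> measure n {z}" if "z \<in> atoms n" for z
  proof -
    have z: "z \<in> space n" "emeasure n {z} \<noteq> 0" using that by (auto simp: atoms_def)
    then have "measure n {z} \<noteq> 0" by (simp add: emeasure_eq_measure)
    moreover obtain k :: int where "measure n {z} = of_int k"
      using pt[OF z(1)] by (auto elim: Ints_cases)
    moreover have "0 \<le> measure n {z}" by simp
    ultimately show ?thesis by simp
  qed
  show "finite (atoms n)"
  proof (rule finite_if_finite_subsets_card_bdd[THEN conjunct1])
    fix Q assume Q: "Q \<subseteq> atoms n" "finite Q"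
    have "real (card Q) \<le> (\<Sum>z\<in>Q. measure n {z})"
      using sum_mono[of Q "\<lambda>_. 1" "\<lambda>z. measure n {z}"] one Q by auto
    also have "\<dots> = measure n Q"
      by (rule finite_measure_eq_sum_singleton[symmetric]) (use Q sing in \<open>auto simp: atoms_def\<close>)
    also have "\<dots> \<le> measure n (space n)" by (rule bounded_measure)
    finally show "card Q \<le> nat \<lceil>measure n (space n)\<rceil>" by linarith
  qed
  define \<C> where "\<C> = {B\<in>\<B>. measure n (B \<inter> space n) = 0}"
  have nullB: "(\<Union>B\<in>\<C>. B \<inter> space n) \<in> null_sets n"
  proof (rule null_sets_UN')
    show "countable \<C>" using basis(1) by (auto simp: \<C>_def intro: countable_subset)
    show "B \<inter> space n \<in> null_sets n" if "B \<in> \<C>" for B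
      using that op[of B] topological_basis_open[OF basis(2)]
      by (auto simp: \<C>_def null_sets_def emeasure_eq_measure)
  qed
  have "space n - atoms n \<subseteq> (\<Union>B\<in>\<C>. B \<inter> space n)"
  proof
    fix z assume z: "z \<in> space n - atoms n"
    then have "measure n {z} = 0" by (auto simp: atoms_def emeasure_eq_measure)
    with pt[of z] z show "z \<in> (\<Union>B\<in>\<C>. B \<inter> space n)" by (auto simp: \<C>_def)
  qed
  then have "emeasure n (space n - atoms n) \<le> emeasure n (\<Union>B\<in>\<C>. B \<inter> space n)"
    using nullB by (intro emeasure_mono) auto
  then show "emeasure n (space n - atoms n) = 0" using nullB by auto
qed

text \<open>Turns a noise with finitely many unit atoms into a counting measure, so that every
  integral against it becomes a finite sum over its atoms.\<close>

lemma simple_measure_eq_distr: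
  assumes fin: "finite (atoms n)" and null: "emeasure n (space n - atoms n) = 0"
    and sing: "\<And>z. z \<in> space n \<Longrightarrow> {z} \<in> sets n"
    and one: "\<And>z. z \<in> atoms n \<Longrightarrow> emeasure n {z} = 1" and N: "sets N = sets n"
  shows "n = distr (count_space (atoms n)) N (\<lambda>z. z)"
proof (rule measure_eqI)
  show "sets n = sets (distr (count_space (atoms n)) N (\<lambda>z. z))" using N by simp
  fix A assume A: "A \<in> sets n"
  have at: "atoms n \<subseteq> space n" by (auto simp: atoms_def)
  have m: "(\<lambda>z. z) \<in> count_space (atoms n) \<rightarrow>\<^sub>M N" using at sets_eq_imp_space_eq[OF N] by auto
  have sub: "Q \<in> sets n" if "Q \<subseteq> atoms n" for Q
  proof -
    have "(\<Union>z\<in>Q. {z}) \<in> sets n"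
      using that at fin sing by (intro sets.finite_UN) (auto dest: finite_subset)
    then show ?thesis by simp
  qed
  have "emeasure n A = emeasure n (A \<inter> atoms n) + emeasure n (A - atoms n)"
    using A sub[of "atoms n"] sub[of "A \<inter> atoms n"] by (subst plus_emeasure) (auto simp: Int_Diff_Un)
  also have "emeasure n (A - atoms n) = 0"
    using emeasure_mono[of "A - atoms n" "space n - atoms n" n] null sets.sets_into_space[OF A] sub[of "atoms n"]
    by auto
  also have "emeasure n (A \<inter> atoms n) = (\<Sum>z\<in>A \<inter> atoms n. emeasure n {z})"
    using fin at sing by (intro emeasure_eq_sum_singleton) auto
  also have "\<dots> = of_nat (card (A \<inter> atoms n))" using one by simp
  finally show "emeasure n A = emeasure (distr (count_space (atoms n)) N (\<lambda>z. z)) A"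
    using A m N fin by (subst emeasure_distr) (auto simp: emeasure_count_space Int_commute)
qed

lemma integral_distr_count_space:
  fixes f :: "'b \<Rightarrow> 'c::{banach, second_countable_topology}"
  assumes "finite P" "P \<subseteq> space N" "f \<in> borel_measurable N"
  shows "integral\<^sup>L (distr (count_space P) N (\<lambda>z. z)) f = (\<Sum>z\<in>P. f z)"
  using assms by (subst integral_distr) (auto simp: lebesgue_integral_count_space_finite)

lemma nn_integral_distr_count_space:
  assumes "finite P" "P \<subseteq> space N" "f \<in> borel_measurable N"
  shows "integral\<^sup>N (distr (count_space P) N (\<lambda>z. z)) f = (\<Sum>z\<in>P. f z)"
  using assms by (subst nn_integral_distr) (auto simp: nn_integral_count_space_finite)

lemma poisson_mean_sums: "(\<lambda>k. real k * (exp (- l) * l ^ k / fact k)) sums l"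
proof -
  have "(\<lambda>k. (exp (- l) * l) * (l ^ k /\<^sub>R fact k)) sums (exp (- l) * l * exp l)"
    by (intro sums_mult exp_converges)
  then have "(\<lambda>k. exp (- l) * l ^ Suc k / fact k) sums l"
    by (simp add: exp_minus field_simps)
  moreover have "real (Suc k) * (exp (- l) * l ^ Suc k / fact (Suc k)) = exp (- l) * l ^ Suc k / fact k" for k
    by (simp add: field_simps del: of_nat_Suc)
  ultimately have "(\<lambda>k. real (Suc k) * (exp (- l) * l ^ Suc k / fact (Suc k))) sums l"
    by simp
  then show ?thesis
    by (subst (asm) sums_Suc_iff) simp
qed

lemma poisson_mass_sums: "(\<lambda>k. exp (- l :: real) * l ^ k / fact k) sums 1"
proof -
  have "(\<lambda>k. exp (- l) * (l ^ k /\<^sub>R fact k)) sums (exp (- l) * exp l)"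
    by (intro sums_mult exp_converges)
  then show ?thesis by (simp add: exp_minus field_simps)
qed

lemma borel_measurable_ennreal_eq_sets:
  assumes "f \<in> borel_measurable M"
  shows "{\<omega>\<in>space M. f \<omega> = (c :: ennreal)} \<in> sets M"
  using measurable_sets[OF assms, of "{c}"] by (simp add: vimage_def Int_def conj_commute)

locale poisson_variable = prob_space M for M :: "'w measure" +
  fixes f :: "'w \<Rightarrow> ennreal" and l :: real
  assumes meas[measurable]: "f \<in> borel_measurable M" and l: "0 \<le> l"
    and law: "\<And>k::nat. measure M {\<omega>\<in>space M. f \<omega> = of_nat k} = exp (- l) * l ^ k / fact k"
begin

lemma ev[measurable]: "{\<omega>\<in>space M. f \<omega> = c} \<in> sets M"
  using borel_measurable_ennreal_eq_sets[OF meas] .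

text \<open>The prescribed probabilities of the natural numbers already sum to 1, which leaves no
  mass for infinity or for fractional values.\<close>

lemma AE_nat: "AE \<omega> in M. f \<omega> \<in> range of_nat"
proof -
  have "(\<lambda>k. measure M {\<omega>\<in>space M. f \<omega> = of_nat k}) sums measure M (\<Union>k::nat. {\<omega>\<in>space M. f \<omega> = of_nat k})"
    by (intro finite_measure_UNION) (auto simp: disjoint_family_on_def)
  then have "measure M (\<Union>k::nat. {\<omega>\<in>space M. f \<omega> = of_nat k}) = 1"
    using poisson_mass_sums[of l] by (auto simp: law dest: sums_unique2)
  then have "AE \<omega> in M. \<omega> \<in> (\<Union>k::nat. {\<omega>\<in>space M. f \<omega> = of_nat k})"
    by (subst prob_eq_1[symmetric]) auto
  then show ?thesis by eventually_elim auto
qed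

text \<open>Decomposing \<open>f\<close> by its values reduces the claim to the series for the mean
  of the Poisson law. Independence enters through one event and the level sets of \<open>f\<close>,
  which is how it arises from an event of the past and the noise of the future.\<close>

lemma nn_integral_indep:
  assumes A: "A \<in> sets M"
    and ind: "\<And>k::nat. measure M (A \<inter> {\<omega>\<in>space M. f \<omega> = of_nat k}) = measure M A * measure M {\<omega>\<in>space M. f \<omega> = of_nat k}"
  shows "(\<integral>\<^sup>+\<omega>. indicator A \<omega> * f \<omega> \<partial>M) = ennreal (measure M A * l)"
proof -
  note [measurable] = A
  have "(\<integral>\<^sup>+\<omega>. indicator A \<omega> * f \<omega> \<partial>M)
      = (\<integral>\<^sup>+\<omega>. (\<Sum>k. of_nat k * indicator (A \<inter> {\<omega>\<in>space M. f \<omega> = of_nat k}) \<omega>) \<partial>M)"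
  proof (rule nn_integral_cong_AE)
    show "AE \<omega> in M. indicator A \<omega> * f \<omega> = (\<Sum>k. of_nat k * indicator (A \<inter> {\<omega>\<in>space M. f \<omega> = of_nat k}) \<omega>)"
      using AE_nat AE_space
    proof eventually_elim
      case (elim \<omega>)
      then obtain k where k: "f \<omega> = of_nat k" by auto
      have "(\<Sum>k. of_nat k * indicator (A \<inter> {\<omega>\<in>space M. f \<omega> = of_nat k}) \<omega> :: ennreal)
          = (\<Sum>k\<in>{k}. of_nat k * indicator (A \<inter> {\<omega>\<in>space M. f \<omega> = of_nat k}) \<omega>)"
        using k by (intro suminf_finite) auto
      with k elim show ?case by (simp add: indicator_def)
    qed
  qed
  also have "\<dots> = (\<Sum>k. \<integral>\<^sup>+\<omega>. of_nat k * indicator (A \<inter> {\<omega>\<in>space M. f \<omega> = of_nat k}) \<omega> \<partial>M)"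
    by (intro nn_integral_suminf) measurable
  also have "\<dots> = (\<Sum>k. ennreal (measure M A * (real k * (exp (- l) * l ^ k / fact k))))"
  proof (rule suminf_cong)
    fix k :: nat
    let ?p = "exp (- l) * l ^ k / fact k"
    have "(\<integral>\<^sup>+\<omega>. of_nat k * indicator (A \<inter> {\<omega>\<in>space M. f \<omega> = of_nat k}) \<omega> \<partial>M)
        = of_nat k * emeasure M (A \<inter> {\<omega>\<in>space M. f \<omega> = of_nat k})"
      by (rule nn_integral_cmult_indicator) measurable
    also have "\<dots> = ennreal (real k) * ennreal (measure M A * ?p)"
      by (simp only: emeasure_eq_measure ind law) (simp only: ennreal_of_nat_eq_real_of_nat)
    also have "\<dots> = ennreal (measure M A * (real k * ?p))"
      by (subst ennreal_mult'[symmetric]) (simp_all add: ac_simps)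
    finally show "(\<integral>\<^sup>+\<omega>. of_nat k * indicator (A \<inter> {\<omega>\<in>space M. f \<omega> = of_nat k}) \<omega> \<partial>M)
        = ennreal (measure M A * (real k * ?p))" .
  qed
  also have "\<dots> = ennreal (measure M A * l)"
    using l by (intro suminf_ennreal_eq sums_mult poisson_mean_sums) auto
  finally show ?thesis .
qed

lemma prob_ge_1: "prob {\<omega>\<in>space M. 1 \<le> f \<omega>} \<le> l"
proof -
  have "prob {\<omega>\<in>space M. 1 \<le> f \<omega>} \<le> prob (space M - {\<omega>\<in>space M. f \<omega> = of_nat 0})"
    by (intro finite_measure_mono) auto
  also have "\<dots> = 1 - exp (- l)" by (subst prob_compl) (auto simp: law[of 0, simplified])
  also have "\<dots> \<le> l" using exp_ge_add_one_self[of "- l"] by simp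
  finally show ?thesis .
qed

text \<open>The probability is at most \<open>1 - (1 + l) * exp (- l)\<close>, and
  \<open>exp (- l) \<ge> 1 - l\<close>. The order two in \<open>l\<close> is what makes the union
  bound over small time slabs in \<open>AE_separated\<close> vanish.\<close>

lemma prob_ge_2: "prob {\<omega>\<in>space M. 1 < f \<omega>} \<le> l\<^sup>2"
proof -
  have "prob {\<omega>\<in>space M. 1 < f \<omega>} \<le> prob (space M - ({\<omega>\<in>space M. f \<omega> = of_nat 0} \<union> {\<omega>\<in>space M. f \<omega> = of_nat 1}))"
    by (intro finite_measure_mono) auto
  also have "\<dots> = 1 - (exp (- l) + exp (- l) * l)"
    using law[of 0] law[of 1] by (subst prob_compl, measurable) (subst finite_measure_Union, auto)
  also have "\<dots> = 1 - (1 + l) * exp (- l)" by (simp add: algebra_simps)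
  also have "\<dots> \<le> 1 - (1 + l) * (1 - l)"
    using exp_ge_add_one_self[of "- l"] l by (intro diff_left_mono mult_left_mono) auto
  also have "\<dots> = l\<^sup>2" by (simp add: algebra_simps power2_eq_square)
  finally show ?thesis .
qed

lemma AE_eq_0: "l = 0 \<Longrightarrow> AE \<omega> in M. f \<omega> = 0"
  using law[of 0] prob_eq_1[OF ev, of 0] by simp

end

section \<open>Predictable processes and left limits\<close>

locale game =
  fixes G :: "('a::metric_space, 'd::finite) game"
  assumes data: "game_data G"
begin

abbreviation "T \<equiv> horizon G"
abbreviation "\<tau> \<equiv> time_space G"
abbreviation "\<mu> \<equiv> intensity G"
abbreviation "\<nu> \<equiv> measure (intensity G) (marks G)"
abbreviation "state_space \<equiv> count_space (states G)"
abbreviation "jump_space \<equiv> \<tau> \<Otimes>\<^sub>M state_space \<Otimes>\<^sub>M \<mu> \<Otimes>\<^sub>M action_space G \<Otimes>\<^sub>M simplex_space"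
abbreviation "cost_space \<equiv> \<tau> \<Otimes>\<^sub>M state_space \<Otimes>\<^sub>M action_space G \<Otimes>\<^sub>M simplex_space"

lemma T_pos: "0 < T" and compact_actions: "compact (actions G)" and compact_marks: "compact (marks G)"
  and sets_intensity: "sets \<mu> = sets (restrict_space borel (marks G))"
  and finite_intensity: "finite_measure \<mu>" and init_law_simplex: "init_law G \<in> prob_simplex"
  and jump_measurable: "(\<lambda>(t, x, u, a, p). jump G t x u a p) \<in>
       jump_space \<rightarrow>\<^sub>M count_space UNIV"
  and jump_range: "\<And>t x u a p. t \<in> {0..T} \<Longrightarrow> x \<in> states G \<Longrightarrow> u \<in> marks G \<Longrightarrow> a \<in> actions G \<Longrightarrow>
     p \<in> prob_simplex \<Longrightarrow> jump G t x u a p \<in> {1 - x..int CARD('d) - x}"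
  and run_cost_measurable: "(\<lambda>(t, x, a, p). run_cost G t x a p) \<in>
       borel_measurable (cost_space)"
  and end_cost_measurable: "(\<lambda>(x, p). end_cost G x p) \<in> borel_measurable (state_space \<Otimes>\<^sub>M simplex_space)"
  using data unfolding game_data_def by auto

lemma space_time: "space \<tau> = {0..T}" by (simp add: space_restrict_space)
lemma space_intensity: "space \<mu> = marks G"
  using sets_eq_imp_space_eq[OF sets_intensity] by (simp add: space_restrict_space)
lemma space_mark: "space (mark_space G) = {0..T} \<times> marks G"
  by (simp add: space_pair_measure space_time space_intensity)

sublocale U: finite_measure \<mu> by (rule finite_intensity)
sublocale tau: finite_measure \<tau>
  by (rule finite_measureI) (simp add: emeasure_restrict_space space_restrict_space emeasure_lborel_Icc_eq)
sublocale tauU: finite_measure "mark_space G" by (rule finite_measure_pair_measure) unfold_locales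

lemma time_meas: "X \<in> sets borel \<Longrightarrow> X \<subseteq> {0..T} \<Longrightarrow> X \<in> sets \<tau>"
  by (auto simp: sets_restrict_space)

lemma marks_sets: "marks G \<in> sets \<mu>" using sets.top[of \<mu>] by (simp add: space_intensity)

lemma measure_slab:
  assumes "0 \<le> a" "a \<le> b" "b \<le> T"
  shows "{a<..b} \<times> marks G \<in> sets (mark_space G)" "measure (mark_space G) ({a<..b} \<times> marks G) = (b - a) * \<nu>"
proof -
  have A: "{a<..b} \<in> sets \<tau>" using assms by (intro time_meas) auto
  then show "{a<..b} \<times> marks G \<in> sets (mark_space G)" using marks_sets by auto
  have "emeasure \<tau> {a<..b} = ennreal (b - a)"
    using assms by (subst emeasure_restrict_space) auto
  moreover have "emeasure (mark_space G) ({a<..b} \<times> marks G) = emeasure \<tau> {a<..b} * emeasure \<mu> (marks G)"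
    by (rule U.emeasure_pair_measure_Times[OF A marks_sets])
  ultimately show "measure (mark_space G) ({a<..b} \<times> marks G) = (b - a) * \<nu>"
    using assms by (simp add: measure_def enn2real_mult)
qed

lemma measure_section:
  assumes "0 \<le> a" "a \<le> T"
  shows "{a} \<times> marks G \<in> sets (mark_space G)" "measure (mark_space G) ({a} \<times> marks G) = 0"
proof -
  have A: "{a} \<in> sets \<tau>" using assms by (intro time_meas) auto
  then show "{a} \<times> marks G \<in> sets (mark_space G)" using marks_sets by auto
  have "emeasure \<tau> {a} = 0"
    using assms by (subst emeasure_restrict_space) auto
  then have "emeasure (mark_space G) ({a} \<times> marks G) = 0"
    using U.emeasure_pair_measure_Times[OF A marks_sets] by simp
  then show "measure (mark_space G) ({a} \<times> marks G) = 0" by (simp add: measure_def)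
qed

text \<open>Relates the topology of the product of time and marks to the product
  \<open>\<sigma>\<close>-algebra; this makes \<open>integer_valued_measure_atomic\<close>
  applicable to the noise.\<close>

lemma open_Int_mark_space: "open U \<Longrightarrow> U \<inter> space (mark_space G) \<in> sets (mark_space G)"
proof -
  assume U: "open U"
  have f: "fst \<in> mark_space G \<rightarrow>\<^sub>M borel"
    by (rule measurable_compose[OF measurable_fst]) (rule measurable_restrict_space1, simp)
  have "snd \<in> mark_space G \<rightarrow>\<^sub>M restrict_space borel (marks G)"
    using measurable_cong_sets[OF refl sets_intensity] measurable_snd by blast
  then have s: "snd \<in> mark_space G \<rightarrow>\<^sub>M borel"
    by (simp add: measurable_restrict_space2_iff)
  have "(\<lambda>z. (fst z, snd z)) \<in> mark_space G \<rightarrow>\<^sub>M borel"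
    by (rule borel_measurable_Pair[OF f s])
  from measurable_sets[OF this, of U] U show ?thesis by simp
qed

end

text \<open>The configurations of atoms on which the state equations are finite sums: no atoms at time
  \<open>0\<close> or \<open>horizon G\<close>, and all atoms of all players at different times.\<close>

definition simple_points ::
  "('a, 'd::finite) game \<Rightarrow> nat set \<Rightarrow> (nat \<Rightarrow> (real \<times> (real^'d)) measure) \<Rightarrow> bool" where
  "simple_points G I n \<longleftrightarrow>
     (\<forall>i\<in>I. finite (atoms (n i)) \<and> atoms (n i) \<subseteq> {0<..<horizon G} \<times> marks G \<and>
            n i = distr (count_space (atoms (n i))) (mark_space G) (\<lambda>z. z)) \<and>
     (\<forall>i\<in>I. \<forall>j\<in>I. \<forall>z\<in>atoms (n i). \<forall>z'\<in>atoms (n j). fst z = fst z' \<longrightarrow> i = j \<and> z = z')"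

abbreviation "tw \<omega> z \<equiv> ((fst z, \<omega>), snd z)"

abbreviation left_state :: "(real \<Rightarrow> 'w \<Rightarrow> int) \<Rightarrow> real \<Rightarrow> 'w \<Rightarrow> int" where
  "left_state X s \<omega> \<equiv> left_lim (\<lambda>r. X r \<omega>) s"

locale game_basis = game G for G :: "('a::metric_space, 'd::finite) game" +
  fixes M :: "'w measure" and F :: "real \<Rightarrow> 'w measure"
  assumes filt: "filtered_prob_space G M F"
begin

sublocale prob_space M using filt by (simp add: filtered_prob_space_def)

abbreviation "\<P> \<equiv> predictable_algebra G M F"
abbreviation "\<H> \<equiv> \<P> \<Otimes>\<^sub>M \<mu>"

lemma space_F: "t \<in> {0..T} \<Longrightarrow> space (F t) = space M"
  and sets_F: "t \<in> {0..T} \<Longrightarrow> B \<in> sets (F t) \<Longrightarrow> B \<in> sets M"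
  using filt unfolding filtered_prob_space_def subalgebra_def by blast+

lemma F_mono: "0 \<le> s \<Longrightarrow> s \<le> t \<Longrightarrow> t \<le> T \<Longrightarrow> B \<in> sets (F s) \<Longrightarrow> B \<in> sets (F t)"
  using filt unfolding filtered_prob_space_def subalgebra_def by (meson atLeastAtMost_iff order_trans subsetD)

lemma measurable_F: "t \<in> {0..T} \<Longrightarrow> f \<in> F t \<rightarrow>\<^sub>M N \<Longrightarrow> f \<in> M \<rightarrow>\<^sub>M N"
  using filt unfolding filtered_prob_space_def by (blast intro: measurable_from_subalg)

abbreviation "gens \<equiv> {{0} \<times> B |B. B \<in> sets (F 0)} \<union>
      {{s<..t} \<times> B |s t B. 0 \<le> s \<and> s < t \<and> t \<le> horizon G \<and> B \<in> sets (F s)}"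

lemma gens_sub: "gens \<subseteq> Pow ({0..T} \<times> space M)"
proof
  fix A assume "A \<in> gens"
  then consider A' where "A = {0} \<times> A'" "A' \<in> sets (F 0)" |
    s t A' where "A = {s<..t} \<times> A'" "0 \<le> s" "s < t" "t \<le> T" "A' \<in> sets (F s)" by blast
  then show "A \<in> Pow ({0..T} \<times> space M)"
  proof cases
    case 1
    with T_pos sets.sets_into_space[OF sets_F[of 0 A']] show ?thesis by auto
  next
    case 2
    with sets.sets_into_space[OF sets_F[of s A']] show ?thesis by auto
  qed
qed

lemma space_pred: "space \<P> = {0..T} \<times> space M"
  unfolding predictable_algebra_def using gens_sub by (simp add: space_measure_of_conv)

lemma sets_pred: "sets \<P> = sigma_sets ({0..T} \<times> space M) gens"
  unfolding predictable_algebra_def using gens_sub by (simp add: sets_measure_of)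

lemma pred_gen0: "B \<in> sets (F 0) \<Longrightarrow> {0} \<times> B \<in> sets \<P>"
  unfolding sets_pred by (rule sigma_sets.Basic) auto

lemma pred_gen: "0 \<le> s \<Longrightarrow> t \<le> T \<Longrightarrow> B \<in> sets (F s) \<Longrightarrow> {s<..t} \<times> B \<in> sets \<P>"
proof (cases "s < t")
  case True
  assume "0 \<le> s" "t \<le> T" "B \<in> sets (F s)"
  with True show ?thesis unfolding sets_pred by (intro sigma_sets.Basic) auto
qed simp

lemma gensI0: "B \<in> sets (F 0) \<Longrightarrow> {0} \<times> B \<in> gens"
  and gensI: "0 \<le> s \<Longrightarrow> s < t \<Longrightarrow> t \<le> T \<Longrightarrow> B \<in> sets (F s) \<Longrightarrow> {s<..t} \<times> B \<in> gens"
  by blast+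

text \<open>The intersection of two slabs starts at the later of the two left ends, and at that time
  both events are known. Stability is what the inductions over predictable sets in the compensation
  formula start from.\<close>

lemma Int_stable_gens: "Int_stable gens"
proof (rule Int_stableI)
  have 0: "{} \<in> gens" using gensI0[of "{}"] by simp
  fix A B assume A: "A \<in> gens" and B: "B \<in> gens"
  from A consider A' where "A = {0} \<times> A'" "A' \<in> sets (F 0)" |
    s t A' where "A = {s<..t} \<times> A'" "0 \<le> s" "s < t" "t \<le> T" "A' \<in> sets (F s)" by blast
  then show "A \<inter> B \<in> gens"
  proof cases
    case A: 1
    from B consider B' where "B = {0} \<times> B'" "B' \<in> sets (F 0)" |
      s t B' where "B = {s<..t} \<times> B'" "0 \<le> s" "s < t" "t \<le> T" "B' \<in> sets (F s)" by blast
    then show ?thesis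
    proof cases
      case 1
      then have "A \<inter> B = {0} \<times> (A' \<inter> B')" using A by auto
      then show ?thesis using A 1 gensI0[of "A' \<inter> B'"] by simp
    next
      case 2
      then have "A \<inter> B = {}" using A by auto
      with 0 show ?thesis by simp
    qed
  next
    case A: 2
    from B consider B' where "B = {0} \<times> B'" "B' \<in> sets (F 0)" |
      s' t' B' where "B = {s'<..t'} \<times> B'" "0 \<le> s'" "s' < t'" "t' \<le> T" "B' \<in> sets (F s')" by blast
    then show ?thesis
    proof cases
      case 1
      then have "A \<inter> B = {}" using A by auto
      with 0 show ?thesis by simp
    next
      case 2
      have eq: "A \<inter> B = {max s s'<..min t t'} \<times> (A' \<inter> B')" using A 2 by auto
      have BB: "A' \<inter> B' \<in> sets (F (max s s'))"
        using A 2 F_mono[of s "max s s'" A'] F_mono[of s' "max s s'" B'] by auto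
      show ?thesis
      proof (cases "max s s' < min t t'")
        case True
        show ?thesis unfolding eq by (rule gensI) (use A 2 True BB in auto)
      next
        case False
        then have "A \<inter> B = {}" using eq by auto
        with 0 show ?thesis by simp
      qed
    qed
  qed
qed

text \<open>Predictable sets are progressive: a slab that starts before \<open>t\<close> involves
  only an event known at time \<open>t\<close>, and a later slab misses the interval up to
  \<open>t\<close>. This is the source of adaptedness for the relaxed control induced by a
  predictable process.\<close>

lemma pred_progressive:
  assumes t: "t \<in> {0..T}" and A: "A \<in> sets \<P>"
  shows "A \<inter> ({0..t} \<times> space M) \<in> sets (\<tau> \<Otimes>\<^sub>M F t)"
proof -
  have full: "{0..t} \<times> space M \<in> sets (\<tau> \<Otimes>\<^sub>M F t)"
    using t sets.top[of "F t"] by (auto simp: space_F intro!: pair_measureI time_meas)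
  show ?thesis
    using A unfolding sets_pred
  proof (induction rule: sigma_sets.induct)
    case (Basic A)
    then consider B where "A = {0} \<times> B" "B \<in> sets (F 0)" |
      s r B where "A = {s<..r} \<times> B" "0 \<le> s" "s < r" "r \<le> T" "B \<in> sets (F s)"
      by auto
    then show ?case
    proof cases
      case 1
      then have "A \<inter> ({0..t} \<times> space M) = {0} \<times> B"
        using t sets.sets_into_space[OF 1(2)] space_F[of 0] T_pos by auto
      with 1 t show ?thesis using F_mono[of 0 t B] by (auto intro!: pair_measureI time_meas)
    next
      case 2
      show ?thesis
      proof (cases "s < t")
        case True
        then have "A \<inter> ({0..t} \<times> space M) = {s<..min r t} \<times> B"
          using 2 sets.sets_into_space[OF 2(5)] space_F[of s] by auto
        then show ?thesis using 2 True t F_mono[of s t B] by (auto intro!: pair_measureI time_meas)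
      next
        case False
        then have "A \<inter> ({0..t} \<times> space M) = {}" using 2 by auto
        then show ?thesis by simp
      qed
    qed
  next
    case (Compl A)
    have "({0..T} \<times> space M - A) \<inter> ({0..t} \<times> space M) = ({0..t} \<times> space M) - A \<inter> ({0..t} \<times> space M)"
      using t by auto
    then show ?case using Compl full by auto
  next
    case (Union A)
    have "(\<Union>(range A)) \<inter> ({0..t} \<times> space M) = (\<Union>i. A i \<inter> ({0..t} \<times> space M))" by auto
    then show ?case using Union by (simp only:) (intro sets.countable_UN, auto)
  qed simp
qed

lemma pred_sets_pair: "A \<in> sets \<P> \<Longrightarrow> A \<in> sets (\<tau> \<Otimes>\<^sub>M M)"
proof -
  assume A: "A \<in> sets \<P>"
  have "A \<inter> ({0..T} \<times> space M) \<in> sets (\<tau> \<Otimes>\<^sub>M F T)" using T_pos by (intro pred_progressive A) auto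
  moreover have "A \<inter> ({0..T} \<times> space M) = A" using sets.sets_into_space[OF A] by (auto simp: space_pred)
  moreover have "sets (\<tau> \<Otimes>\<^sub>M F T) \<subseteq> sets (\<tau> \<Otimes>\<^sub>M M)"
  proof -
    have "(\<lambda>z. z) \<in> \<tau> \<Otimes>\<^sub>M M \<rightarrow>\<^sub>M \<tau> \<Otimes>\<^sub>M F T"
      using measurable_Pair[OF measurable_fst measurable_F[OF _ measurable_ident_sets[OF refl], THEN measurable_compose[OF measurable_snd]], of T \<tau>] T_pos
      by simp
    note id = this
    show ?thesis
    proof
      fix A assume A: "A \<in> sets (\<tau> \<Otimes>\<^sub>M F T)"
      then have "A \<subseteq> space (\<tau> \<Otimes>\<^sub>M M)"
        using sets.sets_into_space[OF A] space_F[of T] T_pos by (simp add: space_pair_measure)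
      then show "A \<in> sets (\<tau> \<Otimes>\<^sub>M M)" using measurable_sets[OF id A] by (simp add: Int_absorb2)
    qed
  qed
  ultimately show ?thesis by auto
qed

lemma id_pred: "(\<lambda>z. z) \<in> \<tau> \<Otimes>\<^sub>M M \<rightarrow>\<^sub>M \<P>"
proof (rule measurableI)
  fix A assume "A \<in> sets \<P>"
  from pred_sets_pair[OF this] show "(\<lambda>z. z) -` A \<inter> space (\<tau> \<Otimes>\<^sub>M M) \<in> sets (\<tau> \<Otimes>\<^sub>M M)" by auto
qed (auto simp: space_pred space_pair_measure)

lemma pred_measurable_pair: "f \<in> \<P> \<rightarrow>\<^sub>M N \<Longrightarrow> f \<in> \<tau> \<Otimes>\<^sub>M M \<rightarrow>\<^sub>M N"
  by (rule measurable_compose[OF id_pred])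

lemma pred_section: "\<omega> \<in> space M \<Longrightarrow> (\<lambda>s. (s, \<omega>)) \<in> \<tau> \<rightarrow>\<^sub>M \<P>"
  using measurable_compose[OF measurable_Pair2' id_pred] by simp

lemma fst_pred_borel: "fst \<in> \<P> \<rightarrow>\<^sub>M borel"
proof (rule borel_measurableI_le)
  fix a :: real
  have "{z \<in> space \<P>. fst z \<le> a} = (if a < 0 then {} else ({0} \<times> space M) \<union> ({0<..min a T} \<times> space M))"
    using T_pos by (auto simp: space_pred)
  moreover have "space M \<in> sets (F 0)" using space_F[of 0] T_pos sets.top[of "F 0"] by simp
  ultimately show "{z \<in> space \<P>. fst z \<le> a} \<in> sets \<P>"
    using pred_gen0[of "space M"] pred_gen[of 0 "min a T" "space M"] by auto
qed

lemma fst_pred: "fst \<in> \<P> \<rightarrow>\<^sub>M \<tau>"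
  using fst_pred_borel by (intro measurable_restrict_space2) (auto simp: space_pred)

text \<open>Convergence in a discrete space means eventual equality, so a left limit is the value on
  a whole left neighbourhood. Left limits are handled in this form throughout.\<close>

lemma path_eventually_left:
  assumes X: "state_process G M F X" and \<omega>: "\<omega> \<in> space M" and s: "0 < s" "s \<le> T"
  shows "eventually (\<lambda>r. X r \<omega> = left_lim (\<lambda>r. X r \<omega>) s) (at_left s)"
proof -
  have "\<forall>t\<in>{0<..T}. \<exists>l. ((\<lambda>r. X r \<omega>) \<longlongrightarrow> l) (at_left t)"
    using X \<omega> unfolding state_process_def by blast
  with s obtain l where l: "((\<lambda>r. X r \<omega>) \<longlongrightarrow> l) (at_left s)"
    by (meson greaterThanAtMost_iff)
  then have "Lim (at_left s) (\<lambda>r. X r \<omega>) = l" by (intro tendsto_Lim) auto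
  with l s have "((\<lambda>r. X r \<omega>) \<longlongrightarrow> left_lim (\<lambda>r. X r \<omega>) s) (at_left s)" by (simp add: left_lim_def)
  then show ?thesis by (simp add: tendsto_discrete)
qed

lemma state_process_states: "state_process G M F X \<Longrightarrow> \<omega> \<in> space M \<Longrightarrow> t \<in> {0..T} \<Longrightarrow> X t \<omega> \<in> states G"
  using space_F[of t] unfolding state_process_def by (auto dest!: bspec[of _ _ t] measurable_space)

lemma left_state_states:
  assumes X: "state_process G M F X" and \<omega>: "\<omega> \<in> space M" and s: "s \<in> {0..T}"
  shows "left_state X s \<omega> \<in> states G"
proof -
  consider (2) "s = 0" | (3) "0 < s" "s \<le> T" using s by fastforce
  then show ?thesis
  proof cases
    case 2 then show ?thesis using state_process_states[OF X \<omega>, of 0] T_pos by (auto simp: left_lim_def)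
  next
    case 3
    have "eventually (\<lambda>r. r \<in> {0<..<s}) (at_left s)" using 3 by (intro eventually_at_left_real)
    with path_eventually_left[OF X \<omega> 3] have "eventually (\<lambda>r. X r \<omega> = left_lim (\<lambda>r. X r \<omega>) s \<and> r \<in> {0<..<s}) (at_left s)"
      by eventually_elim auto
    then obtain r where "X r \<omega> = left_lim (\<lambda>r. X r \<omega>) s" "r \<in> {0<..<s}"
      using eventually_happens[of _ "at_left s"] by force
    with state_process_states[OF X \<omega>, of r] 3 show ?thesis by simp
  qed
qed

text \<open>The process is sampled at a grid point before the current time. This gives predictable
  step processes, which by \<open>path_eventually_left\<close> do not merely converge to the left
  limit but are eventually equal to it; eventual equality is a countable union of countable
  intersections.\<close>

lemma left_state_predictable:
  assumes X: "state_process G M F X"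
  shows "(\<lambda>(s, \<omega>). left_state X s \<omega>) \<in> \<P> \<rightarrow>\<^sub>M state_space"
proof -
  \<comment> \<open>The last point strictly before \<open>s\<close> of the grid with mesh
    \<open>1 / Suc n\<close>. Strictness makes the sampled value known at the start of the slab that
    contains \<open>s\<close>.\<close>
  define p where "p n s = (if s \<le> 0 then 0 else (of_int \<lceil>real (Suc n) * s\<rceil> - 1) / real (Suc n))" for n s
  define Y where "Y n z = X (p n (fst z)) (snd z)" for n z
  have ad: "{\<omega>\<in>space M. X t \<omega> = x} \<in> sets (F t)" if "t \<in> {0..T}" "x \<in> states G" for t x
    using X that space_F[OF that(1)] unfolding state_process_def
    by (auto dest!: bspec[of _ _ t] measurable_sets[of _ _ _ "{x}"] simp: vimage_def Int_def conj_commute)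
  have Ym: "{z\<in>space \<P>. Y n z = x} \<in> sets \<P>" if x: "x \<in> states G" for n x
  proof -
    let ?n = "real (Suc n)"
    let ?J = "{k::nat. real k / ?n < T}"
    have "{z\<in>space \<P>. Y n z = x} = ({0} \<times> {\<omega>\<in>space M. X 0 \<omega> = x}) \<union>
        (\<Union>k\<in>?J. {real k / ?n<..min (real (Suc k) / ?n) T} \<times> {\<omega>\<in>space M. X (real k / ?n) \<omega> = x})"
      (is "?L = ?R")
    proof
      show "?L \<subseteq> ?R"
      proof
        fix z assume z: "z \<in> ?L"
        obtain s \<omega> where zs: "z = (s, \<omega>)" by (cases z)
        show "z \<in> ?R"
        proof (cases "s = 0")
          case True
          with z zs show ?thesis by (auto simp: Y_def p_def space_pred)
        next
          case False
          then have s: "0 < s" "s \<le> T" "\<omega> \<in> space M" using z zs by (auto simp: space_pred)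
          define k where "k = nat (\<lceil>?n * s\<rceil> - 1)"
          have "0 < ?n * s" using s by simp
          then have "1 \<le> \<lceil>?n * s\<rceil>" by linarith
          then have k: "real k = of_int \<lceil>?n * s\<rceil> - 1" by (simp add: k_def)
          then have "real k < ?n * s" "?n * s \<le> real (Suc k)" by linarith+
          then have "real k / ?n < s" "s \<le> real (Suc k) / ?n" by (auto simp: field_simps)
          moreover have "p n s = real k / ?n" using s(1) k by (simp add: p_def del: of_nat_Suc)
          then have "X (real k / ?n) \<omega> = x" using z zs by (simp add: Y_def)
          ultimately have "z \<in> {real k / ?n<..min (real (Suc k) / ?n) T} \<times> {\<omega>\<in>space M. X (real k / ?n) \<omega> = x}"
            and "real k / ?n < T"
            using s zs by (simp_all del: of_nat_Suc)
          then show ?thesis by blast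
        qed
      qed
      show "?R \<subseteq> ?L"
      proof
        fix z assume z: "z \<in> ?R"
        obtain s \<omega> where zs: "z = (s, \<omega>)" by (cases z)
        from z zs consider "s = 0" "\<omega> \<in> space M" "X 0 \<omega> = x" |
          k where "real k / ?n < s" "s \<le> real (Suc k) / ?n" "s \<le> T" "\<omega> \<in> space M" "X (real k / ?n) \<omega> = x"
          by auto
        then show "z \<in> ?L"
        proof cases
          case 1 then show ?thesis using zs T_pos by (auto simp: space_pred Y_def p_def)
        next
          case 2
          have s: "0 < s" using 2(1) by (meson divide_nonneg_nonneg le_less_trans of_nat_0_le_iff)
          have "real k < ?n * s" "?n * s \<le> real (Suc k)" using 2 by (auto simp: field_simps)
          then have "\<lceil>?n * s\<rceil> = int k + 1" by (intro ceiling_unique) auto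
          then have "p n s = real k / ?n" using s by (simp add: p_def del: of_nat_Suc)
          then show ?thesis using 2 s zs by (auto simp: space_pred Y_def)
        qed
      qed
    qed
    also have "\<dots> \<in> sets \<P>"
    proof (intro sets.Un pred_gen0 sets.countable_UN'')
      show "{\<omega>\<in>space M. X 0 \<omega> = x} \<in> sets (F 0)" using T_pos x by (intro ad) auto
      show "{real k / ?n<..min (real (Suc k) / ?n) T} \<times> {\<omega>\<in>space M. X (real k / ?n) \<omega> = x} \<in> sets \<P>"
        if "k \<in> ?J" for k
        using that x by (intro pred_gen ad) (simp_all del: of_nat_Suc)
    qed simp
    finally show ?thesis .
  qed
  have conv: "eventually (\<lambda>n. Y n z = left_state X (fst z) (snd z)) sequentially"
    if z: "z \<in> space \<P>" for z
  proof (cases "fst z = 0")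
    case True then show ?thesis using z by (simp add: Y_def p_def left_lim_def)
  next
    case False
    then have s: "0 < fst z" "fst z \<le> T" "snd z \<in> space M" using z by (auto simp: space_pred)
    have lt: "p n (fst z) < fst z \<and> fst z - 1 / real (Suc n) \<le> p n (fst z)" for n
    proof -
      define m where "m = real (Suc n)"
      have m: "0 < m" by (simp add: m_def)
      have "of_int \<lceil>m * fst z\<rceil> - 1 < m * fst z" "m * fst z - 1 \<le> of_int \<lceil>m * fst z\<rceil> - 1" by linarith+
      then have "(of_int \<lceil>m * fst z\<rceil> - 1) / m < fst z" "(m * fst z - 1) / m \<le> (of_int \<lceil>m * fst z\<rceil> - 1) / m"
        using m by (auto simp: pos_divide_less_eq mult.commute intro!: divide_right_mono)
      moreover have "(m * fst z - 1) / m = fst z - 1 / m" using m by (simp add: diff_divide_distrib)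
      ultimately show ?thesis using s unfolding p_def m_def[symmetric] by simp
    qed
    have "(\<lambda>n. p n (fst z)) \<longlonglongrightarrow> fst z"
    proof (rule tendsto_sandwich[OF _ _ _ tendsto_const])
      have "(\<lambda>n. fst z - inverse (real (Suc n))) \<longlonglongrightarrow> fst z - 0"
        by (intro tendsto_diff tendsto_const LIMSEQ_inverse_real_of_nat)
      then show "(\<lambda>n. fst z - 1 / real (Suc n)) \<longlonglongrightarrow> fst z" by (simp add: inverse_eq_divide)
    qed (use lt in \<open>auto intro!: always_eventually less_imp_le\<close>)
    then have "filterlim (\<lambda>n. p n (fst z)) (at_left (fst z)) sequentially"
      using lt by (auto simp: filterlim_at intro!: always_eventually) (metis less_irrefl)
    from eventually_compose_filterlim[OF path_eventually_left[OF X s(3) s(1,2)] this]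
    show ?thesis using s by (simp add: Y_def)
  qed
  have "(\<lambda>z. left_state X (fst z) (snd z)) -` {x} \<inter> space \<P> \<in> sets \<P>" if x: "x \<in> states G" for x
  proof -
    have "(\<lambda>z. left_state X (fst z) (snd z)) -` {x} \<inter> space \<P> = (\<Union>N. \<Inter>n\<in>{N..}. {z\<in>space \<P>. Y n z = x})"
      (is "?L = ?R")
    proof (rule set_eqI)
      fix z
      show "z \<in> ?L \<longleftrightarrow> z \<in> ?R"
      proof (cases "z \<in> space \<P>")
        case True
        with conv[of z] obtain N where N: "\<And>n. n \<ge> N \<Longrightarrow> Y n z = left_state X (fst z) (snd z)"
          by (auto simp: eventually_sequentially)
        have "left_state X (fst z) (snd z) = x \<longleftrightarrow> (\<exists>N. \<forall>n\<ge>N. Y n z = x)"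
        proof
          assume "\<exists>N. \<forall>n\<ge>N. Y n z = x"
          then obtain N' where "\<forall>n\<ge>N'. Y n z = x" by blast
          with N[of "max N N'"] show "left_state X (fst z) (snd z) = x" by auto
        qed (use N in auto)
        with True show ?thesis by auto
      qed auto
    qed
    also have "\<dots> \<in> sets \<P>" using Ym x by (intro sets.countable_UN sets.countable_INT') auto
    finally show ?thesis .
  qed
  then have "(\<lambda>z. left_state X (fst z) (snd z)) \<in> \<P> \<rightarrow>\<^sub>M state_space"
    using left_state_states[OF X] by (subst measurable_count_space_eq_countable) (auto simp: space_pred states_def)
  then show ?thesis by (simp add: case_prod_beta')
qed

text \<open>The same approximation from the right. It looks ahead in time, hence the claim is joint
  measurability and not predictability.\<close>

lemma state_process_measurable_pair:
  assumes X: "state_process G M F X"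
  shows "(\<lambda>(s, \<omega>). X s \<omega>) \<in> \<tau> \<Otimes>\<^sub>M M \<rightarrow>\<^sub>M state_space"
proof -
  \<comment> \<open>The first grid point strictly after \<open>s\<close>, cut off at the horizon. At
    \<open>s = T\<close> the cut-off returns \<open>T\<close> itself, so there the approximation is
    exact and no right limit is involved.\<close>
  define p where "p n s = min T ((of_int \<lfloor>real (Suc n) * s\<rfloor> + 1) / real (Suc n))" for n s
  define Y where "Y n z = X (p n (fst z)) (snd z)" for n z
  have ad: "{\<omega>\<in>space M. X t \<omega> = x} \<in> sets M" if "t \<in> {0..T}" "x \<in> states G" for t x
    using X that space_F[OF that(1)] unfolding state_process_def
    by (auto dest!: bspec[of _ _ t] measurable_sets[of _ _ _ "{x}"] sets_F[OF that(1)] simp: vimage_def Int_def conj_commute)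
  let ?S = "space (\<tau> \<Otimes>\<^sub>M M)"
  have Ym: "{z\<in>?S. Y n z = x} \<in> sets (\<tau> \<Otimes>\<^sub>M M)" if x: "x \<in> states G" for n x
  proof -
    let ?n = "real (Suc n)"
    have "{z\<in>?S. Y n z = x} =
        (\<Union>k::nat. ({real k / ?n..<real (Suc k) / ?n} \<inter> {0..T}) \<times> {\<omega>\<in>space M. X (min T (real (Suc k) / ?n)) \<omega> = x})"
      (is "?L = ?R")
    proof
      show "?L \<subseteq> ?R"
      proof
        fix z assume z: "z \<in> ?L"
        obtain s \<omega> where zs: "z = (s, \<omega>)" by (cases z)
        then have s: "0 \<le> s" "s \<le> T" "\<omega> \<in> space M" using z by (auto simp: space_pair_measure space_time)
        define k where "k = nat \<lfloor>?n * s\<rfloor>"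
        have k: "real k = of_int \<lfloor>?n * s\<rfloor>" using s by (simp add: k_def)
        then have "real k \<le> ?n * s" "?n * s < real (Suc k)" by linarith+
        then have "real k / ?n \<le> s" "s < real (Suc k) / ?n" by (auto simp: field_simps)
        moreover have "p n s = min T (real (Suc k) / ?n)" unfolding p_def k[symmetric] by (simp add: add.commute)
        then have "X (min T (real (Suc k) / ?n)) \<omega> = x" using z zs by (simp add: Y_def)
        ultimately have "z \<in> ({real k / ?n..<real (Suc k) / ?n} \<inter> {0..T}) \<times> {\<omega>\<in>space M. X (min T (real (Suc k) / ?n)) \<omega> = x}"
          using s zs by (simp del: of_nat_Suc)
        then show "z \<in> ?R" by blast
      qed
      show "?R \<subseteq> ?L"
      proof
        fix z assume z: "z \<in> ?R"
        obtain s \<omega> where zs: "z = (s, \<omega>)" by (cases z)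
        from z zs obtain k where k: "real k / ?n \<le> s" "s < real (Suc k) / ?n" "s \<le> T" "0 \<le> s" "\<omega> \<in> space M"
          "X (min T (real (Suc k) / ?n)) \<omega> = x"
          by auto
        have "real k \<le> ?n * s" "?n * s < real (Suc k)" using k by (auto simp: field_simps)
        then have "\<lfloor>?n * s\<rfloor> = int k" by (intro floor_unique) auto
        then have "p n s = min T (real (Suc k) / ?n)" by (simp add: p_def add.commute)
        then show "z \<in> ?L" using k zs by (auto simp: space_pair_measure space_time Y_def)
      qed
    qed
    also have "\<dots> \<in> sets (\<tau> \<Otimes>\<^sub>M M)"
    proof (intro sets.countable_UN'' pair_measureI time_meas)
      show "{\<omega>\<in>space M. X (min T (real (Suc k) / ?n)) \<omega> = x} \<in> sets M" for k
        using T_pos x by (intro ad) (simp_all del: of_nat_Suc)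
    qed auto
    finally show ?thesis .
  qed
  have conv: "eventually (\<lambda>n. Y n z = X (fst z) (snd z)) sequentially" if z: "z \<in> ?S" for z
  proof (cases "fst z < T")
    case False
    then have "fst z = T" using z by (auto simp: space_pair_measure space_time)
    moreover have "p n T = T" for n
    proof -
      have "real (Suc n) * T < of_int \<lfloor>real (Suc n) * T\<rfloor> + 1" by linarith
      then have "T < (of_int \<lfloor>real (Suc n) * T\<rfloor> + 1) / real (Suc n)" by (simp add: field_simps)
      then show ?thesis by (simp add: p_def)
    qed
    ultimately show ?thesis by (simp add: Y_def)
  next
    case True
    then have s: "0 \<le> fst z" "fst z < T" "snd z \<in> space M" using z by (auto simp: space_pair_measure space_time)
    have lt: "fst z < p n (fst z) \<and> p n (fst z) \<le> fst z + 1 / real (Suc n)" for n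
    proof -
      define m where "m = real (Suc n)"
      have m: "0 < m" by (simp add: m_def)
      have "m * fst z < of_int \<lfloor>m * fst z\<rfloor> + 1" "of_int \<lfloor>m * fst z\<rfloor> + 1 \<le> m * fst z + 1" by linarith+
      then have "fst z < (of_int \<lfloor>m * fst z\<rfloor> + 1) / m" "(of_int \<lfloor>m * fst z\<rfloor> + 1) / m \<le> (m * fst z + 1) / m"
        using m by (auto simp: pos_less_divide_eq mult.commute intro!: divide_right_mono)
      moreover have "(m * fst z + 1) / m = fst z + 1 / m" using m by (simp add: add_divide_distrib)
      ultimately show ?thesis using s unfolding p_def m_def[symmetric] by simp
    qed
    have "(\<lambda>n. p n (fst z)) \<longlonglongrightarrow> fst z"
    proof (rule tendsto_sandwich[OF _ _ tendsto_const])
      have "(\<lambda>n. fst z + inverse (real (Suc n))) \<longlonglongrightarrow> fst z + 0"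
        by (intro tendsto_add tendsto_const LIMSEQ_inverse_real_of_nat)
      then show "(\<lambda>n. fst z + 1 / real (Suc n)) \<longlonglongrightarrow> fst z" by (simp add: inverse_eq_divide)
    qed (use lt in \<open>auto intro!: always_eventually less_imp_le\<close>)
    then have "filterlim (\<lambda>n. p n (fst z)) (at_right (fst z)) sequentially"
      using lt by (auto simp: filterlim_at intro!: always_eventually) (metis less_irrefl)
    moreover have "eventually (\<lambda>r. X r (snd z) = X (fst z) (snd z)) (at_right (fst z))"
      using X s by (auto simp: state_process_def tendsto_discrete)
    ultimately show ?thesis by (auto simp: Y_def dest: eventually_compose_filterlim)
  qed
  have "(\<lambda>z. X (fst z) (snd z)) -` {x} \<inter> ?S \<in> sets (\<tau> \<Otimes>\<^sub>M M)" if x: "x \<in> states G" for x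
  proof -
    have "(\<lambda>z. X (fst z) (snd z)) -` {x} \<inter> ?S = (\<Union>N. \<Inter>n\<in>{N..}. {z\<in>?S. Y n z = x})"
      (is "?L = ?R")
    proof (rule set_eqI)
      fix z
      show "z \<in> ?L \<longleftrightarrow> z \<in> ?R"
      proof (cases "z \<in> ?S")
        case True
        with conv[of z] obtain N where N: "\<And>n. n \<ge> N \<Longrightarrow> Y n z = X (fst z) (snd z)"
          by (auto simp: eventually_sequentially)
        have "X (fst z) (snd z) = x \<longleftrightarrow> (\<exists>N. \<forall>n\<ge>N. Y n z = x)"
        proof
          assume "\<exists>N. \<forall>n\<ge>N. Y n z = x"
          then obtain N' where "\<forall>n\<ge>N'. Y n z = x" by blast
          with N[of "max N N'"] show "X (fst z) (snd z) = x" by auto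
        qed (use N in auto)
        with True show ?thesis by auto
      qed auto
    qed
    also have "\<dots> \<in> sets (\<tau> \<Otimes>\<^sub>M M)" using Ym x by (intro sets.countable_UN sets.countable_INT') auto
    finally show ?thesis .
  qed
  then have "(\<lambda>z. X (fst z) (snd z)) \<in> \<tau> \<Otimes>\<^sub>M M \<rightarrow>\<^sub>M state_space"
    using state_process_states[OF X] by (subst measurable_count_space_eq_countable) (auto simp: space_pair_measure space_time states_def)
  then show ?thesis by (simp add: case_prod_beta')
qed

end

section \<open>Atoms of Poisson random measures\<close>

context game_basis
begin

lemma poisson_variableI:
  assumes N: "poisson_random_measure G M F \<N>" and B: "B \<in> sets (mark_space G)"
  shows "poisson_variable M (\<lambda>\<omega>. emeasure (\<N> \<omega>) B) (measure (mark_space G) B)"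
proof
  show "(\<lambda>\<omega>. emeasure (\<N> \<omega>) B) \<in> borel_measurable M"
    using N B unfolding poisson_random_measure_def adapted_random_measure_def by blast
  show "measure M {\<omega> \<in> space M. emeasure (\<N> \<omega>) B = of_nat k} =
      exp (- measure (mark_space G) B) * measure (mark_space G) B ^ k / fact k" for k
    using N B unfolding poisson_random_measure_def by blast
qed simp

lemma sets_noise: "poisson_random_measure G M F \<N> \<Longrightarrow> \<omega> \<in> space M \<Longrightarrow> sets (\<N> \<omega>) = sets (mark_space G)"
  unfolding poisson_random_measure_def adapted_random_measure_def by blast

lemma space_noise: "poisson_random_measure G M F \<N> \<Longrightarrow> \<omega> \<in> space M \<Longrightarrow> space (\<N> \<omega>) = {0..T} \<times> marks G"
  using sets_eq_imp_space_eq[OF sets_noise] space_mark by simp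

text \<open>Union bound at resolution \<open>n\<close>: each of the \<open>n + 1\<close> slabs is
  bad with probability of order \<open>1 / n\<close> squared, both for two atoms of one player, by
  \<open>prob_ge_2\<close>, and for atoms of two different players, by independence and
  \<open>prob_ge_1\<close>. The sum tends to 0 as the slabs shrink.\<close>

lemma AE_separated:
  fixes I :: "nat set"
  assumes I: "finite I" and prm: "\<And>i. i \<in> I \<Longrightarrow> poisson_random_measure G M F (\<N> i)"
    and ind: "indep_sets (\<lambda>i. noise_sigma G M (\<N> i)) I"
  shows "AE \<omega> in M. \<exists>n::nat. \<forall>k\<le>n. \<forall>i\<in>I.
     let B = (\<lambda>k. {real k * (T / real (Suc n))<..real (Suc k) * (T / real (Suc n))} \<times> marks G) in
     emeasure (\<N> i \<omega>) (B k) \<le> 1 \<and> (\<forall>j\<in>I. i \<noteq> j \<longrightarrow> \<not> (1 \<le> emeasure (\<N> i \<omega>) (B k) \<and> 1 \<le> emeasure (\<N> j \<omega>) (B k)))"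
proof -
  define B where "B n k = {real k * (T / real (Suc n))<..real (Suc k) * (T / real (Suc n))} \<times> marks G" for n k :: nat
  define l where "l n = T / real (Suc n) * \<nu>" for n :: nat
  have l0: "0 \<le> l n" for n using T_pos by (simp add: l_def)
  have B: "B n k \<in> sets (mark_space G)" "measure (mark_space G) (B n k) = l n" if "k \<le> n" for n k
  proof -
    have "real (Suc k) * (T / real (Suc n)) \<le> real (Suc n) * (T / real (Suc n))"
      using that T_pos by (intro mult_right_mono) auto
    also have "\<dots> = T" by simp
    finally have "real (Suc k) * (T / real (Suc n)) \<le> T" .
    moreover have "real k * (T / real (Suc n)) \<le> real (Suc k) * (T / real (Suc n))"
      using T_pos by (intro mult_right_mono) auto
    moreover have "real (Suc k) * (T / real (Suc n)) - real k * (T / real (Suc n)) = T / real (Suc n)"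
      by (simp only: of_nat_Suc left_diff_distrib[symmetric]) simp
    moreover have "0 \<le> real k * (T / real (Suc n))" using T_pos by simp
    ultimately show "B n k \<in> sets (mark_space G)" "measure (mark_space G) (B n k) = l n"
      unfolding B_def l_def using measure_slab by auto
  qed
  have pv: "poisson_variable M (\<lambda>\<omega>. emeasure (\<N> i \<omega>) (B n k)) (l n)" if "i \<in> I" "k \<le> n" for i n k
    using poisson_variableI[OF prm[OF that(1)] B(1)[OF that(2)]] B(2)[OF that(2)] by simp
  define b1 where "b1 n k i = {\<omega>\<in>space M. 1 < emeasure (\<N> i \<omega>) (B n k)}" for n k i
  define b2 where "b2 n k q = {\<omega>\<in>space M. 1 \<le> emeasure (\<N> (fst q) \<omega>) (B n k)} \<inter> {\<omega>\<in>space M. 1 \<le> emeasure (\<N> (snd q) \<omega>) (B n k)}" for n k and q :: "nat \<times> nat"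
  define Q where "Q = {q\<in>I \<times> I. fst q \<noteq> snd q}"
  have finQ: "finite Q" using I by (auto simp: Q_def)
  define bad where "bad n = (\<Union>k\<in>{..n}. (\<Union>i\<in>I. b1 n k i) \<union> (\<Union>q\<in>Q. b2 n k q))" for n
  have mf: "(\<lambda>\<omega>. emeasure (\<N> i \<omega>) (B n k)) \<in> borel_measurable M" if "i \<in> I" "k \<le> n" for i n k
    using poisson_variable.meas[OF pv[OF that]] .
  have b1s: "b1 n k i \<in> sets M" "prob (b1 n k i) \<le> (l n)\<^sup>2" if "i \<in> I" "k \<le> n" for i n k
  proof -
    note [measurable] = mf[OF that]
    show "b1 n k i \<in> sets M" unfolding b1_def by measurable
    show "prob (b1 n k i) \<le> (l n)\<^sup>2"
      using poisson_variable.prob_ge_2[OF pv[OF that]] unfolding b1_def .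
  qed
  have b2s: "b2 n k q \<in> sets M" "prob (b2 n k q) \<le> (l n)\<^sup>2" if "q \<in> Q" "k \<le> n" for q n k
  proof -
    have q: "fst q \<in> I" "snd q \<in> I" "fst q \<noteq> snd q" using that(1) by (auto simp: Q_def)
    define E where "E i = {\<omega>\<in>space M. 1 \<le> emeasure (\<N> i \<omega>) (B n k)}" for i
    have E: "E i \<in> sets M" "prob (E i) \<le> l n" if "i \<in> I" for i
    proof -
      note [measurable] = mf[OF that \<open>k \<le> n\<close>]
      show "E i \<in> sets M" unfolding E_def by measurable
      show "prob (E i) \<le> l n"
        using poisson_variable.prob_ge_1[OF pv[OF that \<open>k \<le> n\<close>]] unfolding E_def .
    qed
    show "b2 n k q \<in> sets M" using E q unfolding b2_def E_def by auto
    have En: "E i \<in> noise_sigma G M (\<N> i)" for i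
    proof -
      have "E i = (\<lambda>\<omega>. emeasure (\<N> i \<omega>) (B n k)) -` {1..} \<inter> space M" by (auto simp: E_def)
      then show ?thesis unfolding noise_sigma_def using B(1)[OF that(2)]
        by (intro sigma_sets.Basic) (auto intro!: exI[of _ "B n k"] exI[of _ "{1..}"])
    qed
    have "prob (\<Inter>j\<in>{fst q, snd q}. E j) = (\<Prod>j\<in>{fst q, snd q}. prob (E j))"
      by (rule indep_setsD[OF ind]) (use q En in auto)
    then have "prob (b2 n k q) = prob (E (fst q)) * prob (E (snd q))"
      using q by (simp add: b2_def E_def)
    also have "\<dots> \<le> l n * l n" using E q by (intro mult_mono) (auto intro: l0)
    finally show "prob (b2 n k q) \<le> (l n)\<^sup>2" by (simp add: power2_eq_square)
  qed
  have bads: "bad n \<in> sets M" for n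
    unfolding bad_def using I finQ b1s b2s by (intro sets.finite_UN sets.Un) auto
  \<comment> \<open>One summand for each player and one for each ordered pair of different players.
    With \<open>Suc n\<close> slabs of mass \<open>T * \<nu> / Suc n\<close> one factor
    \<open>Suc n\<close> survives in the denominator.\<close>
  define c where "c = real (card I + card Q) * (T * \<nu>)\<^sup>2"
  have badp: "prob (bad n) \<le> c * inverse (real (Suc n))" for n
  proof -
    have k: "prob ((\<Union>i\<in>I. b1 n k i) \<union> (\<Union>q\<in>Q. b2 n k q)) \<le> real (card I + card Q) * (l n)\<^sup>2" if "k \<le> n" for k
    proof -
      have "prob ((\<Union>i\<in>I. b1 n k i) \<union> (\<Union>q\<in>Q. b2 n k q)) \<le> prob (\<Union>i\<in>I. b1 n k i) + prob (\<Union>q\<in>Q. b2 n k q)"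
        using I finQ b1s b2s that by (intro measure_Un_le sets.finite_UN) auto
      also have "prob (\<Union>i\<in>I. b1 n k i) \<le> (\<Sum>i\<in>I. prob (b1 n k i))"
        using I b1s that by (intro finite_measure_subadditive_finite) auto
      also have "\<dots> \<le> (\<Sum>i\<in>I. (l n)\<^sup>2)" using b1s that by (intro sum_mono) auto
      also have "prob (\<Union>q\<in>Q. b2 n k q) \<le> (\<Sum>q\<in>Q. prob (b2 n k q))"
        using finQ b2s that by (intro finite_measure_subadditive_finite) auto
      also have "\<dots> \<le> (\<Sum>q\<in>Q. (l n)\<^sup>2)" using b2s that by (intro sum_mono) auto
      finally show ?thesis by (simp add: algebra_simps)
    qed
    have "prob (bad n) \<le> (\<Sum>k\<in>{..n}. prob ((\<Union>i\<in>I. b1 n k i) \<union> (\<Union>q\<in>Q. b2 n k q)))"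
      unfolding bad_def using I finQ b1s b2s
      by (intro finite_measure_subadditive_finite) (auto intro!: sets.finite_UN sets.Un)
    also have "\<dots> \<le> (\<Sum>k\<in>{..n}. real (card I + card Q) * (l n)\<^sup>2)" using k by (intro sum_mono) auto
    also have "\<dots> = real (Suc n) * (real (card I + card Q) * (l n)\<^sup>2)" by simp
    also have "\<dots> = c * inverse (real (Suc n))"
    proof -
      have "x * (a * (T / x * \<nu>)\<^sup>2) = a * (T * \<nu>)\<^sup>2 * inverse x" if "0 < x" for x a :: real
        using that by (simp add: power2_eq_square field_simps)
      from this[of "real (Suc n)" "real (card I + card Q)"] show ?thesis by (simp only: l_def c_def of_nat_0_less_iff zero_less_Suc)
    qed
    finally show ?thesis .
  qed
  \<comment> \<open>Being bad at every resolution is less likely than being bad at any single one,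
    hence null. So almost surely some resolution, depending on the outcome, is good.\<close>
  have "prob (\<Inter>n. bad n) \<le> c * inverse (real (Suc n))" for n
    using badp[of n] finite_measure_mono[of "\<Inter>n. bad n" "bad n"] bads by (meson INT_lower UNIV_I order_trans)
  moreover have "(\<lambda>n. c * inverse (real (Suc n))) \<longlonglongrightarrow> c * 0"
    by (intro tendsto_mult tendsto_const LIMSEQ_inverse_real_of_nat)
  ultimately have "prob (\<Inter>n. bad n) \<le> 0" by (intro LIMSEQ_le_const) auto
  then have "(\<Inter>n. bad n) \<in> null_sets M" using bads by (auto simp: null_sets_def emeasure_eq_measure measure_le_0_iff)
  then have "AE \<omega> in M. \<omega> \<notin> (\<Inter>n. bad n)" by (rule AE_not_in)
  with AE_space show ?thesis
  proof eventually_elim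
    case (elim \<omega>)
    then obtain n where n: "\<omega> \<notin> bad n" by auto
    have "emeasure (\<N> i \<omega>) (B n k) \<le> 1 \<and> (\<forall>j\<in>I. i \<noteq> j \<longrightarrow> \<not> (1 \<le> emeasure (\<N> i \<omega>) (B n k) \<and> 1 \<le> emeasure (\<N> j \<omega>) (B n k)))"
      if "k \<le> n" "i \<in> I" for k i
      using n that elim(1) by (auto simp: bad_def b1_def b2_def Q_def not_less)
    then show ?case by (intro exI[of _ n]) (simp add: B_def)
  qed
qed

text \<open>Integer values on a countable basis make the noises atomic; a good resolution from
  \<open>AE_separated\<close> makes the masses 1 and the times distinct; and the time sections at 0
  and at the horizon have mean measure 0, which keeps atoms away from both ends.\<close>

lemma AE_simple_points:
  fixes I :: "nat set"
  assumes I: "finite I" and prm: "\<And>i. i \<in> I \<Longrightarrow> poisson_random_measure G M F (\<N> i)"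
    and ind: "indep_sets (\<lambda>i. noise_sigma G M (\<N> i)) I"
  shows "AE \<omega> in M. simple_points G I (\<lambda>i. \<N> i \<omega>)"
proof -
  obtain \<B> :: "(real \<times> (real^'d)) set set" where \<B>: "countable \<B>" "topological_basis \<B>"
    using ex_countable_basis by blast
  let ?S = "{0..T} \<times> marks G"
  have BS: "B \<inter> ?S \<in> sets (mark_space G)" if "B \<in> \<B>" for B
    using open_Int_mark_space[of B] topological_basis_open[OF \<B>(2) that] by (simp add: space_mark)
  have a: "AE \<omega> in M. \<forall>i\<in>I. \<forall>B\<in>\<B>. emeasure (\<N> i \<omega>) (B \<inter> ?S) \<in> range of_nat"
    using I \<B>(1) poisson_variable.AE_nat[OF poisson_variableI[OF prm BS]]
    by (intro AE_finite_allI AE_ball_countable') auto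
  have b: "AE \<omega> in M. \<forall>i\<in>I. emeasure (\<N> i \<omega>) ?S \<in> range of_nat"
    using I poisson_variable.AE_nat[OF poisson_variableI[OF prm sets.top]] by (intro AE_finite_allI) (auto simp: space_mark)
  have c0: "AE \<omega> in M. \<forall>i\<in>I. emeasure (\<N> i \<omega>) ({0} \<times> marks G) = 0"
    using I T_pos poisson_variable.AE_eq_0[OF poisson_variableI[OF prm measure_section(1)]] measure_section(2)[of 0] by (intro AE_finite_allI) auto
  have cT: "AE \<omega> in M. \<forall>i\<in>I. emeasure (\<N> i \<omega>) ({T} \<times> marks G) = 0"
    using I T_pos poisson_variable.AE_eq_0[OF poisson_variableI[OF prm measure_section(1)]] measure_section(2)[of T] by (intro AE_finite_allI) auto
  from AE_space a b c0 cT AE_separated[OF I prm ind, simplified]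
  show ?thesis
  proof eventually_elim
    case (elim \<omega>)
    have sN: "sets (\<N> i \<omega>) = sets (mark_space G)" and spN: "space (\<N> i \<omega>) = ?S" if "i \<in> I" for i
      using sets_noise[OF prm[OF that] elim(1)] space_noise[OF prm[OF that] elim(1)] by auto
    have fin: "finite_measure (\<N> i \<omega>)" if "i \<in> I" for i
      by (rule finite_measureI) (use elim(3) that in \<open>auto simp: spN\<close>)
    have at: "finite (atoms (\<N> i \<omega>)) \<and> (\<forall>z\<in>atoms (\<N> i \<omega>). 1 \<le> measure (\<N> i \<omega>) {z}) \<and>
        emeasure (\<N> i \<omega>) (space (\<N> i \<omega>) - atoms (\<N> i \<omega>)) = 0 \<and> (\<forall>z\<in>space (\<N> i \<omega>). {z} \<in> sets (\<N> i \<omega>))" if i: "i \<in> I" for i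
    proof -
      have 1: "U \<inter> space (\<N> i \<omega>) \<in> sets (\<N> i \<omega>)" if "open U" for U
        using open_Int_mark_space[OF that] by (simp add: sN[OF i] spN[OF i] space_mark)
      have 2: "measure (\<N> i \<omega>) (B \<inter> space (\<N> i \<omega>)) \<in> \<int>" if B: "B \<in> \<B>" for B
      proof -
        obtain k where "emeasure (\<N> i \<omega>) (B \<inter> ?S) = of_nat k" using elim(2) i B by blast
        then have "measure (\<N> i \<omega>) (B \<inter> ?S) = of_nat k" by (simp add: measure_def)
        then show ?thesis by (simp add: spN[OF i])
      qed
      from integer_valued_measure_atomic[OF 1 fin[OF i] \<B> 2] show ?thesis by blast
    qed
    have sub: "atoms (\<N> i \<omega>) \<subseteq> {0<..<T} \<times> marks G" if i: "i \<in> I" for i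
    proof
      fix z assume z: "z \<in> atoms (\<N> i \<omega>)"
      have "z \<in> ?S" using z spN[OF i] by (auto simp: atoms_def)
      moreover have "fst z \<noteq> s" if "s \<in> {0, T}" for s
      proof
        assume "fst z = s"
        then have "{z} \<subseteq> {s} \<times> marks G" using \<open>z \<in> ?S\<close> by auto
        then have "emeasure (\<N> i \<omega>) {z} \<le> emeasure (\<N> i \<omega>) ({s} \<times> marks G)"
          using measure_section(1)[of s] T_pos that by (intro emeasure_mono) (auto simp: sN[OF i])
        then show False using elim(4,5) i that z by (auto simp: atoms_def)
      qed
      ultimately show "z \<in> {0<..<T} \<times> marks G" by (cases z) (auto simp: less_le)
    qed
    from elim(6) obtain n :: nat where n: "\<And>k i. k \<le> n \<Longrightarrow> i \<in> I \<Longrightarrow>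
      emeasure (\<N> i \<omega>) ({real k * (T / real (Suc n))<..real (Suc k) * (T / real (Suc n))} \<times> marks G) \<le> 1 \<and>
      (\<forall>j\<in>I. i \<noteq> j \<longrightarrow> \<not> (1 \<le> emeasure (\<N> i \<omega>) ({real k * (T / real (Suc n))<..real (Suc k) * (T / real (Suc n))} \<times> marks G) \<and>
         1 \<le> emeasure (\<N> j \<omega>) ({real k * (T / real (Suc n))<..real (Suc k) * (T / real (Suc n))} \<times> marks G)))"
      by (auto simp: Let_def)
    \<comment> \<open>The slabs are open on the left and tile \<open>{0<..T}\<close>. Therefore the
      index comes from a ceiling diminished by 1.\<close>
    have slot: "\<exists>k\<le>n. s \<in> {real k * (T / real (Suc n))<..real (Suc k) * (T / real (Suc n))} \<and>
        {real k * (T / real (Suc n))<..real (Suc k) * (T / real (Suc n))} \<times> marks G \<in> sets (mark_space G)" if s: "0 < s" "s < T" for s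
    proof -
      define h where "h = T / real (Suc n)"
      have h: "0 < h" using T_pos by (simp add: h_def)
      define k where "k = nat (\<lceil>s / h\<rceil> - 1)"
      have "0 < s / h" using s h by simp
      then have k: "real k = of_int \<lceil>s / h\<rceil> - 1" unfolding k_def by simp
      have "real k < s / h" "s / h \<le> real (Suc k)" unfolding of_nat_Suc k by linarith+
      then have k1: "real k * h < s" "s \<le> real (Suc k) * h"
        using h by (simp_all only: pos_less_divide_eq pos_divide_le_eq)
      have Th: "T = real (Suc n) * h" by (simp add: h_def)
      have "s / h < real (Suc n)" using s(2)[unfolded Th] h by (simp only: pos_divide_less_eq)
      with \<open>real k < s / h\<close> have "k \<le> n" by simp
      have "real (Suc k) * h \<le> real (Suc n) * h" using h \<open>k \<le> n\<close> by (intro mult_right_mono) auto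
      also have "\<dots> = T" by (simp add: h_def)
      finally have "{real k * h<..real (Suc k) * h} \<times> marks G \<in> sets (mark_space G)"
        using h by (intro measure_slab(1)) (auto intro: mult_right_mono)
      with k1 \<open>k \<le> n\<close> show ?thesis unfolding h_def by auto
    qed
    \<comment> \<open>Two atoms at one time fall into the same slab, against the choice of the
      resolution \<open>n\<close>: different players cannot both charge the slab, and one player
      cannot charge it twice.\<close>
    have inj: "i = j \<and> z = z'" if ij: "i \<in> I" "j \<in> I" and z: "z \<in> atoms (\<N> i \<omega>)" "z' \<in> atoms (\<N> j \<omega>)" and eq: "fst z = fst z'" for i j z z'
    proof -
      have "0 < fst z" "fst z < T" and zm: "snd z \<in> marks G" "snd z' \<in> marks G" using sub[OF ij(1)] sub[OF ij(2)] z by auto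
      from slot[OF this(1,2)] obtain J k where k: "k \<le> n" "J = {real k * (T / real (Suc n))<..real (Suc k) * (T / real (Suc n))}"
        "fst z \<in> J" "J \<times> marks G \<in> sets (mark_space G)" by blast
      have one: "1 \<le> emeasure (\<N> i \<omega>) {z}" if "i \<in> I" "z \<in> atoms (\<N> i \<omega>)" for i z
      proof -
        interpret finite_measure "\<N> i \<omega>" using fin[OF that(1)] .
        have "1 \<le> measure (\<N> i \<omega>) {z}" using at[OF that(1)] that(2) by blast
        then show ?thesis unfolding emeasure_eq_measure by (metis ennreal_1 ennreal_leI)
      qed
      have le: "emeasure (\<N> i \<omega>) C \<le> emeasure (\<N> i \<omega>) (J \<times> marks G)" if "i \<in> I" "C \<subseteq> J \<times> marks G" for i C
        using that k(4) by (intro emeasure_mono) (auto simp: sN)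
      have i1: "1 \<le> emeasure (\<N> i \<omega>) (J \<times> marks G)"
        using le[OF ij(1), of "{z}"] one[OF ij(1) z(1)] k(3) zm by (cases z) auto
      have j1: "1 \<le> emeasure (\<N> j \<omega>) (J \<times> marks G)"
        using le[OF ij(2), of "{z'}"] one[OF ij(2) z(2)] k(3) zm eq by (cases z') auto
      have ij_eq: "i = j" using n[OF k(1) ij(1)] i1 j1 ij(2) k(2) by blast
      moreover have "z = z'"
      proof (rule ccontr)
        assume "z \<noteq> z'"
        have "2 \<le> emeasure (\<N> i \<omega>) {z} + emeasure (\<N> i \<omega>) {z'}"
          using add_mono[OF one[OF ij(1) z(1)] one[OF ij(2) z(2)]] ij_eq by simp
        also have "\<dots> = emeasure (\<N> i \<omega>) ({z} \<union> {z'})"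
          using at[OF ij(1)] z ij_eq \<open>z \<noteq> z'\<close> by (intro plus_emeasure) (auto simp: atoms_def)
        also have "\<dots> \<le> emeasure (\<N> i \<omega>) (J \<times> marks G)"
          using k(3) zm eq by (intro le[OF ij(1)]) (cases z, cases z', auto)
        also have "\<dots> \<le> 1" using n[OF k(1) ij(1)] k(2) by blast
        finally show False by simp
      qed
      ultimately show ?thesis by blast
    qed
    have one: "emeasure (\<N> i \<omega>) {z} = 1" if i: "i \<in> I" and z: "z \<in> atoms (\<N> i \<omega>)" for i z
    proof -
      interpret finite_measure "\<N> i \<omega>" using fin[OF i] .
      have "0 < fst z" "fst z < T" and zm: "snd z \<in> marks G" using sub[OF i] z by auto
      from slot[OF this(1,2)] obtain J k where k: "k \<le> n" "J = {real k * (T / real (Suc n))<..real (Suc k) * (T / real (Suc n))}"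
        "fst z \<in> J" "J \<times> marks G \<in> sets (mark_space G)" by blast
      have "emeasure (\<N> i \<omega>) {z} \<le> emeasure (\<N> i \<omega>) (J \<times> marks G)"
        using k zm by (intro emeasure_mono) (cases z, auto simp: sN[OF i])
      also have "\<dots> \<le> 1" using n[OF k(1) i] k(2) by blast
      finally have "emeasure (\<N> i \<omega>) {z} \<le> 1" .
      moreover have "1 \<le> measure (\<N> i \<omega>) {z}" using at[OF i] z by blast
      then have "1 \<le> emeasure (\<N> i \<omega>) {z}" unfolding emeasure_eq_measure by (metis ennreal_1 ennreal_leI)
      ultimately show ?thesis by simp
    qed
    have "\<N> i \<omega> = distr (count_space (atoms (\<N> i \<omega>))) (mark_space G) (\<lambda>z. z)" if i: "i \<in> I" for i
      using at[OF i] one[OF i] sN[OF i] by (intro simple_measure_eq_distr) auto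
    with at sub inj show ?case unfolding simple_points_def by blast
  qed
qed

end

section \<open>Compensation formula\<close>

lemma Int_stable_times:
  assumes "Int_stable E" "Int_stable N"
  shows "Int_stable {a \<times> b |a b. a \<in> E \<and> b \<in> N}"
proof (rule Int_stableI)
  fix x y assume "x \<in> {a \<times> b |a b. a \<in> E \<and> b \<in> N}" "y \<in> {a \<times> b |a b. a \<in> E \<and> b \<in> N}"
  then obtain a b a' b' where ab: "x = a \<times> b" "a \<in> E" "b \<in> N" "y = a' \<times> b'" "a' \<in> E" "b' \<in> N"
    by blast
  have "x \<inter> y = (a \<inter> a') \<times> (b \<inter> b')" unfolding ab by auto
  moreover have "a \<inter> a' \<in> E" "b \<inter> b' \<in> N" using ab assms by (auto dest: Int_stableD)
  ultimately show "x \<inter> y \<in> {a \<times> b |a b. a \<in> E \<and> b \<in> N}"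
    by (intro CollectI exI conjI)
qed

text \<open>Simplicity of the atoms is required at every outcome rather than almost surely, so that
  sums over atoms are meaningful without exceptional sets. \<open>good_restriction\<close> provides
  such a basis.\<close>

locale good_basis = game_basis G M F for G :: "('a::metric_space, 'd::finite) game" and M :: "'w measure" and F +
  fixes I :: "nat set" and \<N> :: "nat \<Rightarrow> 'w \<Rightarrow> (real \<times> (real^'d)) measure"
  assumes finI: "finite I" and prm: "\<And>i. i \<in> I \<Longrightarrow> poisson_random_measure G M F (\<N> i)"
    and simple: "\<And>\<omega>. \<omega> \<in> space M \<Longrightarrow> simple_points G I (\<lambda>i. \<N> i \<omega>)"
begin

abbreviation "PP i \<omega> \<equiv> atoms (\<N> i \<omega>)"
abbreviation "PPt i t \<omega> \<equiv> {z \<in> atoms (\<N> i \<omega>). fst z \<le> t}"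

lemma finite_PP: "i \<in> I \<Longrightarrow> \<omega> \<in> space M \<Longrightarrow> finite (PP i \<omega>)"
  and PP_sub: "i \<in> I \<Longrightarrow> \<omega> \<in> space M \<Longrightarrow> PP i \<omega> \<subseteq> {0<..<T} \<times> marks G"
  and noise_eq: "i \<in> I \<Longrightarrow> \<omega> \<in> space M \<Longrightarrow> \<N> i \<omega> = distr (count_space (PP i \<omega>)) (mark_space G) (\<lambda>z. z)"
  and PP_inj: "i \<in> I \<Longrightarrow> j \<in> I \<Longrightarrow> \<omega> \<in> space M \<Longrightarrow> z \<in> PP i \<omega> \<Longrightarrow> z' \<in> PP j \<omega> \<Longrightarrow> fst z = fst z' \<Longrightarrow> i = j \<and> z = z'"
  using simple unfolding simple_points_def by blast+

lemma PP_space: "i \<in> I \<Longrightarrow> \<omega> \<in> space M \<Longrightarrow> PP i \<omega> \<subseteq> space (mark_space G)"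
  using PP_sub[of i \<omega>] by (auto simp: space_mark)

lemma PP_mem: "i \<in> I \<Longrightarrow> \<omega> \<in> space M \<Longrightarrow> z \<in> PP i \<omega> \<Longrightarrow> 0 < fst z \<and> fst z < T \<and> snd z \<in> marks G"
  using PP_sub[of i \<omega>] by auto

lemma nn_integral_noise:
  "i \<in> I \<Longrightarrow> \<omega> \<in> space M \<Longrightarrow> f \<in> borel_measurable (mark_space G) \<Longrightarrow> (\<integral>\<^sup>+z. f z \<partial>\<N> i \<omega>) = (\<Sum>z\<in>PP i \<omega>. f z)"
  using nn_integral_distr_count_space[OF finite_PP PP_space, of i \<omega> f] noise_eq by simp

lemma emeasure_noise:
  assumes i: "i \<in> I" "\<omega> \<in> space M" and B: "B \<in> sets (mark_space G)"
  shows "emeasure (\<N> i \<omega>) B = (\<Sum>z\<in>PP i \<omega>. indicator B z)"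
  using nn_integral_noise[OF i, of "indicator B"] B sets_noise[OF prm[OF i(1)] i(2)] by (simp add: nn_integral_indicator)

lemma noise_adapted:
  "i \<in> I \<Longrightarrow> t \<in> {0..T} \<Longrightarrow> B \<in> sets (mark_space G) \<Longrightarrow> B \<subseteq> {0..t} \<times> UNIV \<Longrightarrow>
    (\<lambda>\<omega>. emeasure (\<N> i \<omega>) B) \<in> borel_measurable (F t)"
  using prm[of i] unfolding poisson_random_measure_def adapted_random_measure_def by blast

lemma space_predU: "space \<H> = ({0..T} \<times> space M) \<times> marks G"
  by (simp add: space_pair_measure space_pred space_intensity)

abbreviation "gensU \<equiv> {a \<times> b |a b. a \<in> gens \<and> b \<in> sets \<mu>}"

lemma gens_cover: "{{0} \<times> space M, {0<..T} \<times> space M} \<subseteq> gens" "\<Union>{{0} \<times> space M, {0<..T} \<times> space M} = {0..T} \<times> space M"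
  using gensI0[of "space M"] gensI[of 0 T "space M"] sets.top[of "F 0"] space_F[of 0] T_pos by auto

lemma gensU_sub: "gensU \<subseteq> Pow (({0..T} \<times> space M) \<times> marks G)"
proof
  fix x assume "x \<in> gensU"
  then obtain a b where ab: "x = a \<times> b" "a \<in> gens" "b \<in> sets \<mu>" by (simp only: mem_Collect_eq) blast
  have "a \<subseteq> {0..T} \<times> space M" using subsetD[OF gens_sub ab(2)] by (rule PowD)
  moreover have "b \<subseteq> marks G" using sets.sets_into_space[OF ab(3)] by (simp add: space_intensity)
  ultimately show "x \<in> Pow (({0..T} \<times> space M) \<times> marks G)" unfolding ab(1) by auto
qed

lemma sets_predU: "sets \<H> = sigma_sets (({0..T} \<times> space M) \<times> marks G) gensU"
proof -
  have "sets \<H> = sets (sigma (space \<P> \<times> space \<mu>) {a \<times> b | a b. a \<in> gens \<and> b \<in> sets \<mu>})"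
  proof (rule sets_pair_eq)
    show "gens \<subseteq> Pow (space \<P>)" using gens_sub by (simp add: space_pred)
    show "sets \<P> = sigma_sets (space \<P>) gens" using sets_pred by (simp add: space_pred)
    show "{{0} \<times> space M, {0<..T} \<times> space M} \<subseteq> gens" by (rule gens_cover)
    show "\<Union>{{0} \<times> space M, {0<..T} \<times> space M} = space \<P>" using gens_cover by (simp add: space_pred)
    show "sets \<mu> \<subseteq> Pow (space \<mu>)" by (rule sets.space_closed)
    show "sets \<mu> = sigma_sets (space \<mu>) (sets \<mu>)" by (simp add: sets.sigma_sets_eq)
    show "{marks G} \<subseteq> sets \<mu>" using marks_sets by simp
  qed (auto simp: space_intensity)
  also have "\<dots> = sigma_sets (({0..T} \<times> space M) \<times> marks G) gensU"
    using gensU_sub by (simp add: space_pred space_intensity)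
  finally show ?thesis .
qed

lemma Int_stable_gensU: "Int_stable gensU"
  by (rule Int_stable_times[OF Int_stable_gens]) (auto simp: Int_stable_def)

lemma sec_predU: "\<omega> \<in> space M \<Longrightarrow> (\<lambda>z. (tw \<omega> z)) \<in> mark_space G \<rightarrow>\<^sub>M \<H>"
  by (rule measurable_Pair[OF fst_compose[OF pred_section] measurable_snd])

lemma gensU_cases:
  assumes "A \<in> gensU"
  obtains (zero) B U where "A = ({0} \<times> B) \<times> U" "B \<in> sets (F 0)" "U \<in> sets \<mu>"
  | (slab) s r B U where "A = ({s<..r} \<times> B) \<times> U" "0 \<le> s" "s < r" "r \<le> T" "B \<in> sets (F s)" "U \<in> sets \<mu>"
  using assms by blast

lemma slab_sum:
  assumes i: "i \<in> I" "\<omega> \<in> space M" and s: "0 \<le> s" "t \<le> T" and U: "U \<in> sets \<mu>"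
  shows "(\<Sum>z\<in>PP i \<omega>. indicator (({s<..r} \<times> B) \<times> U) (tw \<omega> z) * indicator {..t} (fst z)) =
    indicator B \<omega> * emeasure (\<N> i \<omega>) ({s<..min r t} \<times> U)"
proof -
  have "{s<..min r t} \<in> sets \<tau>" using s by (intro time_meas) auto
  with U have "{s<..min r t} \<times> U \<in> sets (mark_space G)" by auto
  then show ?thesis
    by (simp add: emeasure_noise[OF i] sum_distrib_left) (intro sum.cong, auto simp: indicator_def)
qed

text \<open>Induction over the \<open>\<pi>\<close>-system of predictable rectangles. A slab that
  starts before \<open>t\<close> contributes a past event times a number of atoms up to
  \<open>t\<close>, both known at time \<open>t\<close>; a slab that starts at \<open>t\<close> or
  later contributes nothing.\<close>

lemma sum_atoms_measurable_set:
  assumes i: "i \<in> I" and t: "t \<in> {0..T}" and A: "A \<in> sets \<H>"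
  shows "(\<lambda>\<omega>. \<Sum>z\<in>PP i \<omega>. indicator A (tw \<omega> z) * indicator {..t} (fst z) :: ennreal) \<in> borel_measurable (F t)"
  using Int_stable_gensU gensU_sub A[unfolded sets_predU]
proof (induction rule: sigma_sets_induct_disjoint)
  case (basic A)
  then show ?case
  proof (cases rule: gensU_cases)
    case (zero B U)
    have "(\<lambda>\<omega>. 0 :: ennreal) \<in> borel_measurable (F t)" by simp
    moreover have "(\<Sum>z\<in>PP i \<omega>. indicator A (tw \<omega> z) * indicator {..t} (fst z) :: ennreal) = 0" if "\<omega> \<in> space (F t)" for \<omega>
    proof (intro sum.neutral ballI)
      fix z assume "z \<in> PP i \<omega>"
      then have "0 < fst z" using PP_mem[OF i, of \<omega> z] that space_F[OF t] by simp
      then show "indicator A (tw \<omega> z) * indicator {..t} (fst z) = (0 :: ennreal)"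
        by (simp add: zero(1) indicator_def)
    qed
    ultimately show ?thesis by (simp cong: measurable_cong)
  next
    case (slab s r B U)
    have "(\<lambda>\<omega>. indicator B \<omega> * emeasure (\<N> i \<omega>) ({s<..min r t} \<times> U)) \<in> borel_measurable (F t)"
    proof (cases "s < t")
      case True
      have "B \<in> sets (F t)" using F_mono[of s t B] True t slab by auto
      moreover have "{s<..min r t} \<in> sets \<tau>" using slab t by (intro time_meas) auto
      then have "{s<..min r t} \<times> U \<in> sets (mark_space G)" using slab by auto
      then have "(\<lambda>\<omega>. emeasure (\<N> i \<omega>) ({s<..min r t} \<times> U)) \<in> borel_measurable (F t)"
        using slab(2) by (intro noise_adapted[OF i t]) auto
      ultimately show ?thesis by measurable
    next
      case False
      then have e: "{s<..min r t} = {}" by auto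
      show ?thesis unfolding e by simp
    qed
    then show ?thesis
    proof (rule measurable_cong[THEN iffD2, rotated])
      fix \<omega> assume "\<omega> \<in> space (F t)"
      then have \<omega>: "\<omega> \<in> space M" by (simp add: space_F[OF t])
      show "(\<Sum>z\<in>PP i \<omega>. indicator A (tw \<omega> z) * indicator {..t} (fst z)) =
        indicator B \<omega> * emeasure (\<N> i \<omega>) ({s<..min r t} \<times> U)"
        unfolding slab(1) using slab t by (intro slab_sum[OF i \<omega>]) auto
    qed
  qed
next
  case empty show ?case by simp
next
  case (compl A)
  let ?\<Omega> = "({0..T} \<times> space M) \<times> marks G"
  have all: "(\<lambda>\<omega>. \<Sum>z\<in>PP i \<omega>. indicator {..t} (fst z) :: ennreal) \<in> borel_measurable (F t)"
  proof -
    have tt: "{0..t} \<in> sets \<tau>" using t by (intro time_meas) auto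
    then have B: "{0..t} \<times> marks G \<in> sets (mark_space G)" using marks_sets by auto
    then have "(\<lambda>\<omega>. emeasure (\<N> i \<omega>) ({0..t} \<times> marks G)) \<in> borel_measurable (F t)"
      by (intro noise_adapted[OF i t]) auto
    then show ?thesis
    proof (rule measurable_cong[THEN iffD2, rotated])
      fix \<omega> assume "\<omega> \<in> space (F t)"
      then have \<omega>: "\<omega> \<in> space M" by (simp add: space_F[OF t])
      show "(\<Sum>z\<in>PP i \<omega>. indicator {..t} (fst z) :: ennreal) = emeasure (\<N> i \<omega>) ({0..t} \<times> marks G)"
        unfolding emeasure_noise[OF i \<omega> B] by (intro sum.cong) (auto simp: indicator_def dest: PP_mem[OF i \<omega>])
    qed
  qed
  have "(\<lambda>\<omega>. (\<Sum>z\<in>PP i \<omega>. indicator {..t} (fst z)) - (\<Sum>z\<in>PP i \<omega>. indicator A (tw \<omega> z) * indicator {..t} (fst z)) :: ennreal)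
      \<in> borel_measurable (F t)"
    using all compl by measurable
  then show ?case
  proof (rule measurable_cong[THEN iffD2, rotated])
    fix \<omega> assume "\<omega> \<in> space (F t)"
    then have \<omega>: "\<omega> \<in> space M" by (simp add: space_F[OF t])
    have a: "(\<Sum>z\<in>PP i \<omega>. indicator (?\<Omega> - A) (tw \<omega> z) * indicator {..t} (fst z) :: ennreal) +
        (\<Sum>z\<in>PP i \<omega>. indicator A (tw \<omega> z) * indicator {..t} (fst z)) = (\<Sum>z\<in>PP i \<omega>. indicator {..t} (fst z))"
      unfolding sum.distrib[symmetric] using \<omega>
      by (intro sum.cong) (auto simp: indicator_def dest: PP_mem[OF i \<omega>])
    \<comment> \<open>Bounded by the number of atoms, hence finite; this is what allows cancellation
      in the extended nonnegative reals.\<close>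
    have b: "(\<Sum>z\<in>PP i \<omega>. indicator A (tw \<omega> z) * indicator {..t} (fst z) :: ennreal) \<noteq> \<top>"
    proof -
      have "(\<Sum>z\<in>PP i \<omega>. indicator A (tw \<omega> z) * indicator {..t} (fst z) :: ennreal) \<le> (\<Sum>z\<in>PP i \<omega>. 1)"
        by (intro sum_mono) (simp split: split_indicator)
      also have "\<dots> = of_nat (card (PP i \<omega>))" by simp
      also have "\<dots> < \<top>" by (rule of_nat_less_top)
      finally show ?thesis by simp
    qed
    show "(\<Sum>z\<in>PP i \<omega>. indicator (?\<Omega> - A) (tw \<omega> z) * indicator {..t} (fst z) :: ennreal) =
        (\<Sum>z\<in>PP i \<omega>. indicator {..t} (fst z)) - (\<Sum>z\<in>PP i \<omega>. indicator A (tw \<omega> z) * indicator {..t} (fst z))"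
      unfolding a[symmetric] by (rule ennreal_add_diff_cancel_right[OF b, symmetric])
  qed
next
  case (union A)
  have "(\<lambda>\<omega>. \<Sum>k. \<Sum>z\<in>PP i \<omega>. indicator (A k) (tw \<omega> z) * indicator {..t} (fst z) :: ennreal) \<in> borel_measurable (F t)"
    using union(3) by measurable
  moreover have "(\<Sum>z\<in>PP i \<omega>. indicator (\<Union>k. A k) (tw \<omega> z) * indicator {..t} (fst z) :: ennreal) =
    (\<Sum>k. \<Sum>z\<in>PP i \<omega>. indicator (A k) (tw \<omega> z) * indicator {..t} (fst z))" for \<omega>
    by (subst suminf_sum) (auto simp: suminf_indicator[OF union(1), symmetric] ennreal_suminf_multc)
  ultimately show ?case by simp
qed

lemma sum_atoms_measurable_nn:
  fixes W :: "(real \<times> 'w) \<times> (real^'d) \<Rightarrow> ennreal"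
  assumes i: "i \<in> I" and t: "t \<in> {0..T}" and W: "W \<in> borel_measurable \<H>"
  shows "(\<lambda>\<omega>. \<Sum>z\<in>PP i \<omega>. W (tw \<omega> z) * indicator {..t} (fst z)) \<in> borel_measurable (F t)"
  using W
proof (induction rule: borel_measurable_induct)
  case (cong f g)
  have "(\<Sum>z\<in>PP i \<omega>. f (tw \<omega> z) * indicator {..t} (fst z)) = (\<Sum>z\<in>PP i \<omega>. g (tw \<omega> z) * indicator {..t} (fst z))"
    if "\<omega> \<in> space (F t)" for \<omega>
    using that by (intro sum.cong refl) (subst cong(3), auto simp: space_predU space_F[OF t] dest: PP_mem[OF i])
  then show ?case using cong(4) by (subst measurable_cong) auto
next
  case (set A) then show ?case by (rule sum_atoms_measurable_set[OF i t])
next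
  case (mult u c)
  have "(\<lambda>\<omega>. c * (\<Sum>z\<in>PP i \<omega>. u (tw \<omega> z) * indicator {..t} (fst z))) \<in> borel_measurable (F t)"
    using mult by measurable
  then show ?case by (simp add: sum_distrib_left mult.assoc)
next
  case (add u v)
  have "(\<lambda>\<omega>. (\<Sum>z\<in>PP i \<omega>. v (tw \<omega> z) * indicator {..t} (fst z)) + (\<Sum>z\<in>PP i \<omega>. u (tw \<omega> z) * indicator {..t} (fst z)))
     \<in> borel_measurable (F t)"
    using add by measurable
  then show ?case by (simp add: sum.distrib distrib_right)
next
  case (seq U)
  have "(\<lambda>\<omega>. SUP k. \<Sum>z\<in>PP i \<omega>. U k (tw \<omega> z) * indicator {..t} (fst z)) \<in> borel_measurable (F t)"
    using seq by measurable
  moreover have "(SUP k. \<Sum>z\<in>PP i \<omega>. U k (tw \<omega> z) * indicator {..t} (fst z)) =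
     (\<Sum>z\<in>PP i \<omega>. (SUP k. U k) (tw \<omega> z) * indicator {..t} (fst z))" for \<omega>
    using seq(3) by (subst ennreal_SUP_sum) (auto simp: incseq_def le_fun_def SUP_mult_right_ennreal image_comp intro!: mult_right_mono sum.cong)
  ultimately show ?case by simp
qed

lemma sum_atoms_measurable_nn':
  fixes W :: "(real \<times> 'w) \<times> (real^'d) \<Rightarrow> ennreal"
  assumes i: "i \<in> I" and W: "W \<in> borel_measurable \<H>"
  shows "(\<lambda>\<omega>. \<Sum>z\<in>PP i \<omega>. W (tw \<omega> z)) \<in> borel_measurable M"
proof -
  have "(\<lambda>\<omega>. \<Sum>z\<in>PP i \<omega>. W (tw \<omega> z) * indicator {..T} (fst z)) \<in> borel_measurable M"
    using sum_atoms_measurable_nn[OF i _ W, of T] T_pos by (intro measurable_F[of T]) auto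
  moreover have "(\<Sum>z\<in>PP i \<omega>. W (tw \<omega> z) * indicator {..T} (fst z)) = (\<Sum>z\<in>PP i \<omega>. W (tw \<omega> z))"
    if "\<omega> \<in> space M" for \<omega>
    by (intro sum.cong) (auto dest: PP_mem[OF i that])
  ultimately show ?thesis by (simp cong: measurable_cong)
qed

abbreviation "swap_meas \<equiv> (\<lambda>z :: 'w \<times> (real \<times> (real^'d)). ((fst (snd z), fst z), snd (snd z)))"

lemma swap_meas: "swap_meas \<in> M \<Otimes>\<^sub>M mark_space G \<rightarrow>\<^sub>M \<H>"
proof -
  have "(\<lambda>z :: 'w \<times> (real \<times> (real^'d)). (fst (snd z), fst z)) \<in> M \<Otimes>\<^sub>M mark_space G \<rightarrow>\<^sub>M \<tau> \<Otimes>\<^sub>M M" by measurable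
  from measurable_compose[OF this id_pred] show ?thesis by measurable
qed

text \<open>On a rectangle with an event of the past and a later slab, the number of atoms in the
  slab is independent of the event, so the mean is a product. The rectangle at time 0 gives 0 on
  both sides, and complements are taken relative to the finite total mass.\<close>

lemma compensation_set:
  assumes i: "i \<in> I" and A: "A \<in> sets \<H>"
  shows "(\<integral>\<^sup>+\<omega>. (\<Sum>z\<in>PP i \<omega>. indicator A (tw \<omega> z)) \<partial>M) =
    (\<integral>\<^sup>+\<omega>. \<integral>\<^sup>+z. indicator A (tw \<omega> z) \<partial>mark_space G \<partial>M)"
  using Int_stable_gensU gensU_sub A[unfolded sets_predU]
proof (induction rule: sigma_sets_induct_disjoint)
  case (basic A)
  then show ?case
  proof (cases rule: gensU_cases)
    case (zero B U)
    have "(\<Sum>z\<in>PP i \<omega>. indicator A (tw \<omega> z) :: ennreal) = 0" if "\<omega> \<in> space M" for \<omega>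
    proof (intro sum.neutral ballI)
      fix z assume "z \<in> PP i \<omega>"
      then have "0 < fst z" using PP_mem[OF i that, of z] by simp
      then show "indicator A (tw \<omega> z) = (0 :: ennreal)"
        by (simp add: zero(1) indicator_def)
    qed
    then have "(\<integral>\<^sup>+\<omega>. (\<Sum>z\<in>PP i \<omega>. indicator A (tw \<omega> z)) \<partial>M) = 0"
      by (subst nn_integral_cong[where v = "\<lambda>_. 0"]) auto
    moreover have "(\<integral>\<^sup>+z. indicator A (tw \<omega> z) \<partial>mark_space G) = 0" for \<omega>
    proof -
      have "(\<integral>\<^sup>+z. indicator A (tw \<omega> z) \<partial>mark_space G) \<le> (\<integral>\<^sup>+z. indicator ({0} \<times> marks G) z \<partial>mark_space G)"
        by (rule nn_integral_mono) (auto simp: zero(1) space_mark indicator_def)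
      also have "\<dots> = emeasure (mark_space G) ({0} \<times> marks G)"
        using measure_section(1)[of 0] T_pos by simp
      also have "\<dots> = 0" using measure_section(2)[of 0] T_pos by (simp add: tauU.emeasure_eq_measure)
      finally show ?thesis by simp
    qed
    ultimately show ?thesis by simp
  next
    case (slab s r B U)
    have "{s<..r} \<in> sets \<tau>" using slab by (intro time_meas) auto
    then have D: "{s<..r} \<times> U \<in> sets (mark_space G)" using slab by auto
    have BM: "B \<in> sets M" using slab sets_F[of s] by auto
    have eq: "(\<Sum>z\<in>PP i \<omega>. indicator A (tw \<omega> z)) = indicator B \<omega> * emeasure (\<N> i \<omega>) ({s<..r} \<times> U)"
      if "\<omega> \<in> space M" for \<omega>
      unfolding emeasure_noise[OF i that D] sum_distrib_left slab(1) by (intro sum.cong) (auto simp: indicator_def)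
    interpret pv: poisson_variable M "\<lambda>\<omega>. emeasure (\<N> i \<omega>) ({s<..r} \<times> U)" "measure (mark_space G) ({s<..r} \<times> U)"
      by (rule poisson_variableI[OF prm[OF i] D])
    have "(\<integral>\<^sup>+\<omega>. (\<Sum>z\<in>PP i \<omega>. indicator A (tw \<omega> z)) \<partial>M) = (\<integral>\<^sup>+\<omega>. indicator B \<omega> * emeasure (\<N> i \<omega>) ({s<..r} \<times> U) \<partial>M)"
      by (rule nn_integral_cong) (rule eq)
    also have "\<dots> = ennreal (measure M B * measure (mark_space G) ({s<..r} \<times> U))"
    proof (rule pv.nn_integral_indep[OF BM])
      fix k :: nat
      have "{\<omega>\<in>space M. emeasure (\<N> i \<omega>) ({s<..r} \<times> U) = of_nat k} = (\<lambda>\<omega>. emeasure (\<N> i \<omega>) ({s<..r} \<times> U)) -` {of_nat k} \<inter> space M"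
        by auto
      then have "{\<omega>\<in>space M. emeasure (\<N> i \<omega>) ({s<..r} \<times> U) = of_nat k} \<in>
         sigma_sets (space M)
          {(\<lambda>\<omega>. emeasure (\<N> i \<omega>) B) -` E \<inter> space M |B E.
             B \<in> sets (mark_space G) \<and> B \<subseteq> {s<..} \<times> UNIV \<and> E \<in> sets borel}"
        using D by (intro sigma_sets.Basic) (auto intro!: exI[of _ "{s<..r} \<times> U"] exI[of _ "{of_nat k}"])
      moreover have "indep_set (sets (F s))
      (sigma_sets (space M)
          {(\<lambda>\<omega>. emeasure (\<N> i \<omega>) B) -` E \<inter> space M |B E.
             B \<in> sets (mark_space G) \<and> B \<subseteq> {s<..} \<times> UNIV \<and> E \<in> sets borel})"
        using prm[OF i] slab unfolding poisson_random_measure_def by auto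
      ultimately show "prob (B \<inter> {\<omega>\<in>space M. emeasure (\<N> i \<omega>) ({s<..r} \<times> U) = of_nat k}) =
         prob B * prob {\<omega>\<in>space M. emeasure (\<N> i \<omega>) ({s<..r} \<times> U) = of_nat k}"
        using slab by (intro indep_setD)
    qed
    also have "\<dots> = (\<integral>\<^sup>+\<omega>. \<integral>\<^sup>+z. indicator A (tw \<omega> z) \<partial>mark_space G \<partial>M)"
    proof -
      have "(\<integral>\<^sup>+z. indicator A (tw \<omega> z) \<partial>mark_space G) = indicator B \<omega> * emeasure (mark_space G) ({s<..r} \<times> U)" for \<omega>
      proof -
        have "(\<integral>\<^sup>+z. indicator A (tw \<omega> z) \<partial>mark_space G) = (\<integral>\<^sup>+z. indicator B \<omega> * indicator ({s<..r} \<times> U) z \<partial>mark_space G)"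
          by (rule nn_integral_cong) (auto simp: slab(1) indicator_def)
        then show ?thesis using D by (simp add: nn_integral_cmult)
      qed
      then show ?thesis using BM
        by (simp add: nn_integral_multc emeasure_eq_measure tauU.emeasure_eq_measure ennreal_mult)
    qed
    finally show ?thesis .
  qed
next
  case empty show ?case by simp
next
  case (compl A)
  let ?\<Omega> = "({0..T} \<times> space M) \<times> marks G"
  have A: "A \<in> sets \<H>" "?\<Omega> - A \<in> sets \<H>"
    using compl(1) sets.compl_sets[of A "\<H>"] unfolding sets_predU[symmetric] space_predU by auto
  have mL: "(\<lambda>\<omega>. \<Sum>z\<in>PP i \<omega>. indicator C (tw \<omega> z) :: ennreal) \<in> borel_measurable M" if "C \<in> sets \<H>" for C
    using that by (intro sum_atoms_measurable_nn'[OF i]) auto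
  have mR: "(\<lambda>\<omega>. \<integral>\<^sup>+z. indicator C (tw \<omega> z) \<partial>mark_space G) \<in> borel_measurable M" if "C \<in> sets \<H>" for C
    using measurable_compose[OF swap_meas borel_measurable_indicator[OF that]]
    by (intro tauU.borel_measurable_nn_integral) (simp add: case_prod_beta')
  have L: "(\<integral>\<^sup>+\<omega>. (\<Sum>z\<in>PP i \<omega>. indicator (?\<Omega> - A) (tw \<omega> z)) \<partial>M) + (\<integral>\<^sup>+\<omega>. (\<Sum>z\<in>PP i \<omega>. indicator A (tw \<omega> z)) \<partial>M)
      = ennreal (measure (mark_space G) ({0..T} \<times> marks G))"
  proof -
    have D: "{0..T} \<times> marks G \<in> sets (mark_space G)" using sets.top[of "mark_space G"] by (simp add: space_mark)
    interpret pv: poisson_variable M "\<lambda>\<omega>. emeasure (\<N> i \<omega>) ({0..T} \<times> marks G)" "measure (mark_space G) ({0..T} \<times> marks G)"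
      by (rule poisson_variableI[OF prm[OF i] D])
    have "(\<integral>\<^sup>+\<omega>. (\<Sum>z\<in>PP i \<omega>. indicator (?\<Omega> - A) (tw \<omega> z)) \<partial>M) + (\<integral>\<^sup>+\<omega>. (\<Sum>z\<in>PP i \<omega>. indicator A (tw \<omega> z)) \<partial>M)
      = (\<integral>\<^sup>+\<omega>. indicator (space M) \<omega> * emeasure (\<N> i \<omega>) ({0..T} \<times> marks G) \<partial>M)"
    proof (subst nn_integral_add[symmetric, OF mL[OF A(2)] mL[OF A(1)]], rule nn_integral_cong)
      fix \<omega> assume \<omega>: "\<omega> \<in> space M"
      show "(\<Sum>z\<in>PP i \<omega>. indicator (?\<Omega> - A) (tw \<omega> z)) + (\<Sum>z\<in>PP i \<omega>. indicator A (tw \<omega> z)) =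
         indicator (space M) \<omega> * emeasure (\<N> i \<omega>) ({0..T} \<times> marks G)"
        unfolding sum.distrib[symmetric] emeasure_noise[OF i \<omega> D] sum_distrib_left using \<omega>
        by (intro sum.cong) (auto simp: indicator_def dest: PP_mem[OF i \<omega>])
    qed
    also have "\<dots> = ennreal (measure M (space M) * measure (mark_space G) ({0..T} \<times> marks G))"
      by (rule pv.nn_integral_indep) (auto simp: prob_space Int_absorb1)
    finally show ?thesis by (simp add: prob_space)
  qed
  have R: "(\<integral>\<^sup>+\<omega>. \<integral>\<^sup>+z. indicator (?\<Omega> - A) (tw \<omega> z) \<partial>mark_space G \<partial>M) + (\<integral>\<^sup>+\<omega>. \<integral>\<^sup>+z. indicator A (tw \<omega> z) \<partial>mark_space G \<partial>M)
      = ennreal (measure (mark_space G) ({0..T} \<times> marks G))"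
  proof -
    have "(\<integral>\<^sup>+z. indicator (?\<Omega> - A) (tw \<omega> z) \<partial>mark_space G) + (\<integral>\<^sup>+z. indicator A (tw \<omega> z) \<partial>mark_space G)
        = ennreal (measure (mark_space G) ({0..T} \<times> marks G))" if \<omega>: "\<omega> \<in> space M" for \<omega>
    proof -
      have "(\<lambda>z. indicator C (tw \<omega> z) :: ennreal) \<in> borel_measurable (mark_space G)" if "C \<in> sets \<H>" for C
        using measurable_compose[OF sec_predU[OF \<omega>] borel_measurable_indicator[OF that]] .
      then have "(\<integral>\<^sup>+z. indicator (?\<Omega> - A) (tw \<omega> z) \<partial>mark_space G) + (\<integral>\<^sup>+z. indicator A (tw \<omega> z) \<partial>mark_space G)
         = (\<integral>\<^sup>+z. indicator (?\<Omega> - A) (tw \<omega> z) + indicator A (tw \<omega> z) \<partial>mark_space G)"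
        using A by (intro nn_integral_add[symmetric]) auto
      also have "\<dots> = (\<integral>\<^sup>+z. 1 \<partial>mark_space G)"
        using \<omega> by (intro nn_integral_cong) (auto simp: space_mark indicator_def)
      finally show ?thesis by (simp add: tauU.emeasure_eq_measure space_mark)
    qed
    then show ?thesis
      by (subst nn_integral_add[symmetric, OF mR[OF A(2)] mR[OF A(1)]])
        (subst nn_integral_cong[where v = "\<lambda>_. ennreal (measure (mark_space G) ({0..T} \<times> marks G))"], auto simp: emeasure_space_1)
  qed
  \<comment> \<open>Both sides equal the total mass minus the same integral; the subtraction is
    legitimate because this integral is finite.\<close>
  have fin: "(\<integral>\<^sup>+\<omega>. \<integral>\<^sup>+z. indicator A (tw \<omega> z) \<partial>mark_space G \<partial>M) \<noteq> \<top>"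
  proof
    assume "(\<integral>\<^sup>+\<omega>. \<integral>\<^sup>+z. indicator A (tw \<omega> z) \<partial>mark_space G \<partial>M) = \<top>"
    then show False using R by simp
  qed
  have cancel: "x = y" if "x + b = K" "y + b = K" "b \<noteq> \<top>" for x y b K :: ennreal
    using ennreal_add_diff_cancel_right[of b x] ennreal_add_diff_cancel_right[of b y] that by simp
  show ?case
    by (rule cancel[OF L[unfolded compl(2)] R fin])
next
  case (union A)
  have A: "A k \<in> sets \<H>" for k using union(2) unfolding sets_predU by auto
  have mL: "(\<lambda>\<omega>. \<Sum>z\<in>PP i \<omega>. indicator (A k) (tw \<omega> z) :: ennreal) \<in> borel_measurable M" for k
    using A by (intro sum_atoms_measurable_nn'[OF i]) auto
  have mR: "(\<lambda>\<omega>. \<integral>\<^sup>+z. indicator (A k) (tw \<omega> z) \<partial>mark_space G) \<in> borel_measurable M" for k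
    using measurable_compose[OF swap_meas borel_measurable_indicator[OF A[of k]]]
    by (intro tauU.borel_measurable_nn_integral) (simp add: case_prod_beta')
  have "(\<integral>\<^sup>+\<omega>. (\<Sum>z\<in>PP i \<omega>. indicator (\<Union>k. A k) (tw \<omega> z)) \<partial>M) =
     (\<integral>\<^sup>+\<omega>. (\<Sum>k. \<Sum>z\<in>PP i \<omega>. indicator (A k) (tw \<omega> z)) \<partial>M)"
    by (subst suminf_sum) (auto simp: suminf_indicator[OF union(1), symmetric])
  also have "\<dots> = (\<Sum>k. \<integral>\<^sup>+\<omega>. (\<Sum>z\<in>PP i \<omega>. indicator (A k) (tw \<omega> z)) \<partial>M)"
    using mL by (rule nn_integral_suminf)
  also have "\<dots> = (\<Sum>k. \<integral>\<^sup>+\<omega>. \<integral>\<^sup>+z. indicator (A k) (tw \<omega> z) \<partial>mark_space G \<partial>M)"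
    using union(3) by simp
  also have "\<dots> = (\<integral>\<^sup>+\<omega>. (\<Sum>k. \<integral>\<^sup>+z. indicator (A k) (tw \<omega> z) \<partial>mark_space G) \<partial>M)"
    using mR by (rule nn_integral_suminf[symmetric])
  also have "\<dots> = (\<integral>\<^sup>+\<omega>. \<integral>\<^sup>+z. indicator (\<Union>k. A k) (tw \<omega> z) \<partial>mark_space G \<partial>M)"
  proof (rule nn_integral_cong)
    fix \<omega> assume \<omega>: "\<omega> \<in> space M"
    have "(\<Sum>k. \<integral>\<^sup>+z. indicator (A k) (tw \<omega> z) \<partial>mark_space G) = (\<integral>\<^sup>+z. (\<Sum>k. indicator (A k) (tw \<omega> z)) \<partial>mark_space G)"
      using measurable_compose[OF sec_predU[OF \<omega>] borel_measurable_indicator[OF A]] by (intro nn_integral_suminf[symmetric]) auto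
    then show "(\<Sum>k. \<integral>\<^sup>+z. indicator (A k) (tw \<omega> z) \<partial>mark_space G) = (\<integral>\<^sup>+z. indicator (\<Union>k. A k) (tw \<omega> z) \<partial>mark_space G)"
      by (simp add: suminf_indicator[OF union(1)])
  qed
  finally show ?case .
qed

lemma compensation_nn:
  fixes W :: "(real \<times> 'w) \<times> (real^'d) \<Rightarrow> ennreal"
  assumes i: "i \<in> I" and W: "W \<in> borel_measurable \<H>"
  shows "(\<integral>\<^sup>+\<omega>. (\<Sum>z\<in>PP i \<omega>. W (tw \<omega> z)) \<partial>M) =
    (\<integral>\<^sup>+\<omega>. \<integral>\<^sup>+z. W (tw \<omega> z) \<partial>mark_space G \<partial>M)"
  using W
proof (induction rule: borel_measurable_induct)
  case (cong f g)
  have "(\<Sum>z\<in>PP i \<omega>. f (tw \<omega> z)) = (\<Sum>z\<in>PP i \<omega>. g (tw \<omega> z))" if "\<omega> \<in> space M" for \<omega>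
    using that by (intro sum.cong refl cong(3)) (auto simp: space_predU dest: PP_mem[OF i])
  moreover have "(\<integral>\<^sup>+z. f (tw \<omega> z) \<partial>mark_space G) = (\<integral>\<^sup>+z. g (tw \<omega> z) \<partial>mark_space G)" if "\<omega> \<in> space M" for \<omega>
    using that by (intro nn_integral_cong cong(3)) (auto simp: space_predU space_mark)
  ultimately show ?case using cong(4) by (simp cong: nn_integral_cong)
next
  case (set A) then show ?case by (rule compensation_set[OF i])
next
  case (mult u c)
  have m2: "(\<lambda>z. u (tw \<omega> z)) \<in> borel_measurable (mark_space G)" if "\<omega> \<in> space M" for \<omega>
    using measurable_compose[OF sec_predU[OF that] mult(2)] .
  have m3: "(\<lambda>\<omega>. \<integral>\<^sup>+z. u (tw \<omega> z) \<partial>mark_space G) \<in> borel_measurable M"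
    using measurable_compose[OF swap_meas mult(2)]
    by (intro tauU.borel_measurable_nn_integral) (simp add: case_prod_beta')
  have "(\<integral>\<^sup>+\<omega>. (\<Sum>z\<in>PP i \<omega>. c * u (tw \<omega> z)) \<partial>M) = c * (\<integral>\<^sup>+\<omega>. (\<Sum>z\<in>PP i \<omega>. u (tw \<omega> z)) \<partial>M)"
    unfolding sum_distrib_left[symmetric] by (rule nn_integral_cmult[OF sum_atoms_measurable_nn'[OF i mult(2)]])
  also have "\<dots> = (\<integral>\<^sup>+\<omega>. c * (\<integral>\<^sup>+z. u (tw \<omega> z) \<partial>mark_space G) \<partial>M)"
    unfolding mult by (rule nn_integral_cmult[symmetric, OF m3])
  also have "\<dots> = (\<integral>\<^sup>+\<omega>. \<integral>\<^sup>+z. c * u (tw \<omega> z) \<partial>mark_space G \<partial>M)"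
    using m2 by (intro nn_integral_cong nn_integral_cmult[symmetric])
  finally show ?case .
next
  case (add u v)
  have m2: "(\<lambda>z. u (tw \<omega> z)) \<in> borel_measurable (mark_space G)" "(\<lambda>z. v (tw \<omega> z)) \<in> borel_measurable (mark_space G)" if "\<omega> \<in> space M" for \<omega>
    using measurable_compose[OF sec_predU[OF that] add(1)] measurable_compose[OF sec_predU[OF that] add(3)] .
  have m3: "(\<lambda>\<omega>. \<integral>\<^sup>+z. u (tw \<omega> z) \<partial>mark_space G) \<in> borel_measurable M" "(\<lambda>\<omega>. \<integral>\<^sup>+z. v (tw \<omega> z) \<partial>mark_space G) \<in> borel_measurable M"
    using measurable_compose[OF swap_meas add(1)] measurable_compose[OF swap_meas add(3)]
    by (intro tauU.borel_measurable_nn_integral; simp add: case_prod_beta')+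
  have "(\<integral>\<^sup>+\<omega>. (\<Sum>z\<in>PP i \<omega>. v (tw \<omega> z) + u (tw \<omega> z)) \<partial>M) =
    (\<integral>\<^sup>+\<omega>. (\<Sum>z\<in>PP i \<omega>. v (tw \<omega> z)) \<partial>M) + (\<integral>\<^sup>+\<omega>. (\<Sum>z\<in>PP i \<omega>. u (tw \<omega> z)) \<partial>M)"
    unfolding sum.distrib by (rule nn_integral_add[OF sum_atoms_measurable_nn'[OF i add(3)] sum_atoms_measurable_nn'[OF i add(1)]])
  also have "\<dots> = (\<integral>\<^sup>+\<omega>. (\<integral>\<^sup>+z. v (tw \<omega> z) \<partial>mark_space G) + (\<integral>\<^sup>+z. u (tw \<omega> z) \<partial>mark_space G) \<partial>M)"
    unfolding add by (rule nn_integral_add[symmetric, OF m3(2,1)])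
  also have "\<dots> = (\<integral>\<^sup>+\<omega>. \<integral>\<^sup>+z. v (tw \<omega> z) + u (tw \<omega> z) \<partial>mark_space G \<partial>M)"
    using m2 by (intro nn_integral_cong nn_integral_add[symmetric])
  finally show ?case .
next
  case (seq U)
  have m2: "(\<lambda>z. U k (tw \<omega> z)) \<in> borel_measurable (mark_space G)" if "\<omega> \<in> space M" for \<omega> k
    using measurable_compose[OF sec_predU[OF that] seq(1)] .
  have m3: "(\<lambda>\<omega>. \<integral>\<^sup>+z. U k (tw \<omega> z) \<partial>mark_space G) \<in> borel_measurable M" for k
    using measurable_compose[OF swap_meas seq(1)]
    by (intro tauU.borel_measurable_nn_integral) (simp add: case_prod_beta')
  have mono: "U k x \<le> U l x" if "k \<le> l" for k l x using incseqD[OF seq(3) that] by (rule le_funD)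
  have "(\<integral>\<^sup>+\<omega>. (\<Sum>z\<in>PP i \<omega>. (SUP k. U k) (tw \<omega> z)) \<partial>M) = (\<integral>\<^sup>+\<omega>. (SUP k. \<Sum>z\<in>PP i \<omega>. U k (tw \<omega> z)) \<partial>M)"
    by (subst ennreal_SUP_sum) (auto simp: incseq_def image_comp mono)
  also have "\<dots> = (SUP k. \<integral>\<^sup>+\<omega>. (\<Sum>z\<in>PP i \<omega>. U k (tw \<omega> z)) \<partial>M)"
    using sum_atoms_measurable_nn'[OF i seq(1)]
    by (intro nn_integral_monotone_convergence_SUP) (auto simp: incseq_def le_fun_def mono intro!: sum_mono)
  also have "\<dots> = (SUP k. \<integral>\<^sup>+\<omega>. \<integral>\<^sup>+z. U k (tw \<omega> z) \<partial>mark_space G \<partial>M)"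
    unfolding seq(5) ..
  also have "\<dots> = (\<integral>\<^sup>+\<omega>. (SUP k. \<integral>\<^sup>+z. U k (tw \<omega> z) \<partial>mark_space G) \<partial>M)"
    using m3 by (intro nn_integral_monotone_convergence_SUP[symmetric]) (auto simp: incseq_def le_fun_def mono intro!: nn_integral_mono)
  also have "\<dots> = (\<integral>\<^sup>+\<omega>. \<integral>\<^sup>+z. (SUP k. U k) (tw \<omega> z) \<partial>mark_space G \<partial>M)"
    using m2 by (intro nn_integral_cong)
      (subst nn_integral_monotone_convergence_SUP[symmetric], auto simp: incseq_def le_fun_def mono image_comp)
  finally show ?case .
qed

end

text \<open>Induction on the number of jump times up to \<open>t\<close>: the path is followed back
  to a time just before its last jump. Only finitely many candidate times matter, and at a candidate
  time the path may also stay constant.\<close>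

lemma step_function_telescope:
  fixes x :: "real \<Rightarrow> 'b" and \<phi> :: "'b \<Rightarrow> real"
  assumes fin: "finite J" and J: "J \<subseteq> {0<..}"
    and step: "\<And>r t. 0 \<le> r \<Longrightarrow> r \<le> t \<Longrightarrow> t \<le> T \<Longrightarrow> {r<..t} \<inter> J = {} \<Longrightarrow> x r = x t"
    and left: "\<And>s. s \<in> J \<Longrightarrow> s \<le> T \<Longrightarrow> \<exists>r\<^sub>0<s. \<forall>r. 0 \<le> r \<longrightarrow> r\<^sub>0 < r \<longrightarrow> r < s \<longrightarrow> x r = xm s"
    and t: "0 \<le> t" "t \<le> T"
  shows "\<phi> (x t) = \<phi> (x 0) + (\<Sum>s\<in>{s\<in>J. s \<le> t}. \<phi> (x s) - \<phi> (xm s))"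
  using t
proof (induction "card {s\<in>J. s \<le> t}" arbitrary: t)
  case 0
  then have e: "{s\<in>J. s \<le> t} = {}" using fin by simp
  then have "x 0 = x t" using 0 by (intro step) auto
  then show ?case unfolding e by simp
next
  case (Suc n)
  let ?K = "{s\<in>J. s \<le> t}"
  have finK: "finite ?K" using fin by simp
  have "?K \<noteq> {}" using Suc(2) by force
  define s where "s = Max ?K"
  have s: "s \<in> ?K" unfolding s_def using finK \<open>?K \<noteq> {}\<close> by (rule Max_in)
  have smax: "r \<le> s" if "r \<in> ?K" for r unfolding s_def using finK that by (rule Max_ge)
  have s': "s \<in> J" "s \<le> t" "0 < s" using s J by auto
  have "{s<..t} \<inter> J = {}"
  proof (rule equals0I)
    fix r assume "r \<in> {s<..t} \<inter> J"
    then have "r \<le> s" "s < r" using smax[of r] by auto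
    then show False by simp
  qed
  then have "x s = x t" using s' Suc(4) by (intro step) auto
  obtain r0 where r0: "r0 < s" "\<And>r. 0 \<le> r \<Longrightarrow> r0 < r \<Longrightarrow> r < s \<Longrightarrow> x r = xm s"
    using left[of s] s' Suc(4) by auto
  define b where "b = Max (insert (max 0 r0) {r\<in>J. r < s})"
  have finb: "finite (insert (max 0 r0) {r\<in>J. r < s})" using fin by simp
  have b: "b < s" unfolding b_def by (subst Max_less_iff[OF finb]) (use s' r0 in auto)
  have bge: "max 0 r0 \<le> b" "\<And>r. r \<in> J \<Longrightarrow> r < s \<Longrightarrow> r \<le> b"
    unfolding b_def by (rule Max_ge[OF finb], simp)+
  \<comment> \<open>Midway between the last jump time \<open>s\<close> and the largest of 0,
    \<open>r0\<close> and the earlier jump times. At \<open>r\<close> the path has its left limit at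
    \<open>s\<close>, and exactly the jump at \<open>s\<close> is still to come.\<close>
  define r where "r = (b + s) / 2"
  have r: "b < r" "r < s" "0 \<le> r" "r0 < r" using b bge(1) by (auto simp: r_def)
  have K: "{s\<in>J. s \<le> r} = ?K - {s}"
  proof (intro equalityI subsetI)
    fix q assume "q \<in> {s\<in>J. s \<le> r}"
    then show "q \<in> ?K - {s}" using r s' by auto
  next
    fix q assume q: "q \<in> ?K - {s}"
    then have "q \<le> s" "q \<noteq> s" using smax[of q] by auto
    then have "q < s" by simp
    then show "q \<in> {s\<in>J. s \<le> r}" using bge(2)[of q] q r by auto
  qed
  have n: "n = card {s\<in>J. s \<le> r}" unfolding K card_Diff_singleton[OF s] Suc(2)[symmetric] by simp
  have "\<phi> (xm s) = \<phi> (x r)" using r0(2)[of r] r by simp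
  also have "\<dots> = \<phi> (x 0) + (\<Sum>s\<in>?K - {s}. \<phi> (x s) - \<phi> (xm s))"
    unfolding K[symmetric] using r s' Suc(4) by (intro Suc(1) n) auto
  finally show ?case unfolding sum.remove[OF finK s] \<open>x s = x t\<close>[symmetric] by linarith
qed

context game
begin

lemma LINT_bounded:
  fixes g :: "real \<Rightarrow> real"
  assumes "g \<in> borel_measurable \<tau>" "\<And>s. s \<in> {0..T} \<Longrightarrow> \<bar>g s\<bar> \<le> B"
  shows "integrable \<tau> g" "set_integrable \<tau> {..t} g"
proof -
  show "integrable \<tau> g" using assms by (intro tau.integrable_if_bounded[of _ B]) (auto simp: space_time)
  have "{..t} \<inter> {0..T} \<in> sets \<tau>" by (intro time_meas) auto
  then have [measurable]: "(\<lambda>s. indicator {..t} s :: real) \<in> borel_measurable \<tau>"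
    by (simp add: borel_measurable_indicator_iff space_time)
  show "set_integrable \<tau> {..t} g" unfolding set_integrable_def
  proof (rule tau.integrable_if_bounded[of _ "\<bar>B\<bar>"])
    show "(\<lambda>x. indicat_real {..t} x *\<^sub>R g x) \<in> borel_measurable \<tau>" using assms(1) by measurable
    fix s assume "s \<in> space \<tau>"
    then show "\<bar>indicat_real {..t} s *\<^sub>R g s\<bar> \<le> \<bar>B\<bar>"
      using assms(2)[of s] by (auto simp: space_time split: split_indicator)
  qed
qed

lemma indicator_time[measurable]: "(\<lambda>s. indicator {..t} s :: real) \<in> borel_measurable \<tau>"
proof -
  have "{..t} \<inter> {0..T} \<in> sets \<tau>" by (intro time_meas) auto
  then show ?thesis by (simp add: borel_measurable_indicator_iff space_time)
qed

end

context game_basis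
begin

lemma mark_integral_measurable:
  fixes h :: "(real \<times> 'w) \<times> (real^'d) \<Rightarrow> real"
  assumes "h \<in> borel_measurable \<H>"
  shows "(\<lambda>z. LINT u|\<mu>. h (z, u)) \<in> borel_measurable \<P>"
  using assms by (intro U.borel_measurable_lebesgue_integral) simp

lemma mark_integral_bound:
  fixes h :: "(real \<times> 'w) \<times> (real^'d) \<Rightarrow> real"
  assumes "\<And>s \<omega> u. s \<in> {0..T} \<Longrightarrow> \<omega> \<in> space M \<Longrightarrow> u \<in> marks G \<Longrightarrow> \<bar>h ((s, \<omega>), u)\<bar> \<le> B" "0 \<le> B" "s \<in> {0..T}" "\<omega> \<in> space M"
  shows "\<bar>LINT u|\<mu>. h ((s, \<omega>), u)\<bar> \<le> B * \<nu>"
  using U.abs_integral_le_if_bounded[of "\<lambda>u. h ((s, \<omega>), u)" B] assms by (simp add: space_intensity)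

lemma expectation_bound:
  fixes f :: "'w \<Rightarrow> real"
  assumes "\<And>\<omega>. \<omega> \<in> space M \<Longrightarrow> \<bar>f \<omega>\<bar> \<le> B" "0 \<le> B"
  shows "\<bar>expectation f\<bar> \<le> B"
  using abs_integral_le_if_bounded[of f B] assms by (simp add: prob_space)

lemma section_omega: "s \<in> {0..T} \<Longrightarrow> g \<in> borel_measurable \<P> \<Longrightarrow> (\<lambda>\<omega>. g (s, \<omega>)) \<in> borel_measurable M"
  by (rule measurable_compose[OF measurable_Pair1' pred_measurable_pair]) (simp_all add: space_time)

lemma expectation_measurable:
  fixes g :: "real \<times> 'w \<Rightarrow> real"
  assumes "g \<in> borel_measurable \<P>"
  shows "(\<lambda>s. LINT \<omega>|M. g (s, \<omega>)) \<in> borel_measurable \<tau>"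
  using pred_measurable_pair[OF assms] by (intro borel_measurable_lebesgue_integral) simp

lemma expectation_time_swap:
  fixes g :: "real \<times> 'w \<Rightarrow> real"
  assumes g: "g \<in> borel_measurable (\<tau> \<Otimes>\<^sub>M M)" and b: "\<And>s \<omega>. s \<in> {0..T} \<Longrightarrow> \<omega> \<in> space M \<Longrightarrow> \<bar>g (s, \<omega>)\<bar> \<le> B"
  shows "(LINT \<omega>|M. LINT s|\<tau>. g (s, \<omega>)) = (LINT s|\<tau>. LINT \<omega>|M. g (s, \<omega>))"
proof -
  interpret P: pair_sigma_finite \<tau> M ..
  interpret PP: finite_measure "\<tau> \<Otimes>\<^sub>M M" by (rule finite_measure_pair_measure) unfold_locales
  have "integrable (\<tau> \<Otimes>\<^sub>M M) g"
    using g b by (intro PP.integrable_if_bounded[of _ B]) (auto simp: space_pair_measure space_time)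
  then show ?thesis using P.Fubini_integral[of "\<lambda>s \<omega>. g (s, \<omega>)"] by simp
qed

end

section \<open>Expectations of sums over atoms with bounded real integrands\<close>

context good_basis
begin

lemma sum_atoms_measurable:
  fixes h :: "(real \<times> 'w) \<times> (real^'d) \<Rightarrow> real"
  assumes i: "i \<in> I" and t: "t \<in> {0..T}" and h: "h \<in> borel_measurable \<H>"
  shows "(\<lambda>\<omega>. \<Sum>z\<in>PPt i t \<omega>. h (tw \<omega> z)) \<in> borel_measurable (F t)"
proof -
  have *: "(\<lambda>\<omega>. \<Sum>z\<in>PPt i t \<omega>. max 0 (g (tw \<omega> z))) \<in> borel_measurable (F t)"
    if g: "g \<in> borel_measurable \<H>" for g :: "(real \<times> 'w) \<times> (real^'d) \<Rightarrow> real"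
  proof -
    have m: "(\<lambda>\<omega>. enn2real (\<Sum>z\<in>PP i \<omega>. ennreal (g (tw \<omega> z)) * indicator {..t} (fst z))) \<in> borel_measurable (F t)"
      using sum_atoms_measurable_nn[OF i t, of "\<lambda>x. ennreal (g x)"] g by measurable
    show ?thesis
    proof (rule measurable_cong[THEN iffD2, OF _ m])
      fix \<omega> assume "\<omega> \<in> space (F t)"
      then have \<omega>: "\<omega> \<in> space M" by (simp add: space_F[OF t])
      have "(\<Sum>z\<in>PP i \<omega>. ennreal (g (tw \<omega> z)) * indicator {..t} (fst z)) = (\<Sum>z\<in>PPt i t \<omega>. ennreal (max 0 (g (tw \<omega> z))))"
        unfolding sum.inter_filter[OF finite_PP[OF i \<omega>]] by (intro sum.cong) (auto simp: indicator_def max_def ennreal_neg)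
      also have "\<dots> = ennreal (\<Sum>z\<in>PPt i t \<omega>. max 0 (g (tw \<omega> z)))" by (rule sum_ennreal) simp
      finally show "(\<Sum>z\<in>PPt i t \<omega>. max 0 (g (tw \<omega> z))) =
          enn2real (\<Sum>z\<in>PP i \<omega>. ennreal (g (tw \<omega> z)) * indicator {..t} (fst z))"
        by (simp add: sum_nonneg)
    qed
  qed
  have "(\<lambda>\<omega>. (\<Sum>z\<in>PPt i t \<omega>. max 0 (h (tw \<omega> z))) - (\<Sum>z\<in>PPt i t \<omega>. max 0 (- h (tw \<omega> z)))) \<in> borel_measurable (F t)"
    using *[OF h] *[of "\<lambda>x. - h x"] h by measurable
  moreover have "(\<Sum>z\<in>PPt i t \<omega>. max 0 (h (tw \<omega> z))) - (\<Sum>z\<in>PPt i t \<omega>. max 0 (- h (tw \<omega> z)))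
      = (\<Sum>z\<in>PPt i t \<omega>. h (tw \<omega> z))" for \<omega>
    unfolding sum_subtractf[symmetric] by (intro sum.cong) auto
  ultimately show ?thesis by simp
qed

lemma compensation_nonneg:
  fixes h :: "(real \<times> 'w) \<times> (real^'d) \<Rightarrow> real"
  assumes i: "i \<in> I" and t: "t \<in> {0..T}" and h: "h \<in> borel_measurable \<H>"
    and b: "\<And>s \<omega> u. s \<in> {0..T} \<Longrightarrow> \<omega> \<in> space M \<Longrightarrow> u \<in> marks G \<Longrightarrow> 0 \<le> h ((s, \<omega>), u) \<and> h ((s, \<omega>), u) \<le> B"
    and B: "0 \<le> B"
  shows "has_bochner_integral M (\<lambda>\<omega>. \<Sum>z\<in>PPt i t \<omega>. h (tw \<omega> z)) (LINT s:{..t}|\<tau>. LINT \<omega>|M. LINT u|\<mu>. h ((s, \<omega>), u))"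
proof (rule has_bochner_integral_nn_integral)
  have mem: "0 \<le> h (tw \<omega> z)" if "\<omega> \<in> space M" "z \<in> PP i \<omega>" for z \<omega>
    using b[of "fst z" \<omega> "snd z"] PP_mem[OF i that] that by auto
  show "(\<lambda>\<omega>. \<Sum>z\<in>PPt i t \<omega>. h (tw \<omega> z)) \<in> borel_measurable M"
    using sum_atoms_measurable[OF i t h] t by (rule measurable_F[rotated])
  show "AE \<omega> in M. 0 \<le> (\<Sum>z\<in>PPt i t \<omega>. h (tw \<omega> z))"
    using mem by (intro AE_I2 sum_nonneg) auto
  define H where "H z = (LINT u|\<mu>. h (z, u))" for z
  have Hm: "H \<in> borel_measurable \<P>" unfolding H_def by (rule mark_integral_measurable[OF h])
  have Hb: "0 \<le> H (s, \<omega>) \<and> H (s, \<omega>) \<le> B * \<nu>" if "s \<in> {0..T}" "\<omega> \<in> space M" for s \<omega>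
  proof
    show "0 \<le> H (s, \<omega>)" unfolding H_def using b[OF that] by (intro integral_nonneg_AE AE_I2) (auto simp: space_intensity)
    have "\<bar>H (s, \<omega>)\<bar> \<le> B * \<nu>" unfolding H_def using b B that by (intro mark_integral_bound) (auto simp: abs_le_iff intro: order_trans)
    then show "H (s, \<omega>) \<le> B * \<nu>" by simp
  qed
  show "0 \<le> (LINT s:{..t}|\<tau>. LINT \<omega>|M. LINT u|\<mu>. h ((s, \<omega>), u))"
    unfolding H_def[symmetric] set_LINT_def
  proof (intro integral_nonneg_AE AE_I2)
    fix s assume "s \<in> space \<tau>"
    then have "0 \<le> (LINT \<omega>|M. H (s, \<omega>))" using Hb by (intro integral_nonneg_AE AE_I2) (auto simp: space_time)
    then show "0 \<le> indicator {..t} s *\<^sub>R (LINT \<omega>|M. H (s, \<omega>))" by simp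
  qed
  define W where "W z = ennreal (h z) * ennreal (indicator {..t} (fst (fst z)))" for z
  have Wm: "W \<in> borel_measurable \<H>"
    unfolding W_def using h measurable_compose[OF fst_compose[OF fst_pred] indicator_time[of t]] by measurable
  have "(\<integral>\<^sup>+\<omega>. ennreal (\<Sum>z\<in>PPt i t \<omega>. h (tw \<omega> z)) \<partial>M) = (\<integral>\<^sup>+\<omega>. (\<Sum>z\<in>PP i \<omega>. W (tw \<omega> z)) \<partial>M)"
  proof (rule nn_integral_cong)
    fix \<omega> assume \<omega>: "\<omega> \<in> space M"
    have "ennreal (\<Sum>z\<in>PPt i t \<omega>. h (tw \<omega> z)) = (\<Sum>z\<in>PPt i t \<omega>. ennreal (h (tw \<omega> z)))"
      using mem[OF \<omega>] by (intro sum_ennreal[symmetric]) auto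
    also have "\<dots> = (\<Sum>z\<in>PP i \<omega>. W (tw \<omega> z))"
      using finite_PP[OF i \<omega>] by (subst sum.inter_filter) (auto intro!: sum.cong simp: W_def indicator_def)
    finally show "ennreal (\<Sum>z\<in>PPt i t \<omega>. h (tw \<omega> z)) = (\<Sum>z\<in>PP i \<omega>. W (tw \<omega> z))" .
  qed
  also have "\<dots> = (\<integral>\<^sup>+\<omega>. \<integral>\<^sup>+z. W (tw \<omega> z) \<partial>mark_space G \<partial>M)" by (rule compensation_nn[OF i Wm])
  also have "\<dots> = (\<integral>\<^sup>+\<omega>. \<integral>\<^sup>+s. ennreal (indicator {..t} s * H (s, \<omega>)) \<partial>\<tau> \<partial>M)"
  proof (rule nn_integral_cong)
    fix \<omega> assume \<omega>: "\<omega> \<in> space M"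
    have m1: "(\<lambda>z. W (tw \<omega> z)) \<in> borel_measurable (mark_space G)"
      using measurable_compose[OF sec_predU[OF \<omega>] Wm] .
    have "(\<integral>\<^sup>+z. W (tw \<omega> z) \<partial>mark_space G) = (\<integral>\<^sup>+s. \<integral>\<^sup>+u. W ((s, \<omega>), u) \<partial>\<mu> \<partial>\<tau>)"
      using U.nn_integral_fst[OF m1] by simp
    also have "\<dots> = (\<integral>\<^sup>+s. ennreal (indicator {..t} s * H (s, \<omega>)) \<partial>\<tau>)"
    proof (rule nn_integral_cong)
      fix s assume "s \<in> space \<tau>"
      then have s: "s \<in> {0..T}" by (simp add: space_time)
      have m2: "(\<lambda>u. h ((s, \<omega>), u)) \<in> borel_measurable \<mu>"
        using measurable_compose[OF measurable_Pair1' h, of "(s, \<omega>)"] s \<omega> by (simp add: space_pred)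
      have "(\<integral>\<^sup>+u. ennreal (h ((s, \<omega>), u)) \<partial>\<mu>) = ennreal (H (s, \<omega>))" unfolding H_def
        using b[OF s \<omega>] m2 by (intro nn_integral_eq_integral U.integrable_if_bounded[of _ B]) (auto simp: space_intensity)
      moreover have "(\<integral>\<^sup>+u. W ((s, \<omega>), u) \<partial>\<mu>) = (\<integral>\<^sup>+u. ennreal (h ((s, \<omega>), u)) \<partial>\<mu>) * ennreal (indicator {..t} s)"
        unfolding W_def fst_conv using m2 by (intro nn_integral_multc) auto
      ultimately show "(\<integral>\<^sup>+u. W ((s, \<omega>), u) \<partial>\<mu>) = ennreal (indicator {..t} s * H (s, \<omega>))"
        using Hb[OF s \<omega>] by (simp add: ennreal_mult mult.commute)
    qed
    finally show "(\<integral>\<^sup>+z. W (tw \<omega> z) \<partial>mark_space G) = (\<integral>\<^sup>+s. ennreal (indicator {..t} s * H (s, \<omega>)) \<partial>\<tau>)" .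
  qed
  also have "\<dots> = (\<integral>\<^sup>+s. \<integral>\<^sup>+\<omega>. ennreal (indicator {..t} s * H (s, \<omega>)) \<partial>M \<partial>\<tau>)"
  proof -
    interpret P: pair_sigma_finite \<tau> M ..
    have [measurable]: "H \<in> borel_measurable (\<tau> \<Otimes>\<^sub>M M)" by (rule pred_measurable_pair[OF Hm])
    show ?thesis by (rule P.Fubini') measurable
  qed
  also have "\<dots> = (\<integral>\<^sup>+s. ennreal (indicator {..t} s * (LINT \<omega>|M. H (s, \<omega>))) \<partial>\<tau>)"
  proof (rule nn_integral_cong)
    fix s assume "s \<in> space \<tau>"
    then have s: "s \<in> {0..T}" by (simp add: space_time)
    have "integrable M (\<lambda>\<omega>. H (s, \<omega>))"
      using Hb[OF s] section_omega[OF s Hm] by (intro integrable_if_bounded[of _ "B * \<nu>"]) auto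
    then have "(\<integral>\<^sup>+\<omega>. ennreal (indicator {..t} s * H (s, \<omega>)) \<partial>M) = ennreal (LINT \<omega>|M. indicator {..t} s * H (s, \<omega>))"
      using Hb[OF s] by (intro nn_integral_eq_integral) auto
    then show "(\<integral>\<^sup>+\<omega>. ennreal (indicator {..t} s * H (s, \<omega>)) \<partial>M) = ennreal (indicator {..t} s * (LINT \<omega>|M. H (s, \<omega>)))" by simp
  qed
  also have "\<dots> = ennreal (LINT s|\<tau>. indicator {..t} s * (LINT \<omega>|M. H (s, \<omega>)))"
  proof (rule nn_integral_eq_integral)
    have EH: "0 \<le> (LINT \<omega>|M. H (s, \<omega>))" "\<bar>LINT \<omega>|M. H (s, \<omega>)\<bar> \<le> B * \<nu>" if s: "s \<in> {0..T}" for s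
    proof -
      show "0 \<le> (LINT \<omega>|M. H (s, \<omega>))" using Hb[OF s] by (intro integral_nonneg_AE AE_I2) auto
      show "\<bar>LINT \<omega>|M. H (s, \<omega>)\<bar> \<le> B * \<nu>" using Hb[OF s] B by (intro expectation_bound) auto
    qed
    show "integrable \<tau> (\<lambda>s. indicator {..t} s * (LINT \<omega>|M. H (s, \<omega>)))"
      using LINT_bounded(2)[OF expectation_measurable[OF Hm] EH(2)] by (simp add: set_integrable_def)
    show "AE s in \<tau>. 0 \<le> indicator {..t} s * (LINT \<omega>|M. H (s, \<omega>))"
      using EH(1) by (intro AE_I2) (auto simp: space_time)
  qed
  finally show "(\<integral>\<^sup>+\<omega>. ennreal (\<Sum>z\<in>PPt i t \<omega>. h (tw \<omega> z)) \<partial>M) = ennreal (LINT s:{..t}|\<tau>. LINT \<omega>|M. LINT u|\<mu>. h ((s, \<omega>), u))"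
    by (simp add: set_LINT_def H_def)
qed

text \<open>Adding the bound \<open>B\<close> makes the integrand nonnegative; the formula for the
  constant \<open>B\<close> is subtracted afterwards, both expectations being finite.\<close>

lemma compensation:
  fixes h :: "(real \<times> 'w) \<times> (real^'d) \<Rightarrow> real"
  assumes i: "i \<in> I" and t: "t \<in> {0..T}" and h: "h \<in> borel_measurable \<H>"
    and b: "\<And>s \<omega> u. s \<in> {0..T} \<Longrightarrow> \<omega> \<in> space M \<Longrightarrow> u \<in> marks G \<Longrightarrow> \<bar>h ((s, \<omega>), u)\<bar> \<le> B"
    and B: "0 \<le> B"
  shows "has_bochner_integral M (\<lambda>\<omega>. \<Sum>z\<in>PPt i t \<omega>. h (tw \<omega> z)) (LINT s:{..t}|\<tau>. LINT \<omega>|M. LINT u|\<mu>. h ((s, \<omega>), u))"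
proof -
  have m1: "(\<lambda>x. h x + B) \<in> borel_measurable \<H>" using h by measurable
  have "has_bochner_integral M (\<lambda>\<omega>. \<Sum>z\<in>PPt i t \<omega>. h (tw \<omega> z) + B) (LINT s:{..t}|\<tau>. LINT \<omega>|M. LINT u|\<mu>. h ((s, \<omega>), u) + B)"
    by (rule compensation_nonneg[OF i t m1, where B = "2 * B"]) (use b B in \<open>fastforce simp: abs_le_iff\<close>, use B in simp)
  moreover have "has_bochner_integral M (\<lambda>\<omega>. \<Sum>z\<in>PPt i t \<omega>. B) (LINT s:{..t}|\<tau>. LINT \<omega>|M. LINT u|\<mu>. B)"
    using B compensation_nonneg[OF i t, of "\<lambda>_. B" B] by simp
  ultimately have *: "has_bochner_integral M (\<lambda>\<omega>. (\<Sum>z\<in>PPt i t \<omega>. h (tw \<omega> z) + B) - (\<Sum>z\<in>PPt i t \<omega>. B))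
     ((LINT s:{..t}|\<tau>. LINT \<omega>|M. LINT u|\<mu>. h ((s, \<omega>), u) + B) - (LINT s:{..t}|\<tau>. LINT \<omega>|M. LINT u|\<mu>. B))"
    by (rule has_bochner_integral_diff)
  define H where "H z = (LINT u|\<mu>. h (z, u))" for z
  have Hm: "H \<in> borel_measurable \<P>" unfolding H_def by (rule mark_integral_measurable[OF h])
  have Hb: "\<bar>H (s, \<omega>)\<bar> \<le> B * \<nu>" if "s \<in> {0..T}" "\<omega> \<in> space M" for s \<omega>
    unfolding H_def using b B that by (intro mark_integral_bound) auto
  have E: "(LINT \<omega>|M. LINT u|\<mu>. h ((s, \<omega>), u) + B) = (LINT \<omega>|M. H (s, \<omega>)) + B * \<nu>" if s: "s \<in> {0..T}" for s
  proof -
    have "(LINT u|\<mu>. h ((s, \<omega>), u) + B) = H (s, \<omega>) + B * \<nu>" if \<omega>: "\<omega> \<in> space M" for \<omega>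
    proof -
      have "(\<lambda>u. h ((s, \<omega>), u)) \<in> borel_measurable \<mu>"
        using measurable_compose[OF measurable_Pair1' h, of "(s, \<omega>)"] s \<omega> by (simp add: space_pred)
      then have "integrable \<mu> (\<lambda>u. h ((s, \<omega>), u))"
        using b[OF s \<omega>] by (intro U.integrable_if_bounded[of _ B]) (auto simp: space_intensity)
      then show ?thesis unfolding H_def by (simp add: space_intensity)
    qed
    then have "(LINT \<omega>|M. LINT u|\<mu>. h ((s, \<omega>), u) + B) = (LINT \<omega>|M. H (s, \<omega>) + B * \<nu>)"
      by (intro LINT_cong) auto
    also have "\<dots> = (LINT \<omega>|M. H (s, \<omega>)) + B * \<nu>"
      using Hb[OF s] section_omega[OF s Hm] by (subst LINT_add)
        (auto intro!: integrable_if_bounded[of _ "B * \<nu>"] simp: prob_space)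
    finally show ?thesis .
  qed
  have i1: "set_integrable \<tau> {..t} (\<lambda>s. LINT \<omega>|M. H (s, \<omega>))"
    using B Hb by (intro LINT_bounded(2)[OF expectation_measurable[OF Hm], of "B * \<nu>"] expectation_bound) auto
  have i2: "set_integrable \<tau> {..t} (\<lambda>s. B * \<nu>)" by (rule LINT_bounded(2)[of _ "B * \<nu>"]) (use B in auto)
  have "(LINT s:{..t}|\<tau>. LINT \<omega>|M. LINT u|\<mu>. h ((s, \<omega>), u) + B) = (LINT s:{..t}|\<tau>. (LINT \<omega>|M. H (s, \<omega>)) + B * \<nu>)"
    unfolding set_LINT_def by (intro LINT_cong) (auto simp: E space_time)
  also have "\<dots> = (LINT s:{..t}|\<tau>. LINT \<omega>|M. H (s, \<omega>)) + (LINT s:{..t}|\<tau>. B * \<nu>)"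
    using i1 i2 by (rule set_integral_add)
  also have "(LINT s:{..t}|\<tau>. B * \<nu>) = (LINT s:{..t}|\<tau>. LINT \<omega>|M. LINT u|\<mu>. B)"
    by (simp add: prob_space space_intensity mult.commute)
  finally show ?thesis using * by (simp add: sum.distrib H_def)
qed

end

section \<open>Jump systems and Dynkin's formula\<close>

definition at_state :: "'d::finite \<Rightarrow> int \<Rightarrow> real" where
  "at_state j x = (if x = state_of j then 1 else 0)"

text \<open>The generator of the controlled chain applied to the indicator of one state: the
  intensity of jumps into the state minus the intensity of jumps out of it.\<close>

definition rate :: "('a, 'd::finite) game \<Rightarrow> 'd \<Rightarrow> real \<Rightarrow> int \<Rightarrow> 'a \<Rightarrow> real^'d \<Rightarrow> real" where
  "rate G j s x a p = (LINT u|intensity G. at_state j (x + jump G s x u a p) - at_state j x)"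

lemma state_of_mem: "state_of (j :: 'd::finite) \<in> {1..int CARD('d)}"
  and state_of_inj: "state_of (j :: 'd) = state_of j' \<longleftrightarrow> j = j'"
  and state_of_cases: "x \<in> {1..int CARD('d)} \<Longrightarrow> \<exists>j :: 'd. x = state_of j"
  using bij_betw_state_of[where 'd = 'd] unfolding bij_betw_def inj_on_def by auto

lemma at_state_bounds: "0 \<le> at_state j x" "at_state j x \<le> 1" "at_state j x ^ 2 = at_state j x"
  by (auto simp: at_state_def)

lemma sum_at_state:
  fixes f :: "int \<Rightarrow> real"
  assumes "x \<in> {1..int CARD('d::finite)}"
  shows "(\<Sum>j\<in>UNIV. at_state (j :: 'd) x * f (state_of j)) = f x"
proof -
  obtain k :: 'd where k: "x = state_of k" using state_of_cases[OF assms] by blast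
  have "(\<Sum>j\<in>UNIV. at_state (j :: 'd) x * f (state_of j)) = (\<Sum>j\<in>UNIV. if j = k then f x else 0)"
    by (intro sum.cong) (auto simp: at_state_def k state_of_inj)
  then show ?thesis by simp
qed

lemma sum_at_state_1:
  assumes "x \<in> {1..int CARD('d::finite)}"
  shows "(\<Sum>j\<in>UNIV. at_state (j :: 'd) x) = 1"
  using sum_at_state[OF assms, of "\<lambda>_. 1"] by simp

lemma norm_le_sum_abs: "norm (p - q :: real^'d::finite) \<le> (\<Sum>j\<in>UNIV. \<bar>p $ j - q $ j\<bar>)"
  using norm_le_l1_cart[of "p - q"] by simp

lemma empirical_eq: "empirical N x $ j = (\<Sum>i\<in>{1..N}. at_state j (x i)) / real N"
proof -
  have "(\<Sum>i\<in>{1..N}. at_state j (x i)) = real (card {i\<in>{1..N}. x i = state_of j})"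
    unfolding at_state_def by (subst sum.inter_filter[symmetric]) auto
  then show ?thesis by (simp add: empirical_def)
qed

lemma empirical_simplex:
  assumes "1 \<le> N" "\<And>i. i \<in> {1..N} \<Longrightarrow> x i \<in> {1..int CARD('d::finite)}"
  shows "(empirical N x :: real^'d) \<in> prob_simplex"
proof -
  have "(\<Sum>j\<in>UNIV. (empirical N x :: real^'d) $ j) = (\<Sum>i\<in>{1..N}. \<Sum>j\<in>UNIV. at_state (j :: 'd) (x i)) / real N"
    unfolding empirical_eq sum_divide_distrib[symmetric] by (subst sum.swap) simp
  also have "\<dots> = (\<Sum>i\<in>{1..N}. 1) / real N"
    using assms(2) by (intro arg_cong[where f = "\<lambda>x. x / real N"] sum.cong sum_at_state_1) auto
  finally show ?thesis using assms(1)
    by (auto simp: prob_simplex_def empirical_eq intro!: divide_nonneg_nonneg sum_nonneg at_state_bounds)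
qed

lemma simplex_bounds: "p \<in> prob_simplex \<Longrightarrow> 0 \<le> p $ j \<and> p $ j \<le> 1"
proof
  assume p: "p \<in> prob_simplex"
  then show "0 \<le> p $ j" by (auto simp: prob_simplex_def)
  have "p $ j \<le> (\<Sum>j\<in>UNIV. p $ j)" using p by (intro member_le_sum) (auto simp: prob_simplex_def)
  then show "p $ j \<le> 1" using p by (auto simp: prob_simplex_def)
qed

locale regular_game = game G for G :: "('a::metric_space, 'd::finite) game" +
  fixes K1 K2 :: real
  assumes dyn: "regular_dynamics G K1" and cst: "regular_costs G K2"
begin

lemma jump_section:
  assumes "t \<in> {0..T}" "x \<in> states G" "a \<in> actions G" "p \<in> prob_simplex"
  shows "(\<lambda>u. jump G t x u a p) \<in> \<mu> \<rightarrow>\<^sub>M count_space UNIV"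
proof -
  have "(\<lambda>u. (t, x, u, a, p)) \<in> \<mu> \<rightarrow>\<^sub>M jump_space"
    using assms by (intro measurable_Pair measurable_const measurable_ident) (auto simp: space_time space_restrict_space)
  from measurable_compose[OF this jump_measurable] show ?thesis by simp
qed

lemma jump_abs_le:
  assumes "t \<in> {0..T}" "x \<in> states G" "u \<in> marks G" "a \<in> actions G" "p \<in> prob_simplex"
  shows "\<bar>real_of_int (jump G t x u a p)\<bar> \<le> real CARD('d)" "x + jump G t x u a p \<in> states G"
proof -
  have *: "jump G t x u a p \<in> {1 - x..int CARD('d) - x}" using jump_range assms by blast
  then show "x + jump G t x u a p \<in> states G" by (auto simp: states_def)
  have "\<bar>jump G t x u a p\<bar> \<le> int CARD('d)" using * assms(2) by (auto simp: states_def)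
  then show "\<bar>real_of_int (jump G t x u a p)\<bar> \<le> real CARD('d)" by linarith
qed

lemma jump_diff_integrable:
  assumes "t \<in> {0..T}" "x \<in> states G" "y \<in> states G" "a \<in> actions G" "p \<in> prob_simplex" "q \<in> prob_simplex"
  shows "integrable \<mu> (\<lambda>u. \<bar>real_of_int (jump G t x u a p) - real_of_int (jump G t y u a q)\<bar>)"
proof (rule U.integrable_if_bounded[of _ "2 * real CARD('d)"])
  have [measurable]: "(\<lambda>u. real_of_int (jump G t x u a p)) \<in> borel_measurable \<mu>" "(\<lambda>u. real_of_int (jump G t y u a q)) \<in> borel_measurable \<mu>"
    using measurable_compose[OF jump_section, of t x a p real_of_int borel] measurable_compose[OF jump_section, of t y a q real_of_int borel] assms by auto
  show "(\<lambda>u. \<bar>real_of_int (jump G t x u a p) - real_of_int (jump G t y u a q)\<bar>) \<in> borel_measurable \<mu>" by measurable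
  show "\<bar>\<bar>real_of_int (jump G t x u a p) - real_of_int (jump G t y u a q)\<bar>\<bar> \<le> 2 * real CARD('d)" if "u \<in> space \<mu>" for u
    using jump_abs_le(1)[of t x u a p] jump_abs_le(1)[of t y u a q] assms that by (simp add: space_intensity)
qed

text \<open>Two systems are always compared under the same action, so the distance of the actions
  drops out. The sign of \<open>K1\<close> is open; with its absolute value the bound can be
  enlarged and multiplied.\<close>

lemma jump_lipschitz:
  assumes "t \<in> {0..T}" "x \<in> states G" "y \<in> states G" "a \<in> actions G" "p \<in> prob_simplex" "q \<in> prob_simplex"
  shows "(LINT u|\<mu>. \<bar>real_of_int (jump G t x u a p) - real_of_int (jump G t y u a q)\<bar>) \<le> \<bar>K1\<bar> * (\<bar>real_of_int (x - y)\<bar> + norm (p - q))"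
proof -
  have "(LINT u|\<mu>. \<bar>real_of_int (jump G t x u a p) - real_of_int (jump G t y u a q)\<bar>) \<le> K1 * (\<bar>real_of_int (x - y)\<bar> + norm (p - q) + dist a a)"
    using dyn assms unfolding regular_dynamics_def by blast
  also have "\<dots> \<le> \<bar>K1\<bar> * (\<bar>real_of_int (x - y)\<bar> + norm (p - q) + dist a a)" by (intro mult_right_mono) auto
  finally show ?thesis by simp
qed

lemma rate_bound: "\<bar>rate G j s x a p\<bar> \<le> \<nu>"
proof -
  have "\<bar>at_state j (x + jump G s x u a p) - at_state j x\<bar> \<le> 1" for u
    by (auto simp: at_state_def)
  then show ?thesis unfolding rate_def
    using U.abs_integral_le_if_bounded[of "\<lambda>u. at_state j (x + jump G s x u a p) - at_state j x" 1] by (simp add: space_intensity)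
qed

lemma at_state_jump_measurable:
  assumes "t \<in> {0..T}" "x \<in> states G" "a \<in> actions G" "p \<in> prob_simplex"
  shows "(\<lambda>u. at_state j (x + jump G t x u a p) - at_state j x) \<in> borel_measurable \<mu>"
  using measurable_compose[OF jump_section[OF assms], of "\<lambda>y. at_state j (x + y) - at_state j x" borel] by simp

text \<open>Jumps are integers. Two of them that lead to different values of an indicator differ by
  at least 1, so the difference of the indicators is bounded by the difference of the jumps.\<close>

lemma rate_lipschitz:
  assumes "t \<in> {0..T}" "x \<in> states G" "a \<in> actions G" "p \<in> prob_simplex" "q \<in> prob_simplex"
  shows "\<bar>rate G j t x a p - rate G j t x a q\<bar> \<le> \<bar>K1\<bar> * norm (p - q)"
proof -
  have i: "integrable \<mu> (\<lambda>u. at_state j (x + jump G t x u a r) - at_state j x)" if "r \<in> prob_simplex" for r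
    using assms that by (intro U.integrable_if_bounded[of _ 1] at_state_jump_measurable) (auto simp: at_state_def)
  have "\<bar>rate G j t x a p - rate G j t x a q\<bar> \<le> (LINT u|\<mu>. \<bar>(at_state j (x + jump G t x u a p) - at_state j x) - (at_state j (x + jump G t x u a q) - at_state j x)\<bar>)"
    unfolding rate_def by (subst LINT_diff[symmetric]) (use i assms in \<open>auto intro: integral_abs_bound\<close>)
  also have "\<dots> \<le> (LINT u|\<mu>. \<bar>real_of_int (jump G t x u a p) - real_of_int (jump G t x u a q)\<bar>)"
    using assms by (intro integral_mono jump_diff_integrable integrable_abs Bochner_Integration.integrable_diff i) (auto simp: at_state_def)
  also have "\<dots> \<le> \<bar>K1\<bar> * (\<bar>real_of_int (x - x)\<bar> + norm (p - q))" using assms by (intro jump_lipschitz)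
  finally show ?thesis by simp
qed

end

text \<open>One setting for all systems that occur: the environment \<open>p\<close> is any
  predictable simplex-valued process, be it the empirical measure of the players or the
  deterministic flow of the mean field game, and the controls are any predictable processes. The
  state equation is stated as a finite sum over atoms.\<close>

locale jump_system = good_basis G M F I \<N> + regular_game G K1 K2
  for G :: "('a::metric_space, 'd::finite) game" and M :: "'w measure" and F I \<N> K1 K2 +
  fixes \<xi> :: "nat \<Rightarrow> 'w \<Rightarrow> int" and X :: "nat \<Rightarrow> real \<Rightarrow> 'w \<Rightarrow> int" and \<alpha> :: "nat \<Rightarrow> real \<Rightarrow> 'w \<Rightarrow> 'a"
    and p :: "real \<Rightarrow> 'w \<Rightarrow> real^'d"
  assumes init: "\<And>i. i \<in> I \<Longrightarrow> initial_state G M F (\<xi> i)"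
    and X: "\<And>i. i \<in> I \<Longrightarrow> state_process G M F (X i)"
    and \<alpha>: "\<And>i. i \<in> I \<Longrightarrow> predictable_control G M F (\<alpha> i)"
    and p: "(\<lambda>(s, \<omega>). p s \<omega>) \<in> \<P> \<rightarrow>\<^sub>M simplex_space"
    and state_eq: "\<And>i \<omega> t. i \<in> I \<Longrightarrow> \<omega> \<in> space M \<Longrightarrow> t \<in> {0..T} \<Longrightarrow> real_of_int (X i t \<omega>) = real_of_int (\<xi> i \<omega>) +
       (\<Sum>z\<in>PPt i t \<omega>. real_of_int (jump G (fst z) (left_state (X i) (fst z) \<omega>) (snd z) (\<alpha> i (fst z) \<omega>) (p (fst z) \<omega>)))"
begin

abbreviation "Xm i s \<omega> \<equiv> left_state (X i) s \<omega>"

definition jmp :: "nat \<Rightarrow> (real \<times> 'w) \<times> (real^'d) \<Rightarrow> int" where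
  "jmp i = (\<lambda>((s, \<omega>), u). jump G s (Xm i s \<omega>) u (\<alpha> i s \<omega>) (p s \<omega>))"

lemma X_states: "i \<in> I \<Longrightarrow> \<omega> \<in> space M \<Longrightarrow> t \<in> {0..T} \<Longrightarrow> X i t \<omega> \<in> states G"
  by (rule state_process_states[OF X])

lemma Xm_states: "i \<in> I \<Longrightarrow> \<omega> \<in> space M \<Longrightarrow> t \<in> {0..T} \<Longrightarrow> Xm i t \<omega> \<in> states G"
  by (rule left_state_states[OF X])

lemma Xm_pred: "i \<in> I \<Longrightarrow> (\<lambda>z. Xm i (fst z) (snd z)) \<in> \<P> \<rightarrow>\<^sub>M state_space"
  using left_state_predictable[OF X] by (simp add: case_prod_beta')

lemma \<alpha>_pred: "i \<in> I \<Longrightarrow> (\<lambda>z. \<alpha> i (fst z) (snd z)) \<in> \<P> \<rightarrow>\<^sub>M action_space G"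
  using \<alpha> by (simp add: predictable_control_def case_prod_beta')

lemma p_pred: "(\<lambda>z. p (fst z) (snd z)) \<in> \<P> \<rightarrow>\<^sub>M simplex_space"
  using p by (simp add: case_prod_beta')

lemma \<alpha>_actions: "i \<in> I \<Longrightarrow> \<omega> \<in> space M \<Longrightarrow> t \<in> {0..T} \<Longrightarrow> \<alpha> i t \<omega> \<in> actions G"
  using measurable_space[OF \<alpha>_pred, of i "(t, \<omega>)"] by (simp add: space_pred space_restrict_space)

lemma p_simplex: "\<omega> \<in> space M \<Longrightarrow> t \<in> {0..T} \<Longrightarrow> p t \<omega> \<in> prob_simplex"
  using measurable_space[OF p_pred, of "(t, \<omega>)"] by (simp add: space_pred space_restrict_space)

lemma jmp_measurable: "i \<in> I \<Longrightarrow> jmp i \<in> \<H> \<rightarrow>\<^sub>M count_space UNIV"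
proof -
  assume i: "i \<in> I"
  have "(\<lambda>z. (fst (fst z), Xm i (fst (fst z)) (snd (fst z)), snd z, \<alpha> i (fst (fst z)) (snd (fst z)), p (fst (fst z)) (snd (fst z))))
    \<in> \<H> \<rightarrow>\<^sub>M jump_space"
    by (intro measurable_Pair measurable_snd fst_compose[OF fst_pred] fst_compose[OF Xm_pred[OF i]]
      fst_compose[OF \<alpha>_pred[OF i]] fst_compose[OF p_pred])
  from measurable_compose[OF this jump_measurable] show ?thesis by (simp add: jmp_def case_prod_beta')
qed

lemma Xm_real[measurable]: "i \<in> I \<Longrightarrow> (\<lambda>z. real_of_int (Xm i (fst z) (snd z))) \<in> borel_measurable \<P>"
  by (rule measurable_compose[OF Xm_pred]) auto

lemma jmp_real[measurable]: "i \<in> I \<Longrightarrow> (\<lambda>z. real_of_int (jmp i z)) \<in> borel_measurable \<H>"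
  by (rule measurable_compose[OF jmp_measurable]) auto

lemma X_init: "i \<in> I \<Longrightarrow> \<omega> \<in> space M \<Longrightarrow> X i 0 \<omega> = \<xi> i \<omega>"
proof -
  assume i: "i \<in> I" "\<omega> \<in> space M"
  have e: "PPt i 0 \<omega> = {}" by (auto dest: PP_mem[OF i])
  show ?thesis using state_eq[OF i, of 0] T_pos unfolding e by simp
qed

lemma X_const:
  assumes i: "i \<in> I" "\<omega> \<in> space M" and rt: "0 \<le> r" "r \<le> t" "t \<le> T" and no: "{r<..t} \<inter> fst ` PP i \<omega> = {}"
  shows "X i r \<omega> = X i t \<omega>"
proof -
  have "PPt i r \<omega> = PPt i t \<omega>"
  proof (intro equalityI subsetI)
    fix z assume z: "z \<in> PPt i t \<omega>"
    then have "fst z \<notin> {r<..t}" using no by auto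
    then show "z \<in> PPt i r \<omega>" using z by auto
  qed (use rt in auto)
  then have "real_of_int (X i r \<omega>) = real_of_int (X i t \<omega>)"
    using state_eq[OF i, of r] state_eq[OF i, of t] rt by simp
  then show ?thesis by simp
qed

lemma X_left:
  assumes i: "i \<in> I" "\<omega> \<in> space M" and s: "0 < s" "s \<le> T"
  obtains r\<^sub>0 where "r\<^sub>0 < s" "\<And>r. r\<^sub>0 < r \<Longrightarrow> r < s \<Longrightarrow> X i r \<omega> = Xm i s \<omega>"
  using path_eventually_left[OF X[OF i(1)] i(2) s] unfolding eventually_at_left_field by blast

lemma X_left_all:
  assumes \<omega>: "\<omega> \<in> space M" and s: "0 < s" "s \<le> T"
  obtains r\<^sub>0 where "r\<^sub>0 < s" "\<And>r i. i \<in> I \<Longrightarrow> r\<^sub>0 < r \<Longrightarrow> r < s \<Longrightarrow> X i r \<omega> = Xm i s \<omega>"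
proof -
  have "eventually (\<lambda>r. \<forall>i\<in>I. X i r \<omega> = Xm i s \<omega>) (at_left s)"
    using finI path_eventually_left[OF X \<omega> s] by (subst eventually_ball_finite_distrib) auto
  with that show ?thesis unfolding eventually_at_left_field by blast
qed

lemma PP_gap:
  assumes i: "i \<in> I" "\<omega> \<in> space M" and s: "0 < s" "r\<^sub>0 < s"
  obtains r where "r\<^sub>0 < r" "0 \<le> r" "r < s" "{r<..<s} \<inter> fst ` PP i \<omega> = {}"
proof -
  define b where "b = Max (insert (max 0 r\<^sub>0) {q\<in>fst ` PP i \<omega>. q < s})"
  have fin: "finite (insert (max 0 r\<^sub>0) {q\<in>fst ` PP i \<omega>. q < s})" using finite_PP[OF i] by simp
  have b: "b < s" unfolding b_def by (subst Max_less_iff[OF fin]) (use s in auto)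
  have ge: "max 0 r\<^sub>0 \<le> b" "\<And>q. q \<in> fst ` PP i \<omega> \<Longrightarrow> q < s \<Longrightarrow> q \<le> b"
    unfolding b_def by (rule Max_ge[OF fin], simp)+
  show ?thesis
  proof (rule that[of "(b + s) / 2"])
    show "{(b + s) / 2<..<s} \<inter> fst ` PP i \<omega> = {}"
    proof (rule equals0I)
      fix q assume q: "q \<in> {(b + s) / 2<..<s} \<inter> fst ` PP i \<omega>"
      then have "q \<le> b" using ge(2)[of q] by auto
      with q b show False by auto
    qed
  qed (use b ge(1) in auto)
qed

lemma X_no_jump:
  assumes i: "i \<in> I" "\<omega> \<in> space M" and s: "0 \<le> s" "s \<le> T" and no: "s \<notin> fst ` PP i \<omega>"
  shows "X i s \<omega> = Xm i s \<omega>"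
proof (cases "s = 0")
  case True then show ?thesis by (simp add: left_lim_def)
next
  case False
  then have s0: "0 < s" using s by simp
  obtain r0 where r0: "r0 < s" "\<And>r. r0 < r \<Longrightarrow> r < s \<Longrightarrow> X i r \<omega> = Xm i s \<omega>" using X_left[OF i s0 s(2)] by blast
  obtain r where r: "r0 < r" "0 \<le> r" "r < s" "{r<..<s} \<inter> fst ` PP i \<omega> = {}" using PP_gap[OF i s0 r0(1)] by blast
  have "{r<..s} = insert s {r<..<s}" using r by auto
  then have "{r<..s} \<inter> fst ` PP i \<omega> = {}" using r(4) no by auto
  then have "X i r \<omega> = X i s \<omega>" using r s by (intro X_const[OF i]) auto
  with r0(2)[of r] r show ?thesis by simp
qed

lemma X_jump:
  assumes i: "i \<in> I" "\<omega> \<in> space M" and z: "z \<in> PP i \<omega>"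
  shows "X i (fst z) \<omega> = Xm i (fst z) \<omega> + jmp i (tw \<omega> z)"
proof -
  have s: "0 < fst z" "fst z \<le> T" using PP_mem[OF i z] by auto
  obtain r0 where r0: "r0 < fst z" "\<And>r. r0 < r \<Longrightarrow> r < fst z \<Longrightarrow> X i r \<omega> = Xm i (fst z) \<omega>" using X_left[OF i s] by blast
  obtain r where r: "r0 < r" "0 \<le> r" "r < fst z" "{r<..<fst z} \<inter> fst ` PP i \<omega> = {}" using PP_gap[OF i s(1) r0(1)] by blast
  \<comment> \<open>No atom of the player lies strictly between \<open>r\<close> and the time of
    \<open>z\<close>, and \<open>z\<close> is its only atom at that time; so the state equations at
    the two times differ by one summand.\<close>
  have K: "PPt i (fst z) \<omega> = insert z (PPt i r \<omega>)"
  proof (intro equalityI subsetI)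
    fix q assume q: "q \<in> PPt i (fst z) \<omega>"
    show "q \<in> insert z (PPt i r \<omega>)"
    proof (cases "fst q = fst z")
      case True
      then show ?thesis using PP_inj[OF i(1) i(1) i(2), of q z] q z by auto
    next
      case False
      then have "fst q < fst z" using q by auto
      moreover have "fst q \<notin> {r<..<fst z}" using q r(4) by auto
      ultimately show ?thesis using q by auto
    qed
  qed (use z r in auto)
  have fin: "finite (PPt i r \<omega>)" using finite_PP[OF i] by simp
  have "real_of_int (X i (fst z) \<omega>) = real_of_int (X i r \<omega>) + real_of_int (jmp i (tw \<omega> z))"
    using state_eq[OF i, of "fst z"] state_eq[OF i, of r] s r fin unfolding K by (simp add: jmp_def)
  then show ?thesis using r0(2)[of r] r by linarith
qed

text \<open>A fixed time carries an atom with probability 0. Inside expectations at a fixed time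
  states and left limits are therefore interchangeable.\<close>

lemma X_eq_Xm_AE:
  assumes s: "s \<in> {0..T}"
  shows "AE \<omega> in M. \<forall>i\<in>I. X i s \<omega> = Xm i s \<omega>"
proof -
  have "AE \<omega> in M. emeasure (\<N> i \<omega>) ({s} \<times> marks G) = 0" if "i \<in> I" for i
    using poisson_variable.AE_eq_0[OF poisson_variableI[OF prm[OF that] measure_section(1)]] measure_section(2)[of s] s by auto
  then have "AE \<omega> in M. \<forall>i\<in>I. emeasure (\<N> i \<omega>) ({s} \<times> marks G) = 0" using finI by (intro AE_finite_allI) auto
  with AE_space show ?thesis
  proof eventually_elim
    case (elim \<omega>)
    show ?case
    proof
      fix i assume i: "i \<in> I"
      have "s \<notin> fst ` PP i \<omega>"
      proof
        assume "s \<in> fst ` PP i \<omega>"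
        then obtain z where z: "z \<in> PP i \<omega>" "fst z = s" by auto
        have sub: "{z} \<subseteq> {s} \<times> marks G" using PP_mem[OF i elim(1) z(1)] z(2) by (cases z) auto
        have "emeasure (\<N> i \<omega>) {z} \<le> emeasure (\<N> i \<omega>) ({s} \<times> marks G)"
          using sub measure_section(1)[of s] s sets_noise[OF prm[OF i] elim(1)] by (intro emeasure_mono) auto
        then show False using elim(2) i z(1) by (auto simp: atoms_def)
      qed
      then show "X i s \<omega> = Xm i s \<omega>" using X_no_jump[OF i elim(1)] s by auto
    qed
  qed
qed

text \<open>The coordinates outside \<open>I\<close> are frozen at 0, so that test functions on
  infinite sequences only see the players of the system.\<close>

definition xv :: "real \<Rightarrow> 'w \<Rightarrow> nat \<Rightarrow> int" where "xv t \<omega> i = (if i \<in> I then X i t \<omega> else 0)"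
definition xmv :: "real \<Rightarrow> 'w \<Rightarrow> nat \<Rightarrow> int" where "xmv t \<omega> i = (if i \<in> I then Xm i t \<omega> else 0)"

text \<open>Jump times of different players are distinct, hence each jump changes one coordinate of
  the state vector while the others keep their left limits. The telescoping sum over all jump times
  splits into one sum per player.\<close>

lemma dynkin_path:
  fixes \<phi> :: "(nat \<Rightarrow> int) \<Rightarrow> real"
  assumes \<omega>: "\<omega> \<in> space M" and t: "t \<in> {0..T}"
  shows "\<phi> (xv t \<omega>) = \<phi> (xv 0 \<omega>) + (\<Sum>i\<in>I. \<Sum>z\<in>PPt i t \<omega>.
     \<phi> ((xmv (fst z) \<omega>)(i := Xm i (fst z) \<omega> + jmp i (tw \<omega> z))) - \<phi> (xmv (fst z) \<omega>))"
proof -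
  define J where "J = (\<Union>i\<in>I. fst ` PP i \<omega>)"
  have finJ: "finite J" unfolding J_def using finI finite_PP[OF _ \<omega>] by auto
  have J0: "J \<subseteq> {0<..}" unfolding J_def using PP_mem[OF _ \<omega>] by fastforce
  have "\<phi> (xv t \<omega>) = \<phi> (xv 0 \<omega>) + (\<Sum>s\<in>{s\<in>J. s \<le> t}. \<phi> (xv s \<omega>) - \<phi> (xmv s \<omega>))"
  proof (rule step_function_telescope[OF finJ J0, where T = T and x = "\<lambda>t. xv t \<omega>" and xm = "\<lambda>s. xmv s \<omega>" and \<phi> = \<phi>])
    fix r t assume rt: "0 \<le> r" "r \<le> t" "t \<le> T" "{r<..t} \<inter> J = {}"
    have "X i r \<omega> = X i t \<omega>" if i: "i \<in> I" for i
    proof (rule X_const[OF i \<omega> rt(1-3)])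
      show "{r<..t} \<inter> fst ` PP i \<omega> = {}" using rt(4) i unfolding J_def by blast
    qed
    then show "xv r \<omega> = xv t \<omega>" by (auto simp: xv_def fun_eq_iff)
  next
    fix s assume s: "s \<in> J" "s \<le> T"
    then have "0 < s" using J0 by auto
    obtain r0 where "r0 < s" "\<And>r i. i \<in> I \<Longrightarrow> r0 < r \<Longrightarrow> r < s \<Longrightarrow> X i r \<omega> = Xm i s \<omega>"
      using X_left_all[OF \<omega> \<open>0 < s\<close> s(2)] by blast
    then show "\<exists>r\<^sub>0<s. \<forall>r. 0 \<le> r \<longrightarrow> r\<^sub>0 < r \<longrightarrow> r < s \<longrightarrow> xv r \<omega> = xmv s \<omega>"
      by (intro exI[of _ r0]) (auto simp: xv_def xmv_def fun_eq_iff)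
  qed (use t in auto)
  also have "{s\<in>J. s \<le> t} = (\<Union>i\<in>I. fst ` PPt i t \<omega>)" unfolding J_def by auto
  also have "(\<Sum>s\<in>(\<Union>i\<in>I. fst ` PPt i t \<omega>). \<phi> (xv s \<omega>) - \<phi> (xmv s \<omega>)) =
     (\<Sum>i\<in>I. \<Sum>s\<in>fst ` PPt i t \<omega>. \<phi> (xv s \<omega>) - \<phi> (xmv s \<omega>))"
  proof (rule sum.UNION_disjoint[OF finI])
    show "\<forall>i\<in>I. finite (fst ` PPt i t \<omega>)" using finite_PP[OF _ \<omega>] by auto
    have "fst ` PPt i t \<omega> \<inter> fst ` PPt j t \<omega> = {}" if "i \<in> I" "j \<in> I" "i \<noteq> j" for i j
      using PP_inj[OF that(1,2) \<omega>] that(3) by fastforce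
    then show "\<forall>i\<in>I. \<forall>j\<in>I. i \<noteq> j \<longrightarrow> fst ` PPt i t \<omega> \<inter> fst ` PPt j t \<omega> = {}" by blast
  qed
  also have "\<dots> = (\<Sum>i\<in>I. \<Sum>z\<in>PPt i t \<omega>.
     \<phi> ((xmv (fst z) \<omega>)(i := Xm i (fst z) \<omega> + jmp i (tw \<omega> z))) - \<phi> (xmv (fst z) \<omega>))"
  proof (rule sum.cong[OF refl])
    fix i assume i: "i \<in> I"
    have inj: "inj_on fst (PPt i t \<omega>)" using PP_inj[OF i i \<omega>] by (auto intro!: inj_onI)
    have upd: "xv (fst z) \<omega> = (xmv (fst z) \<omega>)(i := Xm i (fst z) \<omega> + jmp i (tw \<omega> z))" if z: "z \<in> PPt i t \<omega>" for z
    proof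
      fix k
      have zi: "z \<in> PP i \<omega>" using z by simp
      show "xv (fst z) \<omega> k = ((xmv (fst z) \<omega>)(i := Xm i (fst z) \<omega> + jmp i (tw \<omega> z))) k"
      proof (cases "k = i \<or> k \<notin> I")
        case True then show ?thesis using i X_jump[OF i \<omega> zi] by (auto simp: xv_def xmv_def)
      next
        case False
        then have k: "k \<in> I" "k \<noteq> i" by auto
        have "fst z \<notin> fst ` PP k \<omega>"
        proof
          assume "fst z \<in> fst ` PP k \<omega>"
          then obtain z' where "z' \<in> PP k \<omega>" "fst z = fst z'" by auto
          from PP_inj[OF i k(1) \<omega> zi this] k show False by simp
        qed
        then have "X k (fst z) \<omega> = Xm k (fst z) \<omega>" using PP_mem[OF i \<omega> zi] by (intro X_no_jump[OF k(1) \<omega>]) auto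
        then show ?thesis using k by (simp add: xv_def xmv_def)
      qed
    qed
    show "(\<Sum>s\<in>fst ` PPt i t \<omega>. \<phi> (xv s \<omega>) - \<phi> (xmv s \<omega>)) = (\<Sum>z\<in>PPt i t \<omega>.
     \<phi> ((xmv (fst z) \<omega>)(i := Xm i (fst z) \<omega> + jmp i (tw \<omega> z))) - \<phi> (xmv (fst z) \<omega>))"
      unfolding sum.reindex[OF inj] comp_def by (intro sum.cong) (auto simp: upd)
  qed
  finally show ?thesis .
qed

text \<open>The increments of the test function appear as a separate \<open>\<Phi>\<close>, which
  has to agree with them only on the actual range of times, outcomes and marks. Measurability and
  bounds can then be checked on a convenient formula instead of on an arbitrary function of the
  state vector.\<close>

lemma expectation_dynkin:
  fixes \<phi> :: "(nat \<Rightarrow> int) \<Rightarrow> real"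
  assumes t: "t \<in> {0..T}"
    and \<Phi>: "\<And>i. i \<in> I \<Longrightarrow> \<Phi> i \<in> borel_measurable \<H>"
    and b: "\<And>i s \<omega> u. i \<in> I \<Longrightarrow> s \<in> {0..T} \<Longrightarrow> \<omega> \<in> space M \<Longrightarrow> u \<in> marks G \<Longrightarrow> \<bar>\<Phi> i ((s, \<omega>), u)\<bar> \<le> B" and B: "0 \<le> B"
    and eq: "\<And>i s \<omega> u. i \<in> I \<Longrightarrow> s \<in> {0..T} \<Longrightarrow> \<omega> \<in> space M \<Longrightarrow> u \<in> marks G \<Longrightarrow>
      \<Phi> i ((s, \<omega>), u) = \<phi> ((xmv s \<omega>)(i := Xm i s \<omega> + jmp i ((s, \<omega>), u))) - \<phi> (xmv s \<omega>)"
    and int0: "integrable M (\<lambda>\<omega>. \<phi> (xv 0 \<omega>))"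
  shows "integrable M (\<lambda>\<omega>. \<phi> (xv t \<omega>))"
    "expectation (\<lambda>\<omega>. \<phi> (xv t \<omega>)) = expectation (\<lambda>\<omega>. \<phi> (xv 0 \<omega>)) +
      (LINT s:{..t}|\<tau>. LINT \<omega>|M. (\<Sum>i\<in>I. LINT u|\<mu>. \<Phi> i ((s, \<omega>), u)))"
proof -
  have hb: "has_bochner_integral M (\<lambda>\<omega>. \<Sum>i\<in>I. \<Sum>z\<in>PPt i t \<omega>. \<Phi> i (tw \<omega> z))
     (\<Sum>i\<in>I. LINT s:{..t}|\<tau>. LINT \<omega>|M. LINT u|\<mu>. \<Phi> i ((s, \<omega>), u))"
    by (rule has_bochner_integral_sum, rule compensation[OF _ t \<Phi> b B])
  have path: "\<phi> (xv t \<omega>) = \<phi> (xv 0 \<omega>) + (\<Sum>i\<in>I. \<Sum>z\<in>PPt i t \<omega>. \<Phi> i (tw \<omega> z))" if \<omega>: "\<omega> \<in> space M" for \<omega>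
  proof -
    have "(\<Sum>z\<in>PPt i t \<omega>. \<phi> ((xmv (fst z) \<omega>)(i := Xm i (fst z) \<omega> + jmp i (tw \<omega> z))) - \<phi> (xmv (fst z) \<omega>)) =
      (\<Sum>z\<in>PPt i t \<omega>. \<Phi> i (tw \<omega> z))" if i: "i \<in> I" for i
      by (rule sum.cong[OF refl], subst eq[OF i]) (auto simp: \<omega> dest: PP_mem[OF i \<omega>])
    then show ?thesis unfolding dynkin_path[OF \<omega> t, of \<phi>] by simp
  qed
  have "integrable M (\<lambda>\<omega>. \<phi> (xv 0 \<omega>) + (\<Sum>i\<in>I. \<Sum>z\<in>PPt i t \<omega>. \<Phi> i (tw \<omega> z)))"
    using int0 hb by (auto simp: has_bochner_integral_iff)
  then show "integrable M (\<lambda>\<omega>. \<phi> (xv t \<omega>))" by (rule Bochner_Integration.integrable_cong[THEN iffD2, rotated 2]) (auto simp: path)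
  have "expectation (\<lambda>\<omega>. \<phi> (xv t \<omega>)) = expectation (\<lambda>\<omega>. \<phi> (xv 0 \<omega>) + (\<Sum>i\<in>I. \<Sum>z\<in>PPt i t \<omega>. \<Phi> i (tw \<omega> z)))"
    by (rule LINT_cong) (auto simp: path)
  also have "\<dots> = expectation (\<lambda>\<omega>. \<phi> (xv 0 \<omega>)) + (\<Sum>i\<in>I. LINT s:{..t}|\<tau>. LINT \<omega>|M. LINT u|\<mu>. \<Phi> i ((s, \<omega>), u))"
    using int0 hb by (subst LINT_add) (auto simp: has_bochner_integral_iff)
  also have "(\<Sum>i\<in>I. LINT s:{..t}|\<tau>. LINT \<omega>|M. LINT u|\<mu>. \<Phi> i ((s, \<omega>), u)) = (LINT s:{..t}|\<tau>. \<Sum>i\<in>I. LINT \<omega>|M. LINT u|\<mu>. \<Phi> i ((s, \<omega>), u))"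
    unfolding set_LINT_def scaleR_sum_right
  proof (rule LINT_sum[symmetric], fold set_integrable_def)
    fix i assume i: "i \<in> I"
    show "set_integrable \<tau> {..t} (\<lambda>s. LINT \<omega>|M. LINT u|\<mu>. \<Phi> i ((s, \<omega>), u))"
      using expectation_measurable[OF mark_integral_measurable[OF \<Phi>[OF i]]] b[OF i] B
      by (intro LINT_bounded(2)[of _ "B * \<nu>"] expectation_bound mark_integral_bound) auto
  qed
  also have "\<dots> = (LINT s:{..t}|\<tau>. LINT \<omega>|M. (\<Sum>i\<in>I. LINT u|\<mu>. \<Phi> i ((s, \<omega>), u)))"
    unfolding set_LINT_def
  proof (intro LINT_cong refl arg_cong[where f = "\<lambda>x. indicator {..t} _ *\<^sub>R x"])
    fix s assume "s \<in> space \<tau>"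
    then have s: "s \<in> {0..T}" by (simp add: space_time)
    show "(\<Sum>i\<in>I. LINT \<omega>|M. LINT u|\<mu>. \<Phi> i ((s, \<omega>), u)) = (LINT \<omega>|M. (\<Sum>i\<in>I. LINT u|\<mu>. \<Phi> i ((s, \<omega>), u)))"
    proof (rule LINT_sum[symmetric])
      fix i assume i: "i \<in> I"
      show "integrable M (\<lambda>\<omega>. LINT u|\<mu>. \<Phi> i ((s, \<omega>), u))"
        using section_omega[OF s mark_integral_measurable[OF \<Phi>[OF i]]] b[OF i] B s
        by (intro integrable_if_bounded[of _ "B * \<nu>"] mark_integral_bound) auto
    qed
  qed
  finally show "expectation (\<lambda>\<omega>. \<phi> (xv t \<omega>)) = expectation (\<lambda>\<omega>. \<phi> (xv 0 \<omega>)) +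
      (LINT s:{..t}|\<tau>. LINT \<omega>|M. (\<Sum>i\<in>I. LINT u|\<mu>. \<Phi> i ((s, \<omega>), u)))" .
qed

end

section \<open>Concentration of the empirical measure\<close>

context game
begin

lemma time_mult:
  fixes f g P Q :: "real \<Rightarrow> real"
  assumes f: "f \<in> borel_measurable \<tau>" "\<And>s. s \<in> {0..T} \<Longrightarrow> \<bar>f s\<bar> \<le> B"
    and g: "g \<in> borel_measurable \<tau>" "\<And>s. s \<in> {0..T} \<Longrightarrow> \<bar>g s\<bar> \<le> B'"
    and P: "\<And>s. s \<in> {0..T} \<Longrightarrow> P s = P\<^sub>0 + (LINT r:{..s}|\<tau>. f r)"
    and Q: "\<And>s. s \<in> {0..T} \<Longrightarrow> Q s = Q\<^sub>0 + (LINT r:{..s}|\<tau>. g r)"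
    and t: "t \<in> {0..T}"
  shows "P t * Q t = P\<^sub>0 * Q\<^sub>0 + (LINT s:{..t}|\<tau>. f s * Q s + P s * g s)"
proof (rule indefinite_integral_mult[of \<tau> f g B B'])
  show "finite_measure \<tau>" by unfold_locales
  show "{..t} \<inter> space \<tau> \<in> sets \<tau>" "{..<t} \<inter> space \<tau> \<in> sets \<tau>" for t
    by (auto simp: space_time intro!: time_meas)
  show "AE r in \<tau>. r \<noteq> s" for s
    by (subst AE_restrict_space_iff) (auto intro: AE_mp[OF AE_lborel_singleton[of s]])
  show "(\<lambda>(r, s). indicat_real {..s} r) \<in> borel_measurable (\<tau> \<Otimes>\<^sub>M \<tau>)"
  proof -
    have 1: "(\<lambda>z. fst z) \<in> borel_measurable (\<tau> \<Otimes>\<^sub>M \<tau>)" "(\<lambda>z. snd z) \<in> borel_measurable (\<tau> \<Otimes>\<^sub>M \<tau>)"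
      by (rule fst_compose[OF measurable_restrict_space1], simp,
          rule snd_compose[OF measurable_restrict_space1], simp)
    have "(\<lambda>z. if fst z \<le> snd z then 1 else 0 :: real) \<in> borel_measurable (\<tau> \<Otimes>\<^sub>M \<tau>)"
      using 1 by measurable
    then show ?thesis by (rule measurable_cong[THEN iffD2, rotated]) (auto simp: indicator_def)
  qed
qed (use assms in \<open>auto simp: space_time\<close>)

lemma flow_measurable: "m \<in> flows G \<Longrightarrow> m \<in> \<tau> \<rightarrow>\<^sub>M simplex_space"
proof (rule measurable_restrict_space2)
  assume m: "m \<in> flows G"
  then have "continuous_on {0..T} m" unfolding flows_def by (auto intro: lipschitz_on_continuous_on)
  then have "m \<in> borel_measurable (restrict_space borel {0..T})" by (rule borel_measurable_continuous_on_restrict)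
  then show "m \<in> borel_measurable \<tau>"
    by (simp cong: measurable_cong_sets add: sets_restrict_space)
qed (auto simp: flows_def space_time)

lemma flow_simplex: "m \<in> flows G \<Longrightarrow> t \<in> {0..T} \<Longrightarrow> m t \<in> prob_simplex"
  by (auto simp: flows_def)

lemma set_LINT_mono:
  fixes f g :: "real \<Rightarrow> real"
  assumes "f \<in> borel_measurable \<tau>" "\<And>s. s \<in> {0..T} \<Longrightarrow> \<bar>f s\<bar> \<le> B"
    "g \<in> borel_measurable \<tau>" "\<And>s. s \<in> {0..T} \<Longrightarrow> \<bar>g s\<bar> \<le> B'" "\<And>s. s \<in> {0..T} \<Longrightarrow> f s \<le> g s"
  shows "(LINT s:{..t}|\<tau>. f s) \<le> (LINT s:{..t}|\<tau>. g s)"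
  using LINT_bounded(2)[OF assms(1,2), of t] LINT_bounded(2)[OF assms(3,4), of t] assms(5)
  unfolding set_LINT_def set_integrable_def
  by (intro integral_mono) (auto simp: space_time split: split_indicator)

lemma set_LINT_const_le: "0 \<le> c \<Longrightarrow> (LINT s:{..t}|\<tau>. c) \<le> c * T"
proof -
  assume c: "0 \<le> c"
  have "\<bar>LINT s:{..t}|\<tau>. c\<bar> \<le> c * measure \<tau> (space \<tau>)"
    unfolding set_LINT_def using c by (intro tau.abs_integral_le_if_bounded) (auto split: split_indicator)
  also have "measure \<tau> (space \<tau>) = T"
    using T_pos by (simp add: measure_restrict_space space_restrict_space)
  finally show ?thesis by simp
qed

end

context regular_game
begin

lemma rate_time_measurable:
  assumes \<gamma>: "(\<lambda>(t, x). \<gamma> t x) \<in> \<tau> \<Otimes>\<^sub>M state_space \<rightarrow>\<^sub>M action_space G" and m: "m \<in> flows G" and x: "x \<in> states G"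
  shows "(\<lambda>s. rate G j s x (\<gamma> s x) (m s)) \<in> borel_measurable \<tau>"
proof -
  have g: "(\<lambda>s. \<gamma> s x) \<in> \<tau> \<rightarrow>\<^sub>M action_space G"
    using measurable_compose[OF measurable_Pair[OF measurable_ident measurable_const] \<gamma>, of x] x by simp
  have "(\<lambda>z. (fst z, x, snd z, \<gamma> (fst z) x, m (fst z))) \<in> \<tau> \<Otimes>\<^sub>M \<mu> \<rightarrow>\<^sub>M
      jump_space"
    using x by (intro measurable_Pair measurable_fst measurable_snd measurable_const
      fst_compose[OF g] fst_compose[OF flow_measurable[OF m]]) auto
  from measurable_compose[OF this jump_measurable]
  have "(\<lambda>z. jump G (fst z) x (snd z) (\<gamma> (fst z) x) (m (fst z))) \<in> \<tau> \<Otimes>\<^sub>M \<mu> \<rightarrow>\<^sub>M count_space UNIV" by simp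
  from measurable_compose[OF this, of "\<lambda>y. at_state j (x + y) - at_state j x" borel]
  have "(\<lambda>z. at_state j (x + jump G (fst z) x (snd z) (\<gamma> (fst z) x) (m (fst z))) - at_state j x) \<in> borel_measurable (\<tau> \<Otimes>\<^sub>M \<mu>)"
    by simp
  then show ?thesis unfolding rate_def
    by (intro U.borel_measurable_lebesgue_integral) (simp add: case_prod_beta')
qed

end

lemma sum_fun_upd:
  fixes f :: "int \<Rightarrow> real"
  assumes "finite I" "i \<in> I"
  shows "(\<Sum>k\<in>I. f ((v(i := y)) k)) = (\<Sum>k\<in>I. f (v k)) + (f y - f (v i))"
  using assms by (simp add: sum.remove[of I i])

context jump_system
begin

definition hj :: "nat \<Rightarrow> 'd \<Rightarrow> (real \<times> 'w) \<times> (real^'d) \<Rightarrow> real" where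
  "hj i j z = at_state j (Xm i (fst (fst z)) (snd (fst z)) + jmp i z) - at_state j (Xm i (fst (fst z)) (snd (fst z)))"

lemma hj_measurable: "i \<in> I \<Longrightarrow> hj i j \<in> borel_measurable \<H>"
proof -
  assume i: "i \<in> I"
  have [measurable]: "(\<lambda>z. real_of_int (Xm i (fst (fst z)) (snd (fst z)))) \<in> borel_measurable \<H>"
    by (rule fst_compose[OF Xm_real[OF i]])
  note jmp_real[OF i, measurable]
  have "(\<lambda>z. (if real_of_int (Xm i (fst (fst z)) (snd (fst z))) + real_of_int (jmp i z) = real_of_int (state_of j) then 1 else 0)
     - (if real_of_int (Xm i (fst (fst z)) (snd (fst z))) = real_of_int (state_of j) then 1 else 0 :: real)) \<in> borel_measurable \<H>"
    by measurable
  then show ?thesis unfolding hj_def[abs_def] at_state_def by (simp flip: of_int_add)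
qed

lemma hj_bound: "\<bar>hj i j z\<bar> \<le> 1" by (auto simp: hj_def at_state_def)

lemma hj_rate: "(LINT u|\<mu>. hj i j ((s, \<omega>), u)) = rate G j s (Xm i s \<omega>) (\<alpha> i s \<omega>) (p s \<omega>)"
  by (simp add: hj_def jmp_def rate_def)

lemma rate_pred: "i \<in> I \<Longrightarrow> (\<lambda>z. rate G j (fst z) (Xm i (fst z) (snd z)) (\<alpha> i (fst z) (snd z)) (p (fst z) (snd z))) \<in> borel_measurable \<P>"
  using mark_integral_measurable[OF hj_measurable, of i j] by (simp add: hj_rate[symmetric])

lemma X_measurable: "i \<in> I \<Longrightarrow> t \<in> {0..T} \<Longrightarrow> X i t \<in> M \<rightarrow>\<^sub>M state_space"
  using X[of i] unfolding state_process_def by (blast intro: measurable_F)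

lemma Xm_measurable: "i \<in> I \<Longrightarrow> t \<in> {0..T} \<Longrightarrow> (\<lambda>\<omega>. Xm i t \<omega>) \<in> M \<rightarrow>\<^sub>M state_space"
  using measurable_compose[OF measurable_Pair1' pred_measurable_pair[OF Xm_pred], of t i] by (simp add: space_time)

lemma X_fun_measurable: "i \<in> I \<Longrightarrow> t \<in> {0..T} \<Longrightarrow> (\<lambda>\<omega>. f (X i t \<omega>)) \<in> borel_measurable M"
  and Xm_fun_measurable: "i \<in> I \<Longrightarrow> t \<in> {0..T} \<Longrightarrow> (\<lambda>\<omega>. f (Xm i t \<omega>)) \<in> borel_measurable M"
  using measurable_compose[OF X_measurable, of i t f borel] measurable_compose[OF Xm_measurable, of i t f borel] by simp_all

lemma Xm_fun_pred: "i \<in> I \<Longrightarrow> (\<lambda>z. f (Xm i (fst z) (snd z))) \<in> borel_measurable \<P>"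
  using measurable_compose[OF Xm_pred, of i f borel] by simp

text \<open>Left limits are predictable, hence jointly measurable in time and outcome; this makes
  the law a measurable function of time. At each time it is the law of the state itself by
  \<open>law_of_X\<close>.\<close>

definition law_of :: "nat \<Rightarrow> 'd \<Rightarrow> real \<Rightarrow> real" where
  "law_of i j t = expectation (\<lambda>\<omega>. at_state j (Xm i t \<omega>))"

lemma law_of_X: "i \<in> I \<Longrightarrow> t \<in> {0..T} \<Longrightarrow> law_of i j t = expectation (\<lambda>\<omega>. at_state j (X i t \<omega>))"
  unfolding law_of_def
proof (rule integral_cong_AE)
  assume *: "i \<in> I" "t \<in> {0..T}"
  show "AE \<omega> in M. at_state j (Xm i t \<omega>) = at_state j (X i t \<omega>)"
    using X_eq_Xm_AE[OF *(2)] by eventually_elim (use * in auto)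
qed (auto intro: X_fun_measurable Xm_fun_measurable)

lemma law_of_X_prob: "i \<in> I \<Longrightarrow> t \<in> {0..T} \<Longrightarrow> law_of i j t = prob {\<omega>\<in>space M. X i t \<omega> = state_of j}"
proof -
  assume *: "i \<in> I" "t \<in> {0..T}"
  have "expectation (\<lambda>\<omega>. at_state j (X i t \<omega>)) = expectation (indicator {\<omega>\<in>space M. X i t \<omega> = state_of j})"
    by (rule LINT_cong) (auto simp: at_state_def indicator_def)
  also have "\<dots> = prob ({\<omega>\<in>space M. X i t \<omega> = state_of j} \<inter> space M)" by simp
  also have "{\<omega>\<in>space M. X i t \<omega> = state_of j} \<inter> space M = {\<omega>\<in>space M. X i t \<omega> = state_of j}" by auto
  finally show ?thesis using law_of_X[OF *] by simp
qed

lemma at_state_integrable: "i \<in> I \<Longrightarrow> t \<in> {0..T} \<Longrightarrow> integrable M (\<lambda>\<omega>. at_state j (Xm i t \<omega>))"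
  by (intro integrable_if_bounded[of _ 1] Xm_fun_measurable) (auto simp: at_state_def)

lemma law_of_nonneg: "0 \<le> law_of i j t"
  unfolding law_of_def by (intro integral_nonneg_AE) (auto simp: at_state_def)

lemma sum_law_of: "i \<in> I \<Longrightarrow> t \<in> {0..T} \<Longrightarrow> (\<Sum>j\<in>UNIV. law_of i j t) = 1"
proof -
  assume *: "i \<in> I" "t \<in> {0..T}"
  have "(\<Sum>j\<in>UNIV. law_of i j t) = expectation (\<lambda>\<omega>. \<Sum>j\<in>UNIV. at_state (j :: 'd) (Xm i t \<omega>))"
    unfolding law_of_def using at_state_integrable[OF *] by (intro LINT_sum[symmetric]) auto
  also have "\<dots> = expectation (\<lambda>\<omega>. 1)"
    using Xm_states[OF *(1) _ *(2)] by (intro LINT_cong refl sum_at_state_1) (auto simp: states_def)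
  finally show ?thesis by (simp add: prob_space)
qed

lemma law_of_measurable: "i \<in> I \<Longrightarrow> law_of i j \<in> borel_measurable \<tau>"
  unfolding law_of_def using expectation_measurable[OF Xm_fun_pred, of i "at_state j"] by simp

lemma law_of_0: "i \<in> I \<Longrightarrow> law_of i j 0 = init_law G $ j"
proof -
  assume i: "i \<in> I"
  have "{\<omega>\<in>space M. X i 0 \<omega> = state_of j} = {\<omega>\<in>space M. \<xi> i \<omega> = state_of j}" using X_init[OF i] by auto
  then show ?thesis using law_of_X_prob[OF i, of 0 j] init[OF i] T_pos unfolding initial_state_def by simp
qed

text \<open>Kolmogorov's forward equation in integral form: Dynkin's formula for the indicator of
  one state.\<close>

lemma law_of_eq:
  assumes i: "i \<in> I" and t: "t \<in> {0..T}"
  shows "law_of i j t = init_law G $ j + (LINT s:{..t}|\<tau>. LINT \<omega>|M. rate G j s (Xm i s \<omega>) (\<alpha> i s \<omega>) (p s \<omega>))"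
proof -
  have "expectation (\<lambda>\<omega>. at_state j (xv t \<omega> i)) = expectation (\<lambda>\<omega>. at_state j (xv 0 \<omega> i)) +
      (LINT s:{..t}|\<tau>. LINT \<omega>|M. (\<Sum>k\<in>I. LINT u|\<mu>. (if k = i then hj i j ((s, \<omega>), u) else 0)))"
  \<comment> \<open>The test function reads the coordinate \<open>i\<close> alone, so jumps of the
    other players contribute increment 0.\<close>
  proof (rule expectation_dynkin(2)[OF t, where \<Phi> = "\<lambda>k z. if k = i then hj i j z else 0" and B = 1 and \<phi> = "\<lambda>v. at_state j (v i)"])
    show "integrable M (\<lambda>\<omega>. at_state j (xv 0 \<omega> i))"
      using i T_pos X_fun_measurable[OF i, of 0] by (intro integrable_if_bounded[of _ 1]) (auto simp: xv_def at_state_def)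
  qed (use i hj_measurable[OF i] hj_bound in \<open>auto simp: hj_def xmv_def\<close>)
  also have "(\<lambda>s \<omega>. \<Sum>k\<in>I. LINT u|\<mu>. (if k = i then hj i j ((s, \<omega>), u) else 0)) = (\<lambda>s \<omega>. rate G j s (Xm i s \<omega>) (\<alpha> i s \<omega>) (p s \<omega>))"
  proof (intro ext)
    fix s \<omega>
    have "(\<Sum>k\<in>I. LINT u|\<mu>. (if k = i then hj i j ((s, \<omega>), u) else 0)) = (\<Sum>k\<in>I. if k = i then LINT u|\<mu>. hj i j ((s, \<omega>), u) else 0)"
      by (intro sum.cong) auto
    then show "(\<Sum>k\<in>I. LINT u|\<mu>. (if k = i then hj i j ((s, \<omega>), u) else 0)) = rate G j s (Xm i s \<omega>) (\<alpha> i s \<omega>) (p s \<omega>)"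
      using i finI by (simp add: hj_rate)
  qed
  finally show ?thesis using law_of_X[OF i t, of j] law_of_X[OF i, of 0 j] law_of_0[OF i, of j] T_pos i by (simp add: xv_def)
qed

lemma expectation_state_sum:
  assumes i: "i \<in> I" and s: "s \<in> {0..T}"
  shows "expectation (\<lambda>\<omega>. g (Xm i s \<omega>)) = (\<Sum>y\<in>UNIV. law_of i y s * g (state_of y))"
proof -
  have "expectation (\<lambda>\<omega>. g (Xm i s \<omega>)) = expectation (\<lambda>\<omega>. \<Sum>y\<in>UNIV. at_state (y :: 'd) (Xm i s \<omega>) * g (state_of y))"
    using Xm_states[OF i _ s] by (intro LINT_cong refl sum_at_state[symmetric]) (auto simp: states_def)
  also have "\<dots> = (\<Sum>y\<in>UNIV. law_of i y s * g (state_of y))"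
    unfolding law_of_def using at_state_integrable[OF i s] by (subst LINT_sum) auto
  finally show ?thesis .
qed

text \<open>For a feedback control in a deterministic environment the mean rate depends on the
  process only through its law, and linearly. This closes the forward equation.\<close>

lemma expectation_rate_feedback:
  assumes i: "i \<in> I" and s: "s \<in> {0..T}"
  shows "expectation (\<lambda>\<omega>. rate G j s (Xm i s \<omega>) (\<gamma> s (Xm i s \<omega>)) q) = (\<Sum>y\<in>UNIV. law_of i y s * rate G j s (state_of y) (\<gamma> s (state_of y)) q)"
  by (rule expectation_state_sum[OF i s, of "\<lambda>x. rate G j s x (\<gamma> s x) q"])

end

text \<open>Player \<open>k\<close> is exempt from the feedback rule \<open>fb\<close>; its control
  is any predictable process. The setting thus covers both the profile in which everybody follows
  \<open>\<gamma>\<close> and the one in which \<open>k\<close> deviates. The limit enters through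
  the function \<open>law\<close> alone, without its probability space: all that is used of it is
  the forward equation, the normalisation and the distance to \<open>m\<close>.\<close>

locale players_near_limit = jump_system G M F "{1..N}" \<N> K1 K2 \<xi> X \<alpha> p
  for G :: "('a::metric_space, 'd::finite) game" and M :: "'w measure" and F N \<N> K1 K2 \<xi> X \<alpha> p +
  fixes k :: nat and \<gamma> :: "real \<Rightarrow> int \<Rightarrow> 'a" and m :: "real \<Rightarrow> real^'d" and law :: "'d \<Rightarrow> real \<Rightarrow> real"
  assumes N: "1 \<le> N" and k: "k \<in> {1..N}"
    and emp: "\<And>s \<omega>. s \<in> {0..T} \<Longrightarrow> \<omega> \<in> space M \<Longrightarrow> p s \<omega> = empirical N (\<lambda>i. Xm i s \<omega>)"
    and indep_init: "indep_sets (\<lambda>i. init_sigma M (\<xi> i)) {1..N}"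
    and \<gamma>: "(\<lambda>(t, x). \<gamma> t x) \<in> \<tau> \<Otimes>\<^sub>M state_space \<rightarrow>\<^sub>M action_space G"
    and fb: "\<And>i s \<omega>. i \<in> {1..N} \<Longrightarrow> i \<noteq> k \<Longrightarrow> s \<in> {0..T} \<Longrightarrow> \<omega> \<in> space M \<Longrightarrow> \<alpha> i s \<omega> = \<gamma> s (Xm i s \<omega>)"
    and m: "m \<in> flows G"
    and law_nonneg: "\<And>j t. t \<in> {0..T} \<Longrightarrow> 0 \<le> law j t" and law_sum: "\<And>t. t \<in> {0..T} \<Longrightarrow> (\<Sum>j\<in>UNIV. law j t) = 1"
    and law_meas: "\<And>j. law j \<in> borel_measurable \<tau>"
    and law_eq: "\<And>j t. t \<in> {0..T} \<Longrightarrow> law j t = init_law G $ j +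
       (LINT s:{..t}|\<tau>. \<Sum>y\<in>UNIV. law y s * rate G j s (state_of y) (\<gamma> s (state_of y)) (m s))"
    and law_close: "\<And>t. t \<in> {0..T} \<Longrightarrow> (\<Sum>j\<in>UNIV. \<bar>law j t - m t $ j\<bar>) \<le> 2 / sqrt (real N)"
begin

declare One_nat_def [simp del]

abbreviation "Nr \<equiv> real N"
abbreviation "L \<equiv> \<bar>K1\<bar>"

text \<open>The drift of the limiting law; \<open>Nr * \<Lambda> j s\<close> is what the drift of
  the count is compared with.\<close>

definition \<Lambda> :: "'d \<Rightarrow> real \<Rightarrow> real" where
  "\<Lambda> j s = (\<Sum>y\<in>UNIV. law y s * rate G j s (state_of y) (\<gamma> s (state_of y)) (m s))"

definition nm :: "'d \<Rightarrow> real \<times> 'w \<Rightarrow> real" where "nm j z = (\<Sum>i\<in>{1..N}. at_state j (Xm i (fst z) (snd z)))"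
text \<open>The drift of the count \<open>nm j\<close> in the actual system, with the empirical
  environment and with player \<open>k\<close> included.\<close>

definition A :: "'d \<Rightarrow> real \<times> 'w \<Rightarrow> real" where
  "A j z = (\<Sum>i\<in>{1..N}. rate G j (fst z) (Xm i (fst z) (snd z)) (\<alpha> i (fst z) (snd z)) (p (fst z) (snd z)))"
text \<open>The rate of the predictable quadratic variation of the count. It has no mixed terms
  because players do not jump simultaneously, and so it is only of order \<open>N\<close>.\<close>

definition R :: "'d \<Rightarrow> real \<times> 'w \<Rightarrow> real" where "R j z = (\<Sum>i\<in>{1..N}. LINT u|\<mu>. (hj i j (z, u))\<^sup>2)"
definition w :: "'d \<Rightarrow> real \<times> 'w \<Rightarrow> real" where "w j z = nm j z - Nr * law j (fst z)"

lemma Nr_pos: "1 \<le> Nr" using N by simp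

lemma state_of_states: "state_of (j :: 'd) \<in> states G" using state_of_mem[of j] by (simp add: states_def)

lemma law_le_1: "t \<in> {0..T} \<Longrightarrow> law j t \<le> 1"
  using member_le_sum[of j UNIV "\<lambda>j. law j t"] law_nonneg[of t] law_sum[of t] by auto

lemma \<Lambda>_meas[measurable]: "\<Lambda> j \<in> borel_measurable \<tau>"
  unfolding \<Lambda>_def using law_meas rate_time_measurable[OF \<gamma> m state_of_states] by (intro borel_measurable_sum borel_measurable_times)

lemma \<Lambda>_bound: "s \<in> {0..T} \<Longrightarrow> \<bar>\<Lambda> j s\<bar> \<le> \<nu>"
proof -
  assume s: "s \<in> {0..T}"
  have "\<bar>\<Lambda> j s\<bar> \<le> (\<Sum>y\<in>UNIV. law y s * \<nu>)"
    unfolding \<Lambda>_def using law_nonneg[OF s]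
    by (intro order_trans[OF sum_abs] sum_mono) (auto simp: abs_mult intro!: mult_left_mono rate_bound)
  also have "\<dots> = \<nu>" by (simp add: sum_distrib_right[symmetric] law_sum[OF s])
  finally show ?thesis .
qed

lemma nm_meas: "nm j \<in> borel_measurable \<P>"
  unfolding nm_def using Xm_fun_pred by (intro borel_measurable_sum) auto
lemma A_meas: "A j \<in> borel_measurable \<P>"
  unfolding A_def using rate_pred by (intro borel_measurable_sum) auto
lemma R_meas: "R j \<in> borel_measurable \<P>"
  unfolding R_def using hj_measurable by (intro borel_measurable_sum mark_integral_measurable borel_measurable_power) auto
lemma law_pred: "(\<lambda>z. law j (fst z)) \<in> borel_measurable \<P>" by (rule measurable_compose[OF fst_pred law_meas])
lemma w_meas: "w j \<in> borel_measurable \<P>"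
  unfolding w_def using nm_meas law_pred by measurable

lemma nm_bound: "0 \<le> nm j z \<and> nm j z \<le> Nr"
proof -
  have "nm j z \<le> (\<Sum>i\<in>{1..N}. 1)" unfolding nm_def by (intro sum_mono at_state_bounds)
  then show ?thesis unfolding nm_def by (auto intro!: sum_nonneg at_state_bounds)
qed

lemma A_bound: "\<bar>A j z\<bar> \<le> Nr * \<nu>"
proof -
  have "\<bar>A j z\<bar> \<le> (\<Sum>i\<in>{1..N}. \<nu>)" unfolding A_def by (intro order_trans[OF sum_abs] sum_mono rate_bound)
  then show ?thesis by simp
qed

lemma R_bound: "0 \<le> R j z \<and> R j z \<le> Nr * \<nu>"
proof -
  have "\<bar>LINT u|\<mu>. (hj i j (z, u))\<^sup>2\<bar> \<le> 1 * \<nu>" for i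
    using U.abs_integral_le_if_bounded[of "\<lambda>u. (hj i j (z, u))\<^sup>2" 1] hj_bound[of i j] by (simp add: space_intensity abs_square_le_1)
  then have "R j z \<le> (\<Sum>i\<in>{1..N}. \<nu>)" unfolding R_def by (intro sum_mono) (auto simp: abs_le_iff)
  then show ?thesis unfolding R_def by (auto intro!: sum_nonneg integral_nonneg_AE)
qed

lemma w_bound: "s \<in> {0..T} \<Longrightarrow> \<bar>w j (s, \<omega>)\<bar> \<le> Nr"
proof -
  assume s: "s \<in> {0..T}"
  have "0 \<le> Nr * law j s" using law_nonneg[OF s] by simp
  moreover have "Nr * law j s \<le> Nr * 1" by (intro mult_left_mono law_le_1[OF s]) simp
  ultimately show ?thesis using nm_bound[of j "(s, \<omega>)"] by (auto simp: w_def)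
qed

lemma pred_integrable:
  fixes g :: "real \<times> 'w \<Rightarrow> real"
  assumes "g \<in> borel_measurable \<P>" "\<And>\<omega>. \<omega> \<in> space M \<Longrightarrow> \<bar>g (s, \<omega>)\<bar> \<le> B" "s \<in> {0..T}"
  shows "integrable M (\<lambda>\<omega>. g (s, \<omega>))"
  using section_omega[OF assms(3,1)] assms(2) by (intro integrable_if_bounded) auto

lemma nm_xv: "t \<in> {0..T} \<Longrightarrow> AE \<omega> in M. nm j (t, \<omega>) = (\<Sum>i\<in>{1..N}. at_state j (xv t \<omega> i))"
  using X_eq_Xm_AE[of t] by (auto elim!: eventually_mono simp: nm_def xv_def intro!: sum.cong)

lemma xv_sum_measurable: "t \<in> {0..T} \<Longrightarrow> (\<lambda>\<omega>. \<Sum>i\<in>{1..N}. at_state j (xv t \<omega> i)) \<in> borel_measurable M"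
  using X_fun_measurable by (intro borel_measurable_sum) (auto simp: xv_def)

lemma xv_sum_bound: "\<bar>\<Sum>i\<in>{1..N}. at_state j (xv t \<omega> i)\<bar> \<le> Nr"
proof -
  have "(\<Sum>i\<in>{1..N}. at_state j (xv t \<omega> i)) \<le> (\<Sum>i\<in>{1..N}. 1)" by (intro sum_mono at_state_bounds)
  moreover have "0 \<le> (\<Sum>i\<in>{1..N}. at_state j (xv t \<omega> i))" by (intro sum_nonneg at_state_bounds)
  ultimately show ?thesis by simp
qed

lemma mean_count:
  assumes t: "t \<in> {0..T}"
  shows "expectation (\<lambda>\<omega>. nm j (t, \<omega>)) = Nr * init_law G $ j + (LINT s:{..t}|\<tau>. LINT \<omega>|M. A j (s, \<omega>))"
proof -
  have E: "expectation (\<lambda>\<omega>. nm j (t, \<omega>)) = expectation (\<lambda>\<omega>. \<Sum>i\<in>{1..N}. at_state j (xv t \<omega> i))" if t: "t \<in> {0..T}" for t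
    using nm_xv[OF t, of j] section_omega[OF t nm_meas] xv_sum_measurable[OF t] by (intro integral_cong_AE) auto
  have "expectation (\<lambda>\<omega>. \<Sum>i\<in>{1..N}. at_state j (xv t \<omega> i)) = expectation (\<lambda>\<omega>. \<Sum>i\<in>{1..N}. at_state j (xv 0 \<omega> i)) +
      (LINT s:{..t}|\<tau>. LINT \<omega>|M. (\<Sum>i\<in>{1..N}. LINT u|\<mu>. hj i j ((s, \<omega>), u)))"
  proof (rule expectation_dynkin(2)[OF t, where \<Phi> = "\<lambda>i. hj i j" and B = 1 and \<phi> = "\<lambda>v. \<Sum>i\<in>{1..N}. at_state j (v i)"])
    show "integrable M (\<lambda>\<omega>. \<Sum>i\<in>{1..N}. at_state j (xv 0 \<omega> i))"
      using xv_sum_measurable[of 0 j] xv_sum_bound T_pos by (intro integrable_if_bounded[of _ Nr]) auto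
    show "hj i j ((s, \<omega>), u) = (\<Sum>l\<in>{1..N}. at_state j (((xmv s \<omega>)(i := Xm i s \<omega> + jmp i ((s, \<omega>), u))) l)) - (\<Sum>l\<in>{1..N}. at_state j (xmv s \<omega> l))"
      if "i \<in> {1..N}" for i s \<omega> u
    proof -
      have e: "xmv s \<omega> i = Xm i s \<omega>" using that by (simp add: xmv_def)
      show ?thesis unfolding sum_fun_upd[OF finite_atLeastAtMost that, of "at_state j"] e hj_def by simp
    qed
  qed (use hj_measurable hj_bound in auto)
  moreover have "expectation (\<lambda>\<omega>. nm j (0, \<omega>)) = Nr * init_law G $ j"
  proof -
    have "expectation (\<lambda>\<omega>. nm j (0, \<omega>)) = (\<Sum>i\<in>{1..N}. law_of i j 0)"
      unfolding nm_def law_of_def using at_state_integrable[of _ 0 j] T_pos by (simp del: of_nat_sum)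
    also have "\<dots> = (\<Sum>i\<in>{1..N}. init_law G $ j)" by (intro sum.cong law_of_0) auto
    finally show ?thesis by simp
  qed
  ultimately show ?thesis using E[OF t] E[of 0] T_pos by (simp add: A_def hj_rate)
qed

text \<open>If one player's jump changes the count by \<open>h\<close>, then its square changes by
  \<open>2 * nm * h + h * h\<close>. Integrated over the marks and summed over the players this is
  twice the count times its drift, plus \<open>R\<close>. Independence of the players is not
  involved.\<close>

lemma mean_square_count:
  assumes t: "t \<in> {0..T}"
  shows "expectation (\<lambda>\<omega>. (nm j (t, \<omega>))\<^sup>2) = expectation (\<lambda>\<omega>. (nm j (0, \<omega>))\<^sup>2) +
    (LINT s:{..t}|\<tau>. LINT \<omega>|M. 2 * nm j (s, \<omega>) * A j (s, \<omega>) + R j (s, \<omega>))"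
proof -
  let ?\<Phi> = "\<lambda>i z. 2 * nm j (fst z) * hj i j z + (hj i j z)\<^sup>2"
  have E: "expectation (\<lambda>\<omega>. (nm j (t, \<omega>))\<^sup>2) = expectation (\<lambda>\<omega>. (\<Sum>i\<in>{1..N}. at_state j (xv t \<omega> i))\<^sup>2)" if t: "t \<in> {0..T}" for t
  proof (rule integral_cong_AE)
    show "AE \<omega> in M. (nm j (t, \<omega>))\<^sup>2 = (\<Sum>i\<in>{1..N}. at_state j (xv t \<omega> i))\<^sup>2"
      using nm_xv[OF t, of j] by eventually_elim simp
  qed (use section_omega[OF t nm_meas] xv_sum_measurable[OF t] in measurable)
  have "expectation (\<lambda>\<omega>. (\<Sum>i\<in>{1..N}. at_state j (xv t \<omega> i))\<^sup>2) = expectation (\<lambda>\<omega>. (\<Sum>i\<in>{1..N}. at_state j (xv 0 \<omega> i))\<^sup>2) +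
      (LINT s:{..t}|\<tau>. LINT \<omega>|M. (\<Sum>i\<in>{1..N}. LINT u|\<mu>. ?\<Phi> i ((s, \<omega>), u)))"
  proof (rule expectation_dynkin(2)[OF t, where \<Phi> = ?\<Phi> and B = "2 * Nr + 1" and \<phi> = "\<lambda>v. (\<Sum>i\<in>{1..N}. at_state j (v i))\<^sup>2"])
    have [measurable]: "(\<lambda>\<omega>. \<Sum>i\<in>{1..N}. at_state j (xv 0 \<omega> i)) \<in> borel_measurable M" using xv_sum_measurable[of 0 j] T_pos by simp
    show "integrable M (\<lambda>\<omega>. (\<Sum>i\<in>{1..N}. at_state j (xv 0 \<omega> i))\<^sup>2)"
      using xv_sum_bound by (intro integrable_if_bounded[of _ "Nr\<^sup>2"]) (auto intro!: power_mono simp: abs_le_square_iff[symmetric])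
    show "?\<Phi> i \<in> borel_measurable \<H>" if "i \<in> {1..N}" for i
      using fst_compose[OF nm_meas] hj_measurable[OF that] by measurable
    show "\<bar>?\<Phi> i ((s, \<omega>), u)\<bar> \<le> 2 * Nr + 1" for i s \<omega> u
    proof -
      have "\<bar>2 * nm j (s, \<omega>) * hj i j ((s, \<omega>), u)\<bar> \<le> (2 * Nr) * 1"
        unfolding abs_mult using nm_bound[of j "(s, \<omega>)"] hj_bound[of i j] by (intro mult_mono) auto
      moreover have "(hj i j ((s, \<omega>), u))\<^sup>2 \<le> 1" using hj_bound[of i j] by (simp add: abs_square_le_1)
      moreover have "0 \<le> (hj i j ((s, \<omega>), u))\<^sup>2" by simp
      ultimately show ?thesis unfolding fst_conv by linarith
    qed
    show "?\<Phi> i ((s, \<omega>), u) = (\<Sum>l\<in>{1..N}. at_state j (((xmv s \<omega>)(i := Xm i s \<omega> + jmp i ((s, \<omega>), u))) l))\<^sup>2 - (\<Sum>l\<in>{1..N}. at_state j (xmv s \<omega> l))\<^sup>2"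
      if i: "i \<in> {1..N}" for i s \<omega> u
    proof -
      have "(\<Sum>l\<in>{1..N}. at_state j (xmv s \<omega> l)) = nm j (s, \<omega>)" by (auto simp: nm_def xmv_def intro!: sum.cong)
      moreover have "at_state j (Xm i s \<omega> + jmp i ((s, \<omega>), u)) - at_state j (xmv s \<omega> i) = hj i j ((s, \<omega>), u)" using i by (simp add: hj_def xmv_def)
      ultimately have "(\<Sum>l\<in>{1..N}. at_state j (((xmv s \<omega>)(i := Xm i s \<omega> + jmp i ((s, \<omega>), u))) l)) = nm j (s, \<omega>) + hj i j ((s, \<omega>), u)"
        using sum_fun_upd[of "{1..N}" i "at_state j" "xmv s \<omega>" "Xm i s \<omega> + jmp i ((s, \<omega>), u)"] i by simp
      with \<open>(\<Sum>l\<in>{1..N}. at_state j (xmv s \<omega> l)) = nm j (s, \<omega>)\<close> show ?thesis by (simp add: power2_eq_square algebra_simps)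
    qed
  qed simp
  moreover have "(\<Sum>i\<in>{1..N}. LINT u|\<mu>. ?\<Phi> i ((s, \<omega>), u)) = 2 * nm j (s, \<omega>) * A j (s, \<omega>) + R j (s, \<omega>)"
    if s: "s \<in> {0..T}" and \<omega>: "\<omega> \<in> space M" for s \<omega>
  proof -
    have "(LINT u|\<mu>. ?\<Phi> i ((s, \<omega>), u)) = 2 * nm j (s, \<omega>) * (LINT u|\<mu>. hj i j ((s, \<omega>), u)) + (LINT u|\<mu>. (hj i j ((s, \<omega>), u))\<^sup>2)"
      if i: "i \<in> {1..N}" for i
    proof -
      have [measurable]: "(\<lambda>u. hj i j ((s, \<omega>), u)) \<in> borel_measurable \<mu>"
        using measurable_compose[OF measurable_Pair1' hj_measurable[OF i], of "(s, \<omega>)"] s \<omega> by (simp add: space_pred)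
      have "integrable \<mu> (\<lambda>u. hj i j ((s, \<omega>), u))" "integrable \<mu> (\<lambda>u. (hj i j ((s, \<omega>), u))\<^sup>2)"
        using hj_bound[of i j] by (auto intro!: U.integrable_if_bounded[of _ 1] simp: abs_square_le_1)
      then show ?thesis by simp
    qed
    then show ?thesis by (simp add: sum.distrib A_def R_def hj_rate sum_distrib_left)
  qed
  then have "(LINT s:{..t}|\<tau>. LINT \<omega>|M. (\<Sum>i\<in>{1..N}. LINT u|\<mu>. ?\<Phi> i ((s, \<omega>), u))) = (LINT s:{..t}|\<tau>. LINT \<omega>|M. 2 * nm j (s, \<omega>) * A j (s, \<omega>) + R j (s, \<omega>))"
    unfolding set_LINT_def
    by (intro LINT_cong refl arg_cong[where f = "\<lambda>x. indicator {..t} _ *\<^sub>R x"]) (simp_all add: space_time)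
  ultimately show ?thesis using E[OF t] E[of 0] T_pos by simp
qed

end

context game
begin

lemma AE_time_neq: "AE r in \<tau>. r \<noteq> s"
  by (subst AE_restrict_space_iff) (auto intro: AE_mp[OF AE_lborel_singleton[of s]])

lemma set_LINT_0: "(LINT s:{..0}|\<tau>. f s :: real) = 0"
proof -
  have "AE s in \<tau>. indicator {..0} s *\<^sub>R f s = 0"
    using AE_time_neq[of 0] AE_space by eventually_elim (auto simp: space_time indicator_def)
  then show ?thesis unfolding set_LINT_def by (rule integral_eq_zero_AE)
qed

lemma set_LINT_abs_le:
  fixes f g :: "real \<Rightarrow> real"
  assumes "f \<in> borel_measurable \<tau>" "\<And>s. s \<in> {0..T} \<Longrightarrow> \<bar>f s\<bar> \<le> B"
    "g \<in> borel_measurable \<tau>" "\<And>s. s \<in> {0..T} \<Longrightarrow> \<bar>g s\<bar> \<le> B'" "\<And>s. s \<in> {0..T} \<Longrightarrow> \<bar>f s\<bar> \<le> g s"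
  shows "\<bar>LINT s:{..t}|\<tau>. f s\<bar> \<le> (LINT s:{..t}|\<tau>. g s)"
proof -
  have "(LINT s:{..t}|\<tau>. f s) \<le> (LINT s:{..t}|\<tau>. g s)"
    using assms(5) by (intro set_LINT_mono[OF assms(1-4)]) (auto simp: abs_le_iff)
  moreover have "(LINT s:{..t}|\<tau>. - f s) \<le> (LINT s:{..t}|\<tau>. g s)"
    using assms by (intro set_LINT_mono[of _ B _ B']) (auto simp: abs_le_iff)
  moreover have "(LINT s:{..t}|\<tau>. - f s) = - (LINT s:{..t}|\<tau>. f s)"
    by (simp add: set_LINT_def)
  ultimately show ?thesis by (simp add: abs_le_iff)
qed

text \<open>The constant is integrated over the whole horizon, so that the additive term in
  Gronwall's lemma is free of \<open>t\<close>.\<close>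

lemma set_LINT_affine:
  fixes g :: "real \<Rightarrow> real"
  assumes "g \<in> borel_measurable \<tau>" "\<And>s. s \<in> {0..T} \<Longrightarrow> \<bar>g s\<bar> \<le> B" "0 \<le> a"
  shows "(LINT s:{..t}|\<tau>. a + b * g s) \<le> a * T + b * (LINT s:{..t}|\<tau>. g s)"
proof -
  have "(LINT s:{..t}|\<tau>. a + b * g s) = (LINT s:{..t}|\<tau>. a) + (LINT s:{..t}|\<tau>. b * g s)"
    using LINT_bounded(2)[OF assms(1,2), of t] LINT_bounded(2)[of "\<lambda>_. a" "\<bar>a\<bar>" t]
    by (intro set_integral_add) auto
  then show ?thesis using set_LINT_const_le[OF assms(3), of t] by simp
qed

end

section \<open>The mean square deviation of the counts and its growth\<close>

context players_near_limit
begin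

definition V :: "real \<Rightarrow> real" where "V s = (\<Sum>j\<in>UNIV. expectation (\<lambda>\<omega>. (w j (s, \<omega>))\<^sup>2))"

definition S :: "real \<times> 'w \<Rightarrow> real" where "S z = (\<Sum>y\<in>UNIV. \<bar>w y z\<bar>)"

lemma w_sq_bound: "s \<in> {0..T} \<Longrightarrow> \<bar>(w j (s, \<omega>))\<^sup>2\<bar> \<le> Nr\<^sup>2"
  using w_bound[of s j \<omega>] power_mono[of "\<bar>w j (s, \<omega>)\<bar>" Nr 2] by simp

lemma w_sq_meas: "(\<lambda>z. (w j z)\<^sup>2) \<in> borel_measurable \<P>" using w_meas by measurable

lemma w_sq_integrable: "s \<in> {0..T} \<Longrightarrow> integrable M (\<lambda>\<omega>. (w j (s, \<omega>))\<^sup>2)"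
  by (rule pred_integrable[OF w_sq_meas w_sq_bound])

lemma V_meas: "V \<in> borel_measurable \<tau>"
  unfolding V_def by (intro borel_measurable_sum expectation_measurable[OF w_sq_meas])

lemma V_bound: "s \<in> {0..T} \<Longrightarrow> 0 \<le> V s \<and> V s \<le> real CARD('d) * Nr\<^sup>2"
proof
  assume s: "s \<in> {0..T}"
  show "0 \<le> V s" unfolding V_def by (intro sum_nonneg integral_nonneg_AE) auto
  have "expectation (\<lambda>\<omega>. (w j (s, \<omega>))\<^sup>2) \<le> Nr\<^sup>2" for j
    using expectation_bound[of "\<lambda>\<omega>. (w j (s, \<omega>))\<^sup>2" "Nr\<^sup>2"] w_sq_bound[OF s, of j] by (simp add: abs_le_iff)
  then have "V s \<le> (\<Sum>j\<in>(UNIV :: 'd set). Nr\<^sup>2)" unfolding V_def by (intro sum_mono)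
  then show "V s \<le> real CARD('d) * Nr\<^sup>2" by simp
qed

text \<open>The initial states are independent with the common law, so the deviation at time 0 is a
  sum of centred terms: mixed products have mean 0, and each of the \<open>N\<close> squares is at
  most 1.\<close>

lemma V_0: "V 0 \<le> real CARD('d) * Nr"
proof -
  have "expectation (\<lambda>\<omega>. (w j (0, \<omega>))\<^sup>2) \<le> Nr" for j
  proof -
    let ?c = "init_law G $ j"
    define a where "a i \<omega> = at_state j (\<xi> i \<omega>)" for i \<omega>
    define E where "E i = {\<omega>\<in>space M. \<xi> i \<omega> = state_of j}" for i
    have Xi: "Xm i 0 \<omega> = \<xi> i \<omega>" if "i \<in> {1..N}" "\<omega> \<in> space M" for i \<omega>
      using X_init[OF that] by (simp add: left_lim_def)
    have l0: "law j 0 = ?c" using law_eq[of 0 j] T_pos set_LINT_0 by simp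
    have prE: "prob (E i) = ?c" if "i \<in> {1..N}" for i
      using init[OF that] by (simp add: initial_state_def E_def)
    have Ein: "E i \<in> init_sigma M (\<xi> i)" for i
      unfolding init_sigma_def E_def by (intro sigma_sets.Basic CollectI exI[of _ "{state_of j}"]) auto
    have Em: "E i \<in> sets M" if "i \<in> {1..N}" for i
      using indep_init Ein that unfolding indep_sets_def by blast
    have ind: "expectation (\<lambda>\<omega>. (a i \<omega> - ?c) * (a l \<omega> - ?c)) \<le> (if i = l then 1 else 0)" if i: "i \<in> {1..N}" and l: "l \<in> {1..N}" for i l
    proof -
      have c01: "0 \<le> ?c" "?c \<le> 1" using simplex_bounds[OF init_law_simplex, of j] by auto
      show ?thesis
      proof (cases "i = l")
        case True
        have "\<bar>expectation (\<lambda>\<omega>. (a i \<omega> - ?c) * (a l \<omega> - ?c))\<bar> \<le> 1"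
        proof (rule expectation_bound)
          fix \<omega>
          have "\<bar>a i \<omega> - ?c\<bar> \<le> 1" "\<bar>a l \<omega> - ?c\<bar> \<le> 1" using c01 by (auto simp: a_def at_state_def)
          then have "\<bar>a i \<omega> - ?c\<bar> * \<bar>a l \<omega> - ?c\<bar> \<le> 1 * 1" by (intro mult_mono) auto
          then show "\<bar>(a i \<omega> - ?c) * (a l \<omega> - ?c)\<bar> \<le> 1" by (simp add: abs_mult)
        qed simp
        then show ?thesis using True by simp
      next
        case False
        have "prob (\<Inter>q\<in>{i, l}. E q) = (\<Prod>q\<in>{i, l}. prob (E q))"
          by (rule indep_setsD[OF indep_init]) (use i l Ein in auto)
        then have pr: "prob (E i \<inter> E l) = ?c * ?c" using False i l prE by simp
        have "expectation (\<lambda>\<omega>. (a i \<omega> - ?c) * (a l \<omega> - ?c)) =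
          expectation (\<lambda>\<omega>. indicator (E i \<inter> E l) \<omega> - ?c * indicator (E i) \<omega> - ?c * indicator (E l) \<omega> + ?c * ?c)"
          by (rule LINT_cong[OF refl]) (auto simp: a_def at_state_def E_def indicator_def algebra_simps)
        also have "\<dots> = prob (E i \<inter> E l) - ?c * prob (E i) - ?c * prob (E l) + ?c * ?c"
        proof -
          have I: "integrable M (indicat_real B)" "expectation (indicat_real B) = prob B" if "B \<in> sets M" for B
            using that sets.sets_into_space[OF that]
            by (auto intro!: integrable_if_bounded[of _ 1] simp: indicator_def Int_absorb2)
          have "E i \<inter> E l \<in> sets M" using Em[OF i] Em[OF l] by simp
          then show ?thesis using I[OF Em[OF i]] I[OF Em[OF l]] I[of "E i \<inter> E l"] by (simp add: prob_space)
        qed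
        also have "\<dots> = 0" using pr prE[OF i] prE[OF l] by (simp add: algebra_simps)
        finally show ?thesis using False by simp
      qed
    qed
    have am: "a i \<in> borel_measurable M" if "i \<in> {1..N}" for i
    proof -
      have "(\<lambda>\<omega>. indicator (E i) \<omega> :: real) \<in> borel_measurable M" using Em[OF that] by measurable
      then show ?thesis by (rule measurable_cong[THEN iffD1, rotated]) (auto simp: a_def at_state_def E_def indicator_def)
    qed
    have int: "integrable M (\<lambda>\<omega>. (a i \<omega> - ?c) * (a l \<omega> - ?c))" if "i \<in> {1..N}" "l \<in> {1..N}" for i l
    proof (rule integrable_if_bounded[of _ 1])
      have c01: "0 \<le> ?c" "?c \<le> 1" using simplex_bounds[OF init_law_simplex, of j] by auto
      fix \<omega>
      have "\<bar>a i \<omega> - ?c\<bar> \<le> 1" "\<bar>a l \<omega> - ?c\<bar> \<le> 1" using c01 by (auto simp: a_def at_state_def)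
      then have "\<bar>a i \<omega> - ?c\<bar> * \<bar>a l \<omega> - ?c\<bar> \<le> 1 * 1" by (intro mult_mono) auto
      then show "\<bar>(a i \<omega> - ?c) * (a l \<omega> - ?c)\<bar> \<le> 1" by (simp add: abs_mult)
    qed (use am[OF that(1)] am[OF that(2)] in measurable)
    have "expectation (\<lambda>\<omega>. (w j (0, \<omega>))\<^sup>2) = expectation (\<lambda>\<omega>. \<Sum>i\<in>{1..N}. \<Sum>l\<in>{1..N}. (a i \<omega> - ?c) * (a l \<omega> - ?c))"
    proof (rule LINT_cong[OF refl])
      fix \<omega> assume \<omega>: "\<omega> \<in> space M"
      have "w j (0, \<omega>) = (\<Sum>i\<in>{1..N}. a i \<omega> - ?c)"
        using Xi[OF _ \<omega>] by (simp add: w_def nm_def l0 a_def sum_subtractf)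
      then show "(w j (0, \<omega>))\<^sup>2 = (\<Sum>i\<in>{1..N}. \<Sum>l\<in>{1..N}. (a i \<omega> - ?c) * (a l \<omega> - ?c))"
        by (simp add: power2_eq_square sum_product)
    qed
    also have "\<dots> = (\<Sum>i\<in>{1..N}. \<Sum>l\<in>{1..N}. expectation (\<lambda>\<omega>. (a i \<omega> - ?c) * (a l \<omega> - ?c)))"
      using int by (subst LINT_sum, auto intro!: sum.cong)
    also have "\<dots> \<le> (\<Sum>i\<in>{1..N}. \<Sum>l\<in>{1..N}. if i = l then 1 else 0)" using ind by (intro sum_mono) auto
    also have "\<dots> = Nr" by simp
    finally show ?thesis .
  qed
  then have "V 0 \<le> (\<Sum>j\<in>(UNIV :: 'd set). Nr)" unfolding V_def by (intro sum_mono)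
  then show ?thesis by simp
qed

text \<open>The time derivative, in integrated form, of the mean of the squared deviation;
  \<open>w_sq_evolution\<close> justifies the reading.\<close>

definition \<iota> :: "'d \<Rightarrow> real \<Rightarrow> real" where
  "\<iota> j s = expectation (\<lambda>\<omega>. 2 * w j (s, \<omega>) * (A j (s, \<omega>) - Nr * \<Lambda> j s) + R j (s, \<omega>))"

lemma drift_measurable: "(\<lambda>z. 2 * w j z * (A j z - Nr * \<Lambda> j (fst z)) + R j z) \<in> borel_measurable \<P>"
  using w_meas A_meas R_meas measurable_compose[OF fst_pred \<Lambda>_meas] by measurable

lemma drift_bound: "s \<in> {0..T} \<Longrightarrow> \<bar>2 * w j (s, \<omega>) * (A j (s, \<omega>) - Nr * \<Lambda> j s) + R j (s, \<omega>)\<bar> \<le> 2 * Nr * (2 * Nr * \<nu>) + Nr * \<nu>"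
proof -
  assume s: "s \<in> {0..T}"
  have "\<bar>Nr * \<Lambda> j s\<bar> \<le> Nr * \<nu>" using \<Lambda>_bound[OF s, of j] by (simp add: abs_mult mult_left_mono)
  then have "\<bar>A j (s, \<omega>) - Nr * \<Lambda> j s\<bar> \<le> 2 * Nr * \<nu>" using A_bound[of j "(s, \<omega>)"] by linarith
  then have "\<bar>2 * w j (s, \<omega>) * (A j (s, \<omega>) - Nr * \<Lambda> j s)\<bar> \<le> 2 * Nr * (2 * Nr * \<nu>)"
    unfolding abs_mult using w_bound[OF s, of j \<omega>] by (intro mult_mono) auto
  then show ?thesis using R_bound[of j "(s, \<omega>)"] by linarith
qed

lemma \<iota>_meas: "\<iota> j \<in> borel_measurable \<tau>"
  unfolding \<iota>_def using expectation_measurable[OF drift_measurable, of j] by simp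

lemma \<iota>_bound: "s \<in> {0..T} \<Longrightarrow> \<bar>\<iota> j s\<bar> \<le> 2 * Nr * (2 * Nr * \<nu>) + Nr * \<nu>"
  unfolding \<iota>_def using drift_bound by (intro expectation_bound) auto

text \<open>The Dynkin formula available has test functions of the states only, whereas
  \<open>w\<close> also depends on time through \<open>law\<close>. Therefore the square is
  expanded: the squared count and the count have their own evolution equations,
  \<open>Nr * law j\<close> is deterministic, and the products are handled by integration by
  parts.\<close>

lemma w_sq_evolution:
  assumes t: "t \<in> {0..T}"
  shows "expectation (\<lambda>\<omega>. (w j (t, \<omega>))\<^sup>2) = expectation (\<lambda>\<omega>. (w j (0, \<omega>))\<^sup>2) + (LINT s:{..t}|\<tau>. \<iota> j s)"
proof -
  define Pn where "Pn s = expectation (\<lambda>\<omega>. nm j (s, \<omega>))" for s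
  define Qn where "Qn s = expectation (\<lambda>\<omega>. (nm j (s, \<omega>))\<^sup>2)" for s
  define b where "b s = Nr * law j s" for s
  define a where "a s = expectation (\<lambda>\<omega>. A j (s, \<omega>))" for s
  define q where "q s = expectation (\<lambda>\<omega>. 2 * nm j (s, \<omega>) * A j (s, \<omega>) + R j (s, \<omega>))" for s
  define c where "c s = Nr * \<Lambda> j s" for s
  have nm_sq_meas: "(\<lambda>z. (nm j z)\<^sup>2) \<in> borel_measurable \<P>" using nm_meas by measurable
  have nmA_meas: "(\<lambda>z. nm j z * A j z) \<in> borel_measurable \<P>" using nm_meas A_meas by measurable
  have nmb: "\<bar>nm j z\<bar> \<le> Nr" for z using nm_bound[of j z] by simp
  have nmAb: "\<bar>nm j z * A j z\<bar> \<le> Nr * (Nr * \<nu>)" for z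
    unfolding abs_mult using nmb A_bound by (intro mult_mono) auto
  have nm_sqb: "\<bar>(nm j z)\<^sup>2\<bar> \<le> Nr\<^sup>2" for z using power_mono[OF nmb, of z 2] by simp
  have Rb: "\<bar>R j z\<bar> \<le> Nr * \<nu>" for z using R_bound[of j z] by simp
  have i_nm: "integrable M (\<lambda>\<omega>. nm j (s, \<omega>))" and i_nm2: "integrable M (\<lambda>\<omega>. (nm j (s, \<omega>))\<^sup>2)" and i_A: "integrable M (\<lambda>\<omega>. A j (s, \<omega>))"
    and i_nmA: "integrable M (\<lambda>\<omega>. nm j (s, \<omega>) * A j (s, \<omega>))" and i_R: "integrable M (\<lambda>\<omega>. R j (s, \<omega>))" if s: "s \<in> {0..T}" for s
    using pred_integrable[OF nm_meas nmb s] pred_integrable[OF nm_sq_meas nm_sqb s] pred_integrable[OF A_meas A_bound s]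
      pred_integrable[OF nmA_meas nmAb s] pred_integrable[OF R_meas Rb s] by auto
  have Ew: "expectation (\<lambda>\<omega>. (w j (s, \<omega>))\<^sup>2) = Qn s - 2 * (b s * Pn s) + b s * b s" if s: "s \<in> {0..T}" for s
  proof -
    have "expectation (\<lambda>\<omega>. (w j (s, \<omega>))\<^sup>2) = expectation (\<lambda>\<omega>. (nm j (s, \<omega>))\<^sup>2 - 2 * b s * nm j (s, \<omega>) + b s * b s)"
      by (rule LINT_cong[OF refl]) (simp add: w_def b_def power2_eq_square algebra_simps)
    then show ?thesis using i_nm[OF s] i_nm2[OF s] by (simp add: Qn_def Pn_def prob_space)
  qed
  have \<iota>_eq: "\<iota> j s = q s - 2 * (c s * Pn s + b s * a s) + (c s * b s + b s * c s)" if s: "s \<in> {0..T}" for s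
  proof -
    have "\<iota> j s = expectation (\<lambda>\<omega>. 2 * (nm j (s, \<omega>) * A j (s, \<omega>)) + R j (s, \<omega>) - 2 * c s * nm j (s, \<omega>) - 2 * b s * A j (s, \<omega>) + 2 * (b s * c s))"
      unfolding \<iota>_def by (rule LINT_cong[OF refl]) (simp add: w_def b_def c_def algebra_simps)
    also have "\<dots> = (2 * expectation (\<lambda>\<omega>. nm j (s, \<omega>) * A j (s, \<omega>)) + expectation (\<lambda>\<omega>. R j (s, \<omega>))) - 2 * c s * Pn s - 2 * b s * a s + 2 * (b s * c s)"
      using i_nm[OF s] i_A[OF s] i_nmA[OF s] i_R[OF s] by (simp add: Pn_def a_def prob_space)
    also have "2 * expectation (\<lambda>\<omega>. nm j (s, \<omega>) * A j (s, \<omega>)) + expectation (\<lambda>\<omega>. R j (s, \<omega>)) = q s"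
      using i_nmA[OF s] i_R[OF s] by (simp add: q_def mult.assoc)
    finally show ?thesis by (simp add: algebra_simps)
  qed
  have am: "a \<in> borel_measurable \<tau>" "\<And>s. \<bar>a s\<bar> \<le> Nr * \<nu>"
    unfolding a_def using expectation_measurable[OF A_meas] A_bound by (auto intro!: expectation_bound)
  have cm: "c \<in> borel_measurable \<tau>" "\<And>s. s \<in> {0..T} \<Longrightarrow> \<bar>c s\<bar> \<le> Nr * \<nu>"
    unfolding c_def using \<Lambda>_bound by (auto simp: abs_mult mult_left_mono)
  have qm: "q \<in> borel_measurable \<tau>" "\<And>s. \<bar>q s\<bar> \<le> 2 * (Nr * (Nr * \<nu>)) + Nr * \<nu>"
  proof -
    have "(\<lambda>z. 2 * nm j z * A j z + R j z) \<in> borel_measurable \<P>" using nm_meas A_meas R_meas by measurable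
    from expectation_measurable[OF this] show "q \<in> borel_measurable \<tau>" unfolding q_def .
    have "\<bar>2 * nm j z * A j z + R j z\<bar> \<le> 2 * (Nr * (Nr * \<nu>)) + Nr * \<nu>" for z
      using nmAb[of z] Rb[of z] by (simp only: mult.assoc)
    then show "\<bar>q s\<bar> \<le> 2 * (Nr * (Nr * \<nu>)) + Nr * \<nu>" for s unfolding q_def by (rule expectation_bound) simp_all
  qed
  have Pm: "Pn \<in> borel_measurable \<tau>" "\<And>s. \<bar>Pn s\<bar> \<le> Nr"
    unfolding Pn_def using expectation_measurable[OF nm_meas] nmb by (auto intro!: expectation_bound)
  have bm: "b \<in> borel_measurable \<tau>" "\<And>s. s \<in> {0..T} \<Longrightarrow> \<bar>b s\<bar> \<le> Nr"
    unfolding b_def using law_meas law_nonneg law_le_1 by (auto simp: abs_mult mult_left_le)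
  have P_eq: "Pn s = Nr * init_law G $ j + (LINT r:{..s}|\<tau>. a r)" if "s \<in> {0..T}" for s
    unfolding Pn_def a_def by (rule mean_count[OF that])
  have b_eq: "b s = Nr * init_law G $ j + (LINT r:{..s}|\<tau>. c r)" if "s \<in> {0..T}" for s
    unfolding b_def c_def \<Lambda>_def[symmetric] law_eq[OF that, of j, folded \<Lambda>_def] by (simp add: distrib_left)
  have Q_eq: "Qn t = Qn 0 + (LINT s:{..t}|\<tau>. q s)" unfolding Qn_def q_def by (rule mean_square_count[OF t])
  \<comment> \<open>The mixed term is a product of two indefinite integrals, \<open>b\<close> of the
    drift \<open>c\<close> of the limit and \<open>Pn\<close> of the mean drift \<open>a\<close> of
    the count. Both start at the same value, so all initial terms match in the end.\<close>
  have bP: "b t * Pn t = (Nr * init_law G $ j) * (Nr * init_law G $ j) + (LINT s:{..t}|\<tau>. c s * Pn s + b s * a s)"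
    by (rule time_mult[OF cm am b_eq P_eq t])
  have bb: "b t * b t = (Nr * init_law G $ j) * (Nr * init_law G $ j) + (LINT s:{..t}|\<tau>. c s * b s + b s * c s)"
    by (rule time_mult[OF cm cm b_eq b_eq t])
  have P0: "Pn 0 = Nr * init_law G $ j" "b 0 = Nr * init_law G $ j"
    using P_eq[of 0] b_eq[of 0] T_pos by (simp_all add: set_LINT_0)
  have bd1: "\<bar>c s * Pn s + b s * a s\<bar> \<le> Nr * \<nu> * Nr + Nr * (Nr * \<nu>)" "\<bar>c s * b s + b s * c s\<bar> \<le> Nr * \<nu> * Nr + Nr * (Nr * \<nu>)" if s: "s \<in> {0..T}" for s
  proof -
    have "\<bar>c s * Pn s\<bar> \<le> Nr * \<nu> * Nr" "\<bar>b s * a s\<bar> \<le> Nr * (Nr * \<nu>)" "\<bar>c s * b s\<bar> \<le> Nr * \<nu> * Nr" "\<bar>b s * c s\<bar> \<le> Nr * (Nr * \<nu>)"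
      unfolding abs_mult using cm(2)[OF s] Pm(2) bm(2)[OF s] am(2) by (auto intro!: mult_mono)
    then show "\<bar>c s * Pn s + b s * a s\<bar> \<le> Nr * \<nu> * Nr + Nr * (Nr * \<nu>)" "\<bar>c s * b s + b s * c s\<bar> \<le> Nr * \<nu> * Nr + Nr * (Nr * \<nu>)" by linarith+
  qed
  have s1: "set_integrable \<tau> {..t} q" by (rule LINT_bounded(2)[OF qm])
  have s2: "set_integrable \<tau> {..t} (\<lambda>s. 2 * (c s * Pn s + b s * a s))"
    using cm(1) Pm(1) bm(1) am(1) bd1 by (intro set_integrable_mult_right LINT_bounded(2)[where B = "Nr * \<nu> * Nr + Nr * (Nr * \<nu>)"]) auto
  have s3: "set_integrable \<tau> {..t} (\<lambda>s. c s * b s + b s * c s)"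
    using cm(1) bm(1) bd1 by (intro LINT_bounded(2)[where B = "Nr * \<nu> * Nr + Nr * (Nr * \<nu>)"]) auto
  have "(LINT s:{..t}|\<tau>. \<iota> j s) = (LINT s:{..t}|\<tau>. q s - 2 * (c s * Pn s + b s * a s) + (c s * b s + b s * c s))"
    unfolding set_LINT_def by (intro LINT_cong refl) (simp add: \<iota>_eq space_time)
  also have "\<dots> = (LINT s:{..t}|\<tau>. q s) - 2 * (LINT s:{..t}|\<tau>. c s * Pn s + b s * a s) + (LINT s:{..t}|\<tau>. c s * b s + b s * c s)"
    by (simp only: set_integral_add(2)[OF set_integral_diff(1)[OF s1 s2] s3] set_integral_diff(2)[OF s1 s2] set_integral_mult_right)
  finally have I: "(LINT s:{..t}|\<tau>. \<iota> j s) =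
    (LINT s:{..t}|\<tau>. q s) - 2 * (LINT s:{..t}|\<tau>. c s * Pn s + b s * a s) + (LINT s:{..t}|\<tau>. c s * b s + b s * c s)" .
  have "0 \<in> {0..T}" using T_pos by simp
  note Ew0 = Ew[OF this, unfolded P0]
  have "Q0 + Iq - 2 * (x + I1) + (x + I2) = Q0 - 2 * x + x + (Iq - 2 * I1 + I2)" for Q0 Iq x I1 I2 :: real by simp
  then show ?thesis unfolding I Ew[OF t] Ew0 bP bb Q_eq by blast
qed

text \<open>The distance to the environment \<open>m\<close> has two sources: the fluctuation of the
  counts around \<open>law\<close>, and the distance of \<open>law\<close> to \<open>m\<close> given
  by \<open>law_close\<close>.\<close>

lemma N_norm_p_m:
  assumes s: "s \<in> {0..T}" and \<omega>: "\<omega> \<in> space M"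
  shows "norm (p s \<omega> - m s) \<le> S (s, \<omega>) / Nr + 2 / sqrt Nr"
proof -
  have "norm (p s \<omega> - m s) \<le> (\<Sum>j\<in>UNIV. \<bar>p s \<omega> $ j - m s $ j\<bar>)" by (rule norm_le_sum_abs)
  also have "\<dots> \<le> (\<Sum>j\<in>UNIV. \<bar>w j (s, \<omega>)\<bar> / Nr + \<bar>law j s - m s $ j\<bar>)"
  proof (rule sum_mono)
    fix j :: 'd
    have "p s \<omega> $ j = nm j (s, \<omega>) / Nr" by (simp add: emp[OF s \<omega>] empirical_eq nm_def)
    then have "p s \<omega> $ j - law j s = w j (s, \<omega>) / Nr" using Nr_pos by (simp add: w_def field_simps)
    then have "\<bar>p s \<omega> $ j - law j s\<bar> = \<bar>w j (s, \<omega>)\<bar> / Nr" by simp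
    then show "\<bar>p s \<omega> $ j - m s $ j\<bar> \<le> \<bar>w j (s, \<omega>)\<bar> / Nr + \<bar>law j s - m s $ j\<bar>" by linarith
  qed
  also have "\<dots> = S (s, \<omega>) / Nr + (\<Sum>j\<in>UNIV. \<bar>law j s - m s $ j\<bar>)"
    by (simp add: S_def sum.distrib sum_divide_distrib)
  finally show ?thesis using law_close[OF s] by linarith
qed

text \<open>Three errors are added. In the environment \<open>m\<close> with feedback
  \<open>\<gamma>\<close> the drift is linear in the counts, so its error is \<open>\<nu>\<close>
  times the total deviation. Replacing \<open>m\<close> by the empirical measure costs each player
  \<open>L\<close> times their distance, hence all players together \<open>L\<close> times the
  deviation plus order \<open>sqrt N\<close>. Player \<open>k\<close> costs a constant.\<close>

lemma A_close:
  assumes s: "s \<in> {0..T}" and \<omega>: "\<omega> \<in> space M"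
  shows "\<bar>A j (s, \<omega>) - Nr * \<Lambda> j s\<bar> \<le> 2 * sqrt Nr * (\<nu> + L) + (\<nu> + L) * S (s, \<omega>)"
proof -
  define g where "g x = rate G j s x (\<gamma> s x) (m s)" for x
  have S0: "0 \<le> S (s, \<omega>)" unfolding S_def by (intro sum_nonneg) auto
  have sq: "1 \<le> sqrt Nr" using Nr_pos by simp
  have "(\<Sum>i\<in>{1..N}. g (Xm i s \<omega>)) = (\<Sum>i\<in>{1..N}. \<Sum>y\<in>UNIV. at_state (y :: 'd) (Xm i s \<omega>) * g (state_of y))"
    using Xm_states[OF _ \<omega> s] by (intro sum.cong refl sum_at_state[symmetric]) (auto simp: states_def)
  also have "\<dots> = (\<Sum>y\<in>UNIV. nm y (s, \<omega>) * g (state_of y))"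
    by (subst sum.swap) (simp add: nm_def sum_distrib_right)
  finally have 1: "(\<Sum>i\<in>{1..N}. g (Xm i s \<omega>)) - Nr * \<Lambda> j s = (\<Sum>y\<in>UNIV. w y (s, \<omega>) * g (state_of y))"
    by (simp add: \<Lambda>_def w_def g_def sum_distrib_left sum_subtractf[symmetric] left_diff_distrib mult.assoc)
  have 2: "\<bar>\<Sum>y\<in>UNIV. w y (s, \<omega>) * g (state_of y)\<bar> \<le> \<nu> * S (s, \<omega>)"
  proof -
    have "\<bar>\<Sum>y\<in>UNIV. w y (s, \<omega>) * g (state_of y)\<bar> \<le> (\<Sum>y\<in>UNIV. \<bar>w y (s, \<omega>)\<bar> * \<nu>)"
      by (intro order_trans[OF sum_abs] sum_mono) (auto simp: abs_mult g_def intro!: mult_left_mono rate_bound)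
    then show ?thesis by (simp add: S_def sum_distrib_left mult.commute)
  qed
  let ?r = "\<lambda>i. rate G j s (Xm i s \<omega>) (\<alpha> i s \<omega>) (p s \<omega>)"
  \<comment> \<open>Nothing ties the control of player \<open>k\<close> to \<open>\<gamma>\<close>,
    so its two rates are merely bounded by the total intensity each.\<close>
  have 3: "\<bar>?r i - g (Xm i s \<omega>)\<bar> \<le> L * norm (p s \<omega> - m s) + (if i = k then 2 * \<nu> else 0)" if i: "i \<in> {1..N}" for i
  proof (cases "i = k")
    case True
    have "\<bar>?r i - g (Xm i s \<omega>)\<bar> \<le> 2 * \<nu>"
      using rate_bound[of j s "Xm i s \<omega>" "\<alpha> i s \<omega>" "p s \<omega>"] rate_bound[of j s "Xm i s \<omega>" "\<gamma> s (Xm i s \<omega>)" "m s"] unfolding g_def by linarith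
    moreover have "0 \<le> L * norm (p s \<omega> - m s)" by simp
    ultimately show ?thesis unfolding if_P[OF True] by linarith
  next
    case False
    have "\<bar>?r i - g (Xm i s \<omega>)\<bar> \<le> L * norm (p s \<omega> - m s)"
      unfolding g_def fb[OF i False s \<omega>, symmetric]
      by (intro rate_lipschitz s Xm_states[OF i \<omega> s] \<alpha>_actions[OF i \<omega> s] p_simplex[OF \<omega> s] flow_simplex[OF m s])
    then show ?thesis using False by simp
  qed
  have "\<bar>A j (s, \<omega>) - (\<Sum>i\<in>{1..N}. g (Xm i s \<omega>))\<bar> \<le> (\<Sum>i\<in>{1..N}. L * norm (p s \<omega> - m s) + (if i = k then 2 * \<nu> else 0))"
    unfolding A_def sum_subtractf[symmetric] fst_conv snd_conv by (intro order_trans[OF sum_abs] sum_mono 3)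
  also have "\<dots> = Nr * (L * norm (p s \<omega> - m s)) + 2 * \<nu>" using k by (simp add: sum.distrib)
  also have "Nr * (L * norm (p s \<omega> - m s)) \<le> L * (S (s, \<omega>) + 2 * sqrt Nr)"
  proof -
    have "Nr * norm (p s \<omega> - m s) \<le> Nr * (S (s, \<omega>) / Nr + 2 / sqrt Nr)"
      by (intro mult_left_mono N_norm_p_m[OF s \<omega>]) simp
    also have "\<dots> = S (s, \<omega>) + 2 * (Nr / sqrt Nr)" using Nr_pos by (simp add: distrib_left)
    also have "Nr / sqrt Nr = sqrt Nr" using Nr_pos by (simp add: real_div_sqrt)
    finally have "L * (Nr * norm (p s \<omega> - m s)) \<le> L * (S (s, \<omega>) + 2 * sqrt Nr)" by (intro mult_left_mono) auto
    then show ?thesis by (simp add: mult.left_commute)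
  qed
  finally have "\<bar>A j (s, \<omega>) - (\<Sum>i\<in>{1..N}. g (Xm i s \<omega>))\<bar> \<le> L * (S (s, \<omega>) + 2 * sqrt Nr) + 2 * \<nu>" by simp
  then have "\<bar>A j (s, \<omega>) - Nr * \<Lambda> j s\<bar> \<le> L * (S (s, \<omega>) + 2 * sqrt Nr) + 2 * \<nu> + \<nu> * S (s, \<omega>)"
    using 1 2 by linarith
  \<comment> \<open>The contribution of player \<open>k\<close> is enlarged to order
    \<open>sqrt N\<close>, so that it merges with the error of the environment.\<close>
  moreover have "2 * \<nu> \<le> 2 * sqrt Nr * \<nu>" using mult_right_mono[OF sq, of "2 * \<nu>"] by simp
  ultimately show ?thesis by (simp add: algebra_simps)
qed

text \<open>Products are split by the inequality between twice a product and the sum of the squares.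
  The deterministic error of order \<open>sqrt N\<close> then contributes its square, of order
  \<open>N\<close>, and everything else is a multiple, free of \<open>N\<close>, of the squared
  deviation: the form that Gronwall's lemma needs.\<close>

lemma drift_pointwise:
  assumes s: "s \<in> {0..T}" and \<omega>: "\<omega> \<in> space M"
  shows "(\<Sum>j\<in>UNIV. 2 * w j (s, \<omega>) * (A j (s, \<omega>) - Nr * \<Lambda> j s) + R j (s, \<omega>))
     \<le> real CARD('d) * Nr * (\<nu> + 4 * (\<nu> + L)\<^sup>2) + (1 + 2 * real CARD('d) * (\<nu> + L)) * (\<Sum>j\<in>UNIV. (w j (s, \<omega>))\<^sup>2)"
proof -
  define e where "e = 2 * sqrt Nr * (\<nu> + L)"
  define \<kappa> where "\<kappa> = \<nu> + L"
  define W where "W = (\<Sum>j\<in>UNIV. (w j (s, \<omega>))\<^sup>2)"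
  have \<kappa>0: "0 \<le> \<kappa>" by (simp add: \<kappa>_def)
  have e2: "e\<^sup>2 = Nr * (4 * (\<nu> + L)\<^sup>2)" by (simp add: e_def power_mult_distrib)
  have "2 * w j (s, \<omega>) * (A j (s, \<omega>) - Nr * \<Lambda> j s) + R j (s, \<omega>) \<le> (w j (s, \<omega>))\<^sup>2 + e\<^sup>2 + \<kappa> * (real CARD('d) * (w j (s, \<omega>))\<^sup>2 + W) + Nr * \<nu>" for j
  proof -
    have "2 * w j (s, \<omega>) * (A j (s, \<omega>) - Nr * \<Lambda> j s) \<le> \<bar>2 * w j (s, \<omega>) * (A j (s, \<omega>) - Nr * \<Lambda> j s)\<bar>" by simp
    also have "\<dots> \<le> (2 * \<bar>w j (s, \<omega>)\<bar>) * (e + \<kappa> * S (s, \<omega>))"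
      unfolding abs_mult using A_close[OF s \<omega>, of j] by (intro mult_mono) (auto simp: e_def \<kappa>_def)
    also have "\<dots> = 2 * \<bar>w j (s, \<omega>)\<bar> * e + \<kappa> * (2 * \<bar>w j (s, \<omega>)\<bar> * S (s, \<omega>))" by (simp add: algebra_simps)
    also have "2 * \<bar>w j (s, \<omega>)\<bar> * e \<le> (w j (s, \<omega>))\<^sup>2 + e\<^sup>2"
      using sum_squares_bound[of "\<bar>w j (s, \<omega>)\<bar>" e] by simp
    also have "2 * \<bar>w j (s, \<omega>)\<bar> * S (s, \<omega>) = (\<Sum>y\<in>UNIV. 2 * \<bar>w j (s, \<omega>)\<bar> * \<bar>w y (s, \<omega>)\<bar>)"
      by (simp add: S_def sum_distrib_left)
    also have "\<dots> \<le> (\<Sum>y\<in>(UNIV :: 'd set). (w j (s, \<omega>))\<^sup>2 + (w y (s, \<omega>))\<^sup>2)"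
      using sum_squares_bound[of "\<bar>w j (s, \<omega>)\<bar>"] by (intro sum_mono) (metis power2_abs)
    also have "\<dots> = real CARD('d) * (w j (s, \<omega>))\<^sup>2 + W" by (simp add: sum.distrib W_def)
    finally have "2 * w j (s, \<omega>) * (A j (s, \<omega>) - Nr * \<Lambda> j s) \<le> (w j (s, \<omega>))\<^sup>2 + e\<^sup>2 + \<kappa> * (real CARD('d) * (w j (s, \<omega>))\<^sup>2 + W)"
      using \<kappa>0 by (simp add: mult_left_mono)
    then show ?thesis using R_bound[of j "(s, \<omega>)"] by linarith
  qed
  then have "(\<Sum>j\<in>UNIV. 2 * w j (s, \<omega>) * (A j (s, \<omega>) - Nr * \<Lambda> j s) + R j (s, \<omega>)) \<le>
     (\<Sum>j\<in>(UNIV :: 'd set). (w j (s, \<omega>))\<^sup>2 + e\<^sup>2 + \<kappa> * (real CARD('d) * (w j (s, \<omega>))\<^sup>2 + W) + Nr * \<nu>)" by (intro sum_mono)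
  also have "\<dots> = W + real CARD('d) * e\<^sup>2 + \<kappa> * (real CARD('d) * W + real CARD('d) * W) + real CARD('d) * (Nr * \<nu>)"
    by (simp add: sum.distrib sum_distrib_left[symmetric] W_def[symmetric] distrib_left)
  also have "\<dots> = real CARD('d) * Nr * (\<nu> + 4 * (\<nu> + L)\<^sup>2) + (1 + 2 * real CARD('d) * (\<nu> + L)) * W"
    by (simp add: e2 \<kappa>_def algebra_simps)
  finally show ?thesis by (simp add: W_def)
qed

text \<open>The Gronwall bound with the factor \<open>N\<close> taken out: one summand for the
  initial deviation, one for the inhomogeneous part of the drift over the horizon.\<close>

definition cV :: real where
  "cV = 2 * (real CARD('d) + T * real CARD('d) * (\<nu> + 4 * (\<nu> + L)\<^sup>2)) * exp (2 * (1 + 2 * real CARD('d) * (\<nu> + L)) * T)"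

lemma V_le:
  assumes t: "t \<in> {0..T}"
  shows "V t \<le> Nr * cV"
proof -
  define a where "a = real CARD('d) * Nr * (\<nu> + 4 * (\<nu> + L)\<^sup>2)"
  define b where "b = 1 + 2 * real CARD('d) * (\<nu> + L)"
  define B where "B = real CARD('d) * Nr\<^sup>2"
  have a0: "0 \<le> a" by (simp add: a_def)
  have b0: "0 < b" unfolding b_def by (intro add_pos_nonneg) auto
  note V_bound' = V_bound[folded B_def]
  have i_le: "(\<Sum>j\<in>UNIV. \<iota> j s) \<le> a + b * V s" if s: "s \<in> {0..T}" for s
  proof -
    have int: "integrable M (\<lambda>\<omega>. 2 * w j (s, \<omega>) * (A j (s, \<omega>) - Nr * \<Lambda> j s) + R j (s, \<omega>))" for j
      using pred_integrable[OF drift_measurable[of j], of s "2 * Nr * (2 * Nr * \<nu>) + Nr * \<nu>"] drift_bound[OF s, of j] s by simp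
    have "(\<Sum>j\<in>UNIV. \<iota> j s) = expectation (\<lambda>\<omega>. \<Sum>j\<in>UNIV. 2 * w j (s, \<omega>) * (A j (s, \<omega>) - Nr * \<Lambda> j s) + R j (s, \<omega>))"
      unfolding \<iota>_def using int by (intro LINT_sum[symmetric]) auto
    also have "\<dots> \<le> expectation (\<lambda>\<omega>. a + b * (\<Sum>j\<in>UNIV. (w j (s, \<omega>))\<^sup>2))"
    proof (rule integral_mono[OF _ _ drift_pointwise[OF s, folded a_def b_def]])
      show "integrable M (\<lambda>\<omega>. \<Sum>j\<in>UNIV. 2 * w j (s, \<omega>) * (A j (s, \<omega>) - Nr * \<Lambda> j s) + R j (s, \<omega>))"
        by (rule Bochner_Integration.integrable_sum[OF int])
      show "integrable M (\<lambda>\<omega>. a + b * (\<Sum>j\<in>UNIV. (w j (s, \<omega>))\<^sup>2))"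
        by (intro Bochner_Integration.integrable_add integrable_const integrable_mult_right Bochner_Integration.integrable_sum w_sq_integrable[OF s])
    qed
    also have "\<dots> = a + b * V s"
    proof -
      have iW: "integrable M (\<lambda>\<omega>. \<Sum>j\<in>UNIV. (w j (s, \<omega>))\<^sup>2)" using w_sq_integrable[OF s] by auto
      have VW: "V s = expectation (\<lambda>\<omega>. \<Sum>j\<in>UNIV. (w j (s, \<omega>))\<^sup>2)"
        unfolding V_def using w_sq_integrable[OF s] by (intro LINT_sum[symmetric]) auto
      show ?thesis unfolding VW by (subst LINT_add) (use iW in \<open>auto simp: prob_space\<close>)
    qed
    finally show ?thesis .
  qed
  have main: "V r \<le> (real CARD('d) * Nr + a * T) + b * (LINT s:{..r}|\<tau>. V s)" if r: "r \<in> {0..T}" for r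
  proof -
    have "V r = V 0 + (\<Sum>j\<in>UNIV. LINT s:{..r}|\<tau>. \<iota> j s)"
      unfolding V_def by (simp add: w_sq_evolution[OF r] sum.distrib)
    also have "(\<Sum>j\<in>UNIV. LINT s:{..r}|\<tau>. \<iota> j s) = (LINT s:{..r}|\<tau>. \<Sum>j\<in>UNIV. \<iota> j s)"
      unfolding set_LINT_def scaleR_sum_right
      using LINT_bounded(2)[OF \<iota>_meas \<iota>_bound] by (intro LINT_sum[symmetric]) (auto simp: set_integrable_def)
    also have "\<dots> \<le> (LINT s:{..r}|\<tau>. a + b * V s)"
    proof (rule set_LINT_mono[where B = "\<Sum>j\<in>(UNIV :: 'd set). 2 * Nr * (2 * Nr * \<nu>) + Nr * \<nu>" and B' = "a + b * B"])
      show "(\<lambda>s. \<Sum>j\<in>UNIV. \<iota> j s) \<in> borel_measurable \<tau>" using \<iota>_meas by (intro borel_measurable_sum)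
      show "\<bar>\<Sum>j\<in>UNIV. \<iota> j s\<bar> \<le> (\<Sum>j\<in>(UNIV :: 'd set). 2 * Nr * (2 * Nr * \<nu>) + Nr * \<nu>)" if "s \<in> {0..T}" for s
        using \<iota>_bound[OF that] by (intro order_trans[OF sum_abs] sum_mono) auto
      show "(\<lambda>s. a + b * V s) \<in> borel_measurable \<tau>" using V_meas by measurable
      show "\<bar>a + b * V s\<bar> \<le> a + b * B" if "s \<in> {0..T}" for s
      proof -
        have "0 \<le> b * V s" using V_bound'[OF that] b0 by (intro mult_nonneg_nonneg) auto
        moreover have "b * V s \<le> b * B" using V_bound'[OF that] b0 by (intro mult_left_mono) auto
        ultimately show ?thesis using a0 by linarith
      qed
    qed (rule i_le)
    also have "\<dots> \<le> a * T + b * (LINT s:{..r}|\<tau>. V s)"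
    proof (rule set_LINT_affine[OF V_meas _ a0])
      show "\<bar>V s\<bar> \<le> B" if "s \<in> {0..T}" for s
        using V_bound'[OF that] by simp
    qed
    finally have fin: "V r \<le> V 0 + (a * T + b * (LINT s:{..r}|\<tau>. V s))" by simp
    from order_trans[OF fin add_right_mono[OF V_0]] show ?thesis by (simp only: add.assoc)
  qed
  have "V t \<le> 2 * (real CARD('d) * Nr + a * T) * exp (2 * b * t)"
    by (rule gronwall_bounded[OF b0 _ V_meas V_bound' main t]) (use a0 T_pos in auto)
  also have "\<dots> \<le> 2 * (real CARD('d) * Nr + a * T) * exp (2 * b * T)"
    using t b0 a0 T_pos by (intro mult_left_mono) auto
  also have "\<dots> = Nr * cV" by (simp add: cV_def a_def b_def algebra_simps)
  finally show ?thesis .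
qed

text \<open>The first summand comes from the weighted square estimate in
  \<open>expectation_p_close\<close>; the summand 2 is the distance of \<open>law\<close> to
  \<open>m\<close>.\<close>

definition cP :: real where "cP = (cV + real CARD('d)) / 2 + 2"

lemma S_meas: "S \<in> borel_measurable \<P>" unfolding S_def using w_meas by measurable

lemma norm_p_m_meas: "(\<lambda>z. norm (p (fst z) (snd z) - m (fst z))) \<in> borel_measurable \<P>"
proof -
  have "(\<lambda>z. p (fst z) (snd z)) \<in> borel_measurable \<P>" using p_pred by (simp add: measurable_restrict_space2_iff)
  moreover have "(\<lambda>z. m (fst z)) \<in> borel_measurable \<P>"
    using measurable_compose[OF fst_pred flow_measurable[OF m]] by (simp add: measurable_restrict_space2_iff)
  ultimately show ?thesis by measurable
qed

lemma norm_simplex_diff: "q \<in> prob_simplex \<Longrightarrow> r \<in> prob_simplex \<Longrightarrow> norm (q - r :: real^'d) \<le> 2"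
proof -
  assume q: "q \<in> prob_simplex" and r: "r \<in> prob_simplex"
  have "norm (q - r) \<le> (\<Sum>j\<in>UNIV. \<bar>q $ j - r $ j\<bar>)" by (rule norm_le_sum_abs)
  also have "\<dots> \<le> (\<Sum>j\<in>UNIV. q $ j + r $ j)"
    using simplex_bounds[OF q] simplex_bounds[OF r] by (intro sum_mono) (smt (verit))
  also have "\<dots> = 2" using q r by (simp add: prob_simplex_def sum.distrib)
  finally show ?thesis .
qed

lemma norm_p_m_bound: "s \<in> {0..T} \<Longrightarrow> \<omega> \<in> space M \<Longrightarrow> \<bar>norm (p s \<omega> - m s)\<bar> \<le> 2"
  using norm_simplex_diff[OF p_simplex flow_simplex[OF m]] by simp

lemma expectation_p_close:
  assumes s: "s \<in> {0..T}"
  shows "expectation (\<lambda>\<omega>. norm (p s \<omega> - m s)) \<le> cP / sqrt Nr"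
proof -
  have sq: "0 < sqrt Nr" using Nr_pos by simp
  have iW: "integrable M (\<lambda>\<omega>. (w j (s, \<omega>))\<^sup>2)" for j by (rule w_sq_integrable[OF s])
  have pt: "norm (p s \<omega> - m s) \<le> ((\<Sum>j\<in>UNIV. (w j (s, \<omega>))\<^sup>2) / sqrt Nr + real CARD('d) * sqrt Nr) / (2 * Nr) + 2 / sqrt Nr" if \<omega>: "\<omega> \<in> space M" for \<omega>
  proof -
    \<comment> \<open>The weight \<open>sqrt N\<close> balances the two terms, because the mean of
      the squared deviation is of order \<open>N\<close>. This replaces the Cauchy-Schwarz
      inequality in the passage from second to first moments.\<close>
    have "\<bar>w j (s, \<omega>)\<bar> \<le> ((w j (s, \<omega>))\<^sup>2 / sqrt Nr + sqrt Nr) / 2" for j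
    proof -
      have "2 * \<bar>w j (s, \<omega>)\<bar> * sqrt Nr \<le> (w j (s, \<omega>))\<^sup>2 + (sqrt Nr)\<^sup>2"
        using sum_squares_bound[of "\<bar>w j (s, \<omega>)\<bar>" "sqrt Nr"] by simp
      then have "2 * \<bar>w j (s, \<omega>)\<bar> \<le> ((w j (s, \<omega>))\<^sup>2 + (sqrt Nr)\<^sup>2) / sqrt Nr" using sq by (simp add: pos_le_divide_eq)
      also have "\<dots> = (w j (s, \<omega>))\<^sup>2 / sqrt Nr + sqrt Nr" using sq by (simp add: add_divide_distrib power2_eq_square real_div_sqrt)
      finally show ?thesis by simp
    qed
    then have "S (s, \<omega>) \<le> (\<Sum>j\<in>(UNIV :: 'd set). ((w j (s, \<omega>))\<^sup>2 / sqrt Nr + sqrt Nr) / 2)" unfolding S_def by (intro sum_mono)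
    also have "\<dots> = ((\<Sum>j\<in>UNIV. (w j (s, \<omega>))\<^sup>2) / sqrt Nr + real CARD('d) * sqrt Nr) / 2"
      by (simp add: sum.distrib sum_divide_distrib[symmetric])
    finally have "S (s, \<omega>) / Nr \<le> ((\<Sum>j\<in>UNIV. (w j (s, \<omega>))\<^sup>2) / sqrt Nr + real CARD('d) * sqrt Nr) / 2 / Nr"
      by (intro divide_right_mono) auto
    then show ?thesis using N_norm_p_m[OF s \<omega>] by (simp add: divide_divide_eq_left)
  qed
  have "expectation (\<lambda>\<omega>. norm (p s \<omega> - m s)) \<le> expectation (\<lambda>\<omega>. ((\<Sum>j\<in>UNIV. (w j (s, \<omega>))\<^sup>2) / sqrt Nr + real CARD('d) * sqrt Nr) / (2 * Nr) + 2 / sqrt Nr)"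
    using pred_integrable[OF norm_p_m_meas, of s 2] norm_p_m_bound[OF s] s iW
    by (intro integral_mono pt) auto
  also have "\<dots> = (V s / sqrt Nr + real CARD('d) * sqrt Nr) / (2 * Nr) + 2 / sqrt Nr"
  proof -
    have iS: "integrable M (\<lambda>\<omega>. \<Sum>j\<in>UNIV. (w j (s, \<omega>))\<^sup>2)" using iW by auto
    have VW: "V s = expectation (\<lambda>\<omega>. \<Sum>j\<in>UNIV. (w j (s, \<omega>))\<^sup>2)"
      unfolding V_def using iW by (intro LINT_sum[symmetric]) auto
    show ?thesis unfolding VW using iS by (simp add: prob_space)
  qed
  also have "\<dots> \<le> (Nr * cV / sqrt Nr + real CARD('d) * sqrt Nr) / (2 * Nr) + 2 / sqrt Nr"
    using V_le[OF s] by (intro add_right_mono divide_right_mono) auto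
  also have "Nr * cV / sqrt Nr = cV * sqrt Nr"
  proof -
    have "Nr * cV / sqrt Nr = cV * (Nr / sqrt Nr)" by (simp add: mult.commute)
    also have "Nr / sqrt Nr = sqrt Nr" by (rule real_div_sqrt) simp
    finally show ?thesis .
  qed
  also have "(cV * sqrt Nr + real CARD('d) * sqrt Nr) / (2 * Nr) + 2 / sqrt Nr = cP / sqrt Nr"
  proof -
    have "sqrt Nr / Nr = 1 / sqrt Nr" unfolding inverse_eq_divide[symmetric] by (rule sqrt_divide_self_eq) simp
    then have "(cV + real CARD('d)) / 2 * (sqrt Nr / Nr) + 2 / sqrt Nr = cP / sqrt Nr" by (simp add: cP_def add_divide_distrib)
    moreover have "(cV * sqrt Nr + real CARD('d) * sqrt Nr) / (2 * Nr) = (cV + real CARD('d)) / 2 * (sqrt Nr / Nr)" by (simp add: distrib_right)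
    ultimately show ?thesis by (simp only:)
  qed
  finally show ?thesis .
qed

end

section \<open>Comparison of costs\<close>

lemma borel_measurable_vecI:
  fixes f :: "'b \<Rightarrow> real^'n::finite"
  assumes "\<And>j. (\<lambda>x. f x $ j) \<in> borel_measurable M"
  shows "f \<in> borel_measurable M"
  by (subst borel_measurable_euclidean_space) (use assms in \<open>auto simp: Basis_vec_def cart_eq_inner_axis[symmetric]\<close>)

lemma abs_integral_diff_le:
  fixes f g :: "'b \<Rightarrow> real"
  assumes "integrable M f" "integrable M g"
  shows "\<bar>integral\<^sup>L M f - integral\<^sup>L M g\<bar> \<le> (LINT x|M. \<bar>f x - g x\<bar>)"
  using integral_abs_bound[of M "\<lambda>x. f x - g x"] assms by simp

context regular_game
begin

lemma run_cost_lipschitz: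
  assumes "t \<in> {0..T}" "x \<in> states G" "y \<in> states G" "a \<in> actions G" "b \<in> actions G" "q \<in> prob_simplex" "r \<in> prob_simplex"
  shows "\<bar>run_cost G t x a q - run_cost G t y b r\<bar> \<le> \<bar>K2\<bar> * (\<bar>real_of_int (x - y)\<bar> + dist a b + norm (q - r))"
    "\<bar>end_cost G x q - end_cost G y r\<bar> \<le> \<bar>K2\<bar> * (\<bar>real_of_int (x - y)\<bar> + dist a b + norm (q - r))"
proof -
  have "\<bar>run_cost G t x a q - run_cost G t y b r\<bar> + \<bar>end_cost G x q - end_cost G y r\<bar>
            \<le> K2 * (\<bar>real_of_int (x - y)\<bar> + dist a b + norm (q - r))"
    using cst assms unfolding regular_costs_def by blast
  also have "\<dots> \<le> \<bar>K2\<bar> * (\<bar>real_of_int (x - y)\<bar> + dist a b + norm (q - r))" by (intro mult_right_mono) auto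
  finally show "\<bar>run_cost G t x a q - run_cost G t y b r\<bar> \<le> \<bar>K2\<bar> * (\<bar>real_of_int (x - y)\<bar> + dist a b + norm (q - r))"
    "\<bar>end_cost G x q - end_cost G y r\<bar> \<le> \<bar>K2\<bar> * (\<bar>real_of_int (x - y)\<bar> + dist a b + norm (q - r))" by linarith+
qed

lemma costs_bounded:
  obtains B where "0 \<le> B"
    "\<And>t x a q. t \<in> {0..T} \<Longrightarrow> x \<in> states G \<Longrightarrow> a \<in> actions G \<Longrightarrow> q \<in> prob_simplex \<Longrightarrow> \<bar>run_cost G t x a q\<bar> \<le> B"
    "\<And>x q. x \<in> states G \<Longrightarrow> q \<in> prob_simplex \<Longrightarrow> \<bar>end_cost G x q\<bar> \<le> B"
proof -
  have b1: "bounded ((\<lambda>(t, x, a, q). run_cost G t x a q) ` ({0..T} \<times> states G \<times> actions G \<times> prob_simplex))"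
    and b2: "bounded ((\<lambda>(x, q). end_cost G x q) ` (states G \<times> prob_simplex))"
    using cst unfolding regular_costs_def by auto
  obtain B1 where B1: "\<And>x. x \<in> (\<lambda>(t, x, a, q). run_cost G t x a q) ` ({0..T} \<times> states G \<times> actions G \<times> prob_simplex) \<Longrightarrow> norm x \<le> B1"
    using b1 unfolding bounded_iff by blast
  obtain B2 where B2: "\<And>x. x \<in> (\<lambda>(x, q). end_cost G x q) ` (states G \<times> prob_simplex) \<Longrightarrow> norm x \<le> B2"
    using b2 unfolding bounded_iff by blast
  show ?thesis
  proof (rule that[of "\<bar>B1\<bar> + \<bar>B2\<bar>"])
    show "\<bar>run_cost G t x a q\<bar> \<le> \<bar>B1\<bar> + \<bar>B2\<bar>" if "t \<in> {0..T}" "x \<in> states G" "a \<in> actions G" "q \<in> prob_simplex" for t x a q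
      using B1[of "run_cost G t x a q"] that by force
    show "\<bar>end_cost G x q\<bar> \<le> \<bar>B1\<bar> + \<bar>B2\<bar>" if "x \<in> states G" "q \<in> prob_simplex" for x q
      using B2[of "end_cost G x q"] that by force
  qed simp
qed

end

context jump_system
begin

lemma run_cost_pred: "i \<in> I \<Longrightarrow> (\<lambda>z. run_cost G (fst z) (Xm i (fst z) (snd z)) (\<alpha> i (fst z) (snd z)) (p (fst z) (snd z))) \<in> borel_measurable \<P>"
proof -
  assume i: "i \<in> I"
  have "(\<lambda>z. (fst z, Xm i (fst z) (snd z), \<alpha> i (fst z) (snd z), p (fst z) (snd z))) \<in> \<P> \<rightarrow>\<^sub>M cost_space"
    by (intro measurable_Pair fst_pred Xm_pred[OF i] \<alpha>_pred[OF i] p_pred)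
  from measurable_compose[OF this run_cost_measurable] show ?thesis by simp
qed

lemma PP_times_null:
  assumes \<omega>: "\<omega> \<in> space M"
  shows "countable (\<Union>l\<in>I. fst ` PP l \<omega>)" "s \<in> (\<Union>l\<in>I. fst ` PP l \<omega>) \<Longrightarrow> {s} \<in> sets \<tau> \<and> emeasure \<tau> {s} = 0"
proof -
  have "finite (\<Union>l\<in>I. fst ` PP l \<omega>)" using finI finite_PP[OF _ \<omega>] by auto
  then show "countable (\<Union>l\<in>I. fst ` PP l \<omega>)" by (rule countable_finite)
  assume "s \<in> (\<Union>l\<in>I. fst ` PP l \<omega>)"
  then obtain l z where "l \<in> I" "z \<in> PP l \<omega>" "s = fst z" by blast
  then have "s \<in> {0..T}" using PP_mem[OF _ \<omega>, of l z] by simp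
  then show "{s} \<in> sets \<tau> \<and> emeasure \<tau> {s} = 0"
    by (subst emeasure_restrict_space) (auto intro: time_meas)
qed

text \<open>For a fixed outcome the integrand \<open>c\<close>, built from states, agrees with its
  predictable version outside the finitely many times of atoms, hence the time integrals coincide.
  The predictable version is jointly measurable and bounded, so the integrals may be
  exchanged.\<close>

lemma cost_time:
  assumes i: "i \<in> I" and e: "e \<in> borel_measurable M" "\<And>\<omega>. \<omega> \<in> space M \<Longrightarrow> \<bar>e \<omega>\<bar> \<le> B"
    and eq: "\<And>\<omega> t. \<omega> \<in> space M \<Longrightarrow> t \<in> {0..T} \<Longrightarrow> t \<notin> (\<Union>l\<in>I. fst ` PP l \<omega>) \<Longrightarrow>
      c t \<omega> = run_cost G t (Xm i t \<omega>) (\<alpha> i t \<omega>) (p t \<omega>)"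
  shows "(LINT \<omega>|M. (LINT t|\<tau>. c t \<omega>) + e \<omega>) =
    (LINT s|\<tau>. LINT \<omega>|M. run_cost G s (Xm i s \<omega>) (\<alpha> i s \<omega>) (p s \<omega>)) + expectation e"
proof -
  obtain B' where B': "0 \<le> B'"
    "\<And>t x a q. t \<in> {0..T} \<Longrightarrow> x \<in> states G \<Longrightarrow> a \<in> actions G \<Longrightarrow> q \<in> prob_simplex \<Longrightarrow> \<bar>run_cost G t x a q\<bar> \<le> B'"
    using costs_bounded by metis
  define g where "g z = run_cost G (fst z) (Xm i (fst z) (snd z)) (\<alpha> i (fst z) (snd z)) (p (fst z) (snd z))" for z
  have gm: "g \<in> borel_measurable (\<tau> \<Otimes>\<^sub>M M)" unfolding g_def by (rule pred_measurable_pair[OF run_cost_pred[OF i]])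
  have gb: "\<bar>g (s, \<omega>)\<bar> \<le> B'" if "s \<in> {0..T}" "\<omega> \<in> space M" for s \<omega>
    unfolding g_def fst_conv snd_conv using that i by (intro B' Xm_states \<alpha>_actions p_simplex)
  have int: "(LINT t|\<tau>. c t \<omega>) = (LINT t|\<tau>. g (t, \<omega>))" if \<omega>: "\<omega> \<in> space M" for \<omega>
    using PP_times_null[OF \<omega>] eq[OF \<omega>]
    by (intro integral_discrete_difference[where X = "\<Union>l\<in>I. fst ` PP l \<omega>"]) (auto simp: g_def space_time)
  have "(LINT \<omega>|M. (LINT t|\<tau>. c t \<omega>) + e \<omega>) = (LINT \<omega>|M. (LINT t|\<tau>. g (t, \<omega>)) + e \<omega>)"
    by (rule LINT_cong) (auto simp: int)
  also have "\<dots> = (LINT \<omega>|M. LINT t|\<tau>. g (t, \<omega>)) + expectation e"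
  proof (rule LINT_add)
    show "integrable M e" using e by (rule integrable_if_bounded)
    have gm': "(\<lambda>(\<omega>, t). g (t, \<omega>)) \<in> borel_measurable (M \<Otimes>\<^sub>M \<tau>)" using measurable_pair_swap[OF gm] by (simp add: case_prod_beta')
    show "integrable M (\<lambda>\<omega>. LINT t|\<tau>. g (t, \<omega>))"
    proof (rule integrable_if_bounded[of _ "B' * measure \<tau> (space \<tau>)"])
      show "(\<lambda>\<omega>. LINT t|\<tau>. g (t, \<omega>)) \<in> borel_measurable M" using gm' by (rule tau.borel_measurable_lebesgue_integral)
      show "\<bar>LINT t|\<tau>. g (t, \<omega>)\<bar> \<le> B' * measure \<tau> (space \<tau>)" if "\<omega> \<in> space M" for \<omega>
        using gb[OF _ that] B'(1) by (intro tau.abs_integral_le_if_bounded) (auto simp: space_time)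
    qed
  qed
  also have "(LINT \<omega>|M. LINT t|\<tau>. g (t, \<omega>)) = (LINT s|\<tau>. LINT \<omega>|M. g (s, \<omega>))"
    by (rule expectation_time_swap[OF gm gb])
  finally show ?thesis by (simp add: g_def)
qed

lemma LINT_lborel: "(LINT t:{0..T}|lborel. f t :: real) = (LINT t|\<tau>. f t)"
  unfolding set_LINT_def by (subst integral_restrict_space) auto

end

section \<open>The cost of player \<open>k\<close> when it follows \<open>\<gamma>\<close>\<close>

context players_near_limit
begin

abbreviation "L2 \<equiv> \<bar>K2\<bar>"

definition gap :: "real \<Rightarrow> real" where "gap s = (\<Sum>x\<in>UNIV. \<bar>law_of k x s - law x s\<bar>)"

definition cD :: real where
  "cD = 2 * (real CARD('d) * L * cP * T) * exp (2 * (real CARD('d) * \<nu> + 1) * T)"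

lemma cP_nonneg: "0 \<le> cP"
proof -
  have "0 \<le> cV" unfolding cV_def using T_pos by (intro mult_nonneg_nonneg add_nonneg_nonneg) auto
  then show ?thesis by (simp add: cP_def)
qed

text \<open>The law of player \<open>k\<close> and \<open>law\<close> solve forward equations with
  the same feedback. The environments differ by order \<open>1 / sqrt N\<close> in mean, which
  enters through the Lipschitz bound on the rates; the rest of the difference is linear in the
  difference of the laws. In each state \<open>\<gamma>\<close> is compared with itself, never with
  its value in another state.\<close>

lemma gap_le:
  assumes all_fb: "\<And>s \<omega>. s \<in> {0..T} \<Longrightarrow> \<omega> \<in> space M \<Longrightarrow> \<alpha> k s \<omega> = \<gamma> s (Xm k s \<omega>)" and t: "t \<in> {0..T}"
  shows "gap t \<le> cD / sqrt Nr"
proof -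
  define r where "r x s = expectation (\<lambda>\<omega>. rate G x s (Xm k s \<omega>) (\<alpha> k s \<omega>) (p s \<omega>))" for x s
  define q where "q = cP / sqrt Nr"
  have q0: "0 \<le> q" using cP_nonneg by (simp add: q_def)
  have r_meas: "r x \<in> borel_measurable \<tau>" for x unfolding r_def using expectation_measurable[OF rate_pred[OF k, of x]] by simp
  have r_bound: "\<bar>r x s\<bar> \<le> \<nu>" for x s unfolding r_def by (rule expectation_bound[OF rate_bound]) simp
  have gap_meas: "gap \<in> borel_measurable \<tau>"
    unfolding gap_def using law_of_measurable[OF k] law_meas by measurable
  have gap_bound: "0 \<le> gap s \<and> gap s \<le> 2" if s: "s \<in> {0..T}" for s
  proof
    show "0 \<le> gap s" unfolding gap_def by (intro sum_nonneg) auto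
    have "gap s \<le> (\<Sum>x\<in>UNIV. law_of k x s + law x s)"
      unfolding gap_def using law_of_nonneg[of k] law_nonneg[OF s] by (intro sum_mono) (smt (verit))
    then show "gap s \<le> 2" using sum_law_of[OF k s] law_sum[OF s] by (simp add: sum.distrib)
  qed
  have diff: "\<bar>r x s - \<Lambda> x s\<bar> \<le> L * q + \<nu> * gap s" if s: "s \<in> {0..T}" for x s
  proof -
    let ?R = "\<lambda>\<omega> q. rate G x s (Xm k s \<omega>) (\<gamma> s (Xm k s \<omega>)) q"
    have r_eq: "r x s = expectation (\<lambda>\<omega>. ?R \<omega> (p s \<omega>))"
      unfolding r_def using all_fb[OF s] by (intro LINT_cong) auto
    have i1: "integrable M (\<lambda>\<omega>. ?R \<omega> (p s \<omega>))"
    proof -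
      have "integrable M (\<lambda>\<omega>. rate G x s (Xm k s \<omega>) (\<alpha> k s \<omega>) (p s \<omega>))"
        using pred_integrable[OF rate_pred[OF k], of x s \<nu>] rate_bound s by simp
      then show ?thesis by (rule Bochner_Integration.integrable_cong[THEN iffD1, rotated 2]) (auto simp: all_fb[OF s])
    qed
    have i2: "integrable M (\<lambda>\<omega>. ?R \<omega> (m s))"
      by (intro integrable_if_bounded[OF _ rate_bound] Xm_fun_measurable[OF k s])
    have i3: "integrable M (\<lambda>\<omega>. L * norm (p s \<omega> - m s))"
      using pred_integrable[OF norm_p_m_meas, of s 2] norm_p_m_bound[OF s] s by simp
    have "\<bar>expectation (\<lambda>\<omega>. ?R \<omega> (p s \<omega>)) - expectation (\<lambda>\<omega>. ?R \<omega> (m s))\<bar> \<le> expectation (\<lambda>\<omega>. \<bar>?R \<omega> (p s \<omega>) - ?R \<omega> (m s)\<bar>)"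
      by (rule abs_integral_diff_le[OF i1 i2])
    also have "\<dots> \<le> expectation (\<lambda>\<omega>. L * norm (p s \<omega> - m s))"
    proof (rule integral_mono[OF integrable_abs[OF Bochner_Integration.integrable_diff[OF i1 i2]] i3])
      fix \<omega> assume \<omega>: "\<omega> \<in> space M"
      have "\<gamma> s (Xm k s \<omega>) \<in> actions G" using \<alpha>_actions[OF k \<omega> s] all_fb[OF s \<omega>] by simp
      then show "\<bar>?R \<omega> (p s \<omega>) - ?R \<omega> (m s)\<bar> \<le> L * norm (p s \<omega> - m s)"
        by (intro rate_lipschitz s Xm_states[OF k \<omega> s] p_simplex[OF \<omega> s] flow_simplex[OF m s])
    qed
    also have "\<dots> \<le> L * q" using mult_left_mono[OF expectation_p_close[OF s] abs_ge_zero[of K1]] by (simp add: q_def)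
    finally have 1: "\<bar>r x s - expectation (\<lambda>\<omega>. ?R \<omega> (m s))\<bar> \<le> L * q" by (simp add: r_eq)
    have "expectation (\<lambda>\<omega>. ?R \<omega> (m s)) - \<Lambda> x s = (\<Sum>y\<in>UNIV. (law_of k y s - law y s) * rate G x s (state_of y) (\<gamma> s (state_of y)) (m s))"
      unfolding expectation_rate_feedback[OF k s] \<Lambda>_def by (simp add: sum_subtractf left_diff_distrib)
    also have "\<bar>\<dots>\<bar> \<le> (\<Sum>y\<in>UNIV. \<bar>law_of k y s - law y s\<bar> * \<nu>)"
      by (intro order_trans[OF sum_abs] sum_mono) (auto simp: abs_mult intro!: mult_left_mono rate_bound)
    also have "\<dots> = \<nu> * gap s" by (simp add: gap_def sum_distrib_left mult.commute)
    finally show ?thesis using 1 by linarith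
  qed
  have main: "gap s \<le> real CARD('d) * L * cP / sqrt Nr * T + (real CARD('d) * \<nu> + 1) * (LINT u:{..s}|\<tau>. gap u)" if s: "s \<in> {0..T}" for s
  proof -
    have pos: "0 \<le> (LINT u:{..s}|\<tau>. gap u)" unfolding set_LINT_def
      using gap_bound by (intro integral_nonneg_AE AE_I2) (auto simp: space_time split: split_indicator)
    have "\<bar>law_of k x s - law x s\<bar> \<le> L * q * T + \<nu> * (LINT u:{..s}|\<tau>. gap u)" for x
    proof -
      have "law_of k x s - law x s = (LINT u:{..s}|\<tau>. r x u) - (LINT u:{..s}|\<tau>. \<Lambda> x u)"
        unfolding law_of_eq[OF k s, of x] law_eq[OF s, of x] r_def \<Lambda>_def by simp
      also have "\<dots> = (LINT u:{..s}|\<tau>. r x u - \<Lambda> x u)"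
        using LINT_bounded(2)[OF r_meas r_bound] LINT_bounded(2)[OF \<Lambda>_meas \<Lambda>_bound] by (intro set_integral_diff(2)[symmetric]) auto
      also have "\<bar>\<dots>\<bar> \<le> (LINT u:{..s}|\<tau>. L * q + \<nu> * gap u)"
      proof (rule set_LINT_abs_le[where B = "2 * \<nu>" and B' = "L * q + \<nu> * 2"])
        show "(\<lambda>u. r x u - \<Lambda> x u) \<in> borel_measurable \<tau>" using r_meas \<Lambda>_meas by measurable
        show "\<bar>r x u - \<Lambda> x u\<bar> \<le> 2 * \<nu>" if "u \<in> {0..T}" for u using r_bound[of x u] \<Lambda>_bound[OF that, of x] by linarith
        show "(\<lambda>u. L * q + \<nu> * gap u) \<in> borel_measurable \<tau>" using gap_meas by measurable
        show "\<bar>L * q + \<nu> * gap u\<bar> \<le> L * q + \<nu> * 2" if "u \<in> {0..T}" for u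
          using gap_bound[OF that] q0 by (auto intro!: mult_left_mono)
      qed (rule diff)
      also have "\<dots> \<le> L * q * T + \<nu> * (LINT u:{..s}|\<tau>. gap u)"
        using gap_bound q0 by (intro set_LINT_affine[OF gap_meas, of 2]) auto
      finally show ?thesis .
    qed
    then have "gap s \<le> (\<Sum>x\<in>(UNIV :: 'd set). L * q * T + \<nu> * (LINT u:{..s}|\<tau>. gap u))" unfolding gap_def by (intro sum_mono)
    also have "\<dots> = real CARD('d) * L * cP / sqrt Nr * T + real CARD('d) * \<nu> * (LINT u:{..s}|\<tau>. gap u)"
      by (simp add: q_def algebra_simps)
    finally show ?thesis using pos by (simp add: distrib_right)
  qed
  \<comment> \<open>The added 1 keeps the Gronwall rate positive even for an intensity of mass
    0.\<close>
  have b0: "0 < real CARD('d) * \<nu> + 1" by (intro add_nonneg_pos) auto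
  have "gap t \<le> 2 * (real CARD('d) * L * cP / sqrt Nr * T) * exp (2 * (real CARD('d) * \<nu> + 1) * t)"
    by (rule gronwall_bounded[OF b0 _ gap_meas gap_bound main t]) (use cP_nonneg T_pos in auto)
  also have "\<dots> \<le> 2 * (real CARD('d) * L * cP / sqrt Nr * T) * exp (2 * (real CARD('d) * \<nu> + 1) * T)"
    using t b0 cP_nonneg T_pos by (intro mult_left_mono) auto
  also have "\<dots> = cD / sqrt Nr" by (simp add: cD_def)
  finally show ?thesis .
qed

text \<open>Both laws have total mass 1, so a constant can be subtracted from \<open>g\<close> at no
  cost. The bound then involves the oscillation of \<open>g\<close> instead of its supremum, and the
  final constant depends on \<open>K2\<close> rather than on the size of the costs.\<close>

lemma sum_law_diff:
  assumes s: "s \<in> {0..T}" and g: "\<And>y. \<bar>g y - g y\<^sub>0\<bar> \<le> B"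
  shows "\<bar>(\<Sum>y\<in>UNIV. law_of k y s * g y) - (\<Sum>y\<in>UNIV. law y s * g y)\<bar> \<le> gap s * B"
proof -
  have "(\<Sum>y\<in>UNIV. law_of k y s * g y) - (\<Sum>y\<in>UNIV. law y s * g y) = (\<Sum>y\<in>UNIV. (law_of k y s - law y s) * (g y - g y\<^sub>0))"
    using sum_law_of[OF k s] law_sum[OF s]
    by (simp add: algebra_simps sum_subtractf sum.distrib flip: sum_distrib_left)
  also have "\<bar>\<dots>\<bar> \<le> (\<Sum>y\<in>UNIV. \<bar>law_of k y s - law y s\<bar> * B)"
    by (intro order_trans[OF sum_abs] sum_mono) (auto simp: abs_mult intro!: mult_left_mono g)
  finally show ?thesis by (simp add: gap_def sum_distrib_right)
qed

lemma state_diff_le: "x \<in> states G \<Longrightarrow> y \<in> states G \<Longrightarrow> \<bar>real_of_int (x - y)\<bar> \<le> real CARD('d)"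
  by (auto simp: states_def abs_le_iff)

text \<open>The cost of \<open>\<gamma>\<close> in the environment \<open>m\<close>, expressed
  through the law alone; \<open>limit_law\<close> identifies it with
  \<open>feedback_cost\<close>.\<close>

definition Jlim :: real where
  "Jlim = (LINT s|\<tau>. (\<Sum>y\<in>UNIV. law y s * run_cost G s (state_of y) (\<gamma> s (state_of y)) (m s))) +
     (\<Sum>y\<in>UNIV. law y T * end_cost G (state_of y) (m T))"

text \<open>The cost of player \<open>k\<close> with left limits in place of the states;
  \<open>players_reduction\<close> identifies it with \<open>players_cost\<close>.\<close>

definition Jk :: real where
  "Jk = (LINT s|\<tau>. LINT \<omega>|M. run_cost G s (Xm k s \<omega>) (\<alpha> k s \<omega>) (p s \<omega>)) +
    expectation (\<lambda>\<omega>. end_cost G (Xm k T \<omega>) (p T \<omega>))"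

lemma \<gamma>_actions: "s \<in> {0..T} \<Longrightarrow> x \<in> states G \<Longrightarrow> \<gamma> s x \<in> actions G"
  using measurable_space[OF \<gamma>, of "(s, x)"] by (simp add: space_pair_measure space_time space_restrict_space)

lemma end_cost_pred: "(\<lambda>z. end_cost G (Xm k (fst z) (snd z)) (p (fst z) (snd z))) \<in> borel_measurable \<P>"
  using measurable_compose[OF measurable_Pair[OF Xm_pred[OF k] p_pred] end_cost_measurable] by simp

text \<open>First the empirical environment is replaced by \<open>m\<close>, which costs
  \<open>L2\<close> times their mean distance; then the law of the player is replaced by
  \<open>law\<close>, which costs the oscillation \<open>B\<close> times \<open>gap\<close>. The
  function \<open>g\<close> is arbitrary so that running and terminal cost are treated
  alike.\<close>

lemma expectation_cost_close:
  fixes g :: "int \<Rightarrow> real^'d \<Rightarrow> real"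
  assumes s: "s \<in> {0..T}" and all: "gap s \<le> cD / sqrt Nr"
    and int: "integrable M (\<lambda>\<omega>. g (Xm k s \<omega>) (p s \<omega>))"
    and lip: "\<And>x q r. x \<in> states G \<Longrightarrow> q \<in> prob_simplex \<Longrightarrow> r \<in> prob_simplex \<Longrightarrow> \<bar>g x q - g x r\<bar> \<le> L2 * norm (q - r)"
    and osc: "\<And>x y r. x \<in> states G \<Longrightarrow> y \<in> states G \<Longrightarrow> r \<in> prob_simplex \<Longrightarrow> \<bar>g x r - g y r\<bar> \<le> B" and B: "0 \<le> B"
  shows "\<bar>expectation (\<lambda>\<omega>. g (Xm k s \<omega>) (p s \<omega>)) - (\<Sum>y\<in>UNIV. law y s * g (state_of y) (m s))\<bar> \<le> (L2 * cP + B * cD) / sqrt Nr"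
proof -
  have ms: "m s \<in> prob_simplex" by (rule flow_simplex[OF m s])
  have i2: "integrable M (\<lambda>\<omega>. g (Xm k s \<omega>) (m s))"
  proof (rule integrable_if_bounded[of _ "\<bar>g (state_of undefined) (m s)\<bar> + B"])
    show "(\<lambda>\<omega>. g (Xm k s \<omega>) (m s)) \<in> borel_measurable M" by (rule Xm_fun_measurable[OF k s])
    show "\<bar>g (Xm k s \<omega>) (m s)\<bar> \<le> \<bar>g (state_of (undefined :: 'd)) (m s)\<bar> + B" if "\<omega> \<in> space M" for \<omega>
      using osc[OF Xm_states[OF k that s] state_of_states ms, of "undefined :: 'd"] by linarith
  qed
  have i3: "integrable M (\<lambda>\<omega>. L2 * norm (p s \<omega> - m s))"
    using pred_integrable[OF norm_p_m_meas, of s 2] norm_p_m_bound[OF s] s by simp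
  have "\<bar>expectation (\<lambda>\<omega>. g (Xm k s \<omega>) (p s \<omega>)) - expectation (\<lambda>\<omega>. g (Xm k s \<omega>) (m s))\<bar> \<le> expectation (\<lambda>\<omega>. \<bar>g (Xm k s \<omega>) (p s \<omega>) - g (Xm k s \<omega>) (m s)\<bar>)"
    by (rule abs_integral_diff_le[OF int i2])
  also have "\<dots> \<le> expectation (\<lambda>\<omega>. L2 * norm (p s \<omega> - m s))"
    by (rule integral_mono[OF integrable_abs[OF Bochner_Integration.integrable_diff[OF int i2]] i3])
      (intro lip Xm_states[OF k _ s] p_simplex[OF _ s] ms)
  also have "\<dots> \<le> L2 * (cP / sqrt Nr)" using mult_left_mono[OF expectation_p_close[OF s] abs_ge_zero[of K2]] by simp
  finally have 1: "\<bar>expectation (\<lambda>\<omega>. g (Xm k s \<omega>) (p s \<omega>)) - expectation (\<lambda>\<omega>. g (Xm k s \<omega>) (m s))\<bar> \<le> L2 * (cP / sqrt Nr)" .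
  have "\<bar>expectation (\<lambda>\<omega>. g (Xm k s \<omega>) (m s)) - (\<Sum>y\<in>UNIV. law y s * g (state_of y) (m s))\<bar> \<le> gap s * B"
    unfolding expectation_state_sum[OF k s, of "\<lambda>x. g x (m s)"]
    by (rule sum_law_diff[OF s, where y\<^sub>0 = undefined]) (intro osc state_of_states ms)
  also have "\<dots> \<le> cD / sqrt Nr * B" using all B by (intro mult_right_mono)
  finally show ?thesis using 1 by (simp add: add_divide_distrib mult.commute)
qed

text \<open>The running cost along \<open>\<gamma>\<close> may vary between two states because of
  the state and because of the action. The actions can be as far apart as the diameter of the action
  set, and this is where the diameter enters. The factor \<open>T + 1\<close> collects the running
  cost over the horizon and the terminal cost.\<close>

lemma Jk_feedback_close:
  assumes all_fb: "\<And>s \<omega>. s \<in> {0..T} \<Longrightarrow> \<omega> \<in> space M \<Longrightarrow> \<alpha> k s \<omega> = \<gamma> s (Xm k s \<omega>)"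
  shows "\<bar>Jk - Jlim\<bar> \<le> (T + 1) * (L2 * cP + L2 * (real CARD('d) + diameter (actions G)) * cD) / sqrt Nr"
proof -
  define B where "B = L2 * (real CARD('d) + diameter (actions G))"
  define K where "K = (L2 * cP + B * cD) / sqrt Nr"
  have diam: "dist a b \<le> diameter (actions G)" if "a \<in> actions G" "b \<in> actions G" for a b
    using that by (intro diameter_bounded_bound compact_imp_bounded[OF compact_actions])
  have s0: "(0::real) \<in> {0..T}" "T \<in> {0..T}" using T_pos by auto
  have diam0: "0 \<le> diameter (actions G)" by (rule diameter_ge_0[OF compact_imp_bounded[OF compact_actions]])
  have B0: "0 \<le> B" using diam0 by (simp add: B_def)
  obtain Bc where Bc: "0 \<le> Bc"
    "\<And>t x a q. t \<in> {0..T} \<Longrightarrow> x \<in> states G \<Longrightarrow> a \<in> actions G \<Longrightarrow> q \<in> prob_simplex \<Longrightarrow> \<bar>run_cost G t x a q\<bar> \<le> Bc"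
    "\<And>x q. x \<in> states G \<Longrightarrow> q \<in> prob_simplex \<Longrightarrow> \<bar>end_cost G x q\<bar> \<le> Bc"
    using costs_bounded by metis
  define f where "f s = expectation (\<lambda>\<omega>. run_cost G s (Xm k s \<omega>) (\<alpha> k s \<omega>) (p s \<omega>))" for s
  define g where "g s = (\<Sum>y\<in>UNIV. law y s * run_cost G s (state_of y) (\<gamma> s (state_of y)) (m s))" for s
  have fm: "f \<in> borel_measurable \<tau>" unfolding f_def using expectation_measurable[OF run_cost_pred[OF k]] by simp
  have fb': "\<bar>f s\<bar> \<le> Bc" if "s \<in> {0..T}" for s
    unfolding f_def using that k Bc(1) by (intro expectation_bound Bc(2) Xm_states \<alpha>_actions p_simplex)
  have gm: "g \<in> borel_measurable \<tau>"
  proof -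
    have "(\<lambda>s. run_cost G s x (\<gamma> s x) (m s)) \<in> borel_measurable \<tau>" if x: "x \<in> states G" for x
    proof -
      have g: "(\<lambda>s. \<gamma> s x) \<in> \<tau> \<rightarrow>\<^sub>M action_space G"
        using measurable_compose[OF measurable_Pair[OF measurable_ident measurable_const] \<gamma>, of x] x by simp
      have "(\<lambda>s. (s, x, \<gamma> s x, m s)) \<in> \<tau> \<rightarrow>\<^sub>M cost_space"
        using x by (intro measurable_Pair measurable_ident measurable_const g flow_measurable[OF m]) auto
      from measurable_compose[OF this run_cost_measurable] show ?thesis by simp
    qed
    then show ?thesis unfolding g_def using law_meas state_of_states by (intro borel_measurable_sum borel_measurable_times) auto
  qed
  have close: "\<bar>f s - g s\<bar> \<le> K" if s: "s \<in> {0..T}" for s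
  proof -
    have fe: "f s = expectation (\<lambda>\<omega>. run_cost G s (Xm k s \<omega>) (\<gamma> s (Xm k s \<omega>)) (p s \<omega>))"
      unfolding f_def using all_fb[OF s] by (intro LINT_cong) auto
    have "integrable M (\<lambda>\<omega>. run_cost G s (Xm k s \<omega>) (\<alpha> k s \<omega>) (p s \<omega>))"
      using section_omega[OF s run_cost_pred[OF k]] s k
      by (intro integrable_if_bounded[of _ Bc] Bc(2) Xm_states \<alpha>_actions p_simplex) auto
    then have int: "integrable M (\<lambda>\<omega>. run_cost G s (Xm k s \<omega>) (\<gamma> s (Xm k s \<omega>)) (p s \<omega>))"
      by (rule Bochner_Integration.integrable_cong[THEN iffD1, rotated 2]) (auto simp: all_fb[OF s])
    show ?thesis unfolding fe g_def K_def
    proof (rule expectation_cost_close[OF s gap_le[OF all_fb s], where g = "\<lambda>x q. run_cost G s x (\<gamma> s x) q" and B = B])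
      show "\<bar>run_cost G s x (\<gamma> s x) q - run_cost G s x (\<gamma> s x) r\<bar> \<le> L2 * norm (q - r)" if "x \<in> states G" "q \<in> prob_simplex" "r \<in> prob_simplex" for x q r
        using run_cost_lipschitz(1)[OF s that(1) that(1) \<gamma>_actions[OF s that(1)] \<gamma>_actions[OF s that(1)] that(2,3)] by simp
      show "\<bar>run_cost G s x (\<gamma> s x) r - run_cost G s y (\<gamma> s y) r\<bar> \<le> B" if "x \<in> states G" "y \<in> states G" "r \<in> prob_simplex" for x y r
      proof -
        have "\<bar>run_cost G s x (\<gamma> s x) r - run_cost G s y (\<gamma> s y) r\<bar> \<le> L2 * (\<bar>real_of_int (x - y)\<bar> + dist (\<gamma> s x) (\<gamma> s y) + norm (r - r))"
          using that by (intro run_cost_lipschitz(1) s \<gamma>_actions)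
        also have "\<dots> \<le> B" unfolding B_def
          using diam[OF \<gamma>_actions[OF s that(1)] \<gamma>_actions[OF s that(2)]] state_diff_le[OF that(1,2)] by (intro mult_left_mono) auto
        finally show ?thesis .
      qed
    qed (use all_fb int B0 in auto)
  qed
  have E: "\<bar>expectation (\<lambda>\<omega>. end_cost G (Xm k T \<omega>) (p T \<omega>)) - (\<Sum>y\<in>UNIV. law y T * end_cost G (state_of y) (m T))\<bar> \<le> K"
    unfolding K_def
  proof (rule expectation_cost_close[OF s0(2) gap_le[OF all_fb s0(2)], where g = "end_cost G" and B = B])
    \<comment> \<open>The regularity of the terminal cost is assumed in a joint inequality with the
      running cost, so some time and action have to be supplied; their choice is immaterial.\<close>
    have act: "\<gamma> 0 (state_of (undefined :: 'd)) \<in> actions G" by (intro \<gamma>_actions s0 state_of_states)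
    show "integrable M (\<lambda>\<omega>. end_cost G (Xm k T \<omega>) (p T \<omega>))"
      using section_omega[OF s0(2) end_cost_pred] s0 k
      by (intro integrable_if_bounded[of _ Bc] Bc(3) Xm_states p_simplex) auto
    show "\<bar>end_cost G x q - end_cost G x r\<bar> \<le> L2 * norm (q - r)" if "x \<in> states G" "q \<in> prob_simplex" "r \<in> prob_simplex" for x q r
      using run_cost_lipschitz(2)[OF s0(1) that(1) that(1) act act that(2,3)] by simp
    show "\<bar>end_cost G x r - end_cost G y r\<bar> \<le> B" if "x \<in> states G" "y \<in> states G" "r \<in> prob_simplex" for x y r
    proof -
      have "\<bar>end_cost G x r - end_cost G y r\<bar> \<le> L2 * (\<bar>real_of_int (x - y)\<bar> + dist (\<gamma> 0 (state_of (undefined :: 'd))) (\<gamma> 0 (state_of (undefined :: 'd))) + norm (r - r))"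
        using that by (intro run_cost_lipschitz(2)[OF s0(1)] act)
      also have "\<dots> \<le> B" unfolding B_def using diam0 state_diff_le[OF that(1,2)] by (intro mult_left_mono) auto
      finally show ?thesis .
    qed
  qed (use all_fb B0 in auto)
  have gb: "\<bar>g s\<bar> \<le> Bc + K" if "s \<in> {0..T}" for s using close[OF that] fb'[OF that] by linarith
  have "(LINT s|\<tau>. f s) - (LINT s|\<tau>. g s) = (LINT s|\<tau>. f s - g s)"
    using LINT_bounded(1)[OF fm fb'] LINT_bounded(1)[OF gm gb] by simp
  also have "\<bar>\<dots>\<bar> \<le> K * measure \<tau> (space \<tau>)"
  proof (rule tau.abs_integral_le_if_bounded)
    show "0 \<le> K" using close[OF s0(1)] by linarith
  qed (use close in \<open>auto simp: space_time\<close>)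
  also have "measure \<tau> (space \<tau>) = T" using T_pos by (simp add: measure_restrict_space space_restrict_space)
  finally have "\<bar>(LINT s|\<tau>. f s) - (LINT s|\<tau>. g s)\<bar> \<le> K * T" .
  then have "\<bar>Jk - Jlim\<bar> \<le> K * T + K" unfolding Jk_def Jlim_def f_def[symmetric] g_def[symmetric] using E by linarith
  also have "\<dots> = (T + 1) * (L2 * cP + B * cD) / sqrt Nr" by (simp add: K_def algebra_simps add_divide_distrib)
  finally show ?thesis by (simp add: B_def)
qed

section \<open>The cost of player \<open>k\<close> when it deviates\<close>

definition cZ :: real where "cZ = 2 * (L * cP * T) * exp (2 * (L + 1) * T)"

text \<open>Here the comparison is by paths. \<open>Z\<close> has the same initial state, noise and
  control process as player \<open>k\<close> but lives in the environment \<open>m\<close>. The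
  control is a process and not a function of the state, so the two systems use the same action at
  every time, and the Lipschitz bound on the jumps is enough.\<close>

lemma Jk_deviation_close:
  assumes Z: "jump_system G M F {k} \<N> K1 K2 \<xi> (\<lambda>_. Z) \<alpha> (\<lambda>s \<omega>. m s)"
  shows "\<bar>Jk - ((LINT s|\<tau>. LINT \<omega>|M. run_cost G s (left_state Z s \<omega>) (\<alpha> k s \<omega>) (m s)) +
    expectation (\<lambda>\<omega>. end_cost G (left_state Z T \<omega>) (m T)))\<bar> \<le> (T + 1) * (L2 * (cZ + cP)) / sqrt Nr"
proof -
  interpret Z: jump_system G M F "{k}" \<N> K1 K2 \<xi> "\<lambda>_. Z" \<alpha> "\<lambda>s \<omega>. m s" by (rule Z)
  have kk: "k \<in> {k}" by simp
  define q where "q = cP / sqrt Nr"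
  have q0: "0 \<le> q" using cP_nonneg by (simp add: q_def)
  define \<delta> where "\<delta> z = \<bar>real_of_int (Xm k (fst z) (snd z)) - real_of_int (left_state Z (fst z) (snd z))\<bar>" for z
  have \<delta>m: "\<delta> \<in> borel_measurable \<P>" unfolding \<delta>_def using Xm_real[OF k] Z.Xm_real[OF kk] by measurable
  have \<delta>b: "\<bar>\<delta> (s, \<omega>)\<bar> \<le> real CARD('d)" if "s \<in> {0..T}" "\<omega> \<in> space M" for s \<omega>
    using state_diff_le[OF Xm_states[OF k that(2,1)] Z.Xm_states[OF kk that(2,1)]] by (simp add: \<delta>_def)
  define u where "u s = expectation (\<lambda>\<omega>. \<delta> (s, \<omega>))" for s
  have um: "u \<in> borel_measurable \<tau>" unfolding u_def by (rule expectation_measurable[OF \<delta>m])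
  have ub: "0 \<le> u s \<and> u s \<le> real CARD('d)" if s: "s \<in> {0..T}" for s
  proof
    show "0 \<le> u s" unfolding u_def by (intro integral_nonneg_AE) (auto simp: \<delta>_def)
    have "\<bar>u s\<bar> \<le> real CARD('d)" unfolding u_def using \<delta>b[OF s] by (intro expectation_bound) auto
    then show "u s \<le> real CARD('d)" by simp
  qed
  \<comment> \<open>The distance of the two paths at time \<open>t\<close> is at most the sum of
    \<open>h\<close> over the atoms up to \<open>t\<close>. By compensation its mean is a time
    integral of mark integrals, and these are controlled by the distance of the left limits and of
    the environments.\<close>
  define h where "h z = \<bar>real_of_int (jmp k z) - real_of_int (Z.jmp k z)\<bar>" for z
  have hm: "h \<in> borel_measurable \<H>" unfolding h_def using jmp_real[OF k] Z.jmp_real[OF kk] by measurable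
  have hb: "\<bar>h ((s, \<omega>), v)\<bar> \<le> 2 * real CARD('d)" if "s \<in> {0..T}" "\<omega> \<in> space M" "v \<in> marks G" for s \<omega> v
  proof -
    have "\<bar>real_of_int (jmp k ((s, \<omega>), v))\<bar> \<le> real CARD('d)" unfolding jmp_def prod.case
      using that k by (intro jump_abs_le Xm_states \<alpha>_actions p_simplex)
    moreover have "\<bar>real_of_int (Z.jmp k ((s, \<omega>), v))\<bar> \<le> real CARD('d)" unfolding Z.jmp_def prod.case
      using that k kk by (intro jump_abs_le Z.Xm_states \<alpha>_actions Z.p_simplex)
    ultimately show ?thesis by (simp add: h_def)
  qed
  have hint: "(LINT v|\<mu>. h ((s, \<omega>), v)) \<le> L * (\<delta> (s, \<omega>) + norm (p s \<omega> - m s))" if s: "s \<in> {0..T}" and \<omega>: "\<omega> \<in> space M" for s \<omega>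
    using jump_lipschitz[OF s Xm_states[OF k \<omega> s] Z.Xm_states[OF kk \<omega> s] \<alpha>_actions[OF k \<omega> s] p_simplex[OF \<omega> s] flow_simplex[OF m s]]
    by (simp add: h_def jmp_def Z.jmp_def \<delta>_def)
  have main: "u t \<le> L * cP * T / sqrt Nr + (L + 1) * (LINT s:{..t}|\<tau>. u s)" if t: "t \<in> {0..T}" for t
  proof -
    have hbi: "has_bochner_integral M (\<lambda>\<omega>. \<Sum>z\<in>PPt k t \<omega>. h (tw \<omega> z)) (LINT s:{..t}|\<tau>. LINT \<omega>|M. LINT v|\<mu>. h ((s, \<omega>), v))"
      by (rule compensation[OF k t hm hb]) auto
    have "u t \<le> expectation (\<lambda>\<omega>. \<Sum>z\<in>PPt k t \<omega>. h (tw \<omega> z))"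
      unfolding u_def
    proof (rule integral_mono_AE)
      show "integrable M (\<lambda>\<omega>. \<delta> (t, \<omega>))" by (rule pred_integrable[OF \<delta>m \<delta>b[OF t] t])
      show "integrable M (\<lambda>\<omega>. \<Sum>z\<in>PPt k t \<omega>. h (tw \<omega> z))" using hbi by (simp add: has_bochner_integral_iff)
      show "AE \<omega> in M. \<delta> (t, \<omega>) \<le> (\<Sum>z\<in>PPt k t \<omega>. h (tw \<omega> z))"
        using X_eq_Xm_AE[OF t] Z.X_eq_Xm_AE[OF t] AE_space
      proof eventually_elim
        case (elim \<omega>)
        have "\<delta> (t, \<omega>) = \<bar>real_of_int (X k t \<omega>) - real_of_int (Z t \<omega>)\<bar>" using elim k by (simp add: \<delta>_def)
        also have "real_of_int (X k t \<omega>) - real_of_int (Z t \<omega>) =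
            (\<Sum>z\<in>PPt k t \<omega>. real_of_int (jmp k (tw \<omega> z)) - real_of_int (Z.jmp k (tw \<omega> z)))"
          using state_eq[OF k elim(3) t] Z.state_eq[OF kk elim(3) t] by (simp add: jmp_def Z.jmp_def sum_subtractf)
        finally show ?case unfolding h_def by simp
      qed
    qed
    also have "\<dots> = (LINT s:{..t}|\<tau>. LINT \<omega>|M. LINT v|\<mu>. h ((s, \<omega>), v))" using hbi by (simp add: has_bochner_integral_iff)
    also have "\<dots> \<le> (LINT s:{..t}|\<tau>. L * q + L * u s)"
    proof (rule set_LINT_mono[where B = "2 * real CARD('d) * \<nu>" and B' = "L * q + L * real CARD('d)"])
      show "(\<lambda>s. LINT \<omega>|M. LINT v|\<mu>. h ((s, \<omega>), v)) \<in> borel_measurable \<tau>"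
        by (rule expectation_measurable[OF mark_integral_measurable[OF hm]])
      show "\<bar>LINT \<omega>|M. LINT v|\<mu>. h ((s, \<omega>), v)\<bar> \<le> 2 * real CARD('d) * \<nu>" if "s \<in> {0..T}" for s
        using hb that by (intro expectation_bound mark_integral_bound) auto
      show "(\<lambda>s. L * q + L * u s) \<in> borel_measurable \<tau>" using um by measurable
      show "\<bar>L * q + L * u s\<bar> \<le> L * q + L * real CARD('d)" if "s \<in> {0..T}" for s
        using ub[OF that] q0 by (auto intro!: mult_left_mono)
      show "(LINT \<omega>|M. LINT v|\<mu>. h ((s, \<omega>), v)) \<le> L * q + L * u s" if s: "s \<in> {0..T}" for s
      proof -
        have i1: "integrable M (\<lambda>\<omega>. \<delta> (s, \<omega>))" by (rule pred_integrable[OF \<delta>m \<delta>b[OF s] s])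
        have i2: "integrable M (\<lambda>\<omega>. norm (p s \<omega> - m s))"
          using pred_integrable[OF norm_p_m_meas, of s 2] norm_p_m_bound[OF s] s by simp
        have "(LINT \<omega>|M. LINT v|\<mu>. h ((s, \<omega>), v)) \<le> (LINT \<omega>|M. L * (\<delta> (s, \<omega>) + norm (p s \<omega> - m s)))"
        proof (rule integral_mono)
          show "integrable M (\<lambda>\<omega>. LINT v|\<mu>. h ((s, \<omega>), v))"
            using hb s by (intro pred_integrable[OF mark_integral_measurable[OF hm], where B = "2 * real CARD('d) * \<nu>"] mark_integral_bound) auto
        qed (use i1 i2 hint[OF s] in auto)
        also have "\<dots> = L * (u s + expectation (\<lambda>\<omega>. norm (p s \<omega> - m s)))" using i1 i2 by (simp add: u_def)
        also have "\<dots> \<le> L * (u s + q)" using expectation_p_close[OF s] by (intro mult_left_mono) (auto simp: q_def)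
        finally show ?thesis by (simp add: algebra_simps)
      qed
    qed
    also have "\<dots> \<le> L * q * T + L * (LINT s:{..t}|\<tau>. u s)"
      using ub q0 by (intro set_LINT_affine[OF um, of "real CARD('d)"]) auto
    also have "\<dots> \<le> L * cP * T / sqrt Nr + (L + 1) * (LINT s:{..t}|\<tau>. u s)"
    proof -
      have "0 \<le> (LINT s:{..t}|\<tau>. u s)" unfolding set_LINT_def
        using ub by (intro integral_nonneg_AE AE_I2) (auto simp: space_time split: split_indicator)
      then show ?thesis by (simp add: q_def distrib_right)
    qed
    finally show ?thesis .
  qed
  have u_le: "u t \<le> cZ / sqrt Nr" if t: "t \<in> {0..T}" for t
  proof -
    have "u t \<le> 2 * (L * cP * T / sqrt Nr) * exp (2 * (L + 1) * t)"
      by (rule gronwall_bounded[OF _ _ um ub main t]) (use cP_nonneg T_pos in auto)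
    also have "\<dots> \<le> 2 * (L * cP * T / sqrt Nr) * exp (2 * (L + 1) * T)"
    proof (rule mult_left_mono)
      have "2 * (L + 1) * t \<le> 2 * (L + 1) * T" using t by (intro mult_left_mono) auto
      then show "exp (2 * (L + 1) * t) \<le> exp (2 * (L + 1) * T)" by simp
    qed (use cP_nonneg T_pos in auto)
    also have "\<dots> = cZ / sqrt Nr" by (simp add: cZ_def)
    finally show ?thesis .
  qed
  define K where "K = L2 * (cZ + cP) / sqrt Nr"
  have s0: "(0::real) \<in> {0..T}" "T \<in> {0..T}" using T_pos by auto
  have Ele: "\<bar>expectation f - expectation g\<bar> \<le> K"
    if s: "s \<in> {0..T}" and f: "integrable M f" and g: "integrable M g"
      and fg: "\<And>\<omega>. \<omega> \<in> space M \<Longrightarrow> \<bar>f \<omega> - g \<omega>\<bar> \<le> L2 * (\<delta> (s, \<omega>) + norm (p s \<omega> - m s))" for s f g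
  proof -
    have i1: "integrable M (\<lambda>\<omega>. \<delta> (s, \<omega>))" by (rule pred_integrable[OF \<delta>m \<delta>b[OF s] s])
    have i2: "integrable M (\<lambda>\<omega>. norm (p s \<omega> - m s))"
      using pred_integrable[OF norm_p_m_meas, of s 2] norm_p_m_bound[OF s] s by simp
    have "\<bar>expectation f - expectation g\<bar> \<le> expectation (\<lambda>\<omega>. \<bar>f \<omega> - g \<omega>\<bar>)"
      by (rule abs_integral_diff_le[OF f g])
    also have "\<dots> \<le> expectation (\<lambda>\<omega>. L2 * (\<delta> (s, \<omega>) + norm (p s \<omega> - m s)))"
      using f g i1 i2 fg by (intro integral_mono) auto
    also have "\<dots> = L2 * (u s + expectation (\<lambda>\<omega>. norm (p s \<omega> - m s)))" using i1 i2 by (simp add: u_def)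
    also have "\<dots> \<le> L2 * (cZ / sqrt Nr + cP / sqrt Nr)" using u_le[OF s] expectation_p_close[OF s] by (intro mult_left_mono add_mono) auto
    finally show ?thesis by (simp add: K_def add_divide_distrib[symmetric])
  qed
  obtain Bc where Bc: "0 \<le> Bc"
    "\<And>t x a q. t \<in> {0..T} \<Longrightarrow> x \<in> states G \<Longrightarrow> a \<in> actions G \<Longrightarrow> q \<in> prob_simplex \<Longrightarrow> \<bar>run_cost G t x a q\<bar> \<le> Bc"
    "\<And>x q. x \<in> states G \<Longrightarrow> q \<in> prob_simplex \<Longrightarrow> \<bar>end_cost G x q\<bar> \<le> Bc"
    using costs_bounded by metis
  define f where "f s = expectation (\<lambda>\<omega>. run_cost G s (Xm k s \<omega>) (\<alpha> k s \<omega>) (p s \<omega>))" for s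
  define g where "g s = expectation (\<lambda>\<omega>. run_cost G s (left_state Z s \<omega>) (\<alpha> k s \<omega>) (m s))" for s
  have fm: "f \<in> borel_measurable \<tau>" unfolding f_def using expectation_measurable[OF run_cost_pred[OF k]] by simp
  have gm: "g \<in> borel_measurable \<tau>" unfolding g_def using expectation_measurable[OF Z.run_cost_pred[OF kk]] by simp
  have fb': "\<bar>f s\<bar> \<le> Bc" if "s \<in> {0..T}" for s
    unfolding f_def using that k Bc(1) by (intro expectation_bound Bc(2) Xm_states \<alpha>_actions p_simplex)
  have gb': "\<bar>g s\<bar> \<le> Bc" if "s \<in> {0..T}" for s
    unfolding g_def using that k kk Bc(1) by (intro expectation_bound Bc(2) Z.Xm_states \<alpha>_actions Z.p_simplex)
  have close: "\<bar>f s - g s\<bar> \<le> K" if s: "s \<in> {0..T}" for s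
    unfolding f_def g_def
  proof (rule Ele[OF s])
    show "integrable M (\<lambda>\<omega>. run_cost G s (Xm k s \<omega>) (\<alpha> k s \<omega>) (p s \<omega>))"
      using section_omega[OF s run_cost_pred[OF k]] s k
      by (intro integrable_if_bounded[of _ Bc] Bc(2) Xm_states \<alpha>_actions p_simplex) auto
    show "integrable M (\<lambda>\<omega>. run_cost G s (left_state Z s \<omega>) (\<alpha> k s \<omega>) (m s))"
      using section_omega[OF s Z.run_cost_pred[OF kk]] s k kk
      by (intro integrable_if_bounded[of _ Bc] Bc(2) Z.Xm_states \<alpha>_actions Z.p_simplex) auto
    fix \<omega> assume \<omega>: "\<omega> \<in> space M"
    show "\<bar>run_cost G s (Xm k s \<omega>) (\<alpha> k s \<omega>) (p s \<omega>) - run_cost G s (left_state Z s \<omega>) (\<alpha> k s \<omega>) (m s)\<bar> \<le> L2 * (\<delta> (s, \<omega>) + norm (p s \<omega> - m s))"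
      using run_cost_lipschitz(1)[OF s Xm_states[OF k \<omega> s] Z.Xm_states[OF kk \<omega> s] \<alpha>_actions[OF k \<omega> s] \<alpha>_actions[OF k \<omega> s] p_simplex[OF \<omega> s] flow_simplex[OF m s]]
      by (simp add: \<delta>_def)
  qed
  have E: "\<bar>expectation (\<lambda>\<omega>. end_cost G (Xm k T \<omega>) (p T \<omega>)) - expectation (\<lambda>\<omega>. end_cost G (left_state Z T \<omega>) (m T))\<bar> \<le> K"
  proof (rule Ele[OF s0(2)])
    show "integrable M (\<lambda>\<omega>. end_cost G (Xm k T \<omega>) (p T \<omega>))"
      using section_omega[OF s0(2) end_cost_pred] s0 k
      by (intro integrable_if_bounded[of _ Bc] Bc(3) Xm_states p_simplex) auto
    show "integrable M (\<lambda>\<omega>. end_cost G (left_state Z T \<omega>) (m T))"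
      using s0 kk by (intro integrable_if_bounded[of _ Bc] Bc(3) Z.Xm_states Z.p_simplex Z.Xm_fun_measurable[OF kk s0(2), of "\<lambda>x. end_cost G x (m T)"]) auto
    fix \<omega> assume \<omega>: "\<omega> \<in> space M"
    show "\<bar>end_cost G (Xm k T \<omega>) (p T \<omega>) - end_cost G (left_state Z T \<omega>) (m T)\<bar> \<le> L2 * (\<delta> (T, \<omega>) + norm (p T \<omega> - m T))"
      using run_cost_lipschitz(2)[OF s0(2) Xm_states[OF k \<omega> s0(2)] Z.Xm_states[OF kk \<omega> s0(2)] \<alpha>_actions[OF k \<omega> s0(2)] \<alpha>_actions[OF k \<omega> s0(2)] p_simplex[OF \<omega> s0(2)] flow_simplex[OF m s0(2)]]
      by (simp add: \<delta>_def)
  qed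
  have "(LINT s|\<tau>. f s) - (LINT s|\<tau>. g s) = (LINT s|\<tau>. f s - g s)"
    using LINT_bounded(1)[OF fm fb'] LINT_bounded(1)[OF gm gb'] by simp
  also have "\<bar>\<dots>\<bar> \<le> K * measure \<tau> (space \<tau>)"
  proof (rule tau.abs_integral_le_if_bounded)
    show "0 \<le> K" using close[OF s0(1)] by linarith
  qed (use close in \<open>auto simp: space_time\<close>)
  also have "measure \<tau> (space \<tau>) = T" using T_pos by (simp add: measure_restrict_space space_restrict_space)
  finally have "\<bar>(LINT s|\<tau>. f s) - (LINT s|\<tau>. g s)\<bar> \<le> K * T" .
  then have "\<bar>Jk - ((LINT s|\<tau>. g s) + expectation (\<lambda>\<omega>. end_cost G (left_state Z T \<omega>) (m T)))\<bar> \<le> K * T + K"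
    unfolding Jk_def f_def[symmetric] using E by linarith
  also have "\<dots> = (T + 1) * (L2 * (cZ + cP)) / sqrt Nr" by (simp add: K_def algebra_simps add_divide_distrib)
  finally show ?thesis unfolding g_def .
qed

end

section \<open>Strong solutions in a given environment\<close>

text \<open>Holds even if neither path has a left limit, because \<open>Lim\<close> then is the same
  description over the same set of candidates.\<close>

lemma left_lim_cong: "0 < s \<Longrightarrow> (\<And>r. 0 \<le> r \<Longrightarrow> r < s \<Longrightarrow> x r = y r) \<Longrightarrow> left_lim x s = left_lim y s"
proof -
  assume s: "0 < s" and eq: "\<And>r. 0 \<le> r \<Longrightarrow> r < s \<Longrightarrow> x r = y r"
  have "eventually (\<lambda>r. r \<in> {0<..<s}) (at_left s)" using s by (intro eventually_at_left_real)
  then have "eventually (\<lambda>r. x r = y r) (at_left s)" by eventually_elim (auto intro: eq)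
  then have "(x \<longlongrightarrow> l) (at_left s) \<longleftrightarrow> (y \<longlongrightarrow> l) (at_left s)" for l by (rule tendsto_cong)
  then show ?thesis using s by (simp add: left_lim_def t2_space_class.Lim_def)
qed

lemma eventually_no_point_right:
  fixes J :: "real set"
  assumes "finite J"
  shows "eventually (\<lambda>r. t < r \<and> J \<inter> {t<..r} = {}) (at_right t)"
proof -
  have "eventually (\<lambda>r. \<not> (t < s \<and> s \<le> r)) (at_right t)" for s
  proof (cases "t < s")
    case True
    from eventually_at_right_real[OF this] show ?thesis by eventually_elim auto
  qed simp
  then have "eventually (\<lambda>r. \<forall>s\<in>J. \<not> (t < s \<and> s \<le> r)) (at_right t)" using assms by (subst eventually_ball_finite_distrib) auto
  with eventually_at_right_less[of t] show ?thesis by eventually_elim auto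
qed

lemma eventually_no_point_left:
  fixes J :: "real set"
  assumes "finite J"
  shows "eventually (\<lambda>r. r < t \<and> J \<inter> {r<..<t} = {}) (at_left t)"
proof -
  have "eventually (\<lambda>r. \<not> (r < s \<and> s < t)) (at_left t)" for s
  proof (cases "s < t")
    case True
    from eventually_at_left_real[OF this] show ?thesis by eventually_elim auto
  qed simp
  then have 1: "eventually (\<lambda>r. \<forall>s\<in>J. \<not> (r < s \<and> s < t)) (at_left t)" using assms by (subst eventually_ball_finite_distrib) auto
  have "eventually (\<lambda>r. r \<in> {t - 1<..<t}) (at_left t)" by (intro eventually_at_left_real) simp
  with 1 show ?thesis by eventually_elim auto
qed

text \<open>The noise of all players is kept although only player \<open>k\<close> moves, so that
  the basis obtained for the deviation profile can be used as it stands.\<close>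

locale controlled_basis = good_basis G M F I \<N> + regular_game G K1 K2
  for G :: "('a::metric_space, 'd::finite) game" and M :: "'w measure" and F I \<N> K1 K2 +
  fixes k :: nat and \<xi> :: "'w \<Rightarrow> int" and \<beta> :: "real \<Rightarrow> 'w \<Rightarrow> 'a" and p :: "real \<Rightarrow> 'w \<Rightarrow> real^'d"
  assumes k: "k \<in> I" and init: "initial_state G M F \<xi>" and \<beta>: "predictable_control G M F \<beta>"
    and p: "(\<lambda>(s, \<omega>). p s \<omega>) \<in> \<P> \<rightarrow>\<^sub>M simplex_space"
begin

lemma \<beta>_pred: "(\<lambda>z. \<beta> (fst z) (snd z)) \<in> \<P> \<rightarrow>\<^sub>M action_space G"
  using \<beta> by (simp add: predictable_control_def case_prod_beta')

lemma p_pred: "(\<lambda>z. p (fst z) (snd z)) \<in> \<P> \<rightarrow>\<^sub>M simplex_space"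
  using p by (simp add: case_prod_beta')

lemma \<beta>_actions: "\<omega> \<in> space M \<Longrightarrow> t \<in> {0..T} \<Longrightarrow> \<beta> t \<omega> \<in> actions G"
  using measurable_space[OF \<beta>_pred, of "(t, \<omega>)"] by (simp add: space_pred space_restrict_space)

lemma p_simplex: "\<omega> \<in> space M \<Longrightarrow> t \<in> {0..T} \<Longrightarrow> p t \<omega> \<in> prob_simplex"
  using measurable_space[OF p_pred, of "(t, \<omega>)"] by (simp add: space_pred space_restrict_space)

lemma \<xi>_states: "\<omega> \<in> space M \<Longrightarrow> \<xi> \<omega> \<in> states G"
  using init space_F[of 0] T_pos measurable_space[of \<xi> "F 0" "state_space" \<omega>] by (auto simp: initial_state_def)

definition clip :: "int \<Rightarrow> int" where "clip x = max 1 (min (int CARD('d)) x)"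

lemma clip_states: "clip x \<in> states G" by (auto simp: clip_def states_def)
lemma clip_id: "x \<in> states G \<Longrightarrow> clip x = x" by (auto simp: clip_def states_def)

definition drive :: "(real \<Rightarrow> 'w \<Rightarrow> int) \<Rightarrow> real \<Rightarrow> 'w \<Rightarrow> int" where
  "drive Y t \<omega> = \<xi> \<omega> + (\<Sum>z\<in>PPt k t \<omega>. jump G (fst z) (left_state Y (fst z) \<omega>) (snd z) (\<beta> (fst z) \<omega>) (p (fst z) \<omega>))"

text \<open>Picard iteration; clipping keeps the iterates in the state space and disappears in the limit.\<close>

primrec picard :: "nat \<Rightarrow> real \<Rightarrow> 'w \<Rightarrow> int" where
  "picard 0 = (\<lambda>t. \<xi>)"
| "picard (Suc n) = (\<lambda>t \<omega>. clip (drive (picard n) t \<omega>))"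

lemma drive_eventually:
  assumes \<omega>: "\<omega> \<in> space M"
  shows "eventually (\<lambda>r. drive Y r \<omega> = drive Y t \<omega>) (at_right t)" "\<exists>l. eventually (\<lambda>r. drive Y r \<omega> = l) (at_left t)"
proof -
  have fin: "finite (fst ` PP k \<omega>)" using finite_PP[OF k \<omega>] by simp
  show "eventually (\<lambda>r. drive Y r \<omega> = drive Y t \<omega>) (at_right t)"
    using eventually_no_point_right[OF fin, of t]
  proof eventually_elim
    case (elim r)
    have "PPt k r \<omega> = PPt k t \<omega>"
    proof (intro equalityI subsetI)
      fix z assume z: "z \<in> PPt k r \<omega>"
      then have "fst z \<notin> {t<..r}" using elim by auto
      then show "z \<in> PPt k t \<omega>" using z by auto
    qed (use elim in auto)
    then show ?case unfolding drive_def by simp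
  qed
  have "eventually (\<lambda>r. drive Y r \<omega> = \<xi> \<omega> + (\<Sum>z\<in>{z\<in>PP k \<omega>. fst z < t}. jump G (fst z) (left_state Y (fst z) \<omega>) (snd z) (\<beta> (fst z) \<omega>) (p (fst z) \<omega>))) (at_left t)"
    using eventually_no_point_left[OF fin, of t]
  proof eventually_elim
    case (elim r)
    have "PPt k r \<omega> = {z\<in>PP k \<omega>. fst z < t}"
    proof (intro equalityI subsetI)
      fix z assume z: "z \<in> {z\<in>PP k \<omega>. fst z < t}"
      then have "fst z \<notin> {r<..<t}" using elim by auto
      then show "z \<in> PPt k r \<omega>" using z by auto
    qed (use elim in auto)
    then show ?case unfolding drive_def by simp
  qed
  then show "\<exists>l. eventually (\<lambda>r. drive Y r \<omega> = l) (at_left t)" by blast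
qed

lemma drive_measurable:
  assumes Y: "state_process G M F Y" and t: "t \<in> {0..T}"
  shows "drive Y t \<in> F t \<rightarrow>\<^sub>M count_space UNIV"
proof -
  have Ym: "(\<lambda>z. left_state Y (fst z) (snd z)) \<in> \<P> \<rightarrow>\<^sub>M state_space"
    using left_state_predictable[OF Y] by (simp add: case_prod_beta')
  have "(\<lambda>z. (fst (fst z), left_state Y (fst (fst z)) (snd (fst z)), snd z, \<beta> (fst (fst z)) (snd (fst z)), p (fst (fst z)) (snd (fst z))))
    \<in> \<H> \<rightarrow>\<^sub>M jump_space"
    by (intro measurable_Pair measurable_snd fst_compose[OF fst_pred] fst_compose[OF Ym]
      fst_compose[OF \<beta>_pred] fst_compose[OF p_pred])
  from measurable_compose[OF measurable_compose[OF this jump_measurable], of real_of_int borel]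
  have "(\<lambda>z. real_of_int (jump G (fst (fst z)) (left_state Y (fst (fst z)) (snd (fst z))) (snd z) (\<beta> (fst (fst z)) (snd (fst z))) (p (fst (fst z)) (snd (fst z)))))
    \<in> borel_measurable \<H>" by simp
  from sum_atoms_measurable[OF k t this]
  have 1: "(\<lambda>\<omega>. \<Sum>z\<in>PPt k t \<omega>. real_of_int (jump G (fst z) (left_state Y (fst z) \<omega>) (snd z) (\<beta> (fst z) \<omega>) (p (fst z) \<omega>))) \<in> borel_measurable (F t)"
    by simp
  have sub: "subalgebra (F t) (F 0)"
    using filt t T_pos unfolding filtered_prob_space_def by auto
  have "(\<lambda>\<omega>. real_of_int (\<xi> \<omega>)) \<in> borel_measurable (F 0)"
    using init unfolding initial_state_def by (auto intro: measurable_compose)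
  then have "(\<lambda>\<omega>. real_of_int (\<xi> \<omega>)) \<in> borel_measurable (F t)" by (rule measurable_from_subalg[OF sub])
  with 1 have "(\<lambda>\<omega>. real_of_int (drive Y t \<omega>)) \<in> borel_measurable (F t)" unfolding drive_def by simp
  from measurable_compose[OF this measurable_real_floor] show ?thesis by simp
qed

lemma state_process_clip_drive:
  assumes Y: "state_process G M F Y"
  shows "state_process G M F (\<lambda>t \<omega>. clip (drive Y t \<omega>))"
  unfolding state_process_def
proof (intro conjI ballI)
  fix t assume t: "t \<in> {0..T}"
  show "(\<lambda>\<omega>. clip (drive Y t \<omega>)) \<in> F t \<rightarrow>\<^sub>M state_space"
    by (rule measurable_compose[OF drive_measurable[OF Y t]]) (auto simp: clip_states)
next
  fix \<omega> t assume \<omega>: "\<omega> \<in> space M" and t: "t \<in> {0..<T}"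
  have "eventually (\<lambda>r. clip (drive Y r \<omega>) = clip (drive Y t \<omega>)) (at_right t)"
    using drive_eventually(1)[OF \<omega>, of Y t] by eventually_elim simp
  then show "((\<lambda>s. clip (drive Y s \<omega>)) \<longlongrightarrow> clip (drive Y t \<omega>)) (at_right t)" by (rule tendsto_eventually)
next
  fix \<omega> t assume \<omega>: "\<omega> \<in> space M" and t: "t \<in> {0<..T}"
  obtain l where "eventually (\<lambda>r. drive Y r \<omega> = l) (at_left t)" using drive_eventually(2)[OF \<omega>] by blast
  then have "eventually (\<lambda>r. clip (drive Y r \<omega>) = clip l) (at_left t)" by eventually_elim simp
  then show "\<exists>l. ((\<lambda>s. clip (drive Y s \<omega>)) \<longlongrightarrow> l) (at_left t)" by (intro exI tendsto_eventually)
qed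

lemma state_process_picard: "state_process G M F (picard n)"
proof (induction n)
  case 0
  have "\<xi> \<in> F t \<rightarrow>\<^sub>M state_space" if t: "t \<in> {0..T}" for t
  proof -
    have "subalgebra (F t) (F 0)" using filt t T_pos unfolding filtered_prob_space_def by auto
    then show ?thesis using init unfolding initial_state_def by (blast intro: measurable_from_subalg)
  qed
  then show ?case unfolding state_process_def by auto
next
  case (Suc n)
  then show ?case using state_process_clip_drive[OF Suc] by simp
qed

text \<open>The jump at an atom depends on the path strictly before it, where there is at least one
  atom less. So after as many iterations as there are atoms up to \<open>t\<close> the value at
  \<open>t\<close> no longer changes.\<close>

lemma picard_stable_step:
  assumes \<omega>: "\<omega> \<in> space M"
  shows "card (PPt k t \<omega>) \<le> n \<Longrightarrow> picard (Suc n) t \<omega> = picard n t \<omega>"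
proof (induction n arbitrary: t)
  case 0
  then have e: "PPt k t \<omega> = {}" using finite_PP[OF k \<omega>] by simp
  show ?case unfolding picard.simps drive_def e by (simp add: clip_id[OF \<xi>_states[OF \<omega>]])
next
  case (Suc n)
  have "left_state (picard (Suc n)) (fst z) \<omega> = left_state (picard n) (fst z) \<omega>" if z: "z \<in> PPt k t \<omega>" for z
  proof (rule left_lim_cong)
    show "0 < fst z" using PP_mem[OF k \<omega>, of z] z by auto
    fix r assume r: "r < fst z"
    have "z \<notin> PPt k r \<omega>" using r by simp
    moreover have "PPt k r \<omega> \<subseteq> PPt k t \<omega>" using z r by auto
    ultimately have "PPt k r \<omega> \<subset> PPt k t \<omega>" using z by blast
    then have "card (PPt k r \<omega>) < card (PPt k t \<omega>)" using finite_PP[OF k \<omega>] by (intro psubset_card_mono) auto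
    then show "picard (Suc n) r \<omega> = picard n r \<omega>" using Suc by (intro Suc(1)) auto
  qed
  then have "drive (picard (Suc n)) t \<omega> = drive (picard n) t \<omega>"
    unfolding drive_def by (intro arg_cong2[where f = "(+)"] sum.cong refl) (simp del: picard.simps)
  then show ?case by (simp only: picard.simps(2))
qed

lemma picard_stable:
  assumes \<omega>: "\<omega> \<in> space M" and n: "card (PP k \<omega>) \<le> n"
  shows "picard n t \<omega> = picard (card (PP k \<omega>)) t \<omega>"
  using n
proof (induction rule: dec_induct)
  case (step n)
  have "card (PPt k t \<omega>) \<le> card (PP k \<omega>)" using finite_PP[OF k \<omega>] by (intro card_mono) auto
  then show ?case using picard_stable_step[OF \<omega>, of t n] step by simp
qed simp

definition sol :: "real \<Rightarrow> 'w \<Rightarrow> int" where "sol t \<omega> = picard (card (PP k \<omega>)) t \<omega>"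

text \<open>The iteration index in \<open>sol\<close> counts all atoms up to the horizon and so
  looks into the future. Adaptedness is seen from the other description of \<open>sol\<close> as the
  eventual value of the adapted iterates; path regularity is inherited for each outcome from one
  iterate.\<close>

lemma state_process_sol: "state_process G M F sol"
  unfolding state_process_def
proof (intro conjI ballI)
  fix t assume t: "t \<in> {0..T}"
  have pm: "picard n t \<in> F t \<rightarrow>\<^sub>M state_space" for n using state_process_picard[of n] t unfolding state_process_def by blast
  have st: "sol t \<omega> \<in> states G" if "\<omega> \<in> space M" for \<omega>
    unfolding sol_def using state_process_states[OF state_process_picard that t] .
  have "sol t -` {x} \<inter> space (F t) \<in> sets (F t)" if x: "x \<in> states G" for x
  proof -
    have "sol t -` {x} \<inter> space (F t) = (\<Union>n0. \<Inter>n\<in>{n0..}. {\<omega>\<in>space (F t). picard n t \<omega> = x})" (is "?L = ?R")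
    proof (rule set_eqI)
      fix \<omega>
      show "\<omega> \<in> ?L \<longleftrightarrow> \<omega> \<in> ?R"
      proof (cases "\<omega> \<in> space (F t)")
        case True
        then have \<omega>: "\<omega> \<in> space M" by (simp add: space_F[OF t])
        have "sol t \<omega> = x \<longleftrightarrow> (\<exists>n0. \<forall>n\<ge>n0. picard n t \<omega> = x)"
        proof
          assume sx: "sol t \<omega> = x"
          show "\<exists>n0. \<forall>n\<ge>n0. picard n t \<omega> = x"
          proof (intro exI allI impI)
            fix n assume "card (PP k \<omega>) \<le> n"
            from picard_stable[OF \<omega> this, of t] sx show "picard n t \<omega> = x" unfolding sol_def by (rule trans)
          qed
        next
          assume "\<exists>n0. \<forall>n\<ge>n0. picard n t \<omega> = x"
          then obtain n0 where "\<forall>n\<ge>n0. picard n t \<omega> = x" by blast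
          then have "picard (max n0 (card (PP k \<omega>))) t \<omega> = x" by simp
          then show "sol t \<omega> = x" using picard_stable[OF \<omega>, of "max n0 (card (PP k \<omega>))" t] unfolding sol_def by simp
        qed
        with True show ?thesis by auto
      qed auto
    qed
    also have "\<dots> \<in> sets (F t)"
    proof -
      have "{\<omega>\<in>space (F t). picard n t \<omega> = x} \<in> sets (F t)" for n
        using measurable_sets[OF pm, of "{x}" n] x by (simp add: vimage_def Int_def conj_commute)
      then show ?thesis by (intro sets.countable_UN sets.countable_INT') auto
    qed
    finally show ?thesis .
  qed
  then show "sol t \<in> F t \<rightarrow>\<^sub>M state_space"
    using st by (subst measurable_count_space_eq_countable) (auto simp: states_def space_F[OF t])
next
  fix \<omega> t assume "\<omega> \<in> space M" "t \<in> {0..<T}"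
  then show "((\<lambda>s. sol s \<omega>) \<longlongrightarrow> sol t \<omega>) (at_right t)"
    using state_process_picard[of "card (PP k \<omega>)"] unfolding state_process_def sol_def by blast
next
  fix \<omega> t assume "\<omega> \<in> space M" "t \<in> {0<..T}"
  then show "\<exists>l. ((\<lambda>s. sol s \<omega>) \<longlongrightarrow> l) (at_left t)"
    using state_process_picard[of "card (PP k \<omega>)"] unfolding state_process_def sol_def by blast
qed

lemma sol_clip: "\<omega> \<in> space M \<Longrightarrow> sol t \<omega> = clip (drive sol t \<omega>)"
proof -
  assume \<omega>: "\<omega> \<in> space M"
  have "sol t \<omega> = picard (Suc (card (PP k \<omega>))) t \<omega>" using picard_stable[OF \<omega>, of "Suc (card (PP k \<omega>))" t] unfolding sol_def by simp
  then show ?thesis by (simp add: drive_def sol_def)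
qed

text \<open>Clipping never acts on the limit: just before the last atom the unclipped value is a
  state by induction, hence equals the left limit of \<open>sol\<close>, and an admissible jump
  leads from a state to a state.\<close>

lemma drive_sol_states:
  assumes \<omega>: "\<omega> \<in> space M"
  shows "t \<in> {0..T} \<Longrightarrow> drive sol t \<omega> \<in> states G"
proof (induction "card (PPt k t \<omega>)" arbitrary: t)
  case 0
  then have e: "PPt k t \<omega> = {}" using finite_PP[OF k \<omega>] by simp
  show ?case unfolding drive_def e by (simp add: \<xi>_states[OF \<omega>])
next
  case (Suc n)
  have fin: "finite (PPt k t \<omega>)" using finite_PP[OF k \<omega>] by simp
  have "PPt k t \<omega> \<noteq> {}" using Suc(2) by force
  then have "Max (fst ` PPt k t \<omega>) \<in> fst ` PPt k t \<omega>" using fin by (intro Max_in) auto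
  then obtain z where z: "z \<in> PPt k t \<omega>" "fst z = Max (fst ` PPt k t \<omega>)" by force
  have zmax: "fst q \<le> fst z" if "q \<in> PPt k t \<omega>" for q using fin that z by auto
  have zt: "0 < fst z" "fst z \<le> T" "fst z \<le> t" "z \<in> PP k \<omega>" "snd z \<in> marks G" using PP_mem[OF k \<omega>, of z] z by auto
  have finJ: "finite (fst ` PP k \<omega>)" using finite_PP[OF k \<omega>] by simp
  have "eventually (\<lambda>r. r \<in> {0<..<fst z}) (at_left (fst z))" using zt by (intro eventually_at_left_real)
  with path_eventually_left[OF state_process_sol \<omega> zt(1,2)] eventually_no_point_left[OF finJ, of "fst z"]
  have "eventually (\<lambda>r. sol r \<omega> = left_state sol (fst z) \<omega> \<and> fst ` PP k \<omega> \<inter> {r<..<fst z} = {} \<and> r \<in> {0<..<fst z}) (at_left (fst z))"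
    by eventually_elim auto
  then obtain r where r: "sol r \<omega> = left_state sol (fst z) \<omega>" "fst ` PP k \<omega> \<inter> {r<..<fst z} = {}" "r \<in> {0<..<fst z}"
    using eventually_happens[of _ "at_left (fst z)"] by force
  have K: "PPt k r \<omega> = PPt k t \<omega> - {z}"
  proof (intro equalityI subsetI)
    fix q assume q: "q \<in> PPt k t \<omega> - {z}"
    then have "fst q \<noteq> fst z" using PP_inj[OF k k \<omega>, of q z] zt by auto
    then have "fst q < fst z" using zmax[of q] q by auto
    moreover have "fst q \<notin> {r<..<fst z}" using q r(2) by auto
    ultimately show "q \<in> PPt k r \<omega>" using q by auto
  qed (use r zt in auto)
  have n: "n = card (PPt k r \<omega>)" unfolding K using Suc(2) z(1) fin by simp
  have Vr: "drive sol r \<omega> \<in> states G" using r zt by (intro Suc(1)[OF n]) auto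
  then have "left_state sol (fst z) \<omega> = drive sol r \<omega>" using sol_clip[OF \<omega>, of r] r(1) clip_id by simp
  moreover have "drive sol t \<omega> = drive sol r \<omega> + jump G (fst z) (left_state sol (fst z) \<omega>) (snd z) (\<beta> (fst z) \<omega>) (p (fst z) \<omega>)"
    unfolding drive_def K sum.remove[OF fin z(1)] by (simp only: ac_simps)
  moreover have "fst z \<in> {0..T}" using zt by auto
  ultimately show ?case using Vr zt jump_abs_le(2)[of "fst z" "drive sol r \<omega>" "snd z" "\<beta> (fst z) \<omega>" "p (fst z) \<omega>"] \<beta>_actions[OF \<omega>] p_simplex[OF \<omega>] by simp
qed

lemma jump_system_sol: "jump_system G M F {k} \<N> K1 K2 (\<lambda>_. \<xi>) (\<lambda>_. sol) (\<lambda>_. \<beta>) p"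
proof (unfold_locales)
  show "poisson_random_measure G M F (\<N> i)" if "i \<in> {k}" for i using prm k that by simp
  show "simple_points G {k} (\<lambda>i. \<N> i \<omega>)" if "\<omega> \<in> space M" for \<omega>
    using simple[OF that] k unfolding simple_points_def by simp
  show "real_of_int (sol t \<omega>) = real_of_int (\<xi> \<omega>) +
       (\<Sum>z\<in>PPt i t \<omega>. real_of_int (jump G (fst z) (left_state sol (fst z) \<omega>) (snd z) (\<beta> (fst z) \<omega>) (p (fst z) \<omega>)))"
    if "i \<in> {k}" "\<omega> \<in> space M" "t \<in> {0..T}" for i \<omega> t
  proof -
    have "sol t \<omega> = drive sol t \<omega>" using sol_clip[OF that(2), of t] clip_id[OF drive_sol_states[OF that(2,3)]] by simp
    then show ?thesis using that(1) by (simp add: drive_def)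
  qed
qed (use init state_process_sol \<beta> p in auto)

end

section \<open>Strict controls as relaxed controls\<close>

text \<open>Balls of radius \<open>1 / Suc n\<close> around the points of finite nets: once the
  radius is below half the distance of two points, no such ball contains both. The family reduces
  the event that two controls differ to a countable union.\<close>

lemma compact_separating_family:
  assumes "compact (S :: 'a::metric_space set)"
  obtains \<E> where "countable \<E>" "\<And>E. E \<in> \<E> \<Longrightarrow> open E"
    "\<And>a b. a \<in> S \<Longrightarrow> b \<in> S \<Longrightarrow> a \<noteq> b \<Longrightarrow> \<exists>E\<in>\<E>. a \<in> E \<and> b \<notin> E"
proof -
  have "\<exists>K. finite K \<and> S \<subseteq> (\<Union>x\<in>K. ball x (1 / real (Suc n)))" for n
  proof -
    have "S \<subseteq> (\<Union>x\<in>S. ball x (1 / real (Suc n)))" by (auto intro!: bexI simp del: of_nat_Suc)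
    from compactE_image[OF assms _ this] show ?thesis by (metis open_ball)
  qed
  then obtain K where K: "\<And>n. finite (K n)" "\<And>n. S \<subseteq> (\<Union>x\<in>K n. ball x (1 / real (Suc n)))" by metis
  define \<E> where "\<E> = (\<Union>n. (\<lambda>x. ball x (1 / real (Suc n))) ` K n)"
  show ?thesis
  proof (rule that[of \<E>])
    show "countable \<E>" unfolding \<E>_def using K(1) by (intro countable_UN countable_image) (auto intro: countable_finite)
    show "open E" if "E \<in> \<E>" for E using that unfolding \<E>_def by auto
    fix a b assume ab: "a \<in> S" "b \<in> S" "a \<noteq> b"
    then obtain n where n: "inverse (real (Suc n)) < dist a b / 2" using reals_Archimedean[of "dist a b / 2"] by auto
    obtain x where x: "x \<in> K n" "dist x a < 1 / real (Suc n)" using K(2)[of n] ab(1) by auto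
    have "dist a b \<le> dist x a + dist x b" by (metis dist_commute dist_triangle)
    then have "\<not> dist x b < 1 / real (Suc n)" using x n by (simp add: inverse_eq_divide del: of_nat_Suc)
    with x show "\<exists>E\<in>\<E>. a \<in> E \<and> b \<notin> E" unfolding \<E>_def by (intro bexI[of _ "ball x (1 / real (Suc n))"]) (auto simp del: of_nat_Suc)
  qed
qed

context good_basis
begin

lemma measurable_noise: "i \<in> I \<Longrightarrow> \<omega> \<in> space M \<Longrightarrow> f \<in> mark_space G \<rightarrow>\<^sub>M N \<Longrightarrow> f \<in> \<N> i \<omega> \<rightarrow>\<^sub>M N"
  using measurable_cong_sets[OF sets_noise[OF prm] refl] by blast

lemma integral_noise:
  fixes f :: "real \<times> (real^'d) \<Rightarrow> real"
  shows "i \<in> I \<Longrightarrow> \<omega> \<in> space M \<Longrightarrow> f \<in> borel_measurable (mark_space G) \<Longrightarrow> (LINT z|\<N> i \<omega>. f z) = (\<Sum>z\<in>PP i \<omega>. f z)"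
  using integral_distr_count_space[OF finite_PP PP_space, of i \<omega> f] noise_eq by simp

end

context controlled_basis
begin

definition \<rho> :: "'w \<Rightarrow> (real \<times> 'a) measure" where
  "\<rho> \<omega> = distr \<tau> (control_space G) (\<lambda>s. (s, \<beta> s \<omega>))"

abbreviation "mk \<omega> \<equiv> (\<lambda>z :: real \<times> (real^'d). (fst z, snd z, \<beta> (fst z) \<omega>))"

text \<open>The marked noise that the definition of relaxed Poisson measures prescribes for a strict
  control. It lives on the given space, so the space does not have to be enlarged.\<close>

definition N\<rho> :: "'w \<Rightarrow> (real \<times> (real^'d) \<times> 'a) measure" where
  "N\<rho> \<omega> = distr (\<N> k \<omega>) (relaxed_mark_space G) (mk \<omega>)"

lemma \<beta>_section: "\<omega> \<in> space M \<Longrightarrow> (\<lambda>s. \<beta> s \<omega>) \<in> \<tau> \<rightarrow>\<^sub>M action_space G"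
  using measurable_compose[OF pred_section \<beta>_pred] by simp

lemma graph_meas: "\<omega> \<in> space M \<Longrightarrow> (\<lambda>s. (s, \<beta> s \<omega>)) \<in> \<tau> \<rightarrow>\<^sub>M control_space G"
  by (intro measurable_Pair \<beta>_section measurable_ident_sets refl)

lemma mk_meas: "\<omega> \<in> space M \<Longrightarrow> mk \<omega> \<in> mark_space G \<rightarrow>\<^sub>M relaxed_mark_space G"
  using fst_compose[OF \<beta>_section] by (intro measurable_Pair measurable_fst measurable_snd)

lemma space_relaxed: "space (relaxed_mark_space G) = {0..T} \<times> marks G \<times> actions G"
  by (simp add: space_pair_measure space_time space_intensity space_restrict_space)

lemma actions_sets: "actions G \<in> sets (action_space G)"
  using sets.top[of "action_space G"] by (simp add: space_restrict_space)

lemma emeasure_\<rho>: "\<omega> \<in> space M \<Longrightarrow> B \<in> sets (control_space G) \<Longrightarrow> emeasure (\<rho> \<omega>) B = emeasure \<tau> {s\<in>{0..T}. (s, \<beta> s \<omega>) \<in> B}"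
  unfolding \<rho>_def by (subst emeasure_distr[OF graph_meas]) (auto simp: space_time intro!: arg_cong[where f = "emeasure \<tau>"])

text \<open>Applied with a general space \<open>H\<close>: for the whole space it gives
  measurability of the random relaxed control, for \<open>F t\<close> its adaptedness.\<close>

lemma emeasure_time_section:
  assumes Q: "Q \<in> sets (\<tau> \<Otimes>\<^sub>M H)"
  shows "(\<lambda>\<omega>. emeasure \<tau> {s. (s, \<omega>) \<in> Q}) \<in> borel_measurable H"
proof -
  have "(\<lambda>z. (snd z, fst z)) \<in> H \<Otimes>\<^sub>M \<tau> \<rightarrow>\<^sub>M \<tau> \<Otimes>\<^sub>M H" by measurable
  from measurable_sets[OF this Q]
  have "(\<lambda>\<omega>. emeasure \<tau> (Pair \<omega> -` ((\<lambda>z. (snd z, fst z)) -` Q \<inter> space (H \<Otimes>\<^sub>M \<tau>)))) \<in> borel_measurable H"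
    by (rule tau.measurable_emeasure_Pair)
  moreover have "Pair \<omega> -` ((\<lambda>z. (snd z, fst z)) -` Q \<inter> space (H \<Otimes>\<^sub>M \<tau>)) = {s. (s, \<omega>) \<in> Q}" for \<omega>
    using sets.sets_into_space[OF Q] by (auto simp: space_pair_measure)
  ultimately show ?thesis by simp
qed

lemma relaxed_control_\<rho>: "relaxed_control G M F \<rho> \<xi> (\<N> k)"
  unfolding relaxed_control_def
proof (intro conjI ballI)
  show "mfg_basis G M F \<xi> (\<N> k)" using filt init prm[OF k] by (simp add: mfg_basis_def)
next
  fix \<omega> assume \<omega>: "\<omega> \<in> space M"
  have "emeasure (\<rho> \<omega>) ({0..t} \<times> actions G) = ennreal t" if t: "t \<in> {0..T}" for t
  proof -
    have B: "{0..t} \<times> actions G \<in> sets (control_space G)" using t actions_sets by (intro pair_measureI time_meas) auto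
    have "{s\<in>{0..T}. (s, \<beta> s \<omega>) \<in> {0..t} \<times> actions G} = {0..t}" using t \<beta>_actions[OF \<omega>] by auto
    then show ?thesis unfolding emeasure_\<rho>[OF \<omega> B] using t by (simp add: emeasure_restrict_space emeasure_lborel_Icc_eq)
  qed
  then show "\<rho> \<omega> \<in> deterministic_relaxed G" by (auto simp: deterministic_relaxed_def \<rho>_def)
next
  have pm: "(\<lambda>z. (fst z, \<beta> (fst z) (snd z))) \<in> \<P> \<rightarrow>\<^sub>M control_space G" by (intro measurable_Pair fst_pred \<beta>_pred)
  have C: "{z\<in>space \<P>. (fst z, \<beta> (fst z) (snd z)) \<in> B} \<in> sets \<P>" if "B \<in> sets (control_space G)" for B
    using measurable_sets[OF pm that] by (simp add: vimage_def Int_def conj_commute)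
  {
    fix B assume B: "B \<in> sets (control_space G)"
    have "(\<lambda>\<omega>. emeasure \<tau> {s. (s, \<omega>) \<in> {z\<in>space \<P>. (fst z, \<beta> (fst z) (snd z)) \<in> B}}) \<in> borel_measurable M"
      by (rule emeasure_time_section[OF pred_sets_pair[OF C[OF B]]])
    then show "(\<lambda>\<omega>. emeasure (\<rho> \<omega>) B) \<in> borel_measurable M"
      by (rule measurable_cong[THEN iffD2, rotated]) (auto simp: emeasure_\<rho>[OF _ B] space_pred intro!: arg_cong[where f = "emeasure \<tau>"])
  next
    fix t E assume t: "t \<in> {0..T}" and E: "E \<in> sets (action_space G)"
    have B: "{0..t} \<times> E \<in> sets (control_space G)" using t E by (intro pair_measureI time_meas) auto
    have "(\<lambda>\<omega>. emeasure \<tau> {s. (s, \<omega>) \<in> {z\<in>space \<P>. (fst z, \<beta> (fst z) (snd z)) \<in> {0..t} \<times> E} \<inter> ({0..t} \<times> space M)}) \<in> borel_measurable (F t)"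
      by (rule emeasure_time_section[OF pred_progressive[OF t C[OF B]]])
    then show "(\<lambda>\<omega>. emeasure (\<rho> \<omega>) ({0..t} \<times> E)) \<in> borel_measurable (F t)"
    proof (rule measurable_cong[THEN iffD2, rotated])
      fix \<omega> assume "\<omega> \<in> space (F t)"
      then have \<omega>: "\<omega> \<in> space M" by (simp add: space_F[OF t])
      have "{s\<in>{0..T}. (s, \<beta> s \<omega>) \<in> {0..t} \<times> E} =
          {s. (s, \<omega>) \<in> {z\<in>space \<P>. (fst z, \<beta> (fst z) (snd z)) \<in> {0..t} \<times> E} \<inter> ({0..t} \<times> space M)}"
        using \<omega> t by (auto simp: space_pred)
      then show "emeasure (\<rho> \<omega>) ({0..t} \<times> E) = emeasure \<tau> {s. (s, \<omega>) \<in> {z\<in>space \<P>. (fst z, \<beta> (fst z) (snd z)) \<in> {0..t} \<times> E} \<inter> ({0..t} \<times> space M)}"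
        using emeasure_\<rho>[OF \<omega> B] by simp
    qed
  }
qed

lemma emeasure_N\<rho>:
  assumes \<omega>: "\<omega> \<in> space M" and B: "B \<in> sets (relaxed_mark_space G)"
  shows "emeasure (N\<rho> \<omega>) B = (\<Sum>z\<in>PP k \<omega>. indicator B (mk \<omega> z))"
proof -
  have m: "mk \<omega> \<in> \<N> k \<omega> \<rightarrow>\<^sub>M relaxed_mark_space G" by (rule measurable_noise[OF k \<omega> mk_meas[OF \<omega>]])
  have B': "mk \<omega> -` B \<inter> space (\<N> k \<omega>) \<in> sets (mark_space G)"
    using measurable_sets[OF m B] sets_noise[OF prm[OF k] \<omega>] by simp
  have "emeasure (N\<rho> \<omega>) B = emeasure (\<N> k \<omega>) (mk \<omega> -` B \<inter> space (\<N> k \<omega>))"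
    unfolding N\<rho>_def by (rule emeasure_distr[OF m B])
  also have "\<dots> = (\<Sum>z\<in>PP k \<omega>. indicator (mk \<omega> -` B \<inter> space (\<N> k \<omega>)) z)" by (rule emeasure_noise[OF k \<omega> B'])
  also have "\<dots> = (\<Sum>z\<in>PP k \<omega>. indicator B (mk \<omega> z))"
    by (intro sum.cong) (auto simp: atoms_def indicator_def)
  finally show ?thesis .
qed

lemma nn_integral_N\<rho>:
  assumes \<omega>: "\<omega> \<in> space M" and f: "f \<in> borel_measurable (relaxed_mark_space G)"
  shows "(\<integral>\<^sup>+y. f y \<partial>N\<rho> \<omega>) = (\<Sum>z\<in>PP k \<omega>. f (mk \<omega> z))"
  unfolding N\<rho>_def by (subst nn_integral_distr[OF measurable_noise[OF k \<omega> mk_meas[OF \<omega>]]])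
    (use f in \<open>auto intro!: nn_integral_noise[OF k \<omega>] measurable_compose[OF mk_meas[OF \<omega>]]\<close>)

lemma integral_N\<rho>:
  fixes f :: "real \<times> (real^'d) \<times> 'a \<Rightarrow> real"
  assumes \<omega>: "\<omega> \<in> space M" and f: "f \<in> borel_measurable (relaxed_mark_space G)"
  shows "(LINT y|N\<rho> \<omega>. f y) = (\<Sum>z\<in>PP k \<omega>. f (mk \<omega> z))"
  unfolding N\<rho>_def by (subst integral_distr[OF measurable_noise[OF k \<omega> mk_meas[OF \<omega>]]])
    (use f in \<open>auto intro!: integral_noise[OF k \<omega>] measurable_compose[OF mk_meas[OF \<omega>]]\<close>)

abbreviation "mkp \<equiv> (\<lambda>x :: (real \<times> 'w) \<times> (real^'d). (fst (fst x), snd x, \<beta> (fst (fst x)) (snd (fst x))))"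

lemma mkp_meas: "mkp \<in> \<H> \<rightarrow>\<^sub>M relaxed_mark_space G"
  by (intro measurable_Pair measurable_snd fst_compose[OF fst_pred] fst_compose[OF \<beta>_pred])

lemma integer_N\<rho>: "integer_random_measure G M F (relaxed_mark_space G) N\<rho>"
  unfolding integer_random_measure_def adapted_random_measure_def
proof (intro conjI ballI impI)
  show "sets (N\<rho> \<omega>) = sets (relaxed_mark_space G)" for \<omega> by (simp add: N\<rho>_def)
next
  fix B assume B: "B \<in> sets (relaxed_mark_space G)"
  have W: "(\<lambda>x. indicator B (mkp x) :: ennreal) \<in> borel_measurable \<H>"
    by (rule measurable_compose[OF mkp_meas borel_measurable_indicator[OF B]])
  show "(\<lambda>\<omega>. emeasure (N\<rho> \<omega>) B) \<in> borel_measurable M"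
    using sum_atoms_measurable_nn'[OF k W] by (simp add: emeasure_N\<rho>[OF _ B] cong: measurable_cong)
next
  fix t B assume t: "t \<in> {0..T}" and B: "B \<in> sets (relaxed_mark_space G)" and sub: "B \<subseteq> {0..t} \<times> UNIV"
  have W: "(\<lambda>x. indicator B (mkp x) :: ennreal) \<in> borel_measurable \<H>"
    by (rule measurable_compose[OF mkp_meas borel_measurable_indicator[OF B]])
  have m: "(\<lambda>\<omega>. \<Sum>z\<in>PP k \<omega>. indicator B (mk \<omega> z) * indicator {..t} (fst z) :: ennreal) \<in> borel_measurable (F t)"
    using sum_atoms_measurable_nn[OF k t W] by simp
  show "(\<lambda>\<omega>. emeasure (N\<rho> \<omega>) B) \<in> borel_measurable (F t)"
  proof (rule measurable_cong[THEN iffD2, OF _ m])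
    fix \<omega> assume "\<omega> \<in> space (F t)"
    then have \<omega>: "\<omega> \<in> space M" by (simp add: space_F[OF t])
    show "emeasure (N\<rho> \<omega>) B = (\<Sum>z\<in>PP k \<omega>. indicator B (mk \<omega> z) * indicator {..t} (fst z))"
      unfolding emeasure_N\<rho>[OF \<omega> B] using sub by (intro sum.cong refl) (auto simp: indicator_def)
  qed
next
  show "AE \<omega> in M. (\<forall>B\<in>sets (relaxed_mark_space G). emeasure (N\<rho> \<omega>) B \<in> range ennreal_of_enat) \<and>
      (\<forall>t\<in>{0..T}. emeasure (N\<rho> \<omega>) (({t} \<times> UNIV) \<inter> space (relaxed_mark_space G)) \<le> 1)"
  proof (intro AE_I2 conjI ballI)
    fix \<omega> B assume \<omega>: "\<omega> \<in> space M" and B: "B \<in> sets (relaxed_mark_space G)"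
    have "(\<Sum>z\<in>PP k \<omega>. indicator B (mk \<omega> z) :: ennreal) = of_nat (\<Sum>z\<in>PP k \<omega>. if mk \<omega> z \<in> B then 1 else 0)"
      unfolding of_nat_sum by (intro sum.cong) (auto simp: indicator_def)
    also have "\<dots> = ennreal_of_enat (enat (\<Sum>z\<in>PP k \<omega>. if mk \<omega> z \<in> B then 1 else 0))" by (simp add: ennreal_of_enat_enat)
    finally show "emeasure (N\<rho> \<omega>) B \<in> range ennreal_of_enat" unfolding emeasure_N\<rho>[OF \<omega> B] by blast
  next
    fix \<omega> t assume \<omega>: "\<omega> \<in> space M" and t: "t \<in> {0..T}"
    have eq: "({t} \<times> UNIV) \<inter> space (relaxed_mark_space G) = {t} \<times> (marks G \<times> actions G)" using t by (auto simp: space_relaxed)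
    have B: "{t} \<times> (marks G \<times> actions G) \<in> sets (relaxed_mark_space G)"
      using t marks_sets actions_sets by (intro pair_measureI time_meas) auto
    have "(\<Sum>z\<in>PP k \<omega>. indicator ({t} \<times> (marks G \<times> actions G)) (mk \<omega> z) :: ennreal) \<le> (\<Sum>z\<in>PP k \<omega>. if fst z = t then 1 else 0)"
      by (intro sum_mono) (auto simp: indicator_def)
    also have "\<dots> = of_nat (card {z\<in>PP k \<omega>. fst z = t})"
      using finite_PP[OF k \<omega>] by (subst sum.inter_filter[symmetric]) auto
    also have "\<dots> \<le> 1"
    proof -
      have "card {z\<in>PP k \<omega>. fst z = t} \<le> 1"
        using finite_PP[OF k \<omega>] PP_inj[OF k k \<omega>] by (intro card_le_Suc0_iff_eq[THEN iffD2, unfolded One_nat_def[symmetric]]) auto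
      then show ?thesis by (metis of_nat_1 of_nat_mono)
    qed
    finally show "emeasure (N\<rho> \<omega>) (({t} \<times> UNIV) \<inter> space (relaxed_mark_space G)) \<le> 1"
      unfolding eq emeasure_N\<rho>[OF \<omega> B] .
  qed
qed

text \<open>Inserting the predictable \<open>\<beta>\<close> for the action leaves a predictable
  function of time, outcome and mark, to which the compensation formula of the driving noise
  applies; and integration against \<open>\<rho>\<close> is integration in time along the graph of
  \<open>\<beta>\<close>.\<close>

lemma compensator_N\<rho>:
  fixes W :: "(real \<times> 'w) \<times> (real^'d) \<times> 'a \<Rightarrow> ennreal"
  assumes W: "W \<in> borel_measurable (\<P> \<Otimes>\<^sub>M \<mu> \<Otimes>\<^sub>M action_space G)"
  shows "(\<integral>\<^sup>+ \<omega>. (\<integral>\<^sup>+ z. (case z of (s, u, a) \<Rightarrow> W ((s, \<omega>), u, a)) \<partial>N\<rho> \<omega>) \<partial>M) =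
        (\<integral>\<^sup>+ \<omega>. (\<integral>\<^sup>+ y. (case y of (s, a) \<Rightarrow> \<integral>\<^sup>+ u. W ((s, \<omega>), u, a) \<partial>\<mu>) \<partial>\<rho> \<omega>) \<partial>M)"
proof -
  define W' where "W' x = W (fst x, snd x, \<beta> (fst (fst x)) (snd (fst x)))" for x
  have "(\<lambda>x. (fst x, snd x, \<beta> (fst (fst x)) (snd (fst x)))) \<in> \<H> \<rightarrow>\<^sub>M \<P> \<Otimes>\<^sub>M \<mu> \<Otimes>\<^sub>M action_space G"
    by (intro measurable_Pair measurable_fst measurable_snd fst_compose[OF \<beta>_pred])
  from measurable_compose[OF this W] have W': "W' \<in> borel_measurable \<H>" by (simp add: W'_def[abs_def])
  have "(\<integral>\<^sup>+ \<omega>. (\<integral>\<^sup>+ z. (case z of (s, u, a) \<Rightarrow> W ((s, \<omega>), u, a)) \<partial>N\<rho> \<omega>) \<partial>M) = (\<integral>\<^sup>+\<omega>. (\<Sum>z\<in>PP k \<omega>. W' (tw \<omega> z)) \<partial>M)"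
  proof (rule nn_integral_cong)
    fix \<omega> assume \<omega>: "\<omega> \<in> space M"
    have "(\<lambda>z. ((fst z, \<omega>), fst (snd z), snd (snd z))) \<in> relaxed_mark_space G \<rightarrow>\<^sub>M \<P> \<Otimes>\<^sub>M \<mu> \<Otimes>\<^sub>M action_space G"
      by (intro measurable_Pair fst_compose[OF pred_section[OF \<omega>]] snd_compose[OF measurable_fst] snd_compose[OF measurable_snd])
    from measurable_compose[OF this W] have m: "(\<lambda>z. case z of (s, u, a) \<Rightarrow> W ((s, \<omega>), u, a)) \<in> borel_measurable (relaxed_mark_space G)"
      by (simp add: case_prod_beta')
    show "(\<integral>\<^sup>+ z. (case z of (s, u, a) \<Rightarrow> W ((s, \<omega>), u, a)) \<partial>N\<rho> \<omega>) = (\<Sum>z\<in>PP k \<omega>. W' (tw \<omega> z))"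
      unfolding nn_integral_N\<rho>[OF \<omega> m] by (simp add: W'_def)
  qed
  also have "\<dots> = (\<integral>\<^sup>+\<omega>. \<integral>\<^sup>+z. W' (tw \<omega> z) \<partial>mark_space G \<partial>M)" by (rule compensation_nn[OF k W'])
  also have "\<dots> = (\<integral>\<^sup>+ \<omega>. (\<integral>\<^sup>+ y. (case y of (s, a) \<Rightarrow> \<integral>\<^sup>+ u. W ((s, \<omega>), u, a) \<partial>\<mu>) \<partial>\<rho> \<omega>) \<partial>M)"
  proof (rule nn_integral_cong)
    fix \<omega> assume \<omega>: "\<omega> \<in> space M"
    have m1: "(\<lambda>z. W' (tw \<omega> z)) \<in> borel_measurable (mark_space G)" by (rule measurable_compose[OF sec_predU[OF \<omega>] W'])
    have "(\<lambda>z. ((fst (fst z), \<omega>), snd z, snd (fst z))) \<in> control_space G \<Otimes>\<^sub>M \<mu> \<rightarrow>\<^sub>M \<P> \<Otimes>\<^sub>M \<mu> \<Otimes>\<^sub>M action_space G"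
      by (intro measurable_Pair measurable_snd fst_compose[OF fst_compose[OF pred_section[OF \<omega>]]] fst_compose[OF measurable_snd])
    from measurable_compose[OF this W] have "(\<lambda>(y, u). W ((fst y, \<omega>), u, snd y)) \<in> borel_measurable (control_space G \<Otimes>\<^sub>M \<mu>)"
      by (simp add: case_prod_beta')
    then have m2: "(\<lambda>y. \<integral>\<^sup>+ u. W ((fst y, \<omega>), u, snd y) \<partial>\<mu>) \<in> borel_measurable (control_space G)"
      by (rule U.borel_measurable_nn_integral)
    have "(\<integral>\<^sup>+z. W' (tw \<omega> z) \<partial>mark_space G) = (\<integral>\<^sup>+s. \<integral>\<^sup>+u. W' ((s, \<omega>), u) \<partial>\<mu> \<partial>\<tau>)"
      using U.nn_integral_fst[OF m1] by simp
    also have "\<dots> = (\<integral>\<^sup>+ y. (\<integral>\<^sup>+ u. W ((fst y, \<omega>), u, snd y) \<partial>\<mu>) \<partial>\<rho> \<omega>)"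
      unfolding \<rho>_def using m2 by (subst nn_integral_distr[OF graph_meas[OF \<omega>]]) (simp_all add: W'_def)
    finally show "(\<integral>\<^sup>+z. W' (tw \<omega> z) \<partial>mark_space G) = (\<integral>\<^sup>+ y. (case y of (s, a) \<Rightarrow> \<integral>\<^sup>+ u. W ((s, \<omega>), u, a) \<partial>\<mu>) \<partial>\<rho> \<omega>)"
      by (simp add: case_prod_beta')
  qed
  finally show ?thesis .
qed

text \<open>The last clause of the relaxed Poisson property concerns every predictable
  \<open>\<alpha>\<close> that represents \<open>\<rho>\<close>, not just \<open>\<beta>\<close>.
  Such an \<open>\<alpha>\<close> agrees with \<open>\<beta>\<close> at almost all times, but the
  clause needs agreement at the atoms. The times of disagreement form predictable sets of time
  measure 0, so the mean number of atoms in them is 0 by compensation.\<close>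

lemma disintegration_unique_AE:
  assumes \<alpha>: "predictable_control G M F \<alpha>"
    and dis: "AE \<omega> in M. disintegrates G (\<rho> \<omega>) (\<lambda>t. return (action_space G) (\<alpha> t \<omega>))"
  shows "AE \<omega> in M. \<forall>z\<in>PP k \<omega>. \<alpha> (fst z) \<omega> = \<beta> (fst z) \<omega>"
proof -
  have \<alpha>p: "(\<lambda>z. \<alpha> (fst z) (snd z)) \<in> \<P> \<rightarrow>\<^sub>M action_space G" using \<alpha> by (simp add: predictable_control_def case_prod_beta')
  have \<alpha>s: "\<omega> \<in> space M \<Longrightarrow> (\<lambda>s. \<alpha> s \<omega>) \<in> \<tau> \<rightarrow>\<^sub>M action_space G" for \<omega>
    using measurable_compose[OF pred_section \<alpha>p] by simp
  have \<alpha>a: "\<alpha> s \<omega> \<in> actions G" if "\<omega> \<in> space M" "s \<in> {0..T}" for s \<omega>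
    using measurable_space[OF \<alpha>s[OF that(1)], of s] that by (simp add: space_time space_restrict_space)
  obtain \<E> where \<E>: "countable \<E>" "\<And>E. E \<in> \<E> \<Longrightarrow> open E"
    "\<And>a b. a \<in> actions G \<Longrightarrow> b \<in> actions G \<Longrightarrow> a \<noteq> b \<Longrightarrow> \<exists>E\<in>\<E>. a \<in> E \<and> b \<notin> E"
    using compact_separating_family[OF compact_actions] by blast
  have EA: "E \<inter> actions G \<in> sets (action_space G)" if "E \<in> \<E>" for E
    using \<E>(2)[OF that] by (auto simp: sets_restrict_space)
  define bad where "bad E = {z\<in>space \<P>. \<beta> (fst z) (snd z) \<notin> E \<and> \<alpha> (fst z) (snd z) \<in> E}" for E
  have bad: "bad E \<in> sets \<P>" if E: "E \<in> \<E>" for E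
  proof -
    have 1: "{z\<in>space \<P>. \<alpha> (fst z) (snd z) \<in> E \<inter> actions G} \<in> sets \<P>" "{z\<in>space \<P>. \<beta> (fst z) (snd z) \<in> E \<inter> actions G} \<in> sets \<P>"
      using measurable_sets[OF \<alpha>p EA[OF E]] measurable_sets[OF \<beta>_pred EA[OF E]] by (simp_all add: vimage_def Int_def conj_commute conj_left_commute)
    have "bad E = {z\<in>space \<P>. \<alpha> (fst z) (snd z) \<in> E \<inter> actions G} - {z\<in>space \<P>. \<beta> (fst z) (snd z) \<in> E \<inter> actions G}"
      using \<alpha>a \<beta>_actions by (auto simp: bad_def space_pred)
    then show ?thesis using 1 by simp
  qed
  have nullE: "AE \<omega> in M. \<forall>z\<in>PP k \<omega>. (fst z, \<omega>) \<notin> bad E" if E: "E \<in> \<E>" for E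
  proof -
    have W: "(\<lambda>x. indicator (bad E) (fst x) :: ennreal) \<in> borel_measurable \<H>"
      by (rule fst_compose[OF borel_measurable_indicator[OF bad[OF E]]])
    have z: "AE \<omega> in M. (\<integral>\<^sup>+z. indicator (bad E) (fst z, \<omega>) \<partial>mark_space G) = 0"
      using dis AE_space
    proof eventually_elim
      case (elim \<omega>)
      \<comment> \<open>\<open>\<rho>\<close> sits on the graph of \<open>\<beta>\<close>, so it
        does not charge \<open>D\<close> times \<open>E\<close>. Read through the disintegration by
        \<open>\<alpha>\<close>, this says that \<open>\<alpha>\<close> is in \<open>E\<close> while
        \<open>\<beta>\<close> is not only at a null set of times.\<close>
      define D where "D = {s\<in>{0..T}. \<beta> s \<omega> \<notin> E}"
      have "(\<lambda>s. \<beta> s \<omega>) -` (E \<inter> actions G) \<inter> space \<tau> \<in> sets \<tau>" by (rule measurable_sets[OF \<beta>_section[OF elim(2)] EA[OF E]])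
      then have "space \<tau> - ((\<lambda>s. \<beta> s \<omega>) -` (E \<inter> actions G) \<inter> space \<tau>) \<in> sets \<tau>" by (rule sets.Diff[OF sets.top])
      moreover have "space \<tau> - ((\<lambda>s. \<beta> s \<omega>) -` (E \<inter> actions G) \<inter> space \<tau>) = D"
        using \<beta>_actions[OF elim(2)] by (auto simp: D_def space_time)
      ultimately have D: "D \<in> sets \<tau>" by simp
      then have B: "D \<times> (E \<inter> actions G) \<in> sets (control_space G)" using EA[OF E] by auto
      have e: "{s\<in>{0..T}. (s, \<beta> s \<omega>) \<in> D \<times> (E \<inter> actions G)} = {}" by (auto simp: D_def)
      have "emeasure (\<rho> \<omega>) (D \<times> (E \<inter> actions G)) = 0" using emeasure_\<rho>[OF elim(2) B] unfolding e by simp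
      then have "(\<integral>\<^sup>+ t. emeasure (return (action_space G) (\<alpha> t \<omega>)) (Pair t -` (D \<times> (E \<inter> actions G))) \<partial>\<tau>) = 0"
        using elim(1) B unfolding disintegrates_def by auto
      moreover have "emeasure (return (action_space G) (\<alpha> t \<omega>)) (Pair t -` (D \<times> (E \<inter> actions G))) = indicator (bad E) (t, \<omega>)" if t: "t \<in> space \<tau>" for t
      proof -
        have "Pair t -` (D \<times> (E \<inter> actions G)) = (if t \<in> D then E \<inter> actions G else {})" by auto
        then show ?thesis using EA[OF E] t elim(2) \<alpha>a[OF elim(2), of t]
          by (auto simp: bad_def D_def space_pred space_time indicator_def)
      qed
      ultimately have 0: "(\<integral>\<^sup>+ t. indicator (bad E) (t, \<omega>) \<partial>\<tau>) = 0"
        by (metis (no_types, lifting) nn_integral_cong)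
      have m: "(\<lambda>z. indicator (bad E) (fst z, \<omega>) :: ennreal) \<in> borel_measurable (mark_space G)"
        using measurable_compose[OF sec_predU[OF elim(2)] W] by simp
      have m': "(\<lambda>t. indicator (bad E) (t, \<omega>) :: ennreal) \<in> borel_measurable \<tau>"
        using measurable_compose[OF pred_section[OF elim(2)] borel_measurable_indicator[OF bad[OF E]]] .
      have "(\<integral>\<^sup>+z. indicator (bad E) (fst z, \<omega>) \<partial>mark_space G) = (\<integral>\<^sup>+s. \<integral>\<^sup>+u. indicator (bad E) (s, \<omega>) \<partial>\<mu> \<partial>\<tau>)"
        using U.nn_integral_fst[OF m] by simp
      also have "\<dots> = 0" using 0 m' by (simp add: nn_integral_multc mult.commute)
      finally show ?case .
    qed
    have "(\<integral>\<^sup>+\<omega>. (\<Sum>z\<in>PP k \<omega>. indicator (bad E) (fst z, \<omega>)) \<partial>M) = (\<integral>\<^sup>+\<omega>. \<integral>\<^sup>+z. indicator (bad E) (fst z, \<omega>) \<partial>mark_space G \<partial>M)"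
      using compensation_nn[OF k W] by simp
    also have "\<dots> = (\<integral>\<^sup>+\<omega>. 0 \<partial>M)" by (rule nn_integral_cong_AE) (rule z)
    finally have "(\<integral>\<^sup>+\<omega>. (\<Sum>z\<in>PP k \<omega>. indicator (bad E) (fst z, \<omega>)) \<partial>M) = 0" by simp
    moreover have "(\<lambda>\<omega>. \<Sum>z\<in>PP k \<omega>. indicator (bad E) (fst z, \<omega>) :: ennreal) \<in> borel_measurable M"
      using sum_atoms_measurable_nn'[OF k W] by simp
    ultimately have "AE \<omega> in M. (\<Sum>z\<in>PP k \<omega>. indicator (bad E) (fst z, \<omega>) :: ennreal) = 0" by (simp add: nn_integral_0_iff_AE)
    then show ?thesis using AE_space
    proof eventually_elim
      case (elim \<omega>)
      then show ?case using finite_PP[OF k elim(2)] by (auto simp: indicator_def split: if_splits)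
    qed
  qed
  have "AE \<omega> in M. \<forall>E\<in>\<E>. \<forall>z\<in>PP k \<omega>. (fst z, \<omega>) \<notin> bad E" using \<E>(1) nullE by (intro AE_ball_countable')
  then show ?thesis using AE_space
  proof eventually_elim
    case (elim \<omega>)
    show ?case
    proof (rule ballI, rule ccontr)
      fix z assume z: "z \<in> PP k \<omega>" and ne: "\<alpha> (fst z) \<omega> \<noteq> \<beta> (fst z) \<omega>"
      have s: "fst z \<in> {0..T}" using PP_mem[OF k elim(2) z] by auto
      from \<E>(3)[OF \<alpha>a[OF elim(2) s] \<beta>_actions[OF elim(2) s] ne] obtain E where "E \<in> \<E>" "\<alpha> (fst z) \<omega> \<in> E" "\<beta> (fst z) \<omega> \<notin> E" by blast
      then have "(fst z, \<omega>) \<in> bad E" using s elim(2) by (auto simp: bad_def space_pred)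
      then show False using elim(1) \<open>E \<in> \<E>\<close> z by blast
    qed
  qed
qed

lemma relaxed_poisson_N\<rho>: "relaxed_poisson_measure G M F \<rho> (\<N> k) N\<rho>"
  unfolding relaxed_poisson_measure_def
proof (intro conjI allI impI)
  show "integer_random_measure G M F (relaxed_mark_space G) N\<rho>" by (rule integer_N\<rho>)
next
  fix W :: "(real \<times> 'w) \<times> (real^'d) \<times> 'a \<Rightarrow> ennreal"
  assume "W \<in> borel_measurable (\<P> \<Otimes>\<^sub>M \<mu> \<Otimes>\<^sub>M action_space G)"
  then show "(\<integral>\<^sup>+ \<omega>. (\<integral>\<^sup>+ z. (case z of (s, u, a) \<Rightarrow> W ((s, \<omega>), u, a)) \<partial>N\<rho> \<omega>) \<partial>M) =
        (\<integral>\<^sup>+ \<omega>. (\<integral>\<^sup>+ y. (case y of (s, a) \<Rightarrow> \<integral>\<^sup>+ u. W ((s, \<omega>), u, a) \<partial>\<mu>) \<partial>\<rho> \<omega>) \<partial>M)"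
    by (rule compensator_N\<rho>)
next
  fix \<alpha>
  assume a: "predictable_control G M F \<alpha> \<and> (AE \<omega> in M. disintegrates G (\<rho> \<omega>) (\<lambda>t. return (action_space G) (\<alpha> t \<omega>)))"
  then have \<alpha>p: "(\<lambda>z. \<alpha> (fst z) (snd z)) \<in> \<P> \<rightarrow>\<^sub>M action_space G" by (simp add: predictable_control_def case_prod_beta')
  have "AE \<omega> in M. \<forall>z\<in>PP k \<omega>. \<alpha> (fst z) \<omega> = \<beta> (fst z) \<omega>" using a by (intro disintegration_unique_AE) auto
  then show "AE \<omega> in M. \<forall>t\<in>{0..T}. \<forall>U\<^sub>0\<in>sets \<mu>. \<forall>A\<^sub>0\<in>sets (action_space G).
           emeasure (N\<rho> \<omega>) ({0..t} \<times> U\<^sub>0 \<times> A\<^sub>0) =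
             (\<integral>\<^sup>+ z. (case z of (s, u) \<Rightarrow> indicator ({0..t} \<times> U\<^sub>0) (s, u) * indicator A\<^sub>0 (\<alpha> s \<omega>)) \<partial>\<N> k \<omega>)"
    using AE_space
  proof eventually_elim
    case (elim \<omega>)
    show ?case
    proof (intro ballI)
      fix t U0 A0 assume t: "t \<in> {0..T}" and U0: "U0 \<in> sets \<mu>" and A0: "A0 \<in> sets (action_space G)"
      have T0: "{0..t} \<in> sets \<tau>" using t by (intro time_meas) auto
      have B: "{0..t} \<times> U0 \<times> A0 \<in> sets (relaxed_mark_space G)" using T0 U0 A0 by auto
      have m1: "(\<lambda>z. indicator ({0..t} \<times> U0) z :: ennreal) \<in> borel_measurable (mark_space G)" using T0 U0 by auto
      have m2: "(\<lambda>z. indicator A0 (\<alpha> (fst z) \<omega>) :: ennreal) \<in> borel_measurable (mark_space G)"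
        using measurable_compose[OF fst_compose[OF measurable_compose[OF pred_section[OF elim(2)] \<alpha>p]] borel_measurable_indicator[OF A0]] by simp
      have "(\<integral>\<^sup>+ z. indicator ({0..t} \<times> U0) z * indicator A0 (\<alpha> (fst z) \<omega>) \<partial>\<N> k \<omega>) =
         (\<Sum>z\<in>PP k \<omega>. indicator ({0..t} \<times> U0) z * indicator A0 (\<alpha> (fst z) \<omega>))"
        by (intro nn_integral_noise[OF k elim(2)] borel_measurable_times_ennreal m1 m2)
      also have "\<dots> = (\<Sum>z\<in>PP k \<omega>. indicator ({0..t} \<times> U0 \<times> A0) (mk \<omega> z))"
      proof (rule sum.cong[OF refl])
        fix z assume "z \<in> PP k \<omega>"
        then have "\<alpha> (fst z) \<omega> = \<beta> (fst z) \<omega>" using elim(1) by blast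
        then show "indicator ({0..t} \<times> U0) z * indicator A0 (\<alpha> (fst z) \<omega>) = (indicator ({0..t} \<times> U0 \<times> A0) (mk \<omega> z) :: ennreal)"
          by (cases z) (simp add: indicator_def)
      qed
      finally show "emeasure (N\<rho> \<omega>) ({0..t} \<times> U0 \<times> A0) =
             (\<integral>\<^sup>+ z. (case z of (s, u) \<Rightarrow> indicator ({0..t} \<times> U0) (s, u) * indicator A0 (\<alpha> s \<omega>)) \<partial>\<N> k \<omega>)"
        unfolding emeasure_N\<rho>[OF elim(2) B] by (simp add: case_prod_beta')
    qed
  qed
qed

lemma relaxed_state_sol:
  assumes m: "m \<in> flows G" and pm: "\<And>s \<omega>. s \<in> {0..T} \<Longrightarrow> \<omega> \<in> space M \<Longrightarrow> p s \<omega> = m s"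
  shows "relaxed_state G M F \<xi> N\<rho> m sol"
  unfolding relaxed_state_def
proof (intro conjI AE_I2 ballI)
  show "state_process G M F sol" by (rule state_process_sol)
  interpret Z: jump_system G M F "{k}" \<N> K1 K2 "\<lambda>_. \<xi>" "\<lambda>_. sol" "\<lambda>_. \<beta>" p by (rule jump_system_sol)
  fix \<omega> t assume \<omega>: "\<omega> \<in> space M" and t: "t \<in> {0..T}"
  define f where "f z = indicator ({0<..t} \<times> marks G \<times> actions G) z * real_of_int (jump G (fst z) (left_state sol (fst z) \<omega>) (fst (snd z)) (snd (snd z)) (m (fst z)))" for z
  have ls: "(\<lambda>s. left_state sol s \<omega>) \<in> \<tau> \<rightarrow>\<^sub>M state_space"
    using measurable_compose[OF pred_section[OF \<omega>] Z.Xm_pred[of k]] by simp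
  have "(\<lambda>z. (fst z, left_state sol (fst z) \<omega>, fst (snd z), snd (snd z), m (fst z))) \<in> relaxed_mark_space G \<rightarrow>\<^sub>M
      jump_space"
    by (intro measurable_Pair measurable_fst fst_compose[OF ls] snd_compose[OF measurable_fst]
      snd_compose[OF measurable_snd] fst_compose[OF flow_measurable[OF m]])
  from measurable_compose[OF measurable_compose[OF this jump_measurable], of real_of_int borel]
  have [measurable]: "(\<lambda>z. real_of_int (jump G (fst z) (left_state sol (fst z) \<omega>) (fst (snd z)) (snd (snd z)) (m (fst z)))) \<in> borel_measurable (relaxed_mark_space G)"
    by simp
  have [measurable]: "{0<..t} \<times> marks G \<times> actions G \<in> sets (relaxed_mark_space G)"
    using t marks_sets actions_sets by (intro pair_measureI time_meas) auto
  have fm: "f \<in> borel_measurable (relaxed_mark_space G)" unfolding f_def by measurable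
  have "(LINT z:{0<..t} \<times> marks G \<times> actions G|N\<rho> \<omega>. case z of (s, u, a) \<Rightarrow> real_of_int (jump G s (left_state sol s \<omega>) u a (m s))) = (LINT z|N\<rho> \<omega>. f z)"
    unfolding set_LINT_def f_def by (simp add: case_prod_beta')
  also have "\<dots> = (\<Sum>z\<in>PP k \<omega>. f (mk \<omega> z))" by (rule integral_N\<rho>[OF \<omega> fm])
  also have "\<dots> = (\<Sum>z\<in>PPt k t \<omega>. real_of_int (jump G (fst z) (left_state sol (fst z) \<omega>) (snd z) (\<beta> (fst z) \<omega>) (p (fst z) \<omega>)))"
    unfolding sum.inter_filter[OF finite_PP[OF k \<omega>]]
  proof (rule sum.cong[OF refl])
    fix z assume z: "z \<in> PP k \<omega>"
    have s: "fst z \<in> {0..T}" "0 < fst z" "snd z \<in> marks G" using PP_mem[OF k \<omega> z] by auto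
    show "f (mk \<omega> z) = (if fst z \<le> t then real_of_int (jump G (fst z) (left_state sol (fst z) \<omega>) (snd z) (\<beta> (fst z) \<omega>) (p (fst z) \<omega>)) else 0)"
      using s \<beta>_actions[OF \<omega> s(1)] pm[OF s(1) \<omega>] by (simp add: f_def indicator_def)
  qed
  finally show "real_of_int (sol t \<omega>) = real_of_int (\<xi> \<omega>) +
     (LINT z:{0<..t} \<times> marks G \<times> actions G|N\<rho> \<omega>. case z of (s, u, a) \<Rightarrow> real_of_int (jump G s (left_state sol s \<omega>) u a (m s)))"
    using Z.state_eq[of k \<omega> t] \<omega> t by simp
qed

lemma relaxed_cost_sol:
  assumes m: "m \<in> flows G" and pm: "\<And>s \<omega>. p s \<omega> = m s"
  shows "relaxed_cost G M \<rho> m sol = (LINT s|\<tau>. LINT \<omega>|M. run_cost G s (left_state sol s \<omega>) (\<beta> s \<omega>) (m s)) +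
    expectation (\<lambda>\<omega>. end_cost G (left_state sol T \<omega>) (m T))"
proof -
  interpret Z: jump_system G M F "{k}" \<N> K1 K2 "\<lambda>_. \<xi>" "\<lambda>_. sol" "\<lambda>_. \<beta>" p by (rule jump_system_sol)
  have s0: "T \<in> {0..T}" using T_pos by simp
  have int: "(LINT y|\<rho> \<omega>. (case y of (s, a) \<Rightarrow> run_cost G s (sol s \<omega>) a (m s))) = (LINT s|\<tau>. run_cost G s (sol s \<omega>) (\<beta> s \<omega>) (m s))"
    if \<omega>: "\<omega> \<in> space M" for \<omega>
  proof -
    have ss: "(\<lambda>s. sol s \<omega>) \<in> \<tau> \<rightarrow>\<^sub>M state_space"
      using measurable_compose[OF measurable_Pair2'[OF \<omega>] state_process_measurable_pair[OF state_process_sol]] by simp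
    have "(\<lambda>y. (fst y, sol (fst y) \<omega>, snd y, m (fst y))) \<in> control_space G \<rightarrow>\<^sub>M cost_space"
      by (intro measurable_Pair measurable_fst measurable_snd fst_compose[OF ss] fst_compose[OF flow_measurable[OF m]])
    from measurable_compose[OF this run_cost_measurable]
    have "(\<lambda>y. case y of (s, a) \<Rightarrow> run_cost G s (sol s \<omega>) a (m s)) \<in> borel_measurable (control_space G)" by (simp add: case_prod_beta')
    then show ?thesis unfolding \<rho>_def by (subst integral_distr[OF graph_meas[OF \<omega>]]) simp_all
  qed
  obtain Bc where Bc: "\<And>x q. x \<in> states G \<Longrightarrow> q \<in> prob_simplex \<Longrightarrow> \<bar>end_cost G x q\<bar> \<le> Bc"
    using costs_bounded by metis
  have "relaxed_cost G M \<rho> m sol = (LINT \<omega>|M. (LINT s|\<tau>. run_cost G s (sol s \<omega>) (\<beta> s \<omega>) (m s)) + end_cost G (sol T \<omega>) (m T))"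
    unfolding relaxed_cost_def by (intro LINT_cong) (auto simp: int)
  also have "\<dots> = (LINT s|\<tau>. LINT \<omega>|M. run_cost G s (left_state sol s \<omega>) (\<beta> s \<omega>) (p s \<omega>)) + expectation (\<lambda>\<omega>. end_cost G (sol T \<omega>) (m T))"
  proof (rule Z.cost_time)
    show "(\<lambda>\<omega>. end_cost G (sol T \<omega>) (m T)) \<in> borel_measurable M" using Z.X_fun_measurable[of k T "\<lambda>x. end_cost G x (m T)"] s0 by simp
    show "\<bar>end_cost G (sol T \<omega>) (m T)\<bar> \<le> Bc" if "\<omega> \<in> space M" for \<omega>
      using that s0 by (intro Bc state_process_states[OF state_process_sol] flow_simplex[OF m])
    show "run_cost G t (sol t \<omega>) (\<beta> t \<omega>) (m t) = run_cost G t (left_state sol t \<omega>) (\<beta> t \<omega>) (p t \<omega>)"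
      if "\<omega> \<in> space M" "t \<in> {0..T}" "t \<notin> (\<Union>l\<in>{k}. fst ` PP l \<omega>)" for \<omega> t
      using Z.X_no_jump[of k \<omega> t] that by (simp add: pm)
  qed simp
  also have "expectation (\<lambda>\<omega>. end_cost G (sol T \<omega>) (m T)) = expectation (\<lambda>\<omega>. end_cost G (left_state sol T \<omega>) (m T))"
  proof (rule integral_cong_AE)
    show "AE \<omega> in M. end_cost G (sol T \<omega>) (m T) = end_cost G (left_state sol T \<omega>) (m T)"
      using Z.X_eq_Xm_AE[OF s0] by eventually_elim simp
  qed (use Z.X_fun_measurable[of k T "\<lambda>x. end_cost G x (m T)"] Z.Xm_fun_measurable[of k T "\<lambda>x. end_cost G x (m T)"] s0 in auto)
  also have "(\<lambda>s. LINT \<omega>|M. run_cost G s (left_state sol s \<omega>) (\<beta> s \<omega>) (p s \<omega>)) = (\<lambda>s. LINT \<omega>|M. run_cost G s (left_state sol s \<omega>) (\<beta> s \<omega>) (m s))"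
    unfolding pm by (rule refl)
  finally show ?thesis .
qed

end

section \<open>Restriction to almost sure events\<close>

lemma empirical_measurable:
  assumes N: "1 \<le> N" and x: "\<And>i. i \<in> {1..N} \<Longrightarrow> x i \<in> H \<rightarrow>\<^sub>M count_space {1..int CARD('d::finite)}"
  shows "(\<lambda>z. empirical N (\<lambda>i. x i z) :: real^'d) \<in> H \<rightarrow>\<^sub>M simplex_space"
proof (rule measurable_restrict_space2)
  show "(\<lambda>z. empirical N (\<lambda>i. x i z) :: real^'d) \<in> space H \<rightarrow> prob_simplex"
  proof
    fix z assume "z \<in> space H"
    then show "(empirical N (\<lambda>i. x i z) :: real^'d) \<in> prob_simplex"
      using measurable_space[OF x] by (intro empirical_simplex[OF N]) auto
  qed
  show "(\<lambda>z. empirical N (\<lambda>i. x i z) :: real^'d) \<in> borel_measurable H"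
  proof (rule borel_measurable_vecI)
    fix j :: 'd
    have "(\<lambda>z. at_state j (x i z)) \<in> borel_measurable H" if "i \<in> {1..N}" for i
      using measurable_compose[OF x[OF that], of "at_state j" borel] by simp
    then show "(\<lambda>z. (empirical N (\<lambda>i. x i z) :: real^'d) $ j) \<in> borel_measurable H"
      unfolding empirical_eq by (intro borel_measurable_divide borel_measurable_sum borel_measurable_const) auto
  qed
qed

text \<open>One inclusion is enough for the transfer of independence, since independence is
  inherited by subfamilies.\<close>

lemma sigma_sets_trace:
  assumes "\<Omega> \<subseteq> S" and DE: "\<And>B. B \<in> E \<Longrightarrow> \<exists>C\<in>D. B = \<Omega> \<inter> C"
  shows "sigma_sets \<Omega> E \<subseteq> (\<lambda>C. \<Omega> \<inter> C) ` sigma_sets S D"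
proof
  fix B assume "B \<in> sigma_sets \<Omega> E"
  then show "B \<in> (\<lambda>C. \<Omega> \<inter> C) ` sigma_sets S D"
  proof induction
    case (Basic a)
    then show ?case using DE sigma_sets.Basic by blast
  next
    case Empty
    show ?case using sigma_sets.Empty by blast
  next
    case (Compl a)
    then obtain C where C: "C \<in> sigma_sets S D" "a = \<Omega> \<inter> C" by blast
    have "\<Omega> - a = \<Omega> \<inter> (S - C)" using assms(1) C(2) by blast
    then show ?case using sigma_sets.Compl[OF C(1)] by blast
  next
    case (Union a)
    then have "\<forall>i. \<exists>C. C \<in> sigma_sets S D \<and> a i = \<Omega> \<inter> C" by blast
    then obtain C where C: "\<And>i. C i \<in> sigma_sets S D" "\<And>i. a i = \<Omega> \<inter> C i" by metis
    have "(\<Union>i. a i) = \<Omega> \<inter> (\<Union>i. C i)" using C(2) by auto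
    then show ?case using sigma_sets.Union[of C, OF C(1)] by blast
  qed
qed

text \<open>The event \<open>\<Omega>\<close> is measurable, but it need not belong to the
  filtration. Hence the filtration is replaced by its traces on \<open>\<Omega>\<close>;
  intersecting it with the events of \<open>F t\<close> within the old space would destroy
  adaptedness.\<close>

locale restricted_basis = game_basis G M F for G :: "('a::metric_space, 'd::finite) game" and M :: "'w measure" and F +
  fixes \<Omega> :: "'w set"
  assumes \<Omega>_sets: "\<Omega> \<in> sets M" and \<Omega>_AE: "AE \<omega> in M. \<omega> \<in> \<Omega>"
begin

abbreviation "M0 \<equiv> restrict_space M \<Omega>"
abbreviation "F0 \<equiv> \<lambda>t. restrict_space (F t) \<Omega>"

lemma \<Omega>_sub: "\<Omega> \<subseteq> space M" by (rule sets.sets_into_space[OF \<Omega>_sets])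

lemma space_M0: "space M0 = \<Omega>" using \<Omega>_sub by (auto simp: space_restrict_space)

lemma sets_M0I: "B \<in> sets M \<Longrightarrow> \<Omega> \<inter> B \<in> sets M0" by (auto simp: sets_restrict_space)

lemma measure_M0: "B \<in> sets M \<Longrightarrow> measure M0 (\<Omega> \<inter> B) = prob B"
proof -
  assume B: "B \<in> sets M"
  have "measure M0 (\<Omega> \<inter> B) = prob (\<Omega> \<inter> B)" using \<Omega>_sets by (intro measure_restrict_space) auto
  also have "\<dots> = prob B"
  proof (rule finite_measure_eq_AE)
    show "AE \<omega> in M. (\<omega> \<in> \<Omega> \<inter> B) = (\<omega> \<in> B)" using \<Omega>_AE by eventually_elim auto
  qed (use B \<Omega>_sets in auto)
  finally show ?thesis .
qed

lemma measure_M0_Collect: "{\<omega>\<in>space M. P \<omega>} \<in> sets M \<Longrightarrow> measure M0 {\<omega>\<in>space M0. P \<omega>} = prob {\<omega>\<in>space M. P \<omega>}"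
proof -
  have "{\<omega>\<in>space M0. P \<omega>} = \<Omega> \<inter> {\<omega>\<in>space M. P \<omega>}" using \<Omega>_sub by (auto simp: space_M0)
  then show "{\<omega>\<in>space M. P \<omega>} \<in> sets M \<Longrightarrow> ?thesis" by (simp add: measure_M0)
qed

lemma expectation_M0: "f \<in> borel_measurable M \<Longrightarrow> (LINT \<omega>|M0. f \<omega>) = (LINT \<omega>|M. f \<omega> :: real)"
proof -
  assume [measurable]: "f \<in> borel_measurable M"
  have [measurable]: "\<Omega> \<in> sets M" by (rule \<Omega>_sets)
  have "(LINT \<omega>|M0. f \<omega>) = (LINT \<omega>|M. indicator \<Omega> \<omega> *\<^sub>R f \<omega>)" using \<Omega>_sets by (intro integral_restrict_space) auto
  also have "\<dots> = (LINT \<omega>|M. f \<omega>)"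
  proof (rule integral_cong_AE)
    show "AE \<omega> in M. indicator \<Omega> \<omega> *\<^sub>R f \<omega> = f \<omega>" using \<Omega>_AE by eventually_elim auto
  qed measurable
  finally show ?thesis .
qed

lemma prob_space_M0: "prob_space M0"
proof (rule prob_spaceI)
  have "emeasure M0 (space M0) = emeasure M \<Omega>"
    unfolding space_M0 using \<Omega>_sets by (intro emeasure_restrict_space) auto
  then show "emeasure M0 (space M0) = 1" using emeasure_eq_1_AE[OF \<Omega>_sets \<Omega>_AE] by simp
qed

lemma space_F0: "t \<in> {0..T} \<Longrightarrow> space (F0 t) = \<Omega>"
  using \<Omega>_sub space_F by (auto simp: space_restrict_space)

lemma filtered_M0: "filtered_prob_space G M0 F0"
  unfolding filtered_prob_space_def subalgebra_def
proof (intro conjI ballI impI)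
  show "space (F0 t) = space M0" if "t \<in> {0..T}" for t using space_F0[OF that] space_M0 by simp
  show "sets (F0 t) \<subseteq> sets M0" if "t \<in> {0..T}" for t
    unfolding sets_restrict_space using sets_F[OF that] by blast
  show "space (F0 s) = space (F0 t)" if "s \<in> {0..T}" "t \<in> {0..T}" for s t using that by (simp add: space_F0)
  show "sets (F0 s) \<subseteq> sets (F0 t)" if "s \<in> {0..T}" "t \<in> {0..T}" "s \<le> t" for s t
    unfolding sets_restrict_space using F_mono[of s t] that by auto
qed (rule prob_space_M0)

sublocale R: game_basis G M0 F0 by unfold_locales (rule filtered_M0)

text \<open>A trace has the probability of the event it comes from, and intersections commute with
  traces, so the product formula carries over.\<close>

lemma indep_sets_M0:
  assumes ind: "indep_sets E I" and E': "\<And>i. i \<in> I \<Longrightarrow> E' i \<subseteq> (\<lambda>B. \<Omega> \<inter> B) ` E i"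
  shows "R.indep_sets E' I"
proof (rule R.indep_setsI)
  have Es: "E i \<subseteq> events" if "i \<in> I" for i using ind that by (auto simp: indep_sets_def)
  show "E' i \<subseteq> R.events" if "i \<in> I" for i using E'[OF that] Es[OF that] sets_M0I by blast
  fix A J assume J: "J \<noteq> {}" "J \<subseteq> I" "finite J" and A: "\<forall>j\<in>J. A j \<in> E' j"
  have "\<forall>j\<in>J. \<exists>B. B \<in> E j \<and> A j = \<Omega> \<inter> B" using A E' J(2) by blast
  then obtain B where B: "\<And>j. j \<in> J \<Longrightarrow> B j \<in> E j" "\<And>j. j \<in> J \<Longrightarrow> A j = \<Omega> \<inter> B j" by metis
  have Bs: "B j \<in> events" if "j \<in> J" for j using B(1)[OF that] Es J(2) that by blast
  have "(\<Inter>j\<in>J. A j) = \<Omega> \<inter> (\<Inter>j\<in>J. B j)" using B(2) J(1) by auto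
  moreover have "(\<Inter>j\<in>J. B j) \<in> events" using Bs J by (intro sets.finite_INT) auto
  ultimately have "R.prob (\<Inter>j\<in>J. A j) = prob (\<Inter>j\<in>J. B j)" using measure_M0 by simp
  also have "\<dots> = (\<Prod>j\<in>J. prob (B j))" using B(1) by (intro indep_setsD[OF ind J(2,1,3)]) blast
  also have "\<dots> = (\<Prod>j\<in>J. R.prob (A j))" by (intro prod.cong refl) (simp add: B(2) measure_M0 Bs)
  finally show "R.prob (\<Inter>j\<in>J. A j) = (\<Prod>j\<in>J. R.prob (A j))" .
qed

lemma vimage_trace: "f -` E \<inter> space M0 = \<Omega> \<inter> (f -` E \<inter> space M)"
  using \<Omega>_sub by (auto simp: space_M0)

lemma init_sigma_M0: "init_sigma M0 \<xi> \<subseteq> (\<lambda>B. \<Omega> \<inter> B) ` init_sigma M \<xi>"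
  unfolding init_sigma_def vimage_trace unfolding space_M0
proof (rule sigma_sets_trace[OF \<Omega>_sub])
  fix B assume "B \<in> {\<Omega> \<inter> (\<xi> -` E \<inter> space M) |E. True}"
  then obtain E where "B = \<Omega> \<inter> (\<xi> -` E \<inter> space M)" by blast
  then show "\<exists>C\<in>{\<xi> -` E \<inter> space M |E. True}. B = \<Omega> \<inter> C" by blast
qed

lemma noise_trace:
  "sigma_sets (space M0) {(\<lambda>\<omega>. emeasure (n \<omega>) B) -` E \<inter> space M0 |B E. P B E} \<subseteq>
    (\<lambda>B. \<Omega> \<inter> B) ` sigma_sets (space M) {(\<lambda>\<omega>. emeasure (n \<omega>) B) -` E \<inter> space M |B E. P B E}"
  unfolding vimage_trace unfolding space_M0
proof (rule sigma_sets_trace[OF \<Omega>_sub])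
  fix C assume "C \<in> {\<Omega> \<inter> ((\<lambda>\<omega>. emeasure (n \<omega>) B) -` E \<inter> space M) |B E. P B E}"
  then obtain B E where "C = \<Omega> \<inter> ((\<lambda>\<omega>. emeasure (n \<omega>) B) -` E \<inter> space M)" "P B E" by blast
  then show "\<exists>C'\<in>{(\<lambda>\<omega>. emeasure (n \<omega>) B) -` E \<inter> space M |B E. P B E}. C = \<Omega> \<inter> C'" by blast
qed

lemma initial_state_M0:
  assumes "initial_state G M F \<xi>" shows "initial_state G M0 F0 \<xi>"
proof -
  have m: "\<xi> \<in> F 0 \<rightarrow>\<^sub>M state_space" and law: "prob {\<omega>\<in>space M. \<xi> \<omega> = state_of j} = init_law G $ j" for j
    using assms by (auto simp: initial_state_def)
  have mM: "\<xi> \<in> M \<rightarrow>\<^sub>M state_space" using measurable_F[OF _ m] T_pos by simp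
  have S: "{\<omega>\<in>space M. \<xi> \<omega> = state_of j} \<in> sets M" for j
  proof -
    have "{\<omega>\<in>space M. \<xi> \<omega> = state_of j} = \<xi> -` ({state_of j} \<inter> states G) \<inter> space M"
      using measurable_space[OF mM] by auto
    then show ?thesis using measurable_sets[OF mM, of "{state_of j} \<inter> states G"] by simp
  qed
  have "R.prob {\<omega>\<in>space M0. \<xi> \<omega> = state_of j} = init_law G $ j" for j
    unfolding measure_M0_Collect[OF S] by (rule law)
  with measurable_restrict_space1[OF m] show ?thesis unfolding initial_state_def by blast
qed

lemma poisson_M0:
  assumes n: "poisson_random_measure G M F n" shows "poisson_random_measure G M0 F0 n"
proof -
  have meas: "(\<lambda>\<omega>. emeasure (n \<omega>) B) \<in> borel_measurable M" if "B \<in> sets (mark_space G)" for B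
    using n that unfolding poisson_random_measure_def adapted_random_measure_def by blast
  show ?thesis
    unfolding poisson_random_measure_def adapted_random_measure_def
  proof (intro conjI ballI allI impI)
    show "sets (n \<omega>) = sets (mark_space G)" if "\<omega> \<in> space M0" for \<omega>
      using sets_noise[OF n] that \<Omega>_sub by (auto simp: space_M0)
    show "(\<lambda>\<omega>. emeasure (n \<omega>) B) \<in> borel_measurable M0" if "B \<in> sets (mark_space G)" for B
      by (rule measurable_restrict_space1[OF meas[OF that]])
    show "(\<lambda>\<omega>. emeasure (n \<omega>) B) \<in> borel_measurable (F0 t)"
      if "t \<in> {0..T}" "B \<in> sets (mark_space G)" "B \<subseteq> {0..t} \<times> UNIV" for t B
      using n that unfolding poisson_random_measure_def adapted_random_measure_def by (intro measurable_restrict_space1) blast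
    show "R.prob {\<omega>\<in>space M0. emeasure (n \<omega>) B = of_nat k} = exp (- measure (mark_space G) B) * measure (mark_space G) B ^ k / fact k"
      if B: "B \<in> sets (mark_space G)" for B and k :: nat
    proof -
      have [measurable]: "(\<lambda>\<omega>. emeasure (n \<omega>) B) \<in> borel_measurable M" by (rule meas[OF B])
      have S: "{\<omega>\<in>space M. emeasure (n \<omega>) B = of_nat k} \<in> sets M" by measurable
      show ?thesis unfolding measure_M0_Collect[OF S] using n B unfolding poisson_random_measure_def by blast
    qed
  next
    fix k :: nat and B :: "nat \<Rightarrow> (real \<times> (real^'d)) set"
    assume B: "(\<forall>i<k. B i \<in> sets (mark_space G)) \<and> disjoint_family_on B {..<k}"
    have iv: "indep_vars (\<lambda>_. borel) (\<lambda>i \<omega>. emeasure (n \<omega>) (B i)) {..<k}"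
      using n B unfolding poisson_random_measure_def by blast
    show "R.indep_vars (\<lambda>_. borel) (\<lambda>i \<omega>. emeasure (n \<omega>) (B i)) {..<k}"
      unfolding R.indep_vars_def2
    proof
      show "\<forall>i\<in>{..<k}. (\<lambda>\<omega>. emeasure (n \<omega>) (B i)) \<in> borel_measurable M0"
        using B by (auto intro!: measurable_restrict_space1 meas)
      show "R.indep_sets (\<lambda>i. {(\<lambda>\<omega>. emeasure (n \<omega>) (B i)) -` A \<inter> space M0 |A. A \<in> sets borel}) {..<k}"
      proof (rule indep_sets_M0)
        show "indep_sets (\<lambda>i. {(\<lambda>\<omega>. emeasure (n \<omega>) (B i)) -` A \<inter> space M |A. A \<in> sets borel}) {..<k}"
          using iv unfolding indep_vars_def2 by (rule conjunct2)
        show "{(\<lambda>\<omega>. emeasure (n \<omega>) (B i)) -` A \<inter> space M0 |A. A \<in> sets borel} \<subseteq>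
            (\<lambda>B. \<Omega> \<inter> B) ` {(\<lambda>\<omega>. emeasure (n \<omega>) (B i)) -` A \<inter> space M |A. A \<in> sets borel}" for i
          unfolding vimage_trace by blast
      qed
    qed
  next
    fix s assume s: "s \<in> {0..T}"
    define E where "E Z = {(\<lambda>\<omega>. emeasure (n \<omega>) B) -` E \<inter> Z |B E. B \<in> sets (mark_space G) \<and> B \<subseteq> {s<..} \<times> UNIV \<and> E \<in> sets borel}" for Z
    have "indep_set (sets (F s)) (sigma_sets (space M) (E (space M)))"
      using n s unfolding poisson_random_measure_def E_def by blast
    then have i: "indep_sets (case_bool (sets (F s)) (sigma_sets (space M) (E (space M)))) UNIV" by (simp add: indep_set_def)
    have tr: "sigma_sets (space M0) (E (space M0)) \<subseteq> (\<lambda>B. \<Omega> \<inter> B) ` sigma_sets (space M) (E (space M))"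
      unfolding E_def by (rule noise_trace)
    have "R.indep_sets (case_bool (sets (F0 s)) (sigma_sets (space M0) (E (space M0)))) UNIV"
    proof (rule indep_sets_M0[OF i])
      fix b :: bool
      show "case_bool (sets (F0 s)) (sigma_sets (space M0) (E (space M0))) b \<subseteq>
          (\<lambda>B. \<Omega> \<inter> B) ` case_bool (sets (F s)) (sigma_sets (space M) (E (space M))) b"
        using tr by (cases b) (simp_all add: sets_restrict_space)
    qed
    then show "R.indep_set (sets (F0 s)) (sigma_sets (space M0) {(\<lambda>\<omega>. emeasure (n \<omega>) B) -` E \<inter> space M0 |B E.
         B \<in> sets (mark_space G) \<and> B \<subseteq> {s<..} \<times> UNIV \<and> E \<in> sets borel})"
      by (simp add: R.indep_set_def E_def)
  qed
qed

lemma state_process_M0: "state_process G M F X \<Longrightarrow> state_process G M0 F0 X"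
  using \<Omega>_sub unfolding state_process_def by (auto simp: space_M0 intro!: measurable_restrict_space1)

text \<open>The trace of a predictable rectangle is a predictable rectangle of the restricted basis;
  predictability of all processes is thereby preserved.\<close>

lemma id_M0: "(\<lambda>z. z) \<in> R.\<P> \<rightarrow>\<^sub>M \<P>"
  unfolding predictable_algebra_def[of G M F]
proof (rule measurable_measure_of[OF gens_sub])
  show "(\<lambda>z. z) \<in> space R.\<P> \<rightarrow> {0..T} \<times> space M" using \<Omega>_sub by (auto simp: R.space_pred space_M0)
  fix y assume "y \<in> gens"
  then consider B where "y = {0} \<times> B" "B \<in> sets (F 0)" |
    s t B where "y = {s<..t} \<times> B" "0 \<le> s" "s < t" "t \<le> T" "B \<in> sets (F s)" by blast
  then show "(\<lambda>z. z) -` y \<inter> space R.\<P> \<in> sets R.\<P>"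
  proof cases
    case 1
    then have "(\<lambda>z. z) -` y \<inter> space R.\<P> = {0} \<times> (\<Omega> \<inter> B)" using T_pos by (auto simp: R.space_pred space_M0)
    moreover have "\<Omega> \<inter> B \<in> sets (F0 0)" using 1 by (auto simp: sets_restrict_space)
    ultimately show ?thesis using R.pred_gen0 by metis
  next
    case 2
    then have "(\<lambda>z. z) -` y \<inter> space R.\<P> = {s<..t} \<times> (\<Omega> \<inter> B)" by (auto simp: R.space_pred space_M0)
    moreover have "\<Omega> \<inter> B \<in> sets (F0 s)" using 2 by (auto simp: sets_restrict_space)
    ultimately show ?thesis using R.pred_gen 2 by metis
  qed
qed

lemma pred_M0: "f \<in> \<P> \<rightarrow>\<^sub>M H \<Longrightarrow> f \<in> R.\<P> \<rightarrow>\<^sub>M H"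
  by (rule measurable_compose[OF id_M0, where g = f])

lemma predictable_control_M0: "predictable_control G M F \<alpha> \<Longrightarrow> predictable_control G M0 F0 \<alpha>"
  unfolding predictable_control_def by (rule pred_M0)

end

text \<open>Collects the two almost sure properties, simplicity of the atoms and the state equation,
  and passes to an event on which both hold. There the integral in the state equation becomes the
  finite sum of \<open>jump_system\<close>.\<close>

lemma (in game_basis) good_restriction:
  assumes reg: "regular_game G K1 K2" and I: "finite I"
    and init: "\<And>i. i \<in> I \<Longrightarrow> initial_state G M F (\<xi> i)" and prm: "\<And>i. i \<in> I \<Longrightarrow> poisson_random_measure G M F (\<N> i)"
    and ind: "indep_sets (\<lambda>i. noise_sigma G M (\<N> i)) I" and X: "\<And>i. i \<in> I \<Longrightarrow> state_process G M F (X i)"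
    and \<alpha>: "\<And>i. i \<in> I \<Longrightarrow> predictable_control G M F (\<alpha> i)" and p: "(\<lambda>(s, \<omega>). p s \<omega>) \<in> \<P> \<rightarrow>\<^sub>M simplex_space"
    and eq: "AE \<omega> in M. \<forall>i\<in>I. \<forall>t\<in>{0..T}. real_of_int (X i t \<omega>) = real_of_int (\<xi> i \<omega>) +
      (LINT z:{0<..t} \<times> marks G|\<N> i \<omega>. case z of (s, u) \<Rightarrow> real_of_int (jump G s (left_state (X i) s \<omega>) u (\<alpha> i s \<omega>) (p s \<omega>)))"
  obtains \<Omega> where "restricted_basis G M F \<Omega>"
    "jump_system G (restrict_space M \<Omega>) (\<lambda>t. restrict_space (F t) \<Omega>) I \<N> K1 K2 \<xi> X \<alpha> p"
proof -
  interpret regular_game G K1 K2 by (rule reg)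
  have sp: "AE \<omega> in M. simple_points G I (\<lambda>i. \<N> i \<omega>)" by (rule AE_simple_points[OF I prm ind])
  define P where "P \<omega> \<longleftrightarrow> simple_points G I (\<lambda>i. \<N> i \<omega>) \<and> (\<forall>i\<in>I. \<forall>t\<in>{0..T}. real_of_int (X i t \<omega>) = real_of_int (\<xi> i \<omega>) +
      (LINT z:{0<..t} \<times> marks G|\<N> i \<omega>. case z of (s, u) \<Rightarrow> real_of_int (jump G s (left_state (X i) s \<omega>) u (\<alpha> i s \<omega>) (p s \<omega>))))" for \<omega>
  have "AE \<omega> in M. P \<omega>" unfolding P_def using sp eq by eventually_elim blast
  \<comment> \<open>The set where \<open>P\<close> fails involves uncountably many times and may not
    be measurable; it is covered by a measurable null set, and the complement of that is
    used.\<close>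
  then obtain Z where Z: "{\<omega>\<in>space M. \<not> P \<omega>} \<subseteq> Z"
    "emeasure M Z = 0" "Z \<in> sets M" by (rule AE_E)
  interpret B: restricted_basis G M F "space M - Z"
  proof
    show "AE \<omega> in M. \<omega> \<in> space M - Z" using AE_not_in[of Z M] Z by (auto simp: null_sets_def elim!: AE_mp)
  qed (use Z in auto)
  have simple: "simple_points G I (\<lambda>i. \<N> i \<omega>)" and
    eq': "i \<in> I \<Longrightarrow> t \<in> {0..T} \<Longrightarrow> real_of_int (X i t \<omega>) = real_of_int (\<xi> i \<omega>) +
      (LINT z:{0<..t} \<times> marks G|\<N> i \<omega>. case z of (s, u) \<Rightarrow> real_of_int (jump G s (left_state (X i) s \<omega>) u (\<alpha> i s \<omega>) (p s \<omega>)))"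
    if "\<omega> \<in> space B.M0" for \<omega> i t using that Z(1) unfolding B.space_M0 P_def by blast+
  interpret S: good_basis G B.M0 B.F0 I \<N>
    by unfold_locales (use I simple B.poisson_M0 prm in auto)
  have "jump_system G B.M0 B.F0 I \<N> K1 K2 \<xi> X \<alpha> p"
  proof unfold_locales
    show "initial_state G B.M0 B.F0 (\<xi> i)" if "i \<in> I" for i by (rule B.initial_state_M0[OF init[OF that]])
    show XR: "state_process G B.M0 B.F0 (X i)" if "i \<in> I" for i by (rule B.state_process_M0[OF X[OF that]])
    show \<alpha>R: "predictable_control G B.M0 B.F0 (\<alpha> i)" if "i \<in> I" for i by (rule B.predictable_control_M0[OF \<alpha>[OF that]])
    show pR: "(\<lambda>(s, \<omega>). p s \<omega>) \<in> B.R.\<P> \<rightarrow>\<^sub>M simplex_space" by (rule B.pred_M0[OF p])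
    fix i \<omega> t assume i: "i \<in> I" and \<omega>: "\<omega> \<in> space B.M0" and t: "t \<in> {0..T}"
    define f where "f z = indicator ({0<..t} \<times> marks G) z *
      real_of_int (jump G (fst z) (left_state (X i) (fst z) \<omega>) (snd z) (\<alpha> i (fst z) \<omega>) (p (fst z) \<omega>))" for z
    have sec: "(\<lambda>s. h s \<omega>) \<in> \<tau> \<rightarrow>\<^sub>M H" if "(\<lambda>(s, \<omega>). h s \<omega>) \<in> B.R.\<P> \<rightarrow>\<^sub>M H" for h H
      using measurable_compose[OF B.R.pred_section[OF \<omega>] that] by simp
    have "(\<lambda>z. (fst z, left_state (X i) (fst z) \<omega>, snd z, \<alpha> i (fst z) \<omega>, p (fst z) \<omega>)) \<in> mark_space G \<rightarrow>\<^sub>M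
        jump_space"
      using \<alpha>R[OF i] unfolding predictable_control_def
      by (intro measurable_Pair measurable_fst measurable_snd fst_compose[OF sec[OF pR]]
        fst_compose[OF sec[OF B.R.left_state_predictable[OF XR[OF i]]]] fst_compose[OF sec[of "\<alpha> i"]])
    from measurable_compose[OF measurable_compose[OF this jump_measurable], of real_of_int borel]
    have [measurable]: "(\<lambda>z. real_of_int (jump G (fst z) (left_state (X i) (fst z) \<omega>) (snd z) (\<alpha> i (fst z) \<omega>) (p (fst z) \<omega>))) \<in> borel_measurable (mark_space G)"
      by simp
    have [measurable]: "{0<..t} \<times> marks G \<in> sets (mark_space G)" using t marks_sets by (intro pair_measureI time_meas) auto
    have fm: "f \<in> borel_measurable (mark_space G)" unfolding f_def by measurable
    have "(LINT z:{0<..t} \<times> marks G|\<N> i \<omega>. case z of (s, u) \<Rightarrow> real_of_int (jump G s (left_state (X i) s \<omega>) u (\<alpha> i s \<omega>) (p s \<omega>))) = (LINT z|\<N> i \<omega>. f z)"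
      unfolding set_LINT_def f_def by (simp add: case_prod_beta')
    also have "\<dots> = (\<Sum>z\<in>atoms (\<N> i \<omega>). f z)" by (rule S.integral_noise[OF i \<omega> fm])
    also have "\<dots> = (\<Sum>z\<in>{z\<in>atoms (\<N> i \<omega>). fst z \<le> t}. real_of_int (jump G (fst z) (left_state (X i) (fst z) \<omega>) (snd z) (\<alpha> i (fst z) \<omega>) (p (fst z) \<omega>)))"
      unfolding sum.inter_filter[OF S.finite_PP[OF i \<omega>]]
    proof (rule sum.cong[OF refl])
      fix z assume "z \<in> atoms (\<N> i \<omega>)"
      then have "0 < fst z" "snd z \<in> marks G" using S.PP_mem[OF i \<omega>] by auto
      then show "f z = (if fst z \<le> t then real_of_int (jump G (fst z) (left_state (X i) (fst z) \<omega>) (snd z) (\<alpha> i (fst z) \<omega>) (p (fst z) \<omega>)) else 0)"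
        by (cases z) (auto simp: f_def)
    qed
    finally show "real_of_int (X i t \<omega>) = real_of_int (\<xi> i \<omega>) +
       (\<Sum>z\<in>{z\<in>atoms (\<N> i \<omega>). fst z \<le> t}. real_of_int (jump G (fst z) (left_state (X i) (fst z) \<omega>) (snd z) (\<alpha> i (fst z) \<omega>) (p (fst z) \<omega>)))"
      using eq'[OF \<omega> i t] by simp
  qed
  from that[OF B.restricted_basis_axioms this] show ?thesis .
qed

text \<open>Two changes at once: to the restricted space, which does not affect expectations of
  measurable functions, and to left limits with the predictable environment \<open>p\<close>, which
  differs from the current environment \<open>q\<close> only at the times of atoms.\<close>

lemma (in restricted_basis) cost_restrict:
  assumes J: "jump_system G M0 F0 I \<N> K1 K2 \<xi> X \<alpha> p" and i: "i \<in> I"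
    and X: "state_process G M F (X i)" and \<alpha>: "predictable_control G M F (\<alpha> i)"
    and q: "(\<lambda>(s, \<omega>). q s \<omega>) \<in> \<tau> \<Otimes>\<^sub>M M \<rightarrow>\<^sub>M simplex_space"
    and qp: "\<And>\<omega> t. \<omega> \<in> \<Omega> \<Longrightarrow> t \<in> {0..T} \<Longrightarrow> t \<notin> (\<Union>l\<in>I. fst ` atoms (\<N> l \<omega>)) \<Longrightarrow> q t \<omega> = p t \<omega>"
  shows "(LINT \<omega>|M. (LINT t:{0..T}|lborel. run_cost G t (X i t \<omega>) (\<alpha> i t \<omega>) (q t \<omega>)) + end_cost G (X i T \<omega>) (q T \<omega>)) =
    (LINT s|\<tau>. LINT \<omega>|M0. run_cost G s (left_state (X i) s \<omega>) (\<alpha> i s \<omega>) (p s \<omega>)) +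
    (LINT \<omega>|M0. end_cost G (left_state (X i) T \<omega>) (p T \<omega>))"
proof -
  interpret J: jump_system G M0 F0 I \<N> K1 K2 \<xi> X \<alpha> p by (rule J)
  have T: "T \<in> {0..T}" using T_pos by simp
  obtain B where B: "\<And>x q. x \<in> states G \<Longrightarrow> q \<in> prob_simplex \<Longrightarrow> \<bar>end_cost G x q\<bar> \<le> B"
    using J.costs_bounded by metis
  have Xp: "(\<lambda>z. X i (fst z) (snd z)) \<in> \<tau> \<Otimes>\<^sub>M M \<rightarrow>\<^sub>M state_space"
    using state_process_measurable_pair[OF X] by (simp add: case_prod_beta')
  have qm: "(\<lambda>z. q (fst z) (snd z)) \<in> \<tau> \<Otimes>\<^sub>M M \<rightarrow>\<^sub>M simplex_space" using q by (simp add: case_prod_beta')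
  have \<alpha>m: "(\<lambda>z. \<alpha> i (fst z) (snd z)) \<in> \<tau> \<Otimes>\<^sub>M M \<rightarrow>\<^sub>M action_space G"
    using pred_measurable_pair \<alpha> by (simp add: predictable_control_def case_prod_beta')
  have "(\<lambda>z. (fst z, X i (fst z) (snd z), \<alpha> i (fst z) (snd z), q (fst z) (snd z))) \<in> \<tau> \<Otimes>\<^sub>M M \<rightarrow>\<^sub>M cost_space"
    by (intro measurable_Pair measurable_fst Xp \<alpha>m qm)
  from measurable_compose[OF this run_cost_measurable]
  have rm: "(\<lambda>z. run_cost G (fst z) (X i (fst z) (snd z)) (\<alpha> i (fst z) (snd z)) (q (fst z) (snd z))) \<in> borel_measurable (\<tau> \<Otimes>\<^sub>M M)" by simp
  have "(\<lambda>(\<omega>, s). run_cost G s (X i s \<omega>) (\<alpha> i s \<omega>) (q s \<omega>)) \<in> borel_measurable (M \<Otimes>\<^sub>M \<tau>)"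
    using measurable_compose[OF measurable_Pair[OF measurable_snd measurable_fst] rm] by (simp add: case_prod_beta')
  then have im: "(\<lambda>\<omega>. LINT s|\<tau>. run_cost G s (X i s \<omega>) (\<alpha> i s \<omega>) (q s \<omega>)) \<in> borel_measurable M"
    by (rule tau.borel_measurable_lebesgue_integral)
  have Tp: "(\<lambda>\<omega>. (T, \<omega>)) \<in> M \<rightarrow>\<^sub>M \<tau> \<Otimes>\<^sub>M M" using T by (intro measurable_Pair1') (simp add: space_time)
  have "(\<lambda>z. end_cost G (X i (fst z) (snd z)) (q (fst z) (snd z))) \<in> borel_measurable (\<tau> \<Otimes>\<^sub>M M)"
    using measurable_compose[OF measurable_Pair[OF Xp qm] end_cost_measurable] by simp
  from measurable_compose[OF Tp this] have em: "(\<lambda>\<omega>. end_cost G (X i T \<omega>) (q T \<omega>)) \<in> borel_measurable M" by simp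
  \<comment> \<open>No atom sits at the horizon, so the terminal state and environment equal their
    left limits surely.\<close>
  have noT: "t = T \<Longrightarrow> t \<notin> (\<Union>l\<in>I. fst ` atoms (\<N> l \<omega>))" if "\<omega> \<in> \<Omega>" for \<omega> t
    using J.PP_mem[of _ \<omega>] that by (force simp: space_M0)
  have XT: "X i T \<omega> = left_state (X i) T \<omega>" "q T \<omega> = p T \<omega>" if "\<omega> \<in> \<Omega>" for \<omega>
    using noT[OF that refl] J.X_no_jump[OF i, of \<omega> T] qp[OF that T] T_pos i that by (auto simp: space_M0)
  have "(LINT \<omega>|M. (LINT t:{0..T}|lborel. run_cost G t (X i t \<omega>) (\<alpha> i t \<omega>) (q t \<omega>)) + end_cost G (X i T \<omega>) (q T \<omega>)) =
     (LINT \<omega>|M0. (LINT s|\<tau>. run_cost G s (X i s \<omega>) (\<alpha> i s \<omega>) (q s \<omega>)) + end_cost G (X i T \<omega>) (q T \<omega>))"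
    unfolding J.LINT_lborel using im em by (intro expectation_M0[symmetric] borel_measurable_add)
  also have "\<dots> = (LINT s|\<tau>. LINT \<omega>|M0. run_cost G s (left_state (X i) s \<omega>) (\<alpha> i s \<omega>) (p s \<omega>)) + (LINT \<omega>|M0. end_cost G (X i T \<omega>) (q T \<omega>))"
  proof (rule J.cost_time[OF i])
    show "(\<lambda>\<omega>. end_cost G (X i T \<omega>) (q T \<omega>)) \<in> borel_measurable M0" by (rule measurable_restrict_space1[OF em])
    show "\<bar>end_cost G (X i T \<omega>) (q T \<omega>)\<bar> \<le> B" if "\<omega> \<in> space M0" for \<omega>
    proof -
      have \<omega>: "\<omega> \<in> \<Omega>" using that by (simp add: space_M0)
      show ?thesis using J.X_states[OF i that T] J.p_simplex[OF that T] XT(2)[OF \<omega>] by (intro B) auto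
    qed
    show "run_cost G t (X i t \<omega>) (\<alpha> i t \<omega>) (q t \<omega>) = run_cost G t (left_state (X i) t \<omega>) (\<alpha> i t \<omega>) (p t \<omega>)"
      if "\<omega> \<in> space M0" "t \<in> {0..T}" "t \<notin> (\<Union>l\<in>I. fst ` atoms (\<N> l \<omega>))" for \<omega> t
      using J.X_no_jump[OF i, of \<omega> t] qp[of \<omega> t] that i by (auto simp: space_M0)
  qed
  also have "(LINT \<omega>|M0. end_cost G (X i T \<omega>) (q T \<omega>)) = (LINT \<omega>|M0. end_cost G (left_state (X i) T \<omega>) (p T \<omega>))"
    by (rule LINT_cong) (auto simp: space_M0 XT)
  finally show ?thesis .
qed

section \<open>Nash inequality\<close>

text \<open>The constants of the preceding estimates as an explicit function of numbers, which shows
  that neither \<open>N\<close> nor the solutions enter. \<open>d\<close> stands for the number of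
  states and \<open>D\<close> for the diameter of the action set. Absolute values and the summand 2
  keep the result positive.\<close>

definition nash_constant :: "real \<Rightarrow> real \<Rightarrow> real \<Rightarrow> real \<Rightarrow> real \<Rightarrow> real \<Rightarrow> real" where
  "nash_constant d D T \<nu> K1 K2 =
    (let L = \<bar>K1\<bar>;
         cV = 2 * (d + T * d * (\<nu> + 4 * (\<nu> + L)\<^sup>2)) * exp (2 * (1 + 2 * d * (\<nu> + L)) * T);
         cP = (cV + d) / 2 + 2;
         cD = 2 * (d * L * cP * T) * exp (2 * (d * \<nu> + 1) * T);
         cZ = 2 * (L * cP * T) * exp (2 * (L + 1) * T)
     in 2 + \<bar>(T + 1) * (\<bar>K2\<bar> * cP + \<bar>K2\<bar> * (d + D) * cD)\<bar> + \<bar>(T + 1) * (\<bar>K2\<bar> * (cZ + cP))\<bar>)"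

lemma nash_constant_ge: "2 \<le> nash_constant d D T \<nu> K1 K2"
  unfolding nash_constant_def Let_def by (intro add_increasing2 abs_ge_zero order_refl)

lemma (in players_near_limit) nash_constant_eq:
  "nash_constant (real CARD('d)) (diameter (actions G)) T \<nu> K1 K2 =
    2 + \<bar>(T + 1) * (L2 * cP + L2 * (real CARD('d) + diameter (actions G)) * cD)\<bar> + \<bar>(T + 1) * (L2 * (cZ + cP))\<bar>"
  unfolding nash_constant_def Let_def cD_def cZ_def cP_def cV_def by (rule refl)

lemma (in game_basis) feedback_predictable:
  assumes X: "state_process G M F X" and \<gamma>: "(\<lambda>(t, x). \<gamma> t x) \<in> \<tau> \<Otimes>\<^sub>M state_space \<rightarrow>\<^sub>M action_space G"
  shows "predictable_control G M F (\<lambda>s \<omega>. \<gamma> s (left_state X s \<omega>))"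
proof -
  have "(\<lambda>z. left_state X (fst z) (snd z)) \<in> \<P> \<rightarrow>\<^sub>M state_space"
    using left_state_predictable[OF X] by (simp add: case_prod_beta')
  from measurable_compose[OF measurable_Pair[OF fst_pred this] \<gamma>]
  show ?thesis unfolding predictable_control_def by (simp add: case_prod_beta')
qed

lemma (in game_basis) flow_predictable: "m \<in> flows G \<Longrightarrow> (\<lambda>(s, \<omega>). m s) \<in> \<P> \<rightarrow>\<^sub>M simplex_space"
  using measurable_compose[OF fst_pred flow_measurable] by (simp add: case_prod_beta')

lemma (in game_basis) state_set:
  assumes X: "state_process G M F X" and t: "t \<in> {0..T}"
  shows "X t \<in> M \<rightarrow>\<^sub>M state_space" "{\<omega>\<in>space M. X t \<omega> = x} \<in> sets M"
    "(\<lambda>\<omega>. f (X t \<omega>)) \<in> borel_measurable M"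
proof -
  show m: "X t \<in> M \<rightarrow>\<^sub>M state_space" using X t measurable_F[OF t] unfolding state_process_def by blast
  have "{\<omega>\<in>space M. X t \<omega> = x} = X t -` ({x} \<inter> states G) \<inter> space M" using measurable_space[OF m] by auto
  then show "{\<omega>\<in>space M. X t \<omega> = x} \<in> sets M" using measurable_sets[OF m, of "{x} \<inter> states G"] by simp
  show "(\<lambda>\<omega>. f (X t \<omega>)) \<in> borel_measurable M" using measurable_compose[OF m, of f borel] by simp
qed

text \<open>The limiting state is a jump system with one player in the deterministic environment
  \<open>m\<close>. Its law solves the closed forward equation, and its cost depends on the law
  alone. In this form the limit can be compared with players on another probability space.\<close>

lemma (in regular_game) limit_law:
  fixes M :: "'w measure"
  assumes fc: "feedback_control G M F \<gamma> \<xi> n" and fs: "feedback_state G M F \<gamma> \<xi> n m X" and m: "m \<in> flows G"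
  obtains law :: "'d \<Rightarrow> real \<Rightarrow> real" where
    "\<And>j t. t \<in> {0..T} \<Longrightarrow> law j t = measure M {\<omega>\<in>space M. X t \<omega> = state_of j}"
    "\<And>j t. t \<in> {0..T} \<Longrightarrow> 0 \<le> law j t" "\<And>t. t \<in> {0..T} \<Longrightarrow> (\<Sum>j\<in>UNIV. law j t) = 1" "\<And>j. law j \<in> borel_measurable \<tau>"
    "\<And>j t. t \<in> {0..T} \<Longrightarrow> law j t = init_law G $ j +
       (LINT s:{..t}|\<tau>. \<Sum>y\<in>UNIV. law y s * rate G j s (state_of y) (\<gamma> s (state_of y)) (m s))"
    "feedback_cost G M \<gamma> m X = (LINT s|\<tau>. (\<Sum>y\<in>UNIV. law y s * run_cost G s (state_of y) (\<gamma> s (state_of y)) (m s))) +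
       (\<Sum>y\<in>UNIV. law y T * end_cost G (state_of y) (m T))"
proof -
  interpret game_basis G M F using fc by unfold_locales (simp add: feedback_control_def mfg_basis_def)
  have X: "state_process G M F X" using fs by (simp add: feedback_state_def)
  have \<gamma>: "(\<lambda>(t, x). \<gamma> t x) \<in> \<tau> \<Otimes>\<^sub>M state_space \<rightarrow>\<^sub>M action_space G"
    and init: "initial_state G M F \<xi>" and prm: "poisson_random_measure G M F n"
    using fc by (auto simp: feedback_control_def mfg_basis_def)
  define \<alpha> where "\<alpha> i s \<omega> = \<gamma> s (left_state X s \<omega>)" for i :: nat and s \<omega>
  have \<alpha>: "predictable_control G M F (\<alpha> i)" for i unfolding \<alpha>_def by (rule feedback_predictable[OF X \<gamma>])
  have T: "T \<in> {0..T}" using T_pos by simp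
  have reg: "regular_game G K1 K2" by unfold_locales
  have sub: "noise_sigma G M n \<subseteq> events" unfolding noise_sigma_def
  proof (rule sets.sigma_sets_subset, safe)
    fix B E assume "B \<in> sets (mark_space G)" "(E :: ennreal set) \<in> sets borel"
    then show "(\<lambda>\<omega>. emeasure (n \<omega>) B) -` E \<inter> space M \<in> events"
      using prm unfolding poisson_random_measure_def adapted_random_measure_def by (blast intro: measurable_sets)
  qed
  \<comment> \<open>\<open>good_restriction\<close> asks for independent noises; a family with one
    member satisfies this trivially.\<close>
  have ind: "indep_sets (\<lambda>i. noise_sigma G M n) {1 :: nat}"
  proof (rule indep_setsI)
    fix A J assume "J \<noteq> {}" "J \<subseteq> {1 :: nat}"
    then have "J = {1}" by auto
    then show "prob (\<Inter>j\<in>J. A j) = (\<Prod>j\<in>J. prob (A j))" by simp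
  qed (rule sub)
  have eq: "AE \<omega> in M. \<forall>i\<in>{1 :: nat}. \<forall>t\<in>{0..T}. real_of_int (X t \<omega>) = real_of_int (\<xi> \<omega>) +
      (LINT z:{0<..t} \<times> marks G|n \<omega>. case z of (s, u) \<Rightarrow> real_of_int (jump G s (left_state X s \<omega>) u (\<alpha> i s \<omega>) (m s)))"
    using fs by (simp add: feedback_state_def \<alpha>_def Let_def)
  obtain \<Omega> where \<Omega>: "restricted_basis G M F \<Omega>"
    and JS: "jump_system G (restrict_space M \<Omega>) (\<lambda>t. restrict_space (F t) \<Omega>) {1} (\<lambda>_. n) K1 K2 (\<lambda>_. \<xi>) (\<lambda>_. X) \<alpha> (\<lambda>s \<omega>. m s)"
    by (rule good_restriction[OF reg finite.insertI[OF finite.emptyI] init prm ind X \<alpha> flow_predictable[OF m] eq])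
  interpret B: restricted_basis G M F \<Omega> by (rule \<Omega>)
  interpret J: jump_system G B.M0 B.F0 "{1}" "\<lambda>_. n" K1 K2 "\<lambda>_. \<xi>" "\<lambda>_. X" \<alpha> "\<lambda>s \<omega>. m s" by (rule JS)
  have one: "1 \<in> {1 :: nat}" by simp
  show ?thesis
  proof (rule that[of "\<lambda>j t. J.law_of 1 j t"])
    fix t assume t: "t \<in> {0..T}"
    show "0 \<le> J.law_of 1 j t" for j by (rule J.law_of_nonneg)
    show "(\<Sum>j\<in>UNIV. J.law_of 1 j t) = 1" by (rule J.sum_law_of[OF one t])
    show "J.law_of 1 j t = measure M {\<omega>\<in>space M. X t \<omega> = state_of j}" for j
      unfolding J.law_of_X_prob[OF one t] by (rule B.measure_M0_Collect[OF state_set(2)[OF X t]])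
    show "J.law_of 1 j t = init_law G $ j +
       (LINT s:{..t}|\<tau>. \<Sum>y\<in>UNIV. J.law_of 1 y s * rate G j s (state_of y) (\<gamma> s (state_of y)) (m s))" for j
    proof -
      have "(LINT s:{..t}|\<tau>. LINT \<omega>|B.M0. rate G j s (left_state X s \<omega>) (\<alpha> 1 s \<omega>) (m s)) =
          (LINT s:{..t}|\<tau>. \<Sum>y\<in>UNIV. J.law_of 1 y s * rate G j s (state_of y) (\<gamma> s (state_of y)) (m s))"
        unfolding set_LINT_def \<alpha>_def
        by (intro LINT_cong refl) (simp only: space_time J.expectation_rate_feedback[OF one])
      then show ?thesis using J.law_of_eq[OF one t, of j] by simp
    qed
  next
    show "J.law_of 1 j \<in> borel_measurable \<tau>" for j by (rule J.law_of_measurable[OF one])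
    have "feedback_cost G M \<gamma> m X = (LINT s|\<tau>. LINT \<omega>|B.M0. run_cost G s (left_state X s \<omega>) (\<alpha> 1 s \<omega>) (m s)) +
        (LINT \<omega>|B.M0. end_cost G (left_state X T \<omega>) (m T))"
    proof -
      have mm: "(\<lambda>(s, \<omega>). m s) \<in> \<tau> \<Otimes>\<^sub>M M \<rightarrow>\<^sub>M simplex_space" by (rule pred_measurable_pair[OF flow_predictable[OF m]])
      show ?thesis using B.cost_restrict[OF JS one X \<alpha> mm] unfolding feedback_cost_def \<alpha>_def by simp
    qed
    also have "(LINT s|\<tau>. LINT \<omega>|B.M0. run_cost G s (left_state X s \<omega>) (\<alpha> 1 s \<omega>) (m s)) =
        (LINT s|\<tau>. (\<Sum>y\<in>UNIV. J.law_of 1 y s * run_cost G s (state_of y) (\<gamma> s (state_of y)) (m s)))"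
      unfolding \<alpha>_def
      by (intro LINT_cong refl) (simp only: space_time J.expectation_state_sum[OF one, of _ "\<lambda>x. run_cost G _ x (\<gamma> _ x) (m _)"])
    also have "(LINT \<omega>|B.M0. end_cost G (left_state X T \<omega>) (m T)) = (\<Sum>y\<in>UNIV. J.law_of 1 y T * end_cost G (state_of y) (m T))"
      by (rule J.expectation_state_sum[OF one T])
    finally show "feedback_cost G M \<gamma> m X = (LINT s|\<tau>. (\<Sum>y\<in>UNIV. J.law_of 1 y s * run_cost G s (state_of y) (\<gamma> s (state_of y)) (m s))) +
       (\<Sum>y\<in>UNIV. J.law_of 1 y T * end_cost G (state_of y) (m T))" .
  qed
qed

text \<open>Where two integer states differ, their distance is at least 1, while the indicators of
  all states differ by 2 in total. So twice the mean distance dominates the distance of the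
  laws.\<close>

lemma (in game_basis) law_distance:
  assumes X: "state_process G M F X" and Y: "state_process G M F Y" and t: "t \<in> {0..T}"
  shows "(\<Sum>j\<in>UNIV. \<bar>prob {\<omega>\<in>space M. X t \<omega> = state_of (j :: 'd)} - prob {\<omega>\<in>space M. Y t \<omega> = state_of j}\<bar>) \<le>
    2 * expectation (\<lambda>\<omega>. SUP t\<in>{0..T}. \<bar>real_of_int (X t \<omega> - Y t \<omega>)\<bar>)"
proof -
  define f where "f t \<omega> = \<bar>real_of_int (X t \<omega> - Y t \<omega>)\<bar>" for t \<omega>
  \<comment> \<open>The supremum must be shown to be measurable, since the Bochner integral of a
    function that is not integrable is 0 and would bound nothing. By right continuity rational times
    suffice; the horizon, which has no right neighbours, is added by hand.\<close>
  define D where "D = ({0..T} \<inter> \<rat>) \<union> {T}"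
  define S where "S \<omega> = (SUP t\<in>{0..T}. f t \<omega>)" for \<omega>
  have im: "(\<lambda>t. f t \<omega>) ` {0..T} = (\<lambda>t. f t \<omega>) ` D" if \<omega>: "\<omega> \<in> space M" for \<omega>
  proof (intro subset_antisym image_subsetI)
    fix t assume t: "t \<in> {0..T}"
    show "f t \<omega> \<in> (\<lambda>t. f t \<omega>) ` D"
    proof (cases "t = T")
      case False
      then have tT: "t \<in> {0..<T}" "t < T" using t by auto
      have "eventually (\<lambda>r. X r \<omega> = X t \<omega>) (at_right t)" "eventually (\<lambda>r. Y r \<omega> = Y t \<omega>) (at_right t)"
        using X Y \<omega> tT(1) unfolding state_process_def tendsto_discrete by blast+
      then have "eventually (\<lambda>r. f r \<omega> = f t \<omega>) (at_right t)" by eventually_elim (simp add: f_def)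
      then obtain b where b: "b > t" "\<And>r. t < r \<Longrightarrow> r < b \<Longrightarrow> f r \<omega> = f t \<omega>"
        unfolding eventually_at_right[OF tT(2)] by blast
      obtain r where r: "r \<in> \<rat>" "t < r" "r < min b T" using Rats_dense_in_real[of t "min b T"] b(1) tT(2) by auto
      then have "r \<in> D" "f t \<omega> = f r \<omega>" using t b(2)[of r] by (auto simp: D_def)
      then show ?thesis by blast
    qed (auto simp: D_def)
  next
    fix t assume "t \<in> D"
    then have "t \<in> {0..T}" using T_pos by (auto simp: D_def)
    then show "f t \<omega> \<in> (\<lambda>t. f t \<omega>) ` {0..T}" by blast
  qed
  have fb: "0 \<le> f t \<omega> \<and> f t \<omega> \<le> real CARD('d)" if "\<omega> \<in> space M" "t \<in> {0..T}" for t \<omega>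
  proof -
    have "\<bar>X t \<omega> - Y t \<omega>\<bar> \<le> int CARD('d)"
      using state_process_states[OF X that] state_process_states[OF Y that] by (auto simp: states_def)
    then show ?thesis unfolding f_def by linarith
  qed
  have bdd: "bdd_above ((\<lambda>t. f t \<omega>) ` {0..T})" if "\<omega> \<in> space M" for \<omega>
    using fb[OF that] by (intro bdd_aboveI[of _ "real CARD('d)"]) auto
  have fm: "f t \<in> borel_measurable M" if "t \<in> {0..T}" for t
  proof -
    have "(\<lambda>\<omega>. real_of_int (X t \<omega>)) \<in> borel_measurable M" "(\<lambda>\<omega>. real_of_int (Y t \<omega>)) \<in> borel_measurable M"
      by (rule state_set(3)[OF X that] state_set(3)[OF Y that])+
    then show ?thesis unfolding f_def[abs_def] of_int_diff by measurable
  qed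
  have DT: "D \<subseteq> {0..T}" using T_pos by (auto simp: D_def)
  have "countable D" unfolding D_def by (intro countable_Un countable_Int2 countable_rat) auto
  then have "(\<lambda>\<omega>. SUP t\<in>D. f t \<omega>) \<in> borel_measurable M"
    using DT fm im bdd by (intro borel_measurable_cSUP) auto
  then have Sm: "S \<in> borel_measurable M"
    by (rule measurable_cong[THEN iffD2, rotated]) (simp add: S_def im)
  have fS: "f t \<omega> \<le> S \<omega>" if "\<omega> \<in> space M" for \<omega>
    unfolding S_def by (rule cSUP_upper[OF t bdd[OF that]])
  have Sb: "S \<omega> \<le> real CARD('d)" if "\<omega> \<in> space M" for \<omega>
    unfolding S_def using fb[OF that] T_pos by (intro cSUP_least) auto
  have Si: "integrable M S"
  proof (rule integrable_if_bounded[OF Sm])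
    show "\<bar>S \<omega>\<bar> \<le> real CARD('d)" if "\<omega> \<in> space M" for \<omega> using Sb[OF that] fS[OF that] fb[OF that t] by linarith
  qed
  have pr: "prob {\<omega>\<in>space M. W t \<omega> = state_of j} = expectation (\<lambda>\<omega>. at_state j (W t \<omega>))" if "state_process G M F W" for W and j :: 'd
  proof -
    have "expectation (\<lambda>\<omega>. at_state j (W t \<omega>)) = expectation (indicator {\<omega>\<in>space M. W t \<omega> = state_of j})"
      by (rule LINT_cong) (auto simp: at_state_def indicator_def)
    also have "\<dots> = prob {\<omega>\<in>space M. W t \<omega> = state_of j}" using state_set(2)[OF that t] by simp
    finally show ?thesis by simp
  qed
  have ai: "integrable M (\<lambda>\<omega>. at_state j (W t \<omega>))" if "state_process G M F W" for W and j :: 'd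
    by (intro integrable_if_bounded[of _ 1] state_set(3)[OF that t]) (auto simp: at_state_def)
  have "(\<Sum>j\<in>UNIV. \<bar>prob {\<omega>\<in>space M. X t \<omega> = state_of (j :: 'd)} - prob {\<omega>\<in>space M. Y t \<omega> = state_of j}\<bar>) =
      (\<Sum>j\<in>UNIV. \<bar>expectation (\<lambda>\<omega>. at_state (j :: 'd) (X t \<omega>) - at_state j (Y t \<omega>))\<bar>)"
    unfolding pr[OF X] pr[OF Y] using ai[OF X] ai[OF Y] by (simp add: LINT_diff)
  also have "\<dots> \<le> (\<Sum>j\<in>UNIV. expectation (\<lambda>\<omega>. \<bar>at_state (j :: 'd) (X t \<omega>) - at_state j (Y t \<omega>)\<bar>))"
    by (intro sum_mono integral_abs_bound)
  also have "\<dots> = expectation (\<lambda>\<omega>. \<Sum>j\<in>UNIV. \<bar>at_state (j :: 'd) (X t \<omega>) - at_state j (Y t \<omega>)\<bar>)"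
    using ai[OF X] ai[OF Y] by (intro LINT_sum[symmetric]) auto
  also have "\<dots> \<le> expectation (\<lambda>\<omega>. 2 * S \<omega>)"
  proof (rule integral_mono)
    show "integrable M (\<lambda>\<omega>. \<Sum>j\<in>UNIV. \<bar>at_state (j :: 'd) (X t \<omega>) - at_state j (Y t \<omega>)\<bar>)"
      using ai[OF X] ai[OF Y] by (intro Bochner_Integration.integrable_sum integrable_abs Bochner_Integration.integrable_diff) auto
    fix \<omega> assume \<omega>: "\<omega> \<in> space M"
    have "(\<Sum>j\<in>UNIV. \<bar>at_state (j :: 'd) (X t \<omega>) - at_state j (Y t \<omega>)\<bar>) \<le> 2 * f t \<omega>"
    proof (cases "X t \<omega> = Y t \<omega>")
      case False
      then have "1 \<le> f t \<omega>" unfolding f_def by linarith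
      have "(\<Sum>j\<in>UNIV. \<bar>at_state (j :: 'd) (X t \<omega>) - at_state j (Y t \<omega>)\<bar>) \<le>
          (\<Sum>j\<in>UNIV. at_state (j :: 'd) (X t \<omega>) + at_state j (Y t \<omega>))"
        by (intro sum_mono) (auto simp: at_state_def)
      also have "\<dots> = 2"
        using state_process_states[OF X \<omega> t] state_process_states[OF Y \<omega> t] by (simp add: sum.distrib sum_at_state_1 states_def)
      finally show ?thesis using \<open>1 \<le> f t \<omega>\<close> by simp
    qed (simp add: f_def)
    then show "(\<Sum>j\<in>UNIV. \<bar>at_state (j :: 'd) (X t \<omega>) - at_state j (Y t \<omega>)\<bar>) \<le> 2 * S \<omega>" using fS[OF \<omega>] by linarith
  qed (use Si in simp)
  also have "\<dots> = 2 * expectation S" by simp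
  finally show ?thesis unfolding S_def f_def .
qed

lemma empirical_cong: "(\<And>i. i \<in> {1..N} \<Longrightarrow> x i = y i) \<Longrightarrow> (empirical N x :: real^'d::finite) = empirical N y"
proof -
  assume eq: "\<And>i. i \<in> {1..N} \<Longrightarrow> x i = y i"
  have "{i\<in>{1..N}. x i = state_of j} = {i\<in>{1..N}. y i = state_of j}" for j :: 'd using eq by auto
  then show ?thesis by (simp only: empirical_def)
qed

lemma feedback_process_eq:
  "i \<in> {1..N} \<Longrightarrow> feedback_process N (\<lambda>i t x. \<gamma> t (x i)) X i = (\<lambda>t \<omega>. \<gamma> t (left_state (X i) t \<omega>))"
  by (intro ext) (simp add: feedback_process_def)

text \<open>Bridge from the definitions of the game to \<open>players_near_limit\<close>. It is used
  for the profile in which all follow \<open>\<gamma>\<close> and again for the deviation; the two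
  restricted bases may differ, and predictability of further controls is carried along for the
  comparison system.\<close>

lemma (in regular_game) players_reduction:
  assumes basis: "players_basis G N M F \<xi> \<N>" and st: "players_state G N M F \<xi> \<N> \<alpha> X"
    and N: "1 \<le> N" and k: "k \<in> {1..N}" and \<alpha>: "\<And>i. i \<in> {1..N} \<Longrightarrow> predictable_control G M F (\<alpha> i)"
    and fb: "\<And>i s \<omega>. i \<in> {1..N} \<Longrightarrow> i \<noteq> k \<Longrightarrow> \<alpha> i s \<omega> = \<gamma> s (left_state (X i) s \<omega>)"
    and \<gamma>: "(\<lambda>(t, x). \<gamma> t x) \<in> \<tau> \<Otimes>\<^sub>M state_space \<rightarrow>\<^sub>M action_space G"
    and m: "m \<in> flows G" and law: "\<And>j t. t \<in> {0..T} \<Longrightarrow> 0 \<le> law j t" "\<And>t. t \<in> {0..T} \<Longrightarrow> (\<Sum>j\<in>UNIV. law j t) = 1" "\<And>j. law j \<in> borel_measurable \<tau>"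
    "\<And>j t. t \<in> {0..T} \<Longrightarrow> law j t = init_law G $ j +
       (LINT s:{..t}|\<tau>. \<Sum>y\<in>UNIV. law y s * rate G j s (state_of y) (\<gamma> s (state_of y)) (m s))"
    "\<And>t. t \<in> {0..T} \<Longrightarrow> (\<Sum>j\<in>UNIV. \<bar>law j t - m t $ j\<bar>) \<le> 2 / sqrt (real N)"
  obtains M' F' p where "players_near_limit G M' F' N \<N> K1 K2 \<xi> X \<alpha> p k \<gamma> m law"
    "\<And>\<beta>. predictable_control G M F \<beta> \<Longrightarrow> predictable_control G M' F' \<beta>"
    "players_cost G N M \<alpha> X k = players_near_limit.Jk G M' X \<alpha> p k"
proof -
  interpret game_basis G M F using basis by unfold_locales (simp add: players_basis_def)
  define p where "p s \<omega> = (empirical N (\<lambda>i. left_state (X i) s \<omega>) :: real^'d)" for s \<omega>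
  have X: "state_process G M F (X i)" if "i \<in> {1..N}" for i using st that by (simp add: players_state_def)
  have Xl: "(\<lambda>z. left_state (X i) (fst z) (snd z)) \<in> \<P> \<rightarrow>\<^sub>M count_space {1..int CARD('d)}" if "i \<in> {1..N}" for i
    using left_state_predictable[OF X[OF that]] by (simp add: case_prod_beta' states_def)
  have p: "(\<lambda>(s, \<omega>). p s \<omega>) \<in> \<P> \<rightarrow>\<^sub>M simplex_space"
    using empirical_measurable[OF N Xl] unfolding p_def by (simp add: case_prod_beta')
  have reg: "regular_game G K1 K2" by unfold_locales
  have init: "initial_state G M F (\<xi> i)" and prm: "poisson_random_measure G M F (\<N> i)" if "i \<in> {1..N}" for i
    using basis that unfolding players_basis_def by blast+
  have ii: "indep_sets (\<lambda>i. init_sigma M (\<xi> i)) {1..N}" and ind: "indep_sets (\<lambda>i. noise_sigma G M (\<N> i)) {1..N}"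
    using basis unfolding players_basis_def by blast+
  have eq: "AE \<omega> in M. \<forall>i\<in>{1..N}. \<forall>t\<in>{0..T}. real_of_int (X i t \<omega>) = real_of_int (\<xi> i \<omega>) +
      (LINT z:{0<..t} \<times> marks G|\<N> i \<omega>. case z of (s, u) \<Rightarrow> real_of_int (jump G s (left_state (X i) s \<omega>) u (\<alpha> i s \<omega>) (p s \<omega>)))"
    using st unfolding players_state_def p_def by (rule conjunct2)
  obtain \<Omega> where \<Omega>: "restricted_basis G M F \<Omega>"
    and JS: "jump_system G (restrict_space M \<Omega>) (\<lambda>t. restrict_space (F t) \<Omega>) {1..N} \<N> K1 K2 \<xi> X \<alpha> p"
    by (rule good_restriction[OF reg finite_atLeastAtMost init prm ind X \<alpha> p eq])
  interpret B: restricted_basis G M F \<Omega> by (rule \<Omega>)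
  interpret J: jump_system G B.M0 B.F0 "{1..N}" \<N> K1 K2 \<xi> X \<alpha> p by (rule JS)
  have PL: "players_near_limit G B.M0 B.F0 N \<N> K1 K2 \<xi> X \<alpha> p k \<gamma> m law"
  proof unfold_locales
    show "B.R.indep_sets (\<lambda>i. init_sigma B.M0 (\<xi> i)) {1..N}" by (rule B.indep_sets_M0[OF ii B.init_sigma_M0])
    show "p s \<omega> = empirical N (\<lambda>i. left_state (X i) s \<omega>)" for s \<omega> by (rule p_def)
  qed (fact N k \<gamma> m law | rule fb, assumption+)+
  interpret P: players_near_limit G B.M0 B.F0 N \<N> K1 K2 \<xi> X \<alpha> p k \<gamma> m law by (rule PL)
  have Xp: "(\<lambda>z. X i (fst z) (snd z)) \<in> \<tau> \<Otimes>\<^sub>M M \<rightarrow>\<^sub>M count_space {1..int CARD('d)}" if "i \<in> {1..N}" for i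
    using state_process_measurable_pair[OF X[OF that]] by (simp add: case_prod_beta' states_def)
  have q: "(\<lambda>(s, \<omega>). empirical N (\<lambda>i. X i s \<omega>) :: real^'d) \<in> \<tau> \<Otimes>\<^sub>M M \<rightarrow>\<^sub>M simplex_space"
    using empirical_measurable[OF N Xp] by (simp add: case_prod_beta')
  have "players_cost G N M \<alpha> X k = P.Jk"
    unfolding players_cost_def P.Jk_def
  proof (rule B.cost_restrict[OF JS k X[OF k] \<alpha>[OF k] q])
    fix \<omega> t assume "\<omega> \<in> \<Omega>" "t \<in> {0..T}" "t \<notin> (\<Union>l\<in>{1..N}. fst ` atoms (\<N> l \<omega>))"
    then show "empirical N (\<lambda>i. X i t \<omega>) = p t \<omega>"
      unfolding p_def by (intro empirical_cong J.X_no_jump) (auto simp: B.space_M0)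
  qed
  note cost = this
  show ?thesis
  proof (rule that[OF PL])
    show "predictable_control G B.M0 B.F0 \<beta>" if "predictable_control G M F \<beta>" for \<beta>
      using that by (rule B.predictable_control_M0)
  qed (rule cost)
qed

text \<open>The chain of comparisons is: the cost of player \<open>k\<close> under
  \<open>\<gamma>\<close>, the cost of \<open>\<gamma>\<close> in the environment \<open>m\<close>,
  the cost of the relaxed feedback solution, the cost of \<open>\<beta>\<close> in the environment
  \<open>m\<close>, the cost of the deviation. Each link costs order \<open>1 / sqrt N\<close>,
  except the third, which is optimality.\<close>

lemma (in regular_game) nash_inequality:
  fixes M M' :: "'w measure"
  assumes sol: "relaxed_feedback_solution G M F \<gamma>' \<xi> n \<rho> n\<^sub>\<rho> m X'"
    and fc: "feedback_control G M F \<gamma> \<xi> n" and fs: "feedback_state G M F \<gamma> \<xi> n m X"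
    and close: "(LINT \<omega>|M. (SUP t\<in>{0..T}. \<bar>real_of_int (X t \<omega> - X' t \<omega>)\<bar>)) \<le> 1 / sqrt (real N)"
    and cost: "\<bar>feedback_cost G M \<gamma> m X - relaxed_cost G M \<rho> m X'\<bar> \<le> 1 / sqrt (real N)"
    and N: "1 \<le> N" and basis: "players_basis G N M' F' \<zeta> \<N>"
    and Y: "players_state G N M' F' \<zeta> \<N> (feedback_process N (\<lambda>i t x. \<gamma> t (x i)) Y) Y"
    and k: "k \<in> {1..N}" and \<beta>: "predictable_control G M' F' \<beta>"
    and Z: "players_state G N M' F' \<zeta> \<N> ((feedback_process N (\<lambda>i t x. \<gamma> t (x i)) Z)(k := \<beta>)) Z"
  shows "players_cost G N M' (feedback_process N (\<lambda>i t x. \<gamma> t (x i)) Y) Y k \<le>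
    players_cost G N M' ((feedback_process N (\<lambda>i t x. \<gamma> t (x i)) Z)(k := \<beta>)) Z k +
    nash_constant (real CARD('d)) (diameter (actions G)) T \<nu> K1 K2 / sqrt (real N)"
proof -
  interpret M: game_basis G M F using fc by unfold_locales (simp add: feedback_control_def mfg_basis_def)
  interpret M': game_basis G M' F' using basis by unfold_locales (simp add: players_basis_def)
  have m: "m \<in> flows G" and opt: "\<And>(Q :: 'w measure) F' \<rho>' \<xi>' n' n\<^sub>\<rho>' Z. relaxed_control G Q F' \<rho>' \<xi>' n' \<Longrightarrow>
      relaxed_poisson_measure G Q F' \<rho>' n' n\<^sub>\<rho>' \<Longrightarrow> relaxed_state G Q F' \<xi>' n\<^sub>\<rho>' m Z \<Longrightarrow>
      relaxed_cost G M \<rho> m X' \<le> relaxed_cost G Q \<rho>' m Z"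
    and X': "state_process G M F X'" and mX': "\<And>t j. t \<in> {0..T} \<Longrightarrow> measure M {\<omega>\<in>space M. X' t \<omega> = state_of j} = m t $ j"
    using sol unfolding relaxed_feedback_solution_def relaxed_state_def by blast+
  have X: "state_process G M F X" using fs by (simp add: feedback_state_def)
  have \<gamma>: "(\<lambda>(t, x). \<gamma> t x) \<in> \<tau> \<Otimes>\<^sub>M state_space \<rightarrow>\<^sub>M action_space G"
    using fc by (simp add: feedback_control_def)
  obtain law :: "'d \<Rightarrow> real \<Rightarrow> real" where law:
    "\<And>j t. t \<in> {0..T} \<Longrightarrow> law j t = measure M {\<omega>\<in>space M. X t \<omega> = state_of j}"
    "\<And>j t. t \<in> {0..T} \<Longrightarrow> 0 \<le> law j t" "\<And>t. t \<in> {0..T} \<Longrightarrow> (\<Sum>j\<in>UNIV. law j t) = 1" "\<And>j. law j \<in> borel_measurable \<tau>"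
    "\<And>j t. t \<in> {0..T} \<Longrightarrow> law j t = init_law G $ j +
       (LINT s:{..t}|\<tau>. \<Sum>y\<in>UNIV. law y s * rate G j s (state_of y) (\<gamma> s (state_of y)) (m s))"
    and fcost: "feedback_cost G M \<gamma> m X = (LINT s|\<tau>. (\<Sum>y\<in>UNIV. law y s * run_cost G s (state_of y) (\<gamma> s (state_of y)) (m s))) +
       (\<Sum>y\<in>UNIV. law y T * end_cost G (state_of y) (m T))"
  proof (rule limit_law[OF fc fs m], goal_cases)
    case (1 law)
    show ?case by (rule 1(1)[OF 1(2-7)])
  qed
  have lc: "(\<Sum>j\<in>UNIV. \<bar>law j t - m t $ j\<bar>) \<le> 2 / sqrt (real N)" if t: "t \<in> {0..T}" for t
  proof -
    have "(\<Sum>j\<in>UNIV. \<bar>law j t - m t $ j\<bar>) \<le> 2 * (LINT \<omega>|M. (SUP t\<in>{0..T}. \<bar>real_of_int (X t \<omega> - X' t \<omega>)\<bar>))"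
      using M.law_distance[OF X X' t] law(1)[OF t] mX'[OF t] by simp
    also have "\<dots> \<le> 2 * (1 / sqrt (real N))" by (rule mult_left_mono[OF close]) simp
    finally show ?thesis by simp
  qed
  let ?f = "feedback_process N (\<lambda>i t x. \<gamma> t (x i))"
  have Ys: "state_process G M' F' (Y i)" "state_process G M' F' (Z i)" if "i \<in> {1..N}" for i
    using Y Z that unfolding players_state_def by blast+
  obtain M1 F1 p1 where P: "players_near_limit G M1 F1 N \<N> K1 K2 \<zeta> Y (?f Y) p1 k \<gamma> m law"
    and P_cost: "players_cost G N M' (?f Y) Y k = players_near_limit.Jk G M1 Y (?f Y) p1 k"
  proof (rule players_reduction[OF basis Y N k _ _ \<gamma> m law(2-5) lc])
    show "predictable_control G M' F' (?f Y i)" if "i \<in> {1..N}" for i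
      unfolding feedback_process_eq[OF that] by (rule M'.feedback_predictable[OF Ys(1)[OF that] \<gamma>])
  qed (simp_all add: feedback_process_eq)
  interpret P: players_near_limit G M1 F1 N \<N> K1 K2 \<zeta> Y "?f Y" p1 k \<gamma> m law by (rule P)
  let ?\<alpha> = "(?f Z)(k := \<beta>)"
  obtain M2 F2 p2 where Q: "players_near_limit G M2 F2 N \<N> K1 K2 \<zeta> Z ?\<alpha> p2 k \<gamma> m law"
    and \<beta>2: "\<And>\<beta>. predictable_control G M' F' \<beta> \<Longrightarrow> predictable_control G M2 F2 \<beta>"
    and Q_cost: "players_cost G N M' ?\<alpha> Z k = players_near_limit.Jk G M2 Z ?\<alpha> p2 k"
  proof (rule players_reduction[OF basis Z N k _ _ \<gamma> m law(2-5) lc])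
    show "predictable_control G M' F' (?\<alpha> i)" if "i \<in> {1..N}" for i
    proof (cases "i = k")
      case False
      then show ?thesis using M'.feedback_predictable[OF Ys(2)[OF that] \<gamma>] by (simp add: feedback_process_eq[OF that])
    qed (simp add: \<beta>)
  qed (simp_all add: feedback_process_eq)
  interpret Q: players_near_limit G M2 F2 N \<N> K1 K2 \<zeta> Z ?\<alpha> p2 k \<gamma> m law by (rule Q)
  interpret C: controlled_basis G M2 F2 "{1..N}" \<N> K1 K2 k "\<zeta> k" \<beta> "\<lambda>s \<omega>. m s"
  proof unfold_locales
    show "k \<in> {1..N}" by (rule k)
    show "initial_state G M2 F2 (\<zeta> k)" by (rule Q.init[OF k])
    show "predictable_control G M2 F2 \<beta>" by (rule \<beta>2[OF \<beta>])
    show "(\<lambda>(s, \<omega>). m s) \<in> Q.\<P> \<rightarrow>\<^sub>M simplex_space" by (rule Q.flow_predictable[OF m])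
  qed
  \<comment> \<open>The strong solution was built from the initial state and control of player
    \<open>k\<close> alone; on the index set \<open>{k}\<close> these agree with the families of the
    deviation profile.\<close>
  have JC: "jump_system G M2 F2 {k} \<N> K1 K2 \<zeta> (\<lambda>_. C.sol) ?\<alpha> (\<lambda>s \<omega>. m s)"
  proof -
    interpret J: jump_system G M2 F2 "{k}" \<N> K1 K2 "\<lambda>_. \<zeta> k" "\<lambda>_. C.sol" "\<lambda>_. \<beta>" "\<lambda>s \<omega>. m s" by (rule C.jump_system_sol)
    show ?thesis by unfold_locales (use J.init J.X J.\<alpha> J.p J.state_eq in auto)
  qed
  define V where "V = (LINT s|\<tau>. LINT \<omega>|M2. run_cost G s (left_state C.sol s \<omega>) (\<beta> s \<omega>) (m s)) +
    (LINT \<omega>|M2. end_cost G (left_state C.sol T \<omega>) (m T))"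
  define c1 where "c1 = (T + 1) * (P.L2 * P.cP + P.L2 * (real CARD('d) + diameter (actions G)) * P.cD)"
  define c2 where "c2 = (T + 1) * (P.L2 * (P.cZ + P.cP))"
  define a where "a = relaxed_cost G M \<rho> m X'"
  define r where "r = sqrt (real N)"
  have r: "0 < r" using N by (simp add: r_def)
  have nc: "nash_constant (real CARD('d)) (diameter (actions G)) T \<nu> K1 K2 = 2 + \<bar>c1\<bar> + \<bar>c2\<bar>"
    unfolding c1_def c2_def by (rule P.nash_constant_eq)
  have 1: "\<bar>P.Jk - feedback_cost G M \<gamma> m X\<bar> \<le> c1 / r"
    using P.Jk_feedback_close unfolding fcost P.Jlim_def c1_def r_def by (simp add: feedback_process_eq[OF k])
  have 2: "\<bar>Q.Jk - V\<bar> \<le> c2 / r"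
    using Q.Jk_deviation_close[OF JC] unfolding V_def c2_def r_def Q.cZ_def Q.cP_def Q.cV_def P.cZ_def P.cP_def P.cV_def by simp
  \<comment> \<open>Optimality is applied on the restricted basis of the deviation, with the point
    masses at \<open>\<beta>\<close> as relaxed control, the marked noise as relaxed Poisson measure
    and the strong solution as state.\<close>
  have 3: "a \<le> V"
    unfolding a_def V_def C.relaxed_cost_sol[OF m refl, symmetric]
    by (rule opt[OF C.relaxed_control_\<rho> C.relaxed_poisson_N\<rho> C.relaxed_state_sol[OF m refl]])
  have 4: "\<bar>feedback_cost G M \<gamma> m X - a\<bar> \<le> 1 / r" using cost by (simp add: a_def r_def)
  have "c1 / r \<le> \<bar>c1\<bar> / r" "c2 / r \<le> \<bar>c2\<bar> / r" "0 \<le> 1 / r" using r by (auto intro: divide_right_mono)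
  with 1 2 3 4 have "P.Jk \<le> Q.Jk + (1 / r + 1 / r + \<bar>c1\<bar> / r + \<bar>c2\<bar> / r)" by linarith
  also have "1 / r + 1 / r + \<bar>c1\<bar> / r + \<bar>c2\<bar> / r = (2 + \<bar>c1\<bar> + \<bar>c2\<bar>) / r" by (simp add: add_divide_distrib)
  finally show ?thesis unfolding P_cost Q_cost nc r_def .
qed

text \<open>The number of states is fixed by the type and the action set \<open>A\<close> is chosen
  before \<open>C\<close>, so \<open>C\<close> may depend on both; for given \<open>A\<close> it is
  one function of the horizon, the total intensity, \<open>K\<^sub>1\<close> and
  \<open>K\<^sub>2\<close>, the same for all games and all \<open>N\<close>. The witness is
  \<open>nash_constant\<close> at the diameter of \<open>A\<close>.\<close>

theorem theorem9:
  fixes A :: "'a::metric_space set"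
  shows "\<exists>C :: real \<Rightarrow> real \<Rightarrow> real \<Rightarrow> real \<Rightarrow> real.
    \<forall>(G :: ('a, 'd::finite) game) K\<^sub>1 K\<^sub>2.
      game_data G \<and> actions G = A \<and> regular_dynamics G K\<^sub>1 \<and> regular_costs G K\<^sub>2 \<longrightarrow>
      (\<forall>N\<ge>1. \<forall>(M :: 'w measure) F \<gamma>' \<xi> \<N> \<rho> \<N>\<^sub>\<rho> m X' \<gamma> X.
        relaxed_feedback_solution G M F \<gamma>' \<xi> \<N> \<rho> \<N>\<^sub>\<rho> m X' \<and>
        feedback_control G M F \<gamma> \<xi> \<N> \<and> feedback_state G M F \<gamma> \<xi> \<N> m X \<and>
        (LINT \<omega>|M. (SUP t\<in>{0..horizon G}. \<bar>real_of_int (X t \<omega> - X' t \<omega>)\<bar>)) \<le> 1 / sqrt (real N) \<and>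
        \<bar>feedback_cost G M \<gamma> m X - relaxed_cost G M \<rho> m X'\<bar> \<le> 1 / sqrt (real N) \<longrightarrow>
        (\<forall>(M\<^sub>N :: 'w measure) F\<^sub>N \<xi>\<^sub>N \<N>\<^sub>N.
          players_basis G N M\<^sub>N F\<^sub>N \<xi>\<^sub>N \<N>\<^sub>N \<and> iid_copies G N M\<^sub>N \<xi>\<^sub>N \<N>\<^sub>N M \<xi> \<N> \<longrightarrow>
          (\<exists>\<epsilon>>0.
            \<epsilon> \<le> C (horizon G) (measure (intensity G) (marks G)) K\<^sub>1 K\<^sub>2 / sqrt (real N) \<and>
            feedback_nash G N \<epsilon> M\<^sub>N F\<^sub>N (\<lambda>i t x. \<gamma> t (x i)) \<xi>\<^sub>N \<N>\<^sub>N)))"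
proof (rule exI[of _ "nash_constant (real CARD('d)) (diameter A)"], intro allI impI, elim conjE)
  fix G :: "('a, 'd) game" and K\<^sub>1 K\<^sub>2 and N :: nat and M :: "'w measure" and F \<gamma>' \<xi> \<N> \<rho> \<N>\<^sub>\<rho> m X' \<gamma> X
    and M\<^sub>N :: "'w measure" and F\<^sub>N \<xi>\<^sub>N \<N>\<^sub>N
  assume G: "game_data G" "regular_dynamics G K\<^sub>1" "regular_costs G K\<^sub>2" and A: "actions G = A" and N: "1 \<le> N"
    and sol: "relaxed_feedback_solution G M F \<gamma>' \<xi> \<N> \<rho> \<N>\<^sub>\<rho> m X'"
    and fc: "feedback_control G M F \<gamma> \<xi> \<N>" and fs: "feedback_state G M F \<gamma> \<xi> \<N> m X"
    and close: "(LINT \<omega>|M. (SUP t\<in>{0..horizon G}. \<bar>real_of_int (X t \<omega> - X' t \<omega>)\<bar>)) \<le> 1 / sqrt (real N)"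
    and cost: "\<bar>feedback_cost G M \<gamma> m X - relaxed_cost G M \<rho> m X'\<bar> \<le> 1 / sqrt (real N)"
    and basis: "players_basis G N M\<^sub>N F\<^sub>N \<xi>\<^sub>N \<N>\<^sub>N"
  interpret regular_game G K\<^sub>1 K\<^sub>2 by unfold_locales (fact G)+
  define \<epsilon> where "\<epsilon> = nash_constant (real CARD('d)) (diameter A) T \<nu> K\<^sub>1 K\<^sub>2 / sqrt (real N)"
  have "0 < \<epsilon>" using N nash_constant_ge[of "real CARD('d)" "diameter A" T \<nu> K\<^sub>1 K\<^sub>2] by (simp add: \<epsilon>_def)
  moreover have "feedback_nash G N \<epsilon> M\<^sub>N F\<^sub>N (\<lambda>i t x. \<gamma> t (x i)) \<xi>\<^sub>N \<N>\<^sub>N"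
    unfolding feedback_nash_def feedback_vector_def
  proof (intro conjI ballI allI impI)
    have \<gamma>: "(\<lambda>(t, x). \<gamma> t x) \<in> \<tau> \<Otimes>\<^sub>M state_space \<rightarrow>\<^sub>M action_space G"
      using fc by (simp add: feedback_control_def)
    show "(\<lambda>(t, x). \<gamma> t (x i)) \<in> \<tau> \<Otimes>\<^sub>M PiM {1..N} (\<lambda>_. state_space) \<rightarrow>\<^sub>M action_space G" if i: "i \<in> {1..N}" for i
      using measurable_compose[OF measurable_Pair[OF measurable_fst snd_compose[OF measurable_component_singleton[OF i]]] \<gamma>]
      by (simp add: case_prod_beta')
    show "players_cost G N M\<^sub>N (feedback_process N (\<lambda>i t x. \<gamma> t (x i)) Y) Y k \<le>
        players_cost G N M\<^sub>N ((feedback_process N (\<lambda>i t x. \<gamma> t (x i)) Z)(k := \<beta>)) Z k + \<epsilon>"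
      if "players_state G N M\<^sub>N F\<^sub>N \<xi>\<^sub>N \<N>\<^sub>N (feedback_process N (\<lambda>i t x. \<gamma> t (x i)) Y) Y" "k \<in> {1..N}"
        "predictable_control G M\<^sub>N F\<^sub>N \<beta> \<and> players_state G N M\<^sub>N F\<^sub>N \<xi>\<^sub>N \<N>\<^sub>N ((feedback_process N (\<lambda>i t x. \<gamma> t (x i)) Z)(k := \<beta>)) Z"
      for Y Z k \<beta>
      using nash_inequality[OF sol fc fs close cost N basis that(1,2) conjunct1[OF that(3)] conjunct2[OF that(3)]]
      by (simp only: \<epsilon>_def A)
  qed (rule basis)
  ultimately show "\<exists>\<epsilon>>0. \<epsilon> \<le> nash_constant (real CARD('d)) (diameter A) T \<nu> K\<^sub>1 K\<^sub>2 / sqrt (real N) \<and>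
      feedback_nash G N \<epsilon> M\<^sub>N F\<^sub>N (\<lambda>i t x. \<gamma> t (x i)) \<xi>\<^sub>N \<N>\<^sub>N"
    unfolding \<epsilon>_def by blast
qed

end
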